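(* Let $q$ be a prime power, $k\ge1$, $n=3k$, $V=\mathbb{F}_q^n$, and $\omega=e^{2\pi i/3}$. Then $1/Z_c(X_2^{[(k,2k)]}(V),u)$ is a product of factors each of one of the forms $(1-q^su^2)$, $(1-\omega q^su^2)(1-\omega^2q^su^2)$, or $(1-q^su^6)$, with $s\in\mathbb{Z}_{\ge0}$.
   Context: A directed flag in $V$ is an ordered pair $F=(W_1,W_2)$ of nonzero proper subspaces with $W_1\subsetneq W_2$ or $W_2\subsetneq W_1$; its multi-dimension is $(\dim W_1,\dim W_2)$. $X_2(V)$ is the digraph whose vertices are the directed flags, with a directed edge from $(W_1,W_2)$ to $(W_3,W_4)$ iff $W_2=W_3$ and either $W_1\oplus W_4=W_2$, or ($W_1\cap W_4=W_2$ and $W_1+W_4=V$). $X_2^{[(k,2k)]}(V)$ is the induced subdigraph on the directed flags of multi-dimension $(k,2k)$ or $(2k,k)$. For a finite digraph $X$, $N_c(X,l)$ is the number of closed walks of length $l$ and $Z_c(X,u)=\exp\left(\sum_{l\ge1}\frac{N_c(X,l)}{l}u^l\right)$. *)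

theory Defs
  imports
    "HOL-Analysis.Analysis"
    "HOL-Computational_Algebra.Computational_Algebra"
    "HOL-Number_Theory.Prime_Powers"
    "Graph_Theory.Graph_Theory"
begin

text \<open>The ambient space \<open>V\<close> is the type \<^typ>\<open>'a ^ 'n\<close>, so the whole space is \<^term>\<open>UNIV\<close>;
  subspaces and dimensions are those over the field \<^typ>\<open>'a\<close>, given by the \<open>vec\<close> interpretation.
  The sum of two subspaces is their elementwise sum as sets.\<close>

definition nonzero_proper_subspace :: "('a::field ^ 'n) set \<Rightarrow> bool" where
  "nonzero_proper_subspace W \<longleftrightarrow> vec.subspace W \<and> W \<noteq> {0} \<and> W \<noteq> UNIV"

definition internal_direct_sum ::
    "('a::field ^ 'n) set \<Rightarrow> ('a ^ 'n) set \<Rightarrow> ('a ^ 'n) set \<Rightarrow> bool" where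
  "internal_direct_sum A B C \<longleftrightarrow> A \<inter> B = {0} \<and> A + B = C"

definition directed_flags :: "(('a::field ^ 'n) set \<times> ('a ^ 'n) set) set" where
  "directed_flags =
     {(W1, W2). nonzero_proper_subspace W1 \<and> nonzero_proper_subspace W2 \<and> (W1 \<subset> W2 \<or> W2 \<subset> W1)}"

definition multi_dimension :: "('a::field ^ 'n) set \<times> ('a ^ 'n) set \<Rightarrow> nat \<times> nat" where
  "multi_dimension F = (vec.dim (fst F), vec.dim (snd F))"

definition X2 :: "(('a::field ^ 'n) set \<times> ('a ^ 'n) set) pair_pre_digraph" where
  "X2 = \<lparr> pverts = directed_flags,
          parcs = {((W1, W2), (W3, W4)).
             (W1, W2) \<in> directed_flags \<and> (W3, W4) \<in> directed_flags \<and> W2 = W3 \<and>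
             (internal_direct_sum W1 W4 W2 \<or> (W1 \<inter> W4 = W2 \<and> W1 + W4 = UNIV))} \<rparr>"

definition X2_multidim :: "nat \<times> nat \<Rightarrow>
    (('a::field ^ 'n) set \<times> ('a ^ 'n) set,
     (('a ^ 'n) set \<times> ('a ^ 'n) set) \<times> (('a ^ 'n) set \<times> ('a ^ 'n) set)) pre_digraph" where
  "X2_multidim d = induce_subgraph (with_proj X2)
     {F \<in> directed_flags. multi_dimension F = d \<or> multi_dimension F = prod.swap d}"

text \<open>Closed walks carry a base point: cyclic rotations of a closed walk are counted separately.\<close>

definition num_closed_walks :: "('v, 'e) pre_digraph \<Rightarrow> nat \<Rightarrow> nat" where
  "num_closed_walks G l = card {(v, p). pre_digraph.awalk G v p v \<and> length p = l}"

text \<open>The zeta function as a formal power series in \<open>u\<close>; the exponent has zero constant term,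
  so the composition is the usual formal exponential.\<close>

definition zeta_closed :: "('v, 'e) pre_digraph \<Rightarrow> complex fps" where
  "zeta_closed G =
     fps_exp 1 oo
       Abs_fps (\<lambda>l. if l = 0 then 0 else of_nat (num_closed_walks G l) / of_nat l)"

end

theory Submission
  imports Defs "Jordan_Normal_Form.Determinant"
begin

text \<open>On the real functions on the flags \<open>L \<subset> P\<close> with \<open>dim L = k\<close>, \<open>dim P = 2k\<close> let \<open>S\<close> sum
  over the complements of \<open>L\<close> in \<open>P\<close> and let \<open>T\<close> sum over the \<open>P'\<close> with \<open>P' \<inter> P = L\<close> and
  \<open>P' + P = V\<close>. Walks alternate between the two kinds of vertices, so the number of closed walks of
  length \<open>2l\<close> is twice the trace of \<open>(ST)\<^sup>l\<close> and there are none of odd length; hence the reciprocal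
  of the zeta function is \<open>det (1 - u\<^sup>2 ST)\<close>.

  Since \<open>S\<close> and \<open>T\<close> are symmetric, the function space is a sum of irreducible modules \<open>E\<close> for the pair
  \<open>(S, T)\<close>. Let \<open>r\<close> be maximal such that for every \<open>f\<close> in \<open>E\<close> the sum of \<open>f\<close> over the flags in
  an interval \<open>[A, B]\<close> vanishes if \<open>dim A + codim B < r\<close>. In degree \<open>r\<close> these sums form functions on
  which raising and lowering operators satisfy a quantum \<open>sl\<^sub>2\<close> relation. Pairing them with the
  string \<open>w, R w, \<dots>, R\<^sup>d w\<close> of a primitive vector \<open>w\<close> of degree \<open>j\<close>, where \<open>r = 2j + d\<close>, embeds
  \<open>E\<close> into a space of dimension \<open>d + 1\<close> in which \<open>S\<close> and \<open>T\<close> are triangular with Gaussian binomial entries.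
  This gives \<open>STS = TST\<close> and \<open>(ST)\<^sup>3 = q\<^sup>s\<close> on \<open>E\<close> for an explicit \<open>s \<ge> 0\<close>.
  If \<open>3\<close> does not divide \<open>d + 1\<close>, then \<open>3\<close> divides \<open>s\<close> and \<open>ST\<close> has eigenvalues \<open>q\<^bsup>s/3\<^esup>\<close> times cube roots
  of unity, the nonreal ones in conjugate pairs. If \<open>3\<close> divides \<open>d + 1\<close>, then
  \<open>E = A \<oplus> STA \<oplus> (ST)\<^sup>2A\<close> for a subspace \<open>A\<close>, which contributes factors \<open>1 - q\<^sup>s u\<^sup>6\<close>.\<close>

section \<open>Gaussian binomial coefficients\<close>

text \<open>Along a string the matrix of S is, up to a scalar in each row, the triangle of Gaussian
  binomials. Gaussian inversion makes STS antidiagonal: it reverses the string. So STS carries S to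
  T and its square is a scalar, which is the source of both relations.

  The obstacle is that E need not fill the coordinate space of dimension d + 1: coordinates that
  would need dim A > k or codim B > k vanish, and the others are not known to be independent. If 3
  does not divide d + 1 this is harmless, since x^3 - c^3 splits into admissible factors on any
  invariant subspace. If 3 divides d + 1, then s is 2 modulo 3, the three cube roots of q^s must
  occur equally often, and dim E is needed. A bidiagonal operator reduces it to one unknown, which
  determinants find.

  A is cut out by two of three conditions: vanishing of top coordinates of v, of a multiple of the
  S-preimage of v, and of STS v. ST permutes the three conditions cyclically, and a degree count for
  polynomials in q^x shows that together they force v = 0.\<close>

lemma sum_Collect: "(\<Sum>x | Q x. g x) = (\<Sum>x\<in>UNIV. if Q x then g x else 0)"
  for g :: "'l::finite \<Rightarrow> real"
  by (simp add: sum.If_cases)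

lemma sum_pairs:
  "(\<Sum>(x,y) | Q x y. g x y) = (\<Sum>x\<in>UNIV. \<Sum>y\<in>UNIV. if Q x y then g x y else 0)"
  for g :: "'l::finite \<Rightarrow> 'm::finite \<Rightarrow> real"
  unfolding sum.cartesian_product UNIV_Times_UNIV
  by (rule sum.mono_neutral_cong_left) (auto split: if_splits)

lemma sum_rotate3:
  "(\<Sum>x\<in>A. \<Sum>y\<in>B. \<Sum>z\<in>C. g x y z) = (\<Sum>y\<in>B. \<Sum>z\<in>C. \<Sum>x\<in>A. g x y z)"
  by (subst sum.swap) (intro sum.cong refl sum.swap)

lemma sum_if_const: "(\<Sum>x\<in>UNIV. if Q x then c else 0) = real (card {x. Q x}) * c"
  for c :: real and Q :: "'l::finite \<Rightarrow> bool"
  by (simp add: sum.If_cases)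

lemma minus_one_power_sq: "(-1) ^ l * ((-1) ^ l * x) = (x :: real)"
  by (simp flip: mult.assoc power_mult_distrib)

locale qnum =
  fixes q :: real
  assumes q_gt_1: "q > 1"
begin

definition qint :: "nat \<Rightarrow> real" where "qint m = (q ^ m - 1) / (q - 1)"

lemma qint_0 [simp]: "qint 0 = 0" and qint_1 [simp]: "qint (Suc 0) = 1"
  using q_gt_1 by (auto simp: qint_def)

lemma qint_Suc: "qint (Suc m) = q ^ m + qint m"
  using q_gt_1 by (simp add: qint_def field_simps)

lemma qint_pos: "m > 0 \<Longrightarrow> qint m > 0"
  using q_gt_1 by (simp add: qint_def)

lemma q_nz [simp]: "q \<noteq> 0" "q > 0" "q - 1 \<noteq> 0"
  using q_gt_1 by auto

text \<open>The Moebius function of the subspace lattice on an interval of length \<open>m\<close>;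
  see \<open>sum_mu\<close>.\<close>

definition mu :: "nat \<Rightarrow> real" where "mu m = (-1) ^ m * q ^ (m choose 2)"

lemma mu_0 [simp]: "mu 0 = 1" and mu_nz [simp]: "mu m \<noteq> 0"
  by (simp_all add: mu_def numeral_2_eq_2)

lemma mu_Suc: "mu (Suc m) = - (q ^ m * mu m)"
  by (simp add: mu_def numeral_2_eq_2 power_add)

definition qfact :: "nat \<Rightarrow> real" where "qfact m = (\<Prod>i=1..m. qint i)"

lemma qfact_0 [simp]: "qfact 0 = 1" by (simp add: qfact_def)
lemma qfact_Suc: "qfact (Suc m) = qint (Suc m) * qfact m" by (simp add: qfact_def)
lemma qfact_pos: "qfact m > 0" unfolding qfact_def by (intro prod_pos) (auto intro: qint_pos)

definition qbin :: "nat \<Rightarrow> nat \<Rightarrow> real" where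
  "qbin t p = (if p \<le> t then qfact t / (qfact p * qfact (t - p)) else 0)"

text \<open>The exponent in the degree \<open>i\<close> eigenvalue of the q-Kneser graph on the
  k-subspaces of a 2k-space; \<open>sig\<close> is that eigenvalue, sign included, at
  \<open>i = j + t\<close>. It is an integer because positions with \<open>i > k\<close> occur along
  a string.\<close>

definition ee :: "nat \<Rightarrow> nat \<Rightarrow> int" where "ee k i = int k * (int k - int i) + int (i choose 2)"

definition sig :: "nat \<Rightarrow> nat \<Rightarrow> nat \<Rightarrow> real" where "sig k j t = (-1) ^ (j + t) * q powi ee k (j + t)"

lemma two_choose_2: "2 * int (m choose 2) = int m * (int m - 1)"
proof (induction m)
  case (Suc m)
  have "Suc m choose 2 = m + (m choose 2)" by (simp add: numeral_2_eq_2)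
  then show ?case using Suc by (simp add: algebra_simps)
qed (simp add: numeral_2_eq_2)

end

section \<open>Finite self-dual modular lattices\<close>

text \<open>The axioms are self-dual. The last one, with \<open>q\<close> the order of the field, is the only place
  where the field enters.\<close>

locale qlattice = qnum q for q +
  fixes le :: "'l::finite \<Rightarrow> 'l \<Rightarrow> bool" (infix "\<preceq>" 50)
    and mt :: "'l \<Rightarrow> 'l \<Rightarrow> 'l" (infixl "\<curlywedge>" 70)
    and jn :: "'l \<Rightarrow> 'l \<Rightarrow> 'l" (infixl "\<curlyvee>" 65)
    and bt tp :: 'l
    and dm :: "'l \<Rightarrow> nat"
    and n :: nat
  assumes le_refl [simp]: "x \<preceq> x"
    and le_antisym: "x \<preceq> y \<Longrightarrow> y \<preceq> x \<Longrightarrow> x = y"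
    and le_trans: "x \<preceq> y \<Longrightarrow> y \<preceq> z \<Longrightarrow> x \<preceq> z"
    and mt_le1 [simp]: "x \<curlywedge> y \<preceq> x" and mt_le2 [simp]: "x \<curlywedge> y \<preceq> y"
    and mt_greatest: "z \<preceq> x \<Longrightarrow> z \<preceq> y \<Longrightarrow> z \<preceq> x \<curlywedge> y"
    and jn_ge1 [simp]: "x \<preceq> x \<curlyvee> y" and jn_ge2 [simp]: "y \<preceq> x \<curlyvee> y"
    and jn_least: "x \<preceq> z \<Longrightarrow> y \<preceq> z \<Longrightarrow> x \<curlyvee> y \<preceq> z"
    and bt_le [simp]: "bt \<preceq> x" and le_tp [simp]: "x \<preceq> tp"
    and dm_bt: "dm bt = 0" and dm_tp: "dm tp = n"
    and dm_strict: "x \<preceq> y \<Longrightarrow> x \<noteq> y \<Longrightarrow> dm x < dm y"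
    and dm_mod: "dm (x \<curlywedge> y) + dm (x \<curlyvee> y) = dm x + dm y"
    and atom_ex: "x \<preceq> y \<Longrightarrow> x \<noteq> y \<Longrightarrow> \<exists>a. x \<preceq> a \<and> a \<preceq> y \<and> dm a = Suc (dm x)"
    and coatom_ex: "x \<preceq> y \<Longrightarrow> x \<noteq> y \<Longrightarrow> \<exists>a. x \<preceq> a \<and> a \<preceq> y \<and> Suc (dm a) = dm y"
    and card_complements: "c \<preceq> a \<Longrightarrow> a \<preceq> b \<Longrightarrow>
      real (card {x. x \<curlywedge> a = c \<and> x \<curlyvee> a = b}) = q ^ ((dm a - dm c) * (dm b - dm a))"
begin

section \<open>Calculus in a modular lattice and duality\<close>

lemma dm_mono: "x \<preceq> y \<Longrightarrow> dm x \<le> dm y"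
  using dm_strict[of x y] by (cases "x = y") auto

lemma le_dm_eq: "x \<preceq> y \<Longrightarrow> dm y \<le> dm x \<Longrightarrow> x = y"
  using dm_strict[of x y] by force

lemma dm_le_n: "dm x \<le> n"
  using dm_mono[OF le_tp[of x]] dm_tp by simp

lemma mt_commute: "x \<curlywedge> y = y \<curlywedge> x"
  by (intro le_antisym mt_greatest) auto

lemma jn_commute: "x \<curlyvee> y = y \<curlyvee> x"
  by (intro le_antisym jn_least) auto

lemma le_mt_iff: "z \<preceq> x \<curlywedge> y \<longleftrightarrow> z \<preceq> x \<and> z \<preceq> y"
  by (meson le_trans mt_le1 mt_le2 mt_greatest)

lemma jn_le_iff: "x \<curlyvee> y \<preceq> z \<longleftrightarrow> x \<preceq> z \<and> y \<preceq> z"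
  by (meson le_trans jn_ge1 jn_ge2 jn_least)

lemma mt_eq1: "x \<preceq> y \<Longrightarrow> x \<curlywedge> y = x"
  by (intro le_antisym mt_greatest) auto

lemma mt_eq2: "y \<preceq> x \<Longrightarrow> x \<curlywedge> y = y"
  by (intro le_antisym mt_greatest) auto

lemma jn_eq1: "y \<preceq> x \<Longrightarrow> x \<curlyvee> y = x"
  by (intro le_antisym jn_least) auto

lemma jn_eq2: "x \<preceq> y \<Longrightarrow> x \<curlyvee> y = y"
  by (intro le_antisym jn_least) auto

lemma le_bt: "x \<preceq> bt \<longleftrightarrow> x = bt"
  using le_antisym by fastforce

lemma mt_assoc: "x \<curlywedge> y \<curlywedge> z = x \<curlywedge> (y \<curlywedge> z)"
  by (rule le_antisym; intro mt_greatest) (meson le_trans mt_le1 mt_le2)+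

lemma jn_assoc: "x \<curlyvee> y \<curlyvee> z = x \<curlyvee> (y \<curlyvee> z)"
  by (rule le_antisym; intro jn_least) (meson le_trans jn_ge1 jn_ge2)+

text \<open>One inclusion is formal. The dimension formula, used four times, gives both sides the
  same dimension.\<close>

lemma modular: assumes "p \<preceq> b" shows "b \<curlywedge> (a \<curlyvee> p) = (b \<curlywedge> a) \<curlyvee> p"
proof (rule sym, rule le_dm_eq)
  show "(b \<curlywedge> a) \<curlyvee> p \<preceq> b \<curlywedge> (a \<curlyvee> p)"
    using assms by (auto simp: jn_le_iff le_mt_iff intro: le_trans[OF mt_le2])
  have 1: "dm (b \<curlywedge> (a \<curlyvee> p)) + dm (b \<curlyvee> (a \<curlyvee> p)) = dm b + dm (a \<curlyvee> p)" by (rule dm_mod)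
  have 2: "dm ((b \<curlywedge> a) \<curlywedge> p) + dm ((b \<curlywedge> a) \<curlyvee> p) = dm (b \<curlywedge> a) + dm p" by (rule dm_mod)
  have 3: "dm (b \<curlywedge> a) + dm (b \<curlyvee> a) = dm b + dm a" by (rule dm_mod)
  have 4: "dm (a \<curlywedge> p) + dm (a \<curlyvee> p) = dm a + dm p" by (rule dm_mod)
  have 5: "b \<curlyvee> (a \<curlyvee> p) = b \<curlyvee> a"
    by (simp only: jn_commute[of a p] jn_assoc[symmetric] jn_eq1[OF assms])
  have 6: "(b \<curlywedge> a) \<curlywedge> p = a \<curlywedge> p"
    by (simp only: mt_commute[of b a] mt_assoc mt_eq2[OF assms])
  show "dm (b \<curlywedge> (a \<curlyvee> p)) \<le> dm ((b \<curlywedge> a) \<curlyvee> p)"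
    using 1 2 3 4 unfolding 5 6 by linarith
qed

text \<open>Interpreting the locale in the opposite lattice transports facts on S, on lower ends of
  intervals and on coatoms to T, to upper ends and to atoms.\<close>

lemma dual: "qlattice q (\<lambda>x y. y \<preceq> x) jn mt tp bt (\<lambda>x. n - dm x) n"
proof
  show "x \<preceq> x" for x by simp
  show "x = y" if "y \<preceq> x" "x \<preceq> y" for x y using that by (auto intro: le_antisym)
  show "z \<preceq> x" if "y \<preceq> x" "z \<preceq> y" for x y z using that by (auto intro: le_trans)
  show "x \<preceq> x \<curlyvee> y" "y \<preceq> x \<curlyvee> y" "x \<curlywedge> y \<preceq> x" "x \<curlywedge> y \<preceq> y" "x \<preceq> tp" "bt \<preceq> x" for x y by simp_all
  show "x \<curlyvee> y \<preceq> z" if "x \<preceq> z" "y \<preceq> z" for x y z using that by (rule jn_least)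
  show "z \<preceq> x \<curlywedge> y" if "z \<preceq> x" "z \<preceq> y" for x y z using that by (rule mt_greatest)
  show "n - dm tp = 0" "n - dm bt = n" by (simp_all add: dm_tp dm_bt)
  show "n - dm x < n - dm y" if "y \<preceq> x" "x \<noteq> y" for x y
    using dm_strict[of y x] that dm_le_n[of x] by auto
  show "n - dm (x \<curlyvee> y) + (n - dm (x \<curlywedge> y)) = n - dm x + (n - dm y)" for x y
    using dm_mod[of x y] dm_le_n[of x] dm_le_n[of y] dm_le_n[of "x \<curlyvee> y"] dm_le_n[of "x \<curlywedge> y"] by linarith
  show "\<exists>a. a \<preceq> x \<and> y \<preceq> a \<and> n - dm a = Suc (n - dm x)" if "y \<preceq> x" "x \<noteq> y" for x y
  proof -
    obtain a where "y \<preceq> a" "a \<preceq> x" "Suc (dm a) = dm x" using coatom_ex[of y x] \<open>y \<preceq> x\<close> \<open>x \<noteq> y\<close> by auto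
    then show ?thesis using dm_le_n[of x] by (intro exI[of _ a]) linarith
  qed
  show "\<exists>a. a \<preceq> x \<and> y \<preceq> a \<and> Suc (n - dm a) = n - dm y" if "y \<preceq> x" "x \<noteq> y" for x y
  proof -
    obtain a where "y \<preceq> a" "a \<preceq> x" "dm a = Suc (dm y)" using atom_ex[of y x] \<open>y \<preceq> x\<close> \<open>x \<noteq> y\<close> by auto
    then show ?thesis using dm_le_n[of a] by (intro exI[of _ a]) linarith
  qed
  show "real (card {x. x \<curlyvee> a = c \<and> x \<curlywedge> a = b}) =
       q ^ ((n - dm a - (n - dm c)) * (n - dm b - (n - dm a)))" if "a \<preceq> c" "b \<preceq> a" for c a b
  proof -
    have "n - dm a - (n - dm c) = dm c - dm a" "n - dm b - (n - dm a) = dm a - dm b"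
      using dm_le_n[of c] dm_le_n[of a] by auto
    then show ?thesis
      using card_complements[OF \<open>b \<preceq> a\<close> \<open>a \<preceq> c\<close>] by (simp add: conj_commute mult.commute)
  qed
qed

text \<open>By the modular law, the relative complements of \<open>a\<close> that contain
  \<open>p\<close> are the ordinary relative complements of \<open>a \<curlyvee> p\<close> over
  \<open>p\<close>.\<close>

lemma card_relative_complements:
  assumes "p \<preceq> b" "a \<preceq> b"
  shows "real (card {x. p \<preceq> x \<and> x \<curlywedge> a = p \<curlywedge> a \<and> x \<curlyvee> a = b}) =
    q ^ ((dm a - dm (p \<curlywedge> a)) * (dm b - dm (p \<curlyvee> a)))"
proof -
  have "{x. p \<preceq> x \<and> x \<curlywedge> a = p \<curlywedge> a \<and> x \<curlyvee> a = b} = {x. x \<curlywedge> (a \<curlyvee> p) = p \<and> x \<curlyvee> (a \<curlyvee> p) = b}"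
  proof (intro Collect_cong iffI conjI; elim conjE)
    fix x assume x: "p \<preceq> x" "x \<curlywedge> a = p \<curlywedge> a" "x \<curlyvee> a = b"
    show "x \<curlywedge> (a \<curlyvee> p) = p" using x by (simp add: modular jn_eq2)
    show "x \<curlyvee> (a \<curlyvee> p) = b" using x by (simp only: jn_assoc[symmetric] jn_eq1[OF assms(1)])
  next
    fix x assume x: "x \<curlywedge> (a \<curlyvee> p) = p" "x \<curlyvee> (a \<curlyvee> p) = b"
    show p: "p \<preceq> x" using x(1) mt_le1 by metis
    have "x \<curlywedge> a = x \<curlywedge> (a \<curlyvee> p) \<curlywedge> a" by (simp only: mt_assoc mt_eq2[OF jn_ge1])
    then show "x \<curlywedge> a = p \<curlywedge> a" using x by simp
    show "x \<curlyvee> a = b" using x(2) by (simp only: jn_commute[of a p] jn_assoc[symmetric] jn_eq1[OF p])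
  qed
  moreover have "dm (a \<curlyvee> p) - dm p = dm a - dm (p \<curlywedge> a)"
    using dm_mod[of p a] dm_mono[of p "p \<curlyvee> a"] dm_mono[of "p \<curlywedge> a" a] by (simp add: jn_commute)
  ultimately show ?thesis
    using card_complements[of p "a \<curlyvee> p" b] assms by (simp add: jn_least jn_commute)
qed

section \<open>Covers, atoms and the Moebius function\<close>

definition cov :: "'l \<Rightarrow> 'l \<Rightarrow> bool" (infix "\<lessdot>" 50) where
  "x \<lessdot> y \<longleftrightarrow> x \<preceq> y \<and> dm y = Suc (dm x)"

lemma cov_le: "x \<lessdot> y \<Longrightarrow> x \<preceq> y" by (simp add: cov_def)
lemma cov_dm: "x \<lessdot> y \<Longrightarrow> dm y = Suc (dm x)" by (simp add: cov_def)

text \<open>Fix an atom \<open>l\<close> of the interval. A coatom either contains \<open>l\<close>,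
  which is a shorter interval, or is a complement of \<open>l\<close>, and there are
  \<open>q ^ m\<close> of these. This is the recursion \<open>qint_Suc\<close>.\<close>

lemma card_coatoms: "a \<preceq> b \<Longrightarrow> real (card {x. a \<preceq> x \<and> x \<lessdot> b}) = qint (dm b - dm a)"
proof (induction "dm b - dm a" arbitrary: a)
  case 0
  then have "a = b" by (intro le_dm_eq) auto
  have "{x. a \<preceq> x \<and> x \<lessdot> b} = {}"
    using \<open>a = b\<close> by (auto simp: cov_def dest!: dm_mono)
  then show ?case using 0 by simp
next
  case (Suc m)
  then have "a \<noteq> b" by auto
  then obtain l where l: "a \<preceq> l" "l \<preceq> b" "dm l = Suc (dm a)" using atom_ex Suc.prems by blast
  have e: "{x. a \<preceq> x \<and> x \<lessdot> b} = {x. l \<preceq> x \<and> x \<lessdot> b} \<union> {x. x \<curlywedge> l = a \<and> x \<curlyvee> l = b}"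
  proof (intro equalityI subsetI)
    fix x assume x: "x \<in> {x. a \<preceq> x \<and> x \<lessdot> b}"
    show "x \<in> {x. l \<preceq> x \<and> x \<lessdot> b} \<union> {x. x \<curlywedge> l = a \<and> x \<curlyvee> l = b}"
    proof (rule ccontr)
      assume c: "\<not> ?thesis"
      with x have nl: "\<not> l \<preceq> x" by auto
      have "x \<curlywedge> l \<noteq> l" using nl mt_le1 by metis
      then have "dm (x \<curlywedge> l) < dm l" using dm_strict mt_le2 by blast
      then have 1: "a = x \<curlywedge> l" using l x by (intro le_dm_eq) (auto simp: le_mt_iff)
      have "x \<curlyvee> l \<noteq> x" using nl jn_ge2 by metis
      then have "dm x < dm (x \<curlyvee> l)" using dm_strict jn_ge1 by metis
      then have "x \<curlyvee> l = b" using l x by (intro le_dm_eq) (auto simp: jn_le_iff cov_def)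
      then show False using c 1 by simp
    qed
  next
    fix x assume "x \<in> {x. l \<preceq> x \<and> x \<lessdot> b} \<union> {x. x \<curlywedge> l = a \<and> x \<curlyvee> l = b}"
    then consider "l \<preceq> x" "x \<lessdot> b" | "x \<curlywedge> l = a" "x \<curlyvee> l = b" by auto
    then show "x \<in> {x. a \<preceq> x \<and> x \<lessdot> b}"
    proof cases
      case 1 then show ?thesis using l le_trans by blast
    next
      case 2
      have "a \<preceq> x" using 2 mt_le1 by metis
      moreover have "x \<preceq> b" using 2 jn_ge1 by metis
      moreover have "dm b = Suc (dm x)" using dm_mod[of x l] l 2 by simp
      ultimately show ?thesis by (simp add: cov_def)
    qed
  qed
  have d: "{x. l \<preceq> x \<and> x \<lessdot> b} \<inter> {x. x \<curlywedge> l = a \<and> x \<curlyvee> l = b} = {}"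
    using l mt_eq2 by fastforce
  have "m = dm b - dm l" using Suc.hyps(2) l by simp
  then have "real (card {x. l \<preceq> x \<and> x \<lessdot> b}) = qint m"
    using Suc.hyps(1)[of l] l(2) by metis
  moreover have "real (card {x. x \<curlywedge> l = a \<and> x \<curlyvee> l = b}) = q ^ m"
  proof -
    have "dm l - dm a = 1" "dm b - dm l = m" using l Suc.hyps(2) by auto
    then show ?thesis using card_complements[OF l(1,2)] by simp
  qed
  ultimately show ?case unfolding e using d Suc.hyps(2)[symmetric]
    by (simp add: card_Un_disjoint qint_Suc)
qed

lemma card_atoms: assumes "a \<preceq> b" shows "real (card {x. a \<lessdot> x \<and> x \<preceq> b}) = qint (dm b - dm a)"
proof -
  interpret d: qlattice q "\<lambda>x y. y \<preceq> x" jn mt tp bt "\<lambda>x. n - dm x" n by (rule dual)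
  have "d.cov x a \<longleftrightarrow> a \<lessdot> x" for x
    using dm_le_n[of x] dm_le_n[of a] by (auto simp: cov_def d.cov_def)
  then have 1: "{x. x \<preceq> b \<and> d.cov x a} = {x. a \<lessdot> x \<and> x \<preceq> b}" by auto
  have 2: "n - dm a - (n - dm b) = dm b - dm a" using dm_le_n[of b] by simp
  have "real (card {x. x \<preceq> b \<and> d.cov x a}) = qint (n - dm a - (n - dm b))"
    by (rule d.card_coatoms) (rule assms)
  then show ?thesis unfolding 1 2 .
qed

text \<open>Fix an atom \<open>l\<close> of the interval and send each \<open>d\<close> not above
  \<open>l\<close> to \<open>D = d \<curlyvee> l\<close>. The fibre over \<open>D\<close> consists
  of relative complements of \<open>l\<close>; their number times the value of \<open>mu\<close> one
  dimension lower is minus the value of \<open>mu\<close> at \<open>D\<close>, so the elements above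
  \<open>l\<close> and the others cancel.\<close>

lemma sum_mu:
  assumes "c \<preceq> e"
  shows "(\<Sum>d | c \<preceq> d \<and> d \<preceq> e. mu (dm d - dm c)) = (if c = e then 1 else 0)"
proof (cases "c = e")
  case True
  then have "{d. c \<preceq> d \<and> d \<preceq> e} = {c}" using le_antisym by auto
  then show ?thesis using True by simp
next
  case False
  then obtain l where l: "c \<preceq> l" "l \<preceq> e" "dm l = Suc (dm c)" using atom_ex assms by blast
  let ?M = "{d. l \<preceq> d \<and> d \<preceq> e}" and ?N = "{d. c \<preceq> d \<and> d \<preceq> e \<and> \<not> l \<preceq> d}"
  have e: "{d. c \<preceq> d \<and> d \<preceq> e} = ?M \<union> ?N" using l le_trans by blast
  have fib: "{d \<in> ?N. d \<curlyvee> l = D} = {x. x \<curlywedge> l = c \<and> x \<curlyvee> l = D}" if D: "D \<in> ?M" for D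
  proof safe
    fix d assume d: "c \<preceq> d" "\<not> l \<preceq> d" "D = d \<curlyvee> l"
    have "d \<curlywedge> l \<noteq> l" using d mt_le1 by metis
    then have "dm (d \<curlywedge> l) < dm l" using dm_strict mt_le2 by blast
    then show "d \<curlywedge> l = c" using l d by (intro le_dm_eq[symmetric]) (auto simp: le_mt_iff)
  next
    fix d assume d: "c = d \<curlywedge> l" "D = d \<curlyvee> l"
    show "d \<curlywedge> l \<preceq> d" by simp
    show "d \<preceq> e" using D d by (auto simp: jn_le_iff)
    assume "l \<preceq> d" then show False using d l mt_eq2 by fastforce
  qed
  have "(\<Sum>d\<in>?N. mu (dm d - dm c)) = (\<Sum>D\<in>?M. \<Sum>d\<in>{d \<in> ?N. d \<curlyvee> l = D}. mu (dm d - dm c))"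
    by (rule sum.group[symmetric]) (auto simp: l jn_least)
  also have "\<dots> = (\<Sum>D\<in>?M. - mu (dm D - dm c))"
  proof (rule sum.cong[OF refl])
    fix D assume D: "D \<in> ?M"
    have lt: "dm l \<le> dm D" using D dm_mono by blast
    have "dm d - dm c = dm D - dm l" if "d \<curlywedge> l = c" "d \<curlyvee> l = D" for d
      using dm_mod[of d l] that l by simp
    then have "(\<Sum>d\<in>{d \<in> ?N. d \<curlyvee> l = D}. mu (dm d - dm c)) =
      real (card {x. x \<curlywedge> l = c \<and> x \<curlyvee> l = D}) * mu (dm D - dm l)"
      unfolding fib[OF D] by simp
    also have "\<dots> = q ^ (dm D - dm l) * mu (dm D - dm l)"
      using card_complements[of c l D] l D by simp
    also have "\<dots> = - mu (Suc (dm D - dm l))" by (simp add: mu_Suc)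
    also have "Suc (dm D - dm l) = dm D - dm c" using l lt by simp
    finally show "(\<Sum>d\<in>{d \<in> ?N. d \<curlyvee> l = D}. mu (dm d - dm c)) = - mu (dm D - dm c)" .
  qed
  finally have N: "(\<Sum>d\<in>?N. mu (dm d - dm c)) = - (\<Sum>d\<in>?M. mu (dm d - dm c))" by (simp add: sum_negf)
  have "(\<Sum>d | c \<preceq> d \<and> d \<preceq> e. mu (dm d - dm c)) = (\<Sum>d\<in>?M. mu (dm d - dm c)) + (\<Sum>d\<in>?N. mu (dm d - dm c))"
    unfolding e by (rule sum.union_disjoint) auto
  then show ?thesis using N False by simp
qed

text \<open>Both components of \<open>(A, B)\<close> go down by \<open>l\<close> dimensions:
  \<open>B\<close> to a \<open>B'\<close> that still joins with \<open>A\<close> to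
  \<open>B\<close>, and \<open>A\<close> to \<open>B' \<curlywedge> A\<close>. On the functions of
  interest this is a multiple of a power of the raising operator, see
  \<open>Rl_annihilated\<close>.\<close>

definition Rl :: "nat \<Rightarrow> ('l \<Rightarrow> 'l \<Rightarrow> real) \<Rightarrow> 'l \<Rightarrow> 'l \<Rightarrow> real" where
  "Rl l g A B = (\<Sum>B' | B' \<curlyvee> A = B \<and> dm B' + l = dm B. g (B' \<curlywedge> A) B')"

end

section \<open>Sums over flags\<close>

locale qflags = qlattice +
  fixes k :: nat
  assumes n_eq: "n = 3 * k"
begin

lemma dual_flags: "qflags q (\<lambda>x y. y \<preceq> x) jn mt tp bt (\<lambda>x. n - dm x) n k"
  using dual n_eq by (simp add: qflags_def qflags_axioms_def)

definition flag :: "'a \<Rightarrow> 'a \<Rightarrow> bool" where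
  "flag L P \<longleftrightarrow> L \<preceq> P \<and> dm L = k \<and> dm P = 2 * k"

definition phi :: "('a \<Rightarrow> 'a \<Rightarrow> real) \<Rightarrow> 'a \<Rightarrow> 'a \<Rightarrow> real" where
  "phi f A B = (\<Sum>(L,P) | flag L P \<and> A \<preceq> L \<and> P \<preceq> B. f L P)"

text \<open>Applying S moves the lower bound \<open>A\<close> from \<open>L\<close> to
  \<open>P\<close>. These sums describe the result, with a second bound \<open>C\<close> left on
  \<open>L\<close>, and are then expressed through \<open>phi\<close> again.\<close>

definition Psi :: "('a \<Rightarrow> 'a \<Rightarrow> real) \<Rightarrow> 'a \<Rightarrow> 'a \<Rightarrow> 'a \<Rightarrow> real" where
  "Psi f C A B = (\<Sum>(L,P) | flag L P \<and> C \<preceq> L \<and> A \<preceq> P \<and> P \<preceq> B. f L P)"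

definition Sop :: "('a \<Rightarrow> 'a \<Rightarrow> real) \<Rightarrow> 'a \<Rightarrow> 'a \<Rightarrow> real" where
  "Sop f L P = (if flag L P then \<Sum>M | M \<curlywedge> L = bt \<and> M \<curlyvee> L = P. f M P else 0)"

text \<open>The filtration from which the degree \<open>r\<close> of an irreducible module is read off.\<close>

definition vanish :: "nat \<Rightarrow> ('a \<Rightarrow> 'a \<Rightarrow> real) \<Rightarrow> bool" where
  "vanish r f \<longleftrightarrow> (\<forall>L P. \<not> flag L P \<longrightarrow> f L P = 0) \<and>
     (\<forall>A B. A \<preceq> B \<longrightarrow> dm A + (n - dm B) < r \<longrightarrow> phi f A B = 0)"

lemma phi_UNIV: "phi f A B = (\<Sum>L\<in>UNIV. \<Sum>P\<in>UNIV. if flag L P \<and> A \<preceq> L \<and> P \<preceq> B then f L P else 0)"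
  unfolding phi_def by (rule sum_pairs)

lemma Psi_UNIV: "Psi f C A B = (\<Sum>L\<in>UNIV. \<Sum>P\<in>UNIV. if flag L P \<and> C \<preceq> L \<and> A \<preceq> P \<and> P \<preceq> B then f L P else 0)"
  unfolding Psi_def by (rule sum_pairs)

lemma flag_complement:
  assumes "flag L P" "M \<curlywedge> L = bt" "M \<curlyvee> L = P"
  shows "flag M P"
proof -
  have "M \<preceq> P" using assms(3) jn_ge1 by metis
  moreover have "dm M = k" using assms dm_mod[of M L] dm_bt by (simp add: flag_def)
  ultimately show ?thesis using assms by (simp add: flag_def)
qed

lemma sum_mu_bt: "(\<Sum>d | d \<preceq> e. mu (dm d)) = (if e = bt then 1 else 0)"
  using sum_mu[of bt e] by (auto simp: dm_bt)

text \<open>A complement of \<open>M\<close> in \<open>P\<close> above \<open>A\<close> can exist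
  only if \<open>A\<close> lies in \<open>P\<close> and meets \<open>M\<close> trivially. Then
  \<open>A \<curlyvee> M\<close> has dimension \<open>k + dm A\<close>, which gives the
  exponent.\<close>

lemma card_flag_complements:
  assumes MP: "flag M P"
  shows "real (card {L. flag L P \<and> A \<preceq> L \<and> M \<curlywedge> L = bt \<and> M \<curlyvee> L = P}) =
    (if A \<preceq> P \<and> M \<curlywedge> A = bt then q ^ (k * (k - dm A)) else 0)"
proof (cases "A \<preceq> P \<and> M \<curlywedge> A = bt")
  case True
  have e: "{L. flag L P \<and> A \<preceq> L \<and> M \<curlywedge> L = bt \<and> M \<curlyvee> L = P} =
     {x. A \<preceq> x \<and> x \<curlywedge> M = A \<curlywedge> M \<and> x \<curlyvee> M = P}"
    using True flag_complement[OF MP, of "_"] by (auto simp: mt_commute jn_commute)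
  have "dm (A \<curlyvee> M) = k + dm A"
    using dm_mod[of A M] True MP by (simp add: flag_def dm_bt mt_commute)
  then show ?thesis unfolding e
    using card_relative_complements[of A P M] True MP by (simp add: flag_def mt_commute[of A] dm_bt)
next
  case False
  have "{L. flag L P \<and> A \<preceq> L \<and> M \<curlywedge> L = bt \<and> M \<curlyvee> L = P} = {}"
  proof -
    have False if "flag L P" "A \<preceq> L" "M \<curlywedge> L = bt" "M \<curlyvee> L = P" for L
    proof -
      have "A \<preceq> P" using that le_trans by (auto simp: flag_def)
      moreover have "M \<curlywedge> A \<preceq> M \<curlywedge> L" using that by (auto simp: le_mt_iff intro: le_trans[OF mt_le2])
      ultimately show False using False that by (simp add: le_bt)
    qed
    then show ?thesis by blast
  qed
  then show ?thesis by (simp only: False if_False card.empty of_nat_0)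
qed

text \<open>After exchanging the sums, the inner one counts the complements \<open>L\<close> of
  \<open>M\<close> above \<open>A\<close>.\<close>

lemma phi_Sop:
  "phi (Sop f) A B = q ^ (k * (k - dm A)) *
     (\<Sum>(M,P) | flag M P \<and> A \<preceq> P \<and> P \<preceq> B \<and> M \<curlywedge> A = bt. f M P)"
proof -
  have "phi (Sop f) A B = (\<Sum>L\<in>UNIV. \<Sum>P\<in>UNIV. \<Sum>M\<in>UNIV.
      if flag L P \<and> A \<preceq> L \<and> P \<preceq> B \<and> M \<curlywedge> L = bt \<and> M \<curlyvee> L = P then f M P else 0)"
    unfolding phi_UNIV Sop_def sum_Collect by (intro sum.cong refl) auto
  also have "\<dots> = (\<Sum>M\<in>UNIV. \<Sum>P\<in>UNIV. \<Sum>L\<in>UNIV.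
      if flag L P \<and> A \<preceq> L \<and> P \<preceq> B \<and> M \<curlywedge> L = bt \<and> M \<curlyvee> L = P then f M P else 0)"
    by (subst sum_rotate3, subst sum.swap) simp
  also have "\<dots> = (\<Sum>M\<in>UNIV. \<Sum>P\<in>UNIV. if flag M P \<and> P \<preceq> B then
      real (card {L. flag L P \<and> A \<preceq> L \<and> M \<curlywedge> L = bt \<and> M \<curlyvee> L = P}) * f M P else 0)"
    unfolding sum_if_const[symmetric]
    by (intro sum.cong refl) (auto intro!: sum.neutral sum.cong dest: flag_complement)
  also have "\<dots> = (\<Sum>M\<in>UNIV. \<Sum>P\<in>UNIV. q ^ (k * (k - dm A)) *
      (if flag M P \<and> A \<preceq> P \<and> P \<preceq> B \<and> M \<curlywedge> A = bt then f M P else 0))"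
    by (intro sum.cong refl) (auto simp: card_flag_complements)
  finally show ?thesis unfolding sum_pairs by (simp add: sum_distrib_left)
qed

text \<open>Moebius inversion of the condition \<open>M \<curlywedge> A = bt\<close> over the
  elements \<open>C\<close> below \<open>A\<close>.\<close>

lemma Sop_Psi:
  "(\<Sum>(M,P) | flag M P \<and> A \<preceq> P \<and> P \<preceq> B \<and> M \<curlywedge> A = bt. f M P) =
     (\<Sum>C | C \<preceq> A. mu (dm C) * Psi f C A B)"
proof -
  have "(\<Sum>C | C \<preceq> A. mu (dm C) * Psi f C A B) = (\<Sum>C\<in>UNIV. \<Sum>L\<in>UNIV. \<Sum>P\<in>UNIV.
      if C \<preceq> A \<and> flag L P \<and> C \<preceq> L \<and> A \<preceq> P \<and> P \<preceq> B then mu (dm C) * f L P else 0)"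
    unfolding Psi_UNIV sum_Collect sum_distrib_left
    by (intro sum.cong refl) (auto simp: sum_distrib_left intro!: sum.cong)
  also have "\<dots> = (\<Sum>L\<in>UNIV. \<Sum>P\<in>UNIV. \<Sum>C\<in>UNIV.
      if C \<preceq> A \<and> flag L P \<and> C \<preceq> L \<and> A \<preceq> P \<and> P \<preceq> B then mu (dm C) * f L P else 0)"
    by (rule sum_rotate3)
  also have "\<dots> = (\<Sum>L\<in>UNIV. \<Sum>P\<in>UNIV. if flag L P \<and> A \<preceq> P \<and> P \<preceq> B then
      (\<Sum>C | C \<preceq> L \<curlywedge> A. mu (dm C)) * f L P else 0)"
    unfolding sum_Collect sum_distrib_right
    by (intro sum.cong refl) (auto simp: le_mt_iff intro!: sum.cong)
  also have "\<dots> = (\<Sum>(M,P) | flag M P \<and> A \<preceq> P \<and> P \<preceq> B \<and> M \<curlywedge> A = bt. f M P)"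
    unfolding sum_mu_bt sum_pairs by (intro sum.cong refl) auto
  finally show ?thesis by simp
qed

text \<open>Double counting: a flag above \<open>C\<close> lies below some relative complement
  \<open>B'\<close> only if \<open>P \<curlywedge> A = C\<close>, and then below the same number of
  them.\<close>

lemma sum_phi_complements:
  assumes "C \<preceq> A" "A \<preceq> B"
  shows "(\<Sum>B' | B' \<curlywedge> A = C \<and> B' \<curlyvee> A = B. phi f C B') =
    q ^ ((dm A - dm C) * (dm B - (2 * k + (dm A - dm C)))) *
    (\<Sum>(L,P) | flag L P \<and> C \<preceq> L \<and> P \<preceq> B \<and> P \<curlywedge> A = C. f L P)"
proof -
  have card: "real (card {x. P \<preceq> x \<and> x \<curlywedge> A = C \<and> x \<curlyvee> A = B}) =
     (if P \<preceq> B \<and> P \<curlywedge> A = C then q ^ ((dm A - dm C) * (dm B - (2 * k + (dm A - dm C)))) else 0)"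
    if "flag L P" "C \<preceq> L" for L P
  proof (cases "P \<preceq> B \<and> P \<curlywedge> A = C")
    case True
    have "dm (P \<curlyvee> A) = 2 * k + (dm A - dm C)"
      using dm_mod[of P A] True that dm_mono[OF assms(1)] by (simp add: flag_def)
    then show ?thesis using card_relative_complements[of P B A] True assms by simp
  next
    case False
    have "C \<preceq> P" using that le_trans by (auto simp: flag_def)
    have "{x. P \<preceq> x \<and> x \<curlywedge> A = C \<and> x \<curlyvee> A = B} = {}"
    proof -
      have False if "P \<preceq> x" "x \<curlywedge> A = C" "x \<curlyvee> A = B" for x
      proof -
        have "P \<preceq> B" using that jn_ge1 le_trans by metis
        moreover have "P \<curlywedge> A \<preceq> x \<curlywedge> A" using that by (auto simp: le_mt_iff intro: le_trans[OF mt_le1])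
        moreover have "C \<preceq> P \<curlywedge> A" using \<open>C \<preceq> P\<close> assms by (simp add: le_mt_iff)
        ultimately show False using False that le_antisym by metis
      qed
      then show ?thesis by blast
    qed
    then show ?thesis by (simp only: False if_False card.empty of_nat_0)
  qed
  have "(\<Sum>B' | B' \<curlywedge> A = C \<and> B' \<curlyvee> A = B. phi f C B') = (\<Sum>B'\<in>UNIV. \<Sum>L\<in>UNIV. \<Sum>P\<in>UNIV.
      if flag L P \<and> C \<preceq> L \<and> P \<preceq> B' \<and> B' \<curlywedge> A = C \<and> B' \<curlyvee> A = B then f L P else 0)"
    unfolding phi_UNIV sum_Collect by (intro sum.cong refl) auto
  also have "\<dots> = (\<Sum>L\<in>UNIV. \<Sum>P\<in>UNIV. \<Sum>B'\<in>UNIV.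
      if flag L P \<and> C \<preceq> L \<and> P \<preceq> B' \<and> B' \<curlywedge> A = C \<and> B' \<curlyvee> A = B then f L P else 0)"
    by (rule sum_rotate3)
  also have "\<dots> = (\<Sum>L\<in>UNIV. \<Sum>P\<in>UNIV. if flag L P \<and> C \<preceq> L then
      real (card {x. P \<preceq> x \<and> x \<curlywedge> A = C \<and> x \<curlyvee> A = B}) * f L P else 0)"
    unfolding sum_if_const[symmetric] by (intro sum.cong refl) auto
  also have "\<dots> = (\<Sum>L\<in>UNIV. \<Sum>P\<in>UNIV. q ^ ((dm A - dm C) * (dm B - (2 * k + (dm A - dm C)))) *
      (if flag L P \<and> C \<preceq> L \<and> P \<preceq> B \<and> P \<curlywedge> A = C then f L P else 0))"
  proof (intro sum.cong refl)
    fix L P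
    show "(if flag L P \<and> C \<preceq> L then real (card {x. P \<preceq> x \<and> x \<curlywedge> A = C \<and> x \<curlyvee> A = B}) * f L P else 0) =
      q ^ ((dm A - dm C) * (dm B - (2 * k + (dm A - dm C)))) *
      (if flag L P \<and> C \<preceq> L \<and> P \<preceq> B \<and> P \<curlywedge> A = C then f L P else 0)"
      using card[of L P] by (cases "flag L P \<and> C \<preceq> L") (simp, auto)
  qed
  finally show ?thesis unfolding sum_pairs by (simp add: sum_distrib_left)
qed

text \<open>Moebius inversion again, now of \<open>P \<curlywedge> A = C\<close> over the interval
  from \<open>C\<close> to \<open>A\<close>.\<close>

lemma sum_mu_Psi:
  assumes "C \<preceq> A"
  shows "(\<Sum>(L,P) | flag L P \<and> C \<preceq> L \<and> P \<preceq> B \<and> P \<curlywedge> A = C. f L P) =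
    (\<Sum>D | C \<preceq> D \<and> D \<preceq> A. mu (dm D - dm C) * Psi f C D B)"
proof -
  have "(\<Sum>D | C \<preceq> D \<and> D \<preceq> A. mu (dm D - dm C) * Psi f C D B) = (\<Sum>D\<in>UNIV. \<Sum>L\<in>UNIV. \<Sum>P\<in>UNIV.
      if C \<preceq> D \<and> D \<preceq> A \<and> flag L P \<and> C \<preceq> L \<and> D \<preceq> P \<and> P \<preceq> B then mu (dm D - dm C) * f L P else 0)"
    unfolding Psi_UNIV sum_Collect
    by (intro sum.cong refl) (auto simp: sum_distrib_left intro!: sum.cong)
  also have "\<dots> = (\<Sum>L\<in>UNIV. \<Sum>P\<in>UNIV. \<Sum>D\<in>UNIV.
      if C \<preceq> D \<and> D \<preceq> A \<and> flag L P \<and> C \<preceq> L \<and> D \<preceq> P \<and> P \<preceq> B then mu (dm D - dm C) * f L P else 0)"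
    by (rule sum_rotate3)
  also have "\<dots> = (\<Sum>L\<in>UNIV. \<Sum>P\<in>UNIV. if flag L P \<and> C \<preceq> L \<and> P \<preceq> B then
      (\<Sum>D | C \<preceq> D \<and> D \<preceq> P \<curlywedge> A. mu (dm D - dm C)) * f L P else 0)"
    unfolding sum_Collect sum_distrib_right
    by (intro sum.cong refl) (auto simp: le_mt_iff intro!: sum.cong)
  also have "\<dots> = (\<Sum>L\<in>UNIV. \<Sum>P\<in>UNIV. if flag L P \<and> C \<preceq> L \<and> P \<preceq> B then
      (if C = P \<curlywedge> A then 1 else 0) * f L P else 0)"
  proof (intro sum.cong refl if_cong arg_cong2[of _ _ _ _ times])
    fix L P assume "flag L P \<and> C \<preceq> L \<and> P \<preceq> B"
    then have "C \<preceq> P \<curlywedge> A" using assms le_trans by (auto simp: flag_def le_mt_iff)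
    then show "(\<Sum>D | C \<preceq> D \<and> D \<preceq> P \<curlywedge> A. mu (dm D - dm C)) = (if C = P \<curlywedge> A then 1 else 0)"
      by (rule sum_mu)
  qed
  also have "\<dots> = (\<Sum>(L,P) | flag L P \<and> C \<preceq> L \<and> P \<preceq> B \<and> P \<curlywedge> A = C. f L P)"
    unfolding sum_pairs by (intro sum.cong refl) auto
  finally show ?thesis by simp
qed

lemma complement_dm:
  assumes "x \<curlywedge> A = C" "x \<curlyvee> A = B"
  shows "dm B - dm x = dm A - dm C" "dm x \<le> dm B" "dm C \<le> dm A" "dm x + (dm A - dm C) = dm B"
  using dm_mod[of x A] assms dm_mono[of x B] dm_mono[of C A] jn_ge1[of x A] mt_le2[of x A] by auto

text \<open>Passing from \<open>(A, B)\<close> to \<open>(C, B')\<close> with a relative complement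
  \<open>B'\<close> keeps the degree, so the sum of \<open>phi f C B'\<close> vanishes. Written
  through \<open>Psi\<close> it has one term for each \<open>D\<close> between \<open>C\<close> and
  \<open>A\<close>; by induction only \<open>D = A\<close> is left, and its coefficient is
  nonzero.\<close>

lemma Psi_zero:
  assumes Z: "vanish r f" and "C \<preceq> A" "A \<preceq> B" "dm A + (n - dm B) < r"
  shows "Psi f C A B = 0"
  using assms(2-)
proof (induction "dm A - dm C" arbitrary: A rule: less_induct)
  case less
  have "phi f C B' = 0" if "B' \<curlywedge> A = C" "B' \<curlyvee> A = B" for B'
  proof -
    have "C \<preceq> B'" using that mt_le1 by metis
    moreover have "dm C + (n - dm B') < r"
      using complement_dm[OF that] less.prems(3) dm_le_n[of B] by linarith
    ultimately show ?thesis using Z by (simp add: vanish_def)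
  qed
  then have "(\<Sum>B' | B' \<curlywedge> A = C \<and> B' \<curlyvee> A = B. phi f C B') = 0" by simp
  then have "(\<Sum>D | C \<preceq> D \<and> D \<preceq> A. mu (dm D - dm C) * Psi f C D B) = 0"
    unfolding sum_phi_complements[OF less.prems(1,2)] sum_mu_Psi[OF less.prems(1)] by simp
  moreover have "(\<Sum>D | C \<preceq> D \<and> D \<preceq> A. mu (dm D - dm C) * Psi f C D B) =
     (\<Sum>D\<in>{A}. mu (dm D - dm C) * Psi f C D B)"
  proof (rule sum.mono_neutral_right)
    show "\<forall>D\<in>{D. C \<preceq> D \<and> D \<preceq> A} - {A}. mu (dm D - dm C) * Psi f C D B = 0"
    proof
      fix D assume D: "D \<in> {D. C \<preceq> D \<and> D \<preceq> A} - {A}"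
      then have "dm D < dm A" "dm C \<le> dm D" using dm_strict dm_mono by auto
      moreover have "D \<preceq> B" using D less.prems(2) le_trans by blast
      ultimately have "Psi f C D B = 0" using D less.prems(3) by (intro less.hyps) auto
      then show "mu (dm D - dm C) * Psi f C D B = 0" by simp
    qed
  qed (use less.prems in auto)
  ultimately show ?case by simp
qed

lemma sum_phi_complements_top:
  assumes Z: "vanish r f" and "C \<preceq> A" "A \<preceq> B" "dm A + (n - dm B) \<le> r"
  shows "(\<Sum>B' | B' \<curlywedge> A = C \<and> B' \<curlyvee> A = B. phi f C B') =
    q ^ ((dm A - dm C) * (dm B - (2 * k + (dm A - dm C)))) * mu (dm A - dm C) * Psi f C A B"
proof -
  have "(\<Sum>D | C \<preceq> D \<and> D \<preceq> A. mu (dm D - dm C) * Psi f C D B) =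
     (\<Sum>D\<in>{A}. mu (dm D - dm C) * Psi f C D B)"
  proof (rule sum.mono_neutral_right)
    show "\<forall>D\<in>{D. C \<preceq> D \<and> D \<preceq> A} - {A}. mu (dm D - dm C) * Psi f C D B = 0"
    proof
      fix D assume D: "D \<in> {D. C \<preceq> D \<and> D \<preceq> A} - {A}"
      then have "dm D < dm A" using dm_strict by auto
      moreover have "D \<preceq> B" using D assms(3) le_trans by blast
      ultimately have "Psi f C D B = 0" using D assms(4) by (intro Psi_zero[OF Z]) auto
      then show "mu (dm D - dm C) * Psi f C D B = 0" by simp
    qed
  qed (use assms in auto)
  then show ?thesis unfolding sum_phi_complements[OF assms(2,3)] sum_mu_Psi[OF assms(2)] by simp
qed

text \<open>The inverse of the coefficient in \<open>sum_phi_complements_top\<close>, with an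
  integer exponent in place of a truncated one. Where the two exponents differ, both sides of
  \<open>Psi_eq\<close> vanish.\<close>

definition coefP :: "nat \<Rightarrow> nat \<Rightarrow> real" where
  "coefP b l = q powi (- (int l * (int b - 2 * int k - int l))) / mu l"

lemma Psi_eq:
  assumes Z: "vanish r f" and "C \<preceq> A" "A \<preceq> B" "dm A + (n - dm B) \<le> r"
  shows "Psi f C A B = coefP (dm B) (dm A - dm C) * (\<Sum>B' | B' \<curlywedge> A = C \<and> B' \<curlyvee> A = B. phi f C B')"
proof (cases "2 * k + (dm A - dm C) \<le> dm B")
  case True
  define l where "l = dm A - dm C"
  have "int l * (int (dm B) - 2 * int k - int l) = int (l * (dm B - (2 * k + l)))"
    using True by (simp add: l_def of_nat_diff)
  then have "coefP (dm B) l = 1 / (q ^ (l * (dm B - (2 * k + l))) * mu l)"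
    by (simp only: coefP_def power_int_minus power_int_of_nat) (simp add: field_simps)
  then show ?thesis using sum_phi_complements_top[OF assms] by (simp add: l_def)
next
  case False
  have "{(L,P). flag L P \<and> C \<preceq> L \<and> P \<preceq> B \<and> P \<curlywedge> A = C} = {}"
  proof -
    have False if "flag L P" "C \<preceq> L" "P \<preceq> B" "P \<curlywedge> A = C" for L P
    proof -
      have "dm (P \<curlyvee> A) = 2 * k + (dm A - dm C)"
        using dm_mod[of P A] that dm_mono[OF assms(2)] by (simp add: flag_def)
      moreover have "dm (P \<curlyvee> A) \<le> dm B" using that assms by (intro dm_mono jn_least)
      ultimately show False using False by simp
    qed
    then show ?thesis by blast
  qed
  then have "(\<Sum>B' | B' \<curlywedge> A = C \<and> B' \<curlyvee> A = B. phi f C B') = 0"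
    unfolding sum_phi_complements[OF assms(2,3)] by (simp only: sum.empty mult_zero_right)
  then show ?thesis using sum_phi_complements_top[OF assms] by simp
qed

definition coefS :: "nat \<Rightarrow> nat \<Rightarrow> nat \<Rightarrow> real" where
  "coefS i b l = q powi (int k * (int k - int i)) * mu (i - l) * coefP b l"

text \<open>The action of S on the leading layer. \<open>phi_Sop\<close>, \<open>Sop_Psi\<close> and
  \<open>Psi_eq\<close> give a double sum over \<open>C\<close> and \<open>B'\<close>; as
  \<open>C = B' \<curlywedge> A\<close>, it is a sum over \<open>B'\<close>, which is then sorted by
  the codimension \<open>l\<close> of \<open>B'\<close> in \<open>B\<close>.\<close>

lemma phi_Sop_top:
  assumes Z: "vanish r f" and AB: "A \<preceq> B" "dm A + (n - dm B) \<le> r"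
  shows "phi (Sop f) A B = (\<Sum>l\<le>dm A. coefS (dm A) (dm B) l * Rl l (phi f) A B)"
proof -
  define X where "X = (\<Sum>C | C \<preceq> A. mu (dm C) * Psi f C A B)"
  have "phi (Sop f) A B = q powi (int k * (int k - int (dm A))) * X"
  proof (cases "dm A \<le> k")
    case True
    then have "int k * (int k - int (dm A)) = int (k * (k - dm A))" by (simp add: of_nat_diff)
    then show ?thesis unfolding phi_Sop Sop_Psi X_def by (simp only: power_int_of_nat)
  next
    case False
    \<comment> \<open>The integer exponent differs from the truncated one only for
      \<open>dm A > k\<close>; then \<open>A\<close> and \<open>M\<close> with trivial meet do not
      fit into \<open>P\<close>.\<close>
    have "{(M, P). flag M P \<and> A \<preceq> P \<and> P \<preceq> B \<and> M \<curlywedge> A = bt} = {}"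
    proof -
      have False if "flag M P" "A \<preceq> P" "M \<curlywedge> A = bt" for M P
        using dm_mod[of M A] that False dm_mono[of "M \<curlyvee> A" P] by (auto simp: flag_def dm_bt jn_least)
      then show ?thesis by blast
    qed
    then have "X = 0" unfolding X_def Sop_Psi[symmetric] by (simp only: sum.empty)
    then show ?thesis unfolding phi_Sop Sop_Psi X_def by simp
  qed
  also have "X = (\<Sum>C\<in>{C. C \<preceq> A}. mu (dm A - (dm A - dm C)) * (coefP (dm B) (dm A - dm C) *
      (\<Sum>B' | B' \<curlywedge> A = C \<and> B' \<curlyvee> A = B. phi f C B')))"
    unfolding X_def
  proof (intro sum.cong refl)
    fix C assume C: "C \<in> {C. C \<preceq> A}"
    then have "dm A - (dm A - dm C) = dm C" using dm_mono by auto
    then show "mu (dm C) * Psi f C A B = mu (dm A - (dm A - dm C)) * (coefP (dm B) (dm A - dm C) *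
      (\<Sum>B' | B' \<curlywedge> A = C \<and> B' \<curlyvee> A = B. phi f C B'))"
      using Psi_eq[OF Z _ AB] C by simp
  qed
  also have "\<dots> = (\<Sum>C\<in>{C. C \<preceq> A}. \<Sum>B'\<in>{B' \<in> {B'. B' \<curlyvee> A = B}. B' \<curlywedge> A = C}.
     mu (dm A - (dm B - dm B')) * coefP (dm B) (dm B - dm B') * phi f (B' \<curlywedge> A) B')"
    unfolding sum_distrib_left mult.assoc by (intro sum.cong refl) (auto simp: complement_dm(1))
  also have "\<dots> = (\<Sum>B'\<in>{B'. B' \<curlyvee> A = B}.
     mu (dm A - (dm B - dm B')) * coefP (dm B) (dm B - dm B') * phi f (B' \<curlywedge> A) B')"
    by (rule sum.group) auto
  also have "\<dots> = (\<Sum>l\<in>{..dm A}. \<Sum>B'\<in>{B' \<in> {B'. B' \<curlyvee> A = B}. dm B - dm B' = l}.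
     mu (dm A - (dm B - dm B')) * coefP (dm B) (dm B - dm B') * phi f (B' \<curlywedge> A) B')"
    using complement_dm(1) by (intro sum.group[symmetric]) auto
  also have "\<dots> = (\<Sum>l\<in>{..dm A}. mu (dm A - l) * coefP (dm B) l * Rl l (phi f) A B)"
    unfolding Rl_def sum_distrib_left
  proof (intro sum.cong refl)
    fix l B' assume "l \<in> {..dm A}"
    show "{B' \<in> {B'. B' \<curlyvee> A = B}. dm B - dm B' = l} = {B'. B' \<curlyvee> A = B \<and> dm B' + l = dm B}"
      using complement_dm(2)[OF refl, of _ A B] by force
    assume "B' \<in> {B'. B' \<curlyvee> A = B \<and> dm B' + l = dm B}"
    then have "dm B - dm B' = l" by auto
    then show "mu (dm A - (dm B - dm B')) * coefP (dm B) (dm B - dm B') * phi f (B' \<curlywedge> A) B' =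
      mu (dm A - l) * coefP (dm B) l * phi f (B' \<curlywedge> A) B'" by simp
  qed
  finally show ?thesis by (simp add: coefS_def sum_distrib_left mult.assoc)
qed

end

section \<open>Raising and lowering operators\<close>

context qlattice
begin

section \<open>Common neighbours in the covering relation\<close>

lemma cov_diamond_up:
  assumes "x \<noteq> y" "w \<lessdot> x" "w \<lessdot> y"
  shows "x \<curlywedge> y = w" "x \<lessdot> x \<curlyvee> y" "y \<lessdot> x \<curlyvee> y"
proof -
  have "x \<curlywedge> y \<noteq> x"
    using assms le_dm_eq[of x y] by (metis cov_dm mt_le2 order_refl)
  then have "dm (x \<curlywedge> y) < dm x" using dm_strict mt_le1 by blast
  then show m: "x \<curlywedge> y = w"
    using assms by (intro le_dm_eq[symmetric]) (auto simp: cov_def le_mt_iff)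
  show "x \<lessdot> x \<curlyvee> y" "y \<lessdot> x \<curlyvee> y"
    using dm_mod[of x y] m assms by (auto simp: cov_def)
qed

lemma cov_diamond_down:
  assumes "x \<noteq> y" "x \<lessdot> z" "y \<lessdot> z"
  shows "x \<curlyvee> y = z" "x \<curlywedge> y \<lessdot> x" "x \<curlywedge> y \<lessdot> y"
proof -
  have "x \<curlyvee> y \<noteq> x"
    using assms le_dm_eq[of y x] by (metis cov_dm jn_ge2 nat.inject order_refl)
  then have "dm x < dm (x \<curlyvee> y)" using dm_strict jn_ge1 by metis
  then show m: "x \<curlyvee> y = z"
    using assms by (intro le_dm_eq) (auto simp: cov_def jn_le_iff)
  show "x \<curlywedge> y \<lessdot> x" "x \<curlywedge> y \<lessdot> y"
    using dm_mod[of x y] m assms by (auto simp: cov_def)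
qed

text \<open>Adjacency in the Grassmann graphs, on all levels at once.\<close>

definition adj :: "'l \<Rightarrow> 'l \<Rightarrow> bool" where
  "adj x y \<longleftrightarrow> x \<noteq> y \<and> x \<curlywedge> y \<lessdot> x \<and> x \<curlywedge> y \<lessdot> y"

lemma adj_iff_join: "adj x y \<longleftrightarrow> x \<noteq> y \<and> x \<lessdot> x \<curlyvee> y \<and> y \<lessdot> x \<curlyvee> y"
  unfolding adj_def using cov_diamond_up(2,3) cov_diamond_down(2,3) by blast

lemma card_le_1_unique: "real (card {x. Q x}) = (if Q y then 1 else 0)" if "\<And>x. Q x \<Longrightarrow> x = y"
proof -
  have "{x. Q x} = {y}" if "Q y" using that \<open>\<And>x. Q x \<Longrightarrow> x = y\<close> by blast
  moreover have "{x. Q x} = {}" if "\<not> Q y" using that \<open>\<And>x. Q x \<Longrightarrow> x = y\<close> by blast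
  ultimately show ?thesis by (cases "Q y") simp_all
qed

lemma card_common_lower:
  "real (card {z. z \<lessdot> x \<and> z \<lessdot> y}) = (if x = y then qint (dm x) else if adj x y then 1 else 0)"
proof (cases "x = y")
  case True
  then show ?thesis using card_coatoms[of bt x] by (simp add: dm_bt)
next
  case False
  have "z = x \<curlywedge> y" if "z \<lessdot> x \<and> z \<lessdot> y" for z using cov_diamond_up(1)[of x y z] False that by metis
  from card_le_1_unique[of "\<lambda>z. z \<lessdot> x \<and> z \<lessdot> y", OF this] show ?thesis using False by (simp add: adj_def)
qed

lemma card_common_upper:
  "real (card {z. x \<lessdot> z \<and> y \<lessdot> z}) = (if x = y then qint (n - dm x) else if adj x y then 1 else 0)"
proof (cases "x = y")
  case True
  then show ?thesis using card_atoms[of x tp] by (simp add: dm_tp)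
next
  case False
  have "z = x \<curlyvee> y" if "x \<lessdot> z \<and> y \<lessdot> z" for z using cov_diamond_down(1)[of x y z] False that by metis
  from card_le_1_unique[of "\<lambda>z. x \<lessdot> z \<and> y \<lessdot> z", OF this] show ?thesis using False by (simp add: adj_iff_join)
qed

lemma card_common_upper_below:
  assumes "x \<preceq> b" "y \<preceq> b"
  shows "real (card {z. x \<lessdot> z \<and> y \<lessdot> z \<and> z \<preceq> b}) =
    (if x = y then qint (dm b - dm x) else if adj x y then 1 else 0)"
proof (cases "x = y")
  case True
  then show ?thesis using card_atoms[of x b] assms by simp
next
  case False
  have "z = x \<curlyvee> y" if "x \<lessdot> z \<and> y \<lessdot> z \<and> z \<preceq> b" for z using cov_diamond_down(1)[of x y z] False that by metis
  from card_le_1_unique[of "\<lambda>z. x \<lessdot> z \<and> y \<lessdot> z \<and> z \<preceq> b", OF this] show ?thesis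
    using False assms by (simp add: adj_iff_join jn_least)
qed

lemma card_between:
  assumes "x \<preceq> y" "dm y = dm x + 2"
  shows "real (card {z. x \<lessdot> z \<and> z \<lessdot> y}) = q + 1"
proof -
  have "{z. x \<lessdot> z \<and> z \<lessdot> y} = {z. x \<lessdot> z \<and> z \<preceq> y}" using assms by (auto simp: cov_def)
  then show ?thesis using card_atoms[of x y] assms by (simp add: qint_Suc numeral_2_eq_2)
qed

text \<open>Sums over intervals of a function in the \<open>r\<close>-th layer of the filtration, restricted to
  \<open>dim A + codim B = r\<close>, have this property with \<open>\<delta> = n - r\<close>; on it the commutator of the raising and
  lowering operators is a scalar in each degree.\<close>

definition annihilated :: "nat \<Rightarrow> ('l \<Rightarrow> 'l \<Rightarrow> real) \<Rightarrow> bool" where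
  "annihilated \<delta> g \<longleftrightarrow> (\<forall>A B. g A B \<noteq> 0 \<longrightarrow> A \<preceq> B \<and> dm B = dm A + \<delta>) \<and>
    (\<forall>A B. A \<preceq> B \<longrightarrow> dm B = Suc (dm A + \<delta>) \<longrightarrow> (\<Sum>X | A \<preceq> X \<and> X \<lessdot> B. g A X) = 0) \<and>
    (\<forall>A B. A \<preceq> B \<longrightarrow> dm B = Suc (dm A + \<delta>) \<longrightarrow> (\<Sum>X | A \<lessdot> X \<and> X \<preceq> B. g X B) = 0)"

lemma annihilated_supp: "annihilated \<delta> g \<Longrightarrow> \<not> (A \<preceq> B \<and> dm B = dm A + \<delta>) \<Longrightarrow> g A B = 0"
  unfolding annihilated_def by blast
lemma annihilated_upper: "annihilated \<delta> g \<Longrightarrow> A \<preceq> B \<Longrightarrow> dm B = Suc (dm A + \<delta>) \<Longrightarrow> (\<Sum>X | A \<preceq> X \<and> X \<lessdot> B. g A X) = 0"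
  unfolding annihilated_def by blast
lemma annihilated_lower: "annihilated \<delta> g \<Longrightarrow> A \<preceq> B \<Longrightarrow> dm B = Suc (dm A + \<delta>) \<Longrightarrow> (\<Sum>X | A \<lessdot> X \<and> X \<preceq> B. g X B) = 0"
  unfolding annihilated_def by blast

lemma dual_cov: "qlattice.cov (\<lambda>x y. y \<preceq> x) (\<lambda>x. n - dm x) x y \<longleftrightarrow> y \<lessdot> x"
proof -
  interpret d: qlattice q "\<lambda>x y. y \<preceq> x" jn mt tp bt "\<lambda>x. n - dm x" n by (rule dual)
  show ?thesis using dm_le_n[of x] dm_le_n[of y] by (auto simp: cov_def d.cov_def)
qed

lemma dual_adj: "qlattice.adj (\<lambda>x y. y \<preceq> x) jn (\<lambda>x. n - dm x) x y \<longleftrightarrow> adj x y"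
proof -
  interpret d: qlattice q "\<lambda>x y. y \<preceq> x" jn mt tp bt "\<lambda>x. n - dm x" n by (rule dual)
  show ?thesis by (simp add: d.adj_def dual_cov adj_iff_join)
qed

lemma dual_annihilated: "qlattice.annihilated (\<lambda>x y. y \<preceq> x) (\<lambda>x. n - dm x) \<delta> (\<lambda>B A. g A B) \<longleftrightarrow> annihilated \<delta> g"
proof -
  interpret d: qlattice q "\<lambda>x y. y \<preceq> x" jn mt tp bt "\<lambda>x. n - dm x" n by (rule dual)
  have 1: "n - dm A = n - dm B + \<delta> \<longleftrightarrow> dm B = dm A + \<delta>" if "A \<preceq> B" for A B
    using dm_le_n[of A] dm_le_n[of B] dm_mono[OF that] by linarith
  have 2: "n - dm A = Suc (n - dm B + \<delta>) \<longleftrightarrow> dm B = Suc (dm A + \<delta>)" if "A \<preceq> B" for A B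
    using dm_le_n[of A] dm_le_n[of B] dm_mono[OF that] by linarith
  show ?thesis
    unfolding d.annihilated_def annihilated_def dual_cov using 1 2 by (simp add: conj_commute) blast
qed

text \<open>Moves \<open>g\<close> one step up in both components, keeping \<open>A\<close> inside
  the old upper end \<open>Y\<close>. \<open>lower_op\<close> is the adjoint and also the image
  under duality.\<close>

definition raise_op :: "('l \<Rightarrow> 'l \<Rightarrow> real) \<Rightarrow> 'l \<Rightarrow> 'l \<Rightarrow> real" where
  "raise_op g A B = (\<Sum>X\<in>UNIV. \<Sum>Y\<in>UNIV. if X \<lessdot> A \<and> A \<preceq> Y \<and> Y \<lessdot> B then g X Y else 0)"

definition lower_op :: "('l \<Rightarrow> 'l \<Rightarrow> real) \<Rightarrow> 'l \<Rightarrow> 'l \<Rightarrow> real" where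
  "lower_op g A B = (\<Sum>X\<in>UNIV. \<Sum>Y\<in>UNIV. if A \<lessdot> X \<and> X \<preceq> B \<and> B \<lessdot> Y then g X Y else 0)"

lemma dual_raise_op: "qlattice.raise_op (\<lambda>x y. y \<preceq> x) (\<lambda>x. n - dm x) (\<lambda>B A. g A B) B A = lower_op g A B"
proof -
  interpret d: qlattice q "\<lambda>x y. y \<preceq> x" jn mt tp bt "\<lambda>x. n - dm x" n by (rule dual)
  show ?thesis unfolding d.raise_op_def lower_op_def dual_cov
    by (subst sum.swap) (intro sum.cong refl if_cong, auto)
qed

text \<open>A neighbour \<open>X\<close> of \<open>A\<close> meets \<open>A\<close> in a coatom
  \<open>D\<close>. For fixed \<open>D\<close>, the vanishing of the sum over all covers of
  \<open>D\<close> below \<open>B\<close> leaves \<open>- g A B\<close>, and \<open>A\<close> has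
  \<open>qint (dm A)\<close> coatoms.\<close>

lemma sum_adj:
  assumes g: "annihilated \<delta> g" and AB: "A \<preceq> B" "dm B = dm A + \<delta>"
  shows "(\<Sum>X | adj A X \<and> X \<preceq> B. g X B) = - qint (dm A) * g A B"
proof -
  have "(\<Sum>X | adj A X \<and> X \<preceq> B. g X B) =
     (\<Sum>D\<in>{D. D \<lessdot> A}. \<Sum>X\<in>{X \<in> {X. adj A X \<and> X \<preceq> B}. A \<curlywedge> X = D}. g X B)"
    by (rule sum.group[symmetric]) (auto simp: adj_def)
  also have "\<dots> = (\<Sum>D\<in>{D. D \<lessdot> A}. - g A B)"
  proof (rule sum.cong[OF refl])
    fix D assume "D \<in> {D. D \<lessdot> A}"
    then have D: "D \<lessdot> A" by simp
    then have DB: "D \<preceq> B" "dm B = Suc (dm D + \<delta>)" using AB le_trans[OF cov_le[OF D] AB(1)] by (auto simp: cov_def)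
    have e: "{X \<in> {X. adj A X \<and> X \<preceq> B}. A \<curlywedge> X = D} = {X. D \<lessdot> X \<and> X \<preceq> B} - {A}"
    proof (intro equalityI subsetI)
      fix X assume "X \<in> {X. D \<lessdot> X \<and> X \<preceq> B} - {A}"
      then show "X \<in> {X \<in> {X. adj A X \<and> X \<preceq> B}. A \<curlywedge> X = D}"
        using D cov_diamond_up(1)[of A X D] by (auto simp: adj_def)
    qed (auto simp: adj_def)
    show "(\<Sum>X\<in>{X \<in> {X. adj A X \<and> X \<preceq> B}. A \<curlywedge> X = D}. g X B) = - g A B"
      unfolding e using annihilated_lower[OF g DB] D AB by (simp add: sum_diff1)
  qed
  also have "\<dots> = - real (card {D. D \<lessdot> A}) * g A B" by simp
  also have "real (card {D. D \<lessdot> A}) = qint (dm A)" using card_coatoms[of bt A] by (simp add: dm_bt)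
  finally show ?thesis .
qed

lemma sum_adj_upper:
  assumes g: "annihilated \<delta> g" and AB: "A \<preceq> B" "dm B = dm A + \<delta>"
  shows "(\<Sum>Y | adj B Y \<and> A \<preceq> Y. g A Y) = - qint (n - dm B) * g A B"
proof -
  interpret d: qlattice q "\<lambda>x y. y \<preceq> x" jn mt tp bt "\<lambda>x. n - dm x" n by (rule dual)
  have g': "d.annihilated \<delta> (\<lambda>B A. g A B)" unfolding dual_annihilated by (rule g)
  have 1: "n - dm A = n - dm B + \<delta>" using AB dm_le_n[of B] by linarith
  have "(\<Sum>X | d.adj B X \<and> A \<preceq> X. g A X) = - qint (n - dm B) * g A B"
    by (rule d.sum_adj[OF g' AB(1) 1])
  then show ?thesis unfolding dual_adj .
qed

lemma raise_op_supp: "annihilated \<delta> g \<Longrightarrow> raise_op g A B \<noteq> 0 \<Longrightarrow> A \<preceq> B \<and> dm B = dm A + \<delta>"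
proof -
  assume g: "annihilated \<delta> g" and nz: "raise_op g A B \<noteq> 0"
  from nz obtain X where "(\<Sum>Y\<in>UNIV. if X \<lessdot> A \<and> A \<preceq> Y \<and> Y \<lessdot> B then g X Y else 0) \<noteq> 0"
    unfolding raise_op_def by (rule sum.not_neutral_contains_not_neutral)
  then obtain Y where "(if X \<lessdot> A \<and> A \<preceq> Y \<and> Y \<lessdot> B then g X Y else 0) \<noteq> 0"
    by (rule sum.not_neutral_contains_not_neutral)
  then have "X \<lessdot> A" "A \<preceq> Y" "Y \<lessdot> B" "dm Y = dm X + \<delta>"
    using annihilated_supp[OF g, of X Y] by (auto split: if_splits)
  then show ?thesis using le_trans[of A Y B] by (auto simp: cov_def)
qed

text \<open>Here \<open>Y\<close> has codimension 2 in \<open>B\<close>, so neither vanishing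
  condition applies directly. Sum the upper condition over coatoms \<open>Z\<close> of
  \<open>B\<close>. With all \<open>Z\<close> above \<open>C\<close>, every \<open>Y\<close> is
  counted \<open>q + 1\<close> times. With the \<open>Z\<close> above \<open>A\<close>, a
  \<open>Y\<close> above \<open>A\<close> is counted \<open>q + 1\<close> times and any other
  \<open>Y\<close> once, through \<open>Z = A \<curlyvee> Y\<close>. The second relation is
  \<open>q\<close> times the wanted sum plus a sum that the first one shows to be 0.\<close>

lemma annihilated_sum_two_below:
  assumes g: "annihilated \<delta> g" and CA: "C \<lessdot> A" and AB: "A \<preceq> B" "dm B = Suc (dm A + \<delta>)"
  shows "(\<Sum>Y\<in>UNIV. if A \<preceq> Y \<and> Y \<preceq> B then g C Y else 0) = 0"
proof -
  let ?Y = "\<Sum>Y\<in>UNIV. if A \<preceq> Y \<and> Y \<preceq> B then g C Y else 0"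
  let ?T = "\<Sum>Y\<in>UNIV. if C \<preceq> Y \<and> Y \<preceq> B then g C Y else 0"
  have CB: "C \<preceq> B" "dm B = dm C + \<delta> + 2" using CA AB le_trans[of C A B] by (auto simp: cov_def)
  have step: "(\<Sum>Z\<in>UNIV. \<Sum>Y\<in>UNIV. if Q Z \<and> Z \<lessdot> B \<and> C \<preceq> Y \<and> Y \<lessdot> Z then g C Y else 0) = 0"
    if Q: "\<And>Z. Q Z \<Longrightarrow> C \<preceq> Z" for Q
  proof (rule sum.neutral, rule ballI)
    fix Z
    show "(\<Sum>Y\<in>UNIV. if Q Z \<and> Z \<lessdot> B \<and> C \<preceq> Y \<and> Y \<lessdot> Z then g C Y else 0) = 0"
    proof (cases "Q Z \<and> Z \<lessdot> B")
      case True
      then have "dm Z = Suc (dm C + \<delta>)" using CB by (simp add: cov_def)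
      then show ?thesis using annihilated_upper[OF g, of C Z] Q True by (simp add: sum_Collect)
    qed auto
  qed
  have card: "real (card {Z. Q Z \<and> Z \<lessdot> B \<and> Y \<lessdot> Z}) * g C Y = (if C \<preceq> Y \<and> Y \<preceq> B then real (card {Z. Q Z \<and> Y \<lessdot> Z \<and> Z \<lessdot> B}) * g C Y else 0)" for Q Y
  proof (cases "C \<preceq> Y \<and> Y \<preceq> B")
    case True
    then show ?thesis by (simp add: conj_commute)
  next
    case False
    then have "g C Y = 0 \<or> {Z. Q Z \<and> Z \<lessdot> B \<and> Y \<lessdot> Z} = {}"
      using annihilated_supp[OF g, of C Y] le_trans[of Y _ B] by (auto simp: cov_def)
    then show ?thesis using False by auto
  qed
  have sw: "(\<Sum>Z\<in>UNIV. \<Sum>Y\<in>UNIV. if Q Z \<and> Z \<lessdot> B \<and> C \<preceq> Y \<and> Y \<lessdot> Z then g C Y else 0) =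
     (\<Sum>Y\<in>UNIV. if C \<preceq> Y \<and> Y \<preceq> B then real (card {Z. Q Z \<and> Y \<lessdot> Z \<and> Z \<lessdot> B}) * g C Y else 0)" for Q
  proof -
    have "(\<Sum>Z\<in>UNIV. \<Sum>Y\<in>UNIV. if Q Z \<and> Z \<lessdot> B \<and> C \<preceq> Y \<and> Y \<lessdot> Z then g C Y else 0) =
      (\<Sum>Y\<in>UNIV. \<Sum>Z\<in>UNIV. if Q Z \<and> Z \<lessdot> B \<and> Y \<lessdot> Z then g C Y else 0)"
      by (subst sum.swap) (use annihilated_supp[OF g, of C] in \<open>auto intro!: sum.cong\<close>)
    also have "\<dots> = (\<Sum>Y\<in>UNIV. real (card {Z. Q Z \<and> Z \<lessdot> B \<and> Y \<lessdot> Z}) * g C Y)"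
      unfolding sum_if_const ..
    finally show ?thesis unfolding card .
  qed
  have dims: "dm B = dm Y + 2" if "g C Y \<noteq> 0" for Y
  proof -
    have "dm Y = dm C + \<delta>" using annihilated_supp[OF g, of C Y] that by blast
    then show ?thesis using CB by simp
  qed
  have T: "?T = 0"
  proof -
    have "0 = (\<Sum>Y\<in>UNIV. if C \<preceq> Y \<and> Y \<preceq> B then real (card {Z. C \<preceq> Z \<and> Y \<lessdot> Z \<and> Z \<lessdot> B}) * g C Y else 0)"
      unfolding sw[symmetric] by (rule step[symmetric])
    also have "\<dots> = (\<Sum>Y\<in>UNIV. (q + 1) * (if C \<preceq> Y \<and> Y \<preceq> B then g C Y else 0))"
    proof (intro sum.cong refl)
      fix Y
      have "{Z. C \<preceq> Z \<and> Y \<lessdot> Z \<and> Z \<lessdot> B} = {Z. Y \<lessdot> Z \<and> Z \<lessdot> B}" if "C \<preceq> Y"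
        using that le_trans[of C Y] by (auto simp: cov_def)
      then show "(if C \<preceq> Y \<and> Y \<preceq> B then real (card {Z. C \<preceq> Z \<and> Y \<lessdot> Z \<and> Z \<lessdot> B}) * g C Y else 0) =
         (q + 1) * (if C \<preceq> Y \<and> Y \<preceq> B then g C Y else 0)"
        using card_between[of Y B] dims[of Y] by (cases "g C Y = 0") auto
    qed
    also have "\<dots> = (q + 1) * ?T" by (rule sum_distrib_left[symmetric])
    finally show ?thesis using q_gt_1 by simp
  qed
  have "0 = (\<Sum>Y\<in>UNIV. if C \<preceq> Y \<and> Y \<preceq> B then real (card {Z. A \<preceq> Z \<and> Y \<lessdot> Z \<and> Z \<lessdot> B}) * g C Y else 0)"
    unfolding sw[symmetric] by (rule step[symmetric]) (use CA le_trans[of C A] in \<open>auto simp: cov_def\<close>)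
  also have "\<dots> = (\<Sum>Y\<in>UNIV. q * (if A \<preceq> Y \<and> Y \<preceq> B then g C Y else 0) + (if C \<preceq> Y \<and> Y \<preceq> B then g C Y else 0))"
  proof (intro sum.cong refl)
    fix Y
    show "(if C \<preceq> Y \<and> Y \<preceq> B then real (card {Z. A \<preceq> Z \<and> Y \<lessdot> Z \<and> Z \<lessdot> B}) * g C Y else 0) =
       q * (if A \<preceq> Y \<and> Y \<preceq> B then g C Y else 0) + (if C \<preceq> Y \<and> Y \<preceq> B then g C Y else 0)"
    proof (cases "g C Y \<noteq> 0 \<and> Y \<preceq> B")
      case True
      then have CY: "C \<preceq> Y" "dm B = dm Y + 2" using annihilated_supp[OF g, of C Y] dims[of Y] by auto
      show ?thesis
      proof (cases "A \<preceq> Y")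
        case AY: True
        have "{Z. A \<preceq> Z \<and> Y \<lessdot> Z \<and> Z \<lessdot> B} = {Z. Y \<lessdot> Z \<and> Z \<lessdot> B}"
          using AY le_trans[of A Y] by (auto simp: cov_def)
        then show ?thesis using card_between[of Y B] True CY AY by (simp add: algebra_simps)
      next
        case AY: False
        have "A \<curlywedge> Y \<noteq> A" using AY mt_le2 by metis
        then have "dm (A \<curlywedge> Y) < dm A" using dm_strict mt_le1 by blast
        then have m: "A \<curlywedge> Y = C"
          using CA CY by (intro le_dm_eq[symmetric]) (auto simp: cov_def le_mt_iff)
        have j: "dm (A \<curlyvee> Y) = Suc (dm Y)" using dm_mod[of A Y] m CA by (simp add: cov_def)
        have "{Z. A \<preceq> Z \<and> Y \<lessdot> Z \<and> Z \<lessdot> B} = {A \<curlyvee> Y}"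
        proof (intro equalityI subsetI)
          fix Z assume "Z \<in> {Z. A \<preceq> Z \<and> Y \<lessdot> Z \<and> Z \<lessdot> B}"
          then show "Z \<in> {A \<curlyvee> Y}" using j
            by (auto simp: cov_def jn_least intro!: le_dm_eq[symmetric])
        next
          fix Z assume "Z \<in> {A \<curlyvee> Y}"
          then show "Z \<in> {Z. A \<preceq> Z \<and> Y \<lessdot> Z \<and> Z \<lessdot> B}"
            using j CY True AB by (simp add: cov_def jn_least)
        qed
        then show ?thesis using True CY AY by simp
      qed
    qed auto
  qed
  also have "\<dots> = q * ?Y + ?T" by (simp add: sum.distrib sum_distrib_left)
  finally show ?thesis using T by simp
qed

text \<open>The first condition reduces to \<open>annihilated_sum_two_below\<close>. For the second,
  count the common covers of \<open>A\<close> and \<open>X\<close> below \<open>Y\<close>: the term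
  \<open>X = A\<close> contributes \<open>qint \<delta>\<close>, the neighbours of \<open>A\<close>
  contribute \<open>- qint (dm A)\<close> by \<open>sum_adj\<close>, and what is left is an upper
  sum of \<open>g\<close>.\<close>

lemma annihilated_raise_op: assumes g: "annihilated \<delta> g" shows "annihilated \<delta> (raise_op g)"
  unfolding annihilated_def
proof (intro conjI allI impI)
  fix A B
  assume "raise_op g A B \<noteq> 0"
  then show "A \<preceq> B" "dm B = dm A + \<delta>" using raise_op_supp[OF g] by auto
next
  fix A B assume AB: "A \<preceq> B" "dm B = Suc (dm A + \<delta>)"
  have "(\<Sum>Z | A \<preceq> Z \<and> Z \<lessdot> B. raise_op g A Z) = (\<Sum>Z\<in>UNIV. \<Sum>X\<in>UNIV. \<Sum>Y\<in>UNIV.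
      if X \<lessdot> A \<and> A \<preceq> Y \<and> Y \<lessdot> Z \<and> Z \<lessdot> B then g X Y else 0)"
  proof (unfold sum_Collect raise_op_def, intro sum.cong refl)
    fix Z
    have "A \<preceq> Z \<and> Z \<lessdot> B \<and> X \<lessdot> A \<and> A \<preceq> Y \<and> Y \<lessdot> Z \<longleftrightarrow> X \<lessdot> A \<and> A \<preceq> Y \<and> Y \<lessdot> Z \<and> Z \<lessdot> B" for X Y
      using le_trans[of A Y Z] by (auto simp: cov_def)
    then show "(if A \<preceq> Z \<and> Z \<lessdot> B then \<Sum>X\<in>UNIV. \<Sum>Y\<in>UNIV. if X \<lessdot> A \<and> A \<preceq> Y \<and> Y \<lessdot> Z then g X Y else 0 else 0) =
      (\<Sum>X\<in>UNIV. \<Sum>Y\<in>UNIV. if X \<lessdot> A \<and> A \<preceq> Y \<and> Y \<lessdot> Z \<and> Z \<lessdot> B then g X Y else 0)"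
      by (cases "A \<preceq> Z \<and> Z \<lessdot> B") (simp, smt (verit, best) sum.neutral)
  qed
  also have "\<dots> = (\<Sum>X\<in>UNIV. \<Sum>Y\<in>UNIV. \<Sum>Z\<in>UNIV.
      if X \<lessdot> A \<and> A \<preceq> Y \<and> Y \<lessdot> Z \<and> Z \<lessdot> B then g X Y else 0)"
    by (rule sum_rotate3)
  also have "\<dots> = (\<Sum>X\<in>UNIV. \<Sum>Y\<in>UNIV. (if X \<lessdot> A then 1 else 0) * ((q + 1) * (if A \<preceq> Y \<and> Y \<preceq> B then g X Y else 0)))"
  proof (intro sum.cong refl)
    fix X Y
    show "(\<Sum>Z\<in>UNIV. if X \<lessdot> A \<and> A \<preceq> Y \<and> Y \<lessdot> Z \<and> Z \<lessdot> B then g X Y else 0) =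
      (if X \<lessdot> A then 1 else 0) * ((q + 1) * (if A \<preceq> Y \<and> Y \<preceq> B then g X Y else 0))"
    proof (cases "X \<lessdot> A \<and> A \<preceq> Y \<and> Y \<preceq> B \<and> g X Y \<noteq> 0")
      case True
      then have "dm Y = dm X + \<delta>" using annihilated_supp[OF g, of X Y] by blast
      then have "dm B = dm Y + 2" using AB True by (auto simp: cov_def)
      then show ?thesis using card_between[of Y B] True by (simp add: sum_if_const)
    next
      case False
      have "\<not> (Y \<lessdot> Z \<and> Z \<lessdot> B)" if "\<not> Y \<preceq> B" for Z using that le_trans[of Y Z B] by (auto simp: cov_def)
      then show ?thesis using False by (auto intro!: sum.neutral)
    qed
  qed
  also have "\<dots> = (\<Sum>X\<in>UNIV. (if X \<lessdot> A then 1 else 0) * ((q + 1) * (\<Sum>Y\<in>UNIV. if A \<preceq> Y \<and> Y \<preceq> B then g X Y else 0)))"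
    by (simp add: sum_distrib_left)
  also have "\<dots> = 0" using annihilated_sum_two_below[OF g _ AB] by (intro sum.neutral) auto
  finally show "(\<Sum>Z | A \<preceq> Z \<and> Z \<lessdot> B. raise_op g A Z) = 0" .
next
  fix A B assume AB: "A \<preceq> B" "dm B = Suc (dm A + \<delta>)"
  have "(\<Sum>Z | A \<lessdot> Z \<and> Z \<preceq> B. raise_op g Z B) = (\<Sum>Z\<in>UNIV. \<Sum>X\<in>UNIV. \<Sum>Y\<in>UNIV.
      if A \<lessdot> Z \<and> X \<lessdot> Z \<and> Z \<preceq> Y \<and> Y \<lessdot> B then g X Y else 0)"
  proof (unfold sum_Collect raise_op_def, intro sum.cong refl)
    fix Z
    have "A \<lessdot> Z \<and> Z \<preceq> B \<and> X \<lessdot> Z \<and> Z \<preceq> Y \<and> Y \<lessdot> B \<longleftrightarrow> A \<lessdot> Z \<and> X \<lessdot> Z \<and> Z \<preceq> Y \<and> Y \<lessdot> B" for X Y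
      using le_trans[of Z Y B] by (auto simp: cov_def)
    then show "(if A \<lessdot> Z \<and> Z \<preceq> B then \<Sum>X\<in>UNIV. \<Sum>Y\<in>UNIV. if X \<lessdot> Z \<and> Z \<preceq> Y \<and> Y \<lessdot> B then g X Y else 0 else 0) =
      (\<Sum>X\<in>UNIV. \<Sum>Y\<in>UNIV. if A \<lessdot> Z \<and> X \<lessdot> Z \<and> Z \<preceq> Y \<and> Y \<lessdot> B then g X Y else 0)"
      by (cases "A \<lessdot> Z \<and> Z \<preceq> B") (simp, smt (verit, best) sum.neutral)
  qed
  also have "\<dots> = (\<Sum>Y\<in>UNIV. \<Sum>X\<in>UNIV. \<Sum>Z\<in>UNIV.
      if A \<lessdot> Z \<and> X \<lessdot> Z \<and> Z \<preceq> Y \<and> Y \<lessdot> B then g X Y else 0)"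
    by (subst sum_rotate3, rule sum.swap)
  also have "\<dots> = (\<Sum>Y\<in>UNIV. \<Sum>X\<in>UNIV. if A \<preceq> Y \<and> Y \<lessdot> B then
      (if X = A then qint \<delta> * g A Y else 0) + (if adj A X \<and> X \<preceq> Y then g X Y else 0) else 0)"
  proof (intro sum.cong refl)
    fix X Y
    show "(\<Sum>Z\<in>UNIV. if A \<lessdot> Z \<and> X \<lessdot> Z \<and> Z \<preceq> Y \<and> Y \<lessdot> B then g X Y else 0) =
      (if A \<preceq> Y \<and> Y \<lessdot> B then (if X = A then qint \<delta> * g A Y else 0) + (if adj A X \<and> X \<preceq> Y then g X Y else 0) else 0)"
    proof (cases "A \<preceq> Y \<and> Y \<lessdot> B \<and> X \<preceq> Y")
      case True
      then have "dm Y = dm A + \<delta>" using AB by (simp add: cov_def)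
      then have "dm Y - dm A = \<delta>" by simp
      then show ?thesis using card_common_upper_below[of A Y X] True by (simp add: sum_if_const adj_def)
    next
      case False
      have "\<not> (A \<lessdot> Z \<and> X \<lessdot> Z \<and> Z \<preceq> Y)" if "\<not> A \<preceq> Y \<or> \<not> X \<preceq> Y" for Z
        using that le_trans[of A Z Y] le_trans[of X Z Y] by (auto simp: cov_def)
      then show ?thesis using False by (auto intro!: sum.neutral)
    qed
  qed
  also have "\<dots> = (\<Sum>Y\<in>UNIV. if A \<preceq> Y \<and> Y \<lessdot> B then qint \<delta> * g A Y + (\<Sum>X | adj A X \<and> X \<preceq> Y. g X Y) else 0)"
    unfolding sum_Collect by (intro sum.cong refl) (auto simp: sum.distrib)
  also have "\<dots> = (\<Sum>Y\<in>UNIV. (qint \<delta> - qint (dm A)) * (if A \<preceq> Y \<and> Y \<lessdot> B then g A Y else 0))"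
  proof (intro sum.cong refl)
    fix Y
    show "(if A \<preceq> Y \<and> Y \<lessdot> B then qint \<delta> * g A Y + (\<Sum>X | adj A X \<and> X \<preceq> Y. g X Y) else 0) =
      (qint \<delta> - qint (dm A)) * (if A \<preceq> Y \<and> Y \<lessdot> B then g A Y else 0)"
    proof (cases "A \<preceq> Y \<and> Y \<lessdot> B")
      case True
      then have "dm Y = dm A + \<delta>" using AB by (simp add: cov_def)
      then show ?thesis using sum_adj[OF g, of A Y] True by (simp add: algebra_simps)
    next
      case False
      then show ?thesis by (simp only: if_False mult_zero_right)
    qed
  qed
  also have "\<dots> = (qint \<delta> - qint (dm A)) * (\<Sum>Y | A \<preceq> Y \<and> Y \<lessdot> B. g A Y)"
    unfolding sum_Collect by (rule sum_distrib_left[symmetric])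
  also have "\<dots> = 0" using annihilated_upper[OF g AB] by simp
  finally show "(\<Sum>Z | A \<lessdot> Z \<and> Z \<preceq> B. raise_op g Z B) = 0" .
qed

lemma annihilated_lower_op: assumes g: "annihilated \<delta> g" shows "annihilated \<delta> (lower_op g)"
proof -
  interpret d: qlattice q "\<lambda>x y. y \<preceq> x" jn mt tp bt "\<lambda>x. n - dm x" n by (rule dual)
  have "d.annihilated \<delta> (\<lambda>B A. g A B)" unfolding dual_annihilated by (rule g)
  then have "d.annihilated \<delta> (d.raise_op (\<lambda>B A. g A B))" by (rule d.annihilated_raise_op)
  moreover have "d.raise_op (\<lambda>B A. g A B) = (\<lambda>B A. lower_op g A B)" by (intro ext dual_raise_op)
  ultimately show ?thesis using dual_annihilated[of \<delta> "lower_op g"] by simp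
qed

section \<open>The commutation relation\<close>

lemma sum_swap4:
  "(\<Sum>x\<in>A. \<Sum>y\<in>B. \<Sum>u\<in>C. \<Sum>v\<in>D. h x y u v) = (\<Sum>u\<in>C. \<Sum>v\<in>D. \<Sum>x\<in>A. \<Sum>y\<in>B. h x y u v)"
proof -
  have "(\<Sum>x\<in>A. \<Sum>y\<in>B. \<Sum>u\<in>C. \<Sum>v\<in>D. h x y u v) = (\<Sum>x\<in>A. \<Sum>u\<in>C. \<Sum>v\<in>D. \<Sum>y\<in>B. h x y u v)"
    by (intro sum.cong refl sum_rotate3)
  also have "\<dots> = (\<Sum>u\<in>C. \<Sum>v\<in>D. \<Sum>x\<in>A. \<Sum>y\<in>B. h x y u v)"
    by (rule sum_rotate3)
  finally show ?thesis .
qed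

lemma sum_if_prod:
  "(\<Sum>x\<in>UNIV. \<Sum>y\<in>UNIV. if P x \<and> Q y then c else 0) = real (card {x. P x}) * real (card {y. Q y}) * c"
  for P Q :: "'l \<Rightarrow> bool"
proof -
  have "(\<Sum>x\<in>UNIV. \<Sum>y\<in>UNIV. if P x \<and> Q y then c else 0) = (\<Sum>x\<in>UNIV. if P x then real (card {y. Q y}) * c else 0)"
    unfolding sum_if_const[symmetric] by (intro sum.cong refl) auto
  then show ?thesis unfolding sum_if_const by simp
qed

lemma card_common_lower_above:
  assumes "a \<preceq> x" "a \<preceq> y"
  shows "real (card {z. a \<preceq> z \<and> z \<lessdot> x \<and> z \<lessdot> y}) =
    (if x = y then qint (dm x - dm a) else if adj x y then 1 else 0)"
proof (cases "x = y")
  case True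
  then show ?thesis using card_coatoms[of a x] assms by simp
next
  case False
  have "z = x \<curlywedge> y" if "a \<preceq> z \<and> z \<lessdot> x \<and> z \<lessdot> y" for z using cov_diamond_up(1)[of x y z] False that by metis
  from card_le_1_unique[of "\<lambda>z. a \<preceq> z \<and> z \<lessdot> x \<and> z \<lessdot> y", OF this] show ?thesis
    using False assms by (simp add: adj_def le_mt_iff)
qed

lemma raise_op_lower_op: "raise_op (lower_op g) A B = (\<Sum>U\<in>UNIV. \<Sum>V\<in>UNIV.
   real (card {X. X \<lessdot> A \<and> X \<lessdot> U}) * real (card {Y. A \<preceq> Y \<and> U \<preceq> Y \<and> Y \<lessdot> B \<and> Y \<lessdot> V}) * g U V)"
proof -
  have "raise_op (lower_op g) A B = (\<Sum>X\<in>UNIV. \<Sum>Y\<in>UNIV. \<Sum>U\<in>UNIV. \<Sum>V\<in>UNIV.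
      if (X \<lessdot> A \<and> X \<lessdot> U) \<and> (A \<preceq> Y \<and> U \<preceq> Y \<and> Y \<lessdot> B \<and> Y \<lessdot> V) then g U V else 0)"
    unfolding raise_op_def lower_op_def
  proof (intro sum.cong refl)
    fix X Y
    show "(if X \<lessdot> A \<and> A \<preceq> Y \<and> Y \<lessdot> B then \<Sum>U\<in>UNIV. \<Sum>V\<in>UNIV. if X \<lessdot> U \<and> U \<preceq> Y \<and> Y \<lessdot> V then g U V else 0 else 0) =
      (\<Sum>U\<in>UNIV. \<Sum>V\<in>UNIV. if (X \<lessdot> A \<and> X \<lessdot> U) \<and> (A \<preceq> Y \<and> U \<preceq> Y \<and> Y \<lessdot> B \<and> Y \<lessdot> V) then g U V else 0)"
      by (cases "X \<lessdot> A \<and> A \<preceq> Y \<and> Y \<lessdot> B") (simp_all, (smt (verit, best) sum.neutral)?)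
  qed
  then show ?thesis unfolding sum_swap4[of _ UNIV UNIV UNIV UNIV] sum_if_prod .
qed

lemma lower_op_raise_op: "lower_op (raise_op g) A B = (\<Sum>U\<in>UNIV. \<Sum>V\<in>UNIV.
   real (card {X. A \<lessdot> X \<and> U \<lessdot> X \<and> X \<preceq> B \<curlywedge> V}) * real (card {Y. B \<lessdot> Y \<and> V \<lessdot> Y}) * g U V)"
proof -
  have "lower_op (raise_op g) A B = (\<Sum>X\<in>UNIV. \<Sum>Y\<in>UNIV. \<Sum>U\<in>UNIV. \<Sum>V\<in>UNIV.
      if (A \<lessdot> X \<and> U \<lessdot> X \<and> X \<preceq> B \<curlywedge> V) \<and> (B \<lessdot> Y \<and> V \<lessdot> Y) then g U V else 0)"
    unfolding raise_op_def lower_op_def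
  proof (intro sum.cong refl)
    fix X Y
    show "(if A \<lessdot> X \<and> X \<preceq> B \<and> B \<lessdot> Y then \<Sum>U\<in>UNIV. \<Sum>V\<in>UNIV. if U \<lessdot> X \<and> X \<preceq> V \<and> V \<lessdot> Y then g U V else 0 else 0) =
      (\<Sum>U\<in>UNIV. \<Sum>V\<in>UNIV. if (A \<lessdot> X \<and> U \<lessdot> X \<and> X \<preceq> B \<curlywedge> V) \<and> (B \<lessdot> Y \<and> V \<lessdot> Y) then g U V else 0)"
      unfolding le_mt_iff
      by (cases "A \<lessdot> X \<and> X \<preceq> B \<and> B \<lessdot> Y") (simp_all, (smt (verit, best) sum.neutral)?)
  qed
  then show ?thesis unfolding sum_swap4[of _ UNIV UNIV UNIV UNIV] sum_if_prod .
qed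

text \<open>Both products count paths from \<open>(U, V)\<close> to \<open>(A, B)\<close>. The
  counts agree unless \<open>U = A\<close> or \<open>V = B\<close>, and in those terms the sums over
  neighbours are known from \<open>sum_adj\<close> and \<open>sum_adj_upper\<close>. With
  \<open>a = qint (dm A)\<close> and \<open>b = qint (n - dm B)\<close> everything collapses to
  \<open>(a - b) * (qint (Suc e) - qint e)\<close>.\<close>

lemma commutator:
  assumes g: "annihilated \<delta> g" and \<delta>: "\<delta> = Suc e"
  shows "raise_op (lower_op g) A B - lower_op (raise_op g) A B = q ^ e * (qint (dm A) - qint (n - dm B)) * g A B"
proof (cases "A \<preceq> B \<and> dm B = dm A + \<delta>")
  case False
  then have "g A B = 0" "raise_op (lower_op g) A B = 0" "lower_op (raise_op g) A B = 0"
    using annihilated_supp[OF g] annihilated_supp[OF annihilated_raise_op[OF annihilated_lower_op[OF g]]] annihilated_supp[OF annihilated_lower_op[OF annihilated_raise_op[OF g]]] by blast+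
  then show ?thesis by simp
next
  case True
  then have AB: "A \<preceq> B" "dm B = dm A + \<delta>" by auto
  let ?a = "qint (dm A)" and ?b = "qint (n - dm B)"
  have key: "(real (card {X. X \<lessdot> A \<and> X \<lessdot> U}) * real (card {Y. A \<preceq> Y \<and> U \<preceq> Y \<and> Y \<lessdot> B \<and> Y \<lessdot> V})
      - real (card {X. A \<lessdot> X \<and> U \<lessdot> X \<and> X \<preceq> B \<curlywedge> V}) * real (card {Y. B \<lessdot> Y \<and> V \<lessdot> Y})) * g U V =
     (if U = A \<and> V = B then (?a - ?b) * qint \<delta> * g A B else 0) +
     (if U = A then (?a - qint e) * (if adj B V \<and> A \<preceq> V then g A V else 0) else 0) +
     (if V = B then (qint e - ?b) * (if adj A U \<and> U \<preceq> B then g U B else 0) else 0)"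
    (is "(?n1 * ?n2 - ?n3 * ?n4) * _ = ?R") for U V
  proof (cases "g U V = 0")
    case True
    then show ?thesis by auto
  next
    case False
    then have UV: "U \<preceq> V" "dm V = dm U + \<delta>" using annihilated_supp[OF g] by blast+
    have n2: "?n2 = (if A \<curlyvee> U \<preceq> B \<and> A \<curlyvee> U \<preceq> V then if B = V then qint (dm B - dm (A \<curlyvee> U)) else if adj B V then 1 else 0 else 0)"
    proof (cases "A \<curlyvee> U \<preceq> B \<and> A \<curlyvee> U \<preceq> V")
      case True
      then show ?thesis using card_common_lower_above[of "A \<curlyvee> U" B V] by (simp add: jn_le_iff)
    next
      case False
      then have "\<not> (A \<preceq> Y \<and> U \<preceq> Y \<and> Y \<lessdot> B \<and> Y \<lessdot> V)" for Y
        using le_trans[of A Y] le_trans[of U Y] by (auto simp: jn_le_iff cov_def)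
      then have e: "{Y. A \<preceq> Y \<and> U \<preceq> Y \<and> Y \<lessdot> B \<and> Y \<lessdot> V} = {}" by blast
      show ?thesis unfolding e if_not_P[OF False] by simp
    qed
    have n3: "?n3 = (if A \<preceq> B \<curlywedge> V \<and> U \<preceq> B \<curlywedge> V then if A = U then qint (dm (B \<curlywedge> V) - dm A) else if adj A U then 1 else 0 else 0)"
    proof (cases "A \<preceq> B \<curlywedge> V \<and> U \<preceq> B \<curlywedge> V")
      case True
      then show ?thesis using card_common_upper_below[of A "B \<curlywedge> V" U] by simp
    next
      case False
      then have "\<not> (A \<lessdot> X \<and> U \<lessdot> X \<and> X \<preceq> B \<curlywedge> V)" for X
        using le_trans[of A X "B \<curlywedge> V"] le_trans[of U X "B \<curlywedge> V"] by (auto simp: cov_def)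
      then have e: "{X. A \<lessdot> X \<and> U \<lessdot> X \<and> X \<preceq> B \<curlywedge> V} = {}" by blast
      show ?thesis unfolding e if_not_P[OF False] by simp
    qed
    note n1 = card_common_lower[of A U] and n4 = card_common_upper[of B V]
    consider "U = A" "V = B" | "U = A" "V \<noteq> B" | "U \<noteq> A" "V = B" | "U \<noteq> A" "V \<noteq> B" by blast
    then show ?thesis
    proof cases
      case 1
      then have "\<not> adj B V" "\<not> adj A U" by (auto simp: adj_def)
      then show ?thesis unfolding n1 n2 n3 n4 using 1 AB by (simp add: jn_eq1 mt_eq1 algebra_simps)
    next
      case 2
      have "dm (B \<curlywedge> V) - dm A = e" if "adj B V" using that AB \<delta> by (auto simp: adj_def cov_def)
      then show ?thesis unfolding n1 n2 n3 n4 using 2 AB UV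
        by (auto simp: jn_eq1 le_mt_iff algebra_simps)
    next
      case 3
      have "dm B - dm (A \<curlyvee> U) = e" if "adj A U" using that AB \<delta> by (auto simp: adj_iff_join cov_def)
      then show ?thesis unfolding n1 n2 n3 n4 using 3 AB UV
        by (auto simp: jn_le_iff mt_eq1 algebra_simps)
    next
      case 4
      then show ?thesis unfolding n1 n2 n3 n4 using AB UV by (auto simp: jn_le_iff le_mt_iff)
    qed
  qed
  have "raise_op (lower_op g) A B - lower_op (raise_op g) A B = (\<Sum>U\<in>UNIV. \<Sum>V\<in>UNIV.
     (if U = A \<and> V = B then (?a - ?b) * qint \<delta> * g A B else 0) +
     (if U = A then (?a - qint e) * (if adj B V \<and> A \<preceq> V then g A V else 0) else 0) +
     (if V = B then (qint e - ?b) * (if adj A U \<and> U \<preceq> B then g U B else 0) else 0))"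
    unfolding raise_op_lower_op lower_op_raise_op sum_subtractf[symmetric] left_diff_distrib[symmetric] key ..
  also have "\<dots> = (\<Sum>U\<in>UNIV. \<Sum>V\<in>UNIV. if U = A \<and> V = B then (?a - ?b) * qint \<delta> * g A B else 0) +
     (\<Sum>U\<in>UNIV. \<Sum>V\<in>UNIV. if U = A then (?a - qint e) * (if adj B V \<and> A \<preceq> V then g A V else 0) else 0) +
     (\<Sum>U\<in>UNIV. \<Sum>V\<in>UNIV. if V = B then (qint e - ?b) * (if adj A U \<and> U \<preceq> B then g U B else 0) else 0)"
    by (simp only: sum.distrib)
  also have "(\<Sum>U\<in>UNIV. \<Sum>V\<in>UNIV. if U = A \<and> V = B then (?a - ?b) * qint \<delta> * g A B else 0) = (?a - ?b) * qint \<delta> * g A B"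
    by (subst sum_if_prod) simp
  also have "(\<Sum>U\<in>UNIV. \<Sum>V\<in>UNIV. if U = A then (?a - qint e) * (if adj B V \<and> A \<preceq> V then g A V else 0) else 0) =
      (?a - qint e) * (\<Sum>V | adj B V \<and> A \<preceq> V. g A V)"
    by (subst sum.swap) (simp add: sum_Collect sum_distrib_left)
  also have "(\<Sum>U\<in>UNIV. \<Sum>V\<in>UNIV. if V = B then (qint e - ?b) * (if adj A U \<and> U \<preceq> B then g U B else 0) else 0) =
      (qint e - ?b) * (\<Sum>U | adj A U \<and> U \<preceq> B. g U B)"
    by (simp add: sum_Collect sum_distrib_left)
  finally show ?thesis
    unfolding sum_adj[OF g AB] sum_adj_upper[OF g AB] \<delta> qint_Suc by (simp add: algebra_simps)
qed

definition ip :: "('l \<Rightarrow> 'l \<Rightarrow> real) \<Rightarrow> ('l \<Rightarrow> 'l \<Rightarrow> real) \<Rightarrow> real" where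
  "ip g h = (\<Sum>A\<in>UNIV. \<Sum>B\<in>UNIV. g A B * h A B)"

lemma ip_raise_op: "ip g (raise_op h) = ip (lower_op g) h"
proof -
  have "ip g (raise_op h) = (\<Sum>A\<in>UNIV. \<Sum>B\<in>UNIV. \<Sum>X\<in>UNIV. \<Sum>Y\<in>UNIV. if X \<lessdot> A \<and> A \<preceq> Y \<and> Y \<lessdot> B then g A B * h X Y else 0)"
    unfolding ip_def raise_op_def sum_distrib_left by (intro sum.cong refl) simp
  also have "\<dots> = (\<Sum>X\<in>UNIV. \<Sum>Y\<in>UNIV. \<Sum>A\<in>UNIV. \<Sum>B\<in>UNIV. if X \<lessdot> A \<and> A \<preceq> Y \<and> Y \<lessdot> B then g A B * h X Y else 0)"
    by (rule sum_swap4)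
  also have "\<dots> = ip (lower_op g) h"
    unfolding ip_def lower_op_def sum_distrib_right by (intro sum.cong refl) simp
  finally show ?thesis .
qed

text \<open>For fixed \<open>X = Y \<curlywedge> A\<close> the admissible \<open>Y\<close> are the
  coatoms of \<open>B\<close> above \<open>X\<close> that do not contain \<open>A\<close>. The sum
  over all coatoms above \<open>X\<close> vanishes, so what remains is minus the sum over those
  containing \<open>A\<close>.\<close>

lemma Rl_1_annihilated:
  assumes g: "annihilated \<delta> g"
  shows "Rl 1 g A B = - raise_op g A B"
proof (cases "A \<preceq> B \<and> dm B = dm A + \<delta>")
  case False
  have "g (Y \<curlywedge> A) Y = 0" if "Y \<curlyvee> A = B" for Y
  proof (rule ccontr)
    assume "g (Y \<curlywedge> A) Y \<noteq> 0"
    then have "dm Y = dm (Y \<curlywedge> A) + \<delta>" using annihilated_supp[OF g] by blast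
    then have "dm B = dm A + \<delta>" using dm_mod[of Y A] that by simp
    moreover have "A \<preceq> B" using that jn_ge2 by metis
    ultimately show False using False by simp
  qed
  then have "Rl 1 g A B = 0" unfolding Rl_def by simp
  moreover have "raise_op g A B = 0" using raise_op_supp[OF g] False by blast
  ultimately show ?thesis by simp
next
  case True
  then have AB: "A \<preceq> B" "dm B = dm A + \<delta>" by auto
  have "Rl 1 g A B = (\<Sum>X\<in>{X. X \<lessdot> A}. \<Sum>Y\<in>{Y \<in> {Y. Y \<curlyvee> A = B \<and> dm Y + 1 = dm B}. Y \<curlywedge> A = X}. g (Y \<curlywedge> A) Y)"
    unfolding Rl_def
  proof (rule sum.group[symmetric])
    show "(\<lambda>Y. Y \<curlywedge> A) ` {Y. Y \<curlyvee> A = B \<and> dm Y + 1 = dm B} \<subseteq> {X. X \<lessdot> A}"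
    proof safe
      fix Y assume "dm Y + 1 = dm (Y \<curlyvee> A)"
      then show "Y \<curlywedge> A \<lessdot> A" using dm_mod[of Y A] by (simp add: cov_def)
    qed
  qed auto
  also have "\<dots> = (\<Sum>X\<in>{X. X \<lessdot> A}. - (\<Sum>Y | A \<preceq> Y \<and> Y \<lessdot> B. g X Y))"
  proof (rule sum.cong[OF refl])
    fix X assume "X \<in> {X. X \<lessdot> A}"
    then have X: "X \<lessdot> A" by simp
    then have XB: "X \<preceq> B" "dm B = Suc (dm X + \<delta>)" using AB le_trans[of X A B] by (auto simp: cov_def)
    have e: "{Y \<in> {Y. Y \<curlyvee> A = B \<and> dm Y + 1 = dm B}. Y \<curlywedge> A = X} = {Y. X \<preceq> Y \<and> Y \<lessdot> B} - {Y. A \<preceq> Y \<and> Y \<lessdot> B}"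
    proof (intro equalityI subsetI)
      fix Y assume "Y \<in> {Y \<in> {Y. Y \<curlyvee> A = B \<and> dm Y + 1 = dm B}. Y \<curlywedge> A = X}"
      then have Y: "Y \<curlyvee> A = B" "dm Y + 1 = dm B" "Y \<curlywedge> A = X" by auto
      have "X \<preceq> Y" "Y \<preceq> B" using Y mt_le1 jn_ge1 by metis+
      moreover have "\<not> A \<preceq> Y" using Y X mt_eq2[of A Y] by (auto simp: cov_def)
      ultimately show "Y \<in> {Y. X \<preceq> Y \<and> Y \<lessdot> B} - {Y. A \<preceq> Y \<and> Y \<lessdot> B}" using Y by (simp add: cov_def)
    next
      fix Y assume "Y \<in> {Y. X \<preceq> Y \<and> Y \<lessdot> B} - {Y. A \<preceq> Y \<and> Y \<lessdot> B}"
      then have Y: "X \<preceq> Y" "Y \<lessdot> B" "\<not> A \<preceq> Y" by auto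
      have "Y \<curlywedge> A \<noteq> A" using Y mt_le1 by metis
      then have "dm (Y \<curlywedge> A) < dm A" using dm_strict[OF mt_le2] by blast
      then have m: "Y \<curlywedge> A = X" using X Y by (intro le_dm_eq[symmetric]) (auto simp: cov_def le_mt_iff)
      then have "dm (Y \<curlyvee> A) = dm B" using dm_mod[of Y A] X Y XB by (auto simp: cov_def)
      then have "Y \<curlyvee> A = B" using Y AB by (intro le_dm_eq) (auto simp: jn_le_iff cov_def)
      then show "Y \<in> {Y \<in> {Y. Y \<curlyvee> A = B \<and> dm Y + 1 = dm B}. Y \<curlywedge> A = X}"
        using m Y by (simp add: cov_def)
    qed
    have sub: "{Y. A \<preceq> Y \<and> Y \<lessdot> B} \<subseteq> {Y. X \<preceq> Y \<and> Y \<lessdot> B}" using X le_trans[of X A] by (auto simp: cov_def)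
    have "(\<Sum>Y\<in>{Y \<in> {Y. Y \<curlyvee> A = B \<and> dm Y + 1 = dm B}. Y \<curlywedge> A = X}. g (Y \<curlywedge> A) Y) =
      (\<Sum>Y\<in>{Y \<in> {Y. Y \<curlyvee> A = B \<and> dm Y + 1 = dm B}. Y \<curlywedge> A = X}. g X Y)" by (rule sum.cong) auto
    also have "\<dots> = - (\<Sum>Y | A \<preceq> Y \<and> Y \<lessdot> B. g X Y)"
      unfolding e using annihilated_upper[OF g XB] sub by (simp add: sum_diff)
    finally show "(\<Sum>Y\<in>{Y \<in> {Y. Y \<curlyvee> A = B \<and> dm Y + 1 = dm B}. Y \<curlywedge> A = X}. g (Y \<curlywedge> A) Y) =
      - (\<Sum>Y | A \<preceq> Y \<and> Y \<lessdot> B. g X Y)" .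
  qed
  also have "\<dots> = - raise_op g A B"
    unfolding raise_op_def sum_negf sum_Collect by (intro arg_cong[of _ _ uminus] sum.cong refl) auto
  finally show ?thesis .
qed

text \<open>Each final \<open>X\<close> is reached through every coatom \<open>Y\<close> of
  \<open>B\<close> above it, and there are \<open>qint (Suc l)\<close> of these. The modular law
  shows that every such \<open>Y\<close> is an admissible intermediate step.\<close>

lemma Rl_Suc: "Rl 1 (Rl l g) A B = qint (Suc l) * Rl (Suc l) g A B"
proof -
  have cond: "Y \<curlyvee> A = B \<and> dm Y + 1 = dm B \<and> X \<curlyvee> (Y \<curlywedge> A) = Y \<and> dm X + l = dm Y \<longleftrightarrow>
     X \<curlyvee> A = B \<and> dm X + Suc l = dm B \<and> X \<preceq> Y \<and> Y \<lessdot> B" for X Y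
  proof
    assume a: "Y \<curlyvee> A = B \<and> dm Y + 1 = dm B \<and> X \<curlyvee> (Y \<curlywedge> A) = Y \<and> dm X + l = dm Y"
    have XY: "X \<preceq> Y" using a jn_ge1 by metis
    moreover have YB: "Y \<preceq> B" using a jn_ge1 by metis
    moreover have "A \<preceq> B" using a jn_ge2 by metis
    ultimately have 1: "X \<curlyvee> A \<preceq> B" using le_trans[of X Y B] by (simp add: jn_le_iff)
    have "Y \<curlywedge> A \<preceq> X \<curlyvee> A" using le_trans[OF mt_le2 jn_ge2] .
    then have "Y \<preceq> X \<curlyvee> A" using a jn_least[of X "X \<curlyvee> A" "Y \<curlywedge> A"] by simp
    then have "B \<preceq> X \<curlyvee> A" using a jn_least[of Y "X \<curlyvee> A" A] by simp
    then show "X \<curlyvee> A = B \<and> dm X + Suc l = dm B \<and> X \<preceq> Y \<and> Y \<lessdot> B"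
      using a 1 XY YB le_antisym by (auto simp: cov_def)
  next
    assume a: "X \<curlyvee> A = B \<and> dm X + Suc l = dm B \<and> X \<preceq> Y \<and> Y \<lessdot> B"
    have AB: "A \<preceq> B" using a jn_ge2 by metis
    have "B \<preceq> Y \<curlyvee> A" using a le_trans[of X Y "Y \<curlyvee> A"] jn_least[of X "Y \<curlyvee> A" A] by simp
    then have 1: "Y \<curlyvee> A = B" using a AB by (intro le_antisym) (auto simp: jn_le_iff cov_def)
    have "Y \<curlywedge> (A \<curlyvee> X) = (Y \<curlywedge> A) \<curlyvee> X" using a by (intro modular) simp
    moreover have "Y \<curlywedge> (A \<curlyvee> X) = Y" using a by (simp add: jn_commute[of A X] mt_eq1 cov_def)
    ultimately show "Y \<curlyvee> A = B \<and> dm Y + 1 = dm B \<and> X \<curlyvee> (Y \<curlywedge> A) = Y \<and> dm X + l = dm Y"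
      using 1 a by (auto simp: cov_def jn_commute)
  qed
  have "Rl 1 (Rl l g) A B = (\<Sum>Y\<in>UNIV. \<Sum>X\<in>UNIV.
      if Y \<curlyvee> A = B \<and> dm Y + 1 = dm B \<and> X \<curlyvee> (Y \<curlywedge> A) = Y \<and> dm X + l = dm Y then g (X \<curlywedge> (Y \<curlywedge> A)) X else 0)"
    unfolding Rl_def sum_Collect by (intro sum.cong refl) auto
  also have "\<dots> = (\<Sum>Y\<in>UNIV. \<Sum>X\<in>UNIV. if X \<curlyvee> A = B \<and> dm X + Suc l = dm B \<and> X \<preceq> Y \<and> Y \<lessdot> B then g (X \<curlywedge> A) X else 0)"
    unfolding cond by (intro sum.cong refl if_cong) (auto simp: mt_assoc[symmetric] mt_eq1)
  also have "\<dots> = (\<Sum>X\<in>UNIV. \<Sum>Y\<in>UNIV. if X \<curlyvee> A = B \<and> dm X + Suc l = dm B \<and> X \<preceq> Y \<and> Y \<lessdot> B then g (X \<curlywedge> A) X else 0)"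
    by (rule sum.swap)
  also have "\<dots> = (\<Sum>X\<in>UNIV. qint (Suc l) * (if X \<curlyvee> A = B \<and> dm X + Suc l = dm B then g (X \<curlywedge> A) X else 0))"
  proof (rule sum.cong[OF refl])
    fix X
    show "(\<Sum>Y\<in>UNIV. if X \<curlyvee> A = B \<and> dm X + Suc l = dm B \<and> X \<preceq> Y \<and> Y \<lessdot> B then g (X \<curlywedge> A) X else 0) =
      qint (Suc l) * (if X \<curlyvee> A = B \<and> dm X + Suc l = dm B then g (X \<curlywedge> A) X else 0)"
    proof (cases "X \<curlyvee> A = B \<and> dm X + Suc l = dm B")
      case True
      then have "X \<preceq> B" "dm B - dm X = Suc l" using jn_ge1[of X A] by (metis, linarith)
      then have "real (card {Y. X \<preceq> Y \<and> Y \<lessdot> B}) = qint (Suc l)" using card_coatoms[of X B] by simp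
      then show ?thesis using True sum_if_const[of "\<lambda>Y. X \<preceq> Y \<and> Y \<lessdot> B" "g (X \<curlywedge> A) X"] by simp
    next
      case False
      then have "\<not> (X \<curlyvee> A = B \<and> dm X + Suc l = dm B \<and> X \<preceq> Y \<and> Y \<lessdot> B)" for Y by blast
      then show ?thesis by (simp only: False if_False sum.neutral_const mult_zero_right)
    qed
  qed
  also have "\<dots> = qint (Suc l) * Rl (Suc l) g A B"
    unfolding Rl_def sum_Collect by (rule sum_distrib_left[symmetric])
  finally show ?thesis .
qed

lemma annihilated_raise_op_pow: "annihilated \<delta> g \<Longrightarrow> annihilated \<delta> ((raise_op ^^ l) g)"
  by (induction l) (auto intro: annihilated_raise_op)

lemma annihilated_lower_op_pow: "annihilated \<delta> g \<Longrightarrow> annihilated \<delta> ((lower_op ^^ l) g)"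
  by (induction l) (auto intro: annihilated_lower_op)

lemma Rl_scale: "Rl l (\<lambda>A B. c * g A B) A B = c * Rl l g A B"
  by (simp add: Rl_def sum_distrib_left)

text \<open>Each step of the induction divides by the q-integer of \<open>Rl_Suc\<close> and brings
  in the sign of \<open>Rl_1_annihilated\<close>.\<close>

lemma Rl_annihilated: "annihilated \<delta> g \<Longrightarrow> Rl l g A B = (-1) ^ l / qfact l * (raise_op ^^ l) g A B"
proof (induction l arbitrary: A B)
  case 0
  show ?case
  proof (cases "A \<preceq> B")
    case True
    have "{Y. Y \<curlyvee> A = B \<and> dm Y + 0 = dm B} = {B}"
    proof (intro equalityI subsetI)
      fix Y assume "Y \<in> {Y. Y \<curlyvee> A = B \<and> dm Y + 0 = dm B}"
      then show "Y \<in> {B}" using jn_ge1[of Y A] by (auto intro: le_dm_eq)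
    qed (use True in \<open>auto simp: jn_eq1\<close>)
    then show ?thesis using True by (simp add: Rl_def mt_eq2)
  next
    case False
    have "{Y. Y \<curlyvee> A = B \<and> dm Y + 0 = dm B} = {}" using False jn_ge2 by blast
    then have "Rl 0 g A B = 0" by (simp only: Rl_def sum.empty)
    moreover have "g A B = 0" using annihilated_supp[OF 0] False by blast
    ultimately show ?thesis by simp
  qed
next
  case (Suc l)
  have "qint (Suc l) * Rl (Suc l) g A B = Rl 1 (Rl l g) A B" by (rule Rl_Suc[symmetric])
  also have "Rl l g = (\<lambda>A B. (-1) ^ l / qfact l * (raise_op ^^ l) g A B)"
    using Suc by (intro ext) auto
  also have "Rl 1 \<dots> A B = (-1) ^ l / qfact l * - (raise_op ^^ Suc l) g A B"
    unfolding Rl_scale Rl_1_annihilated[OF annihilated_raise_op_pow[OF Suc.prems]] by simp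
  finally show ?case using qint_pos[of "Suc l"] qfact_pos[of l] by (simp add: qfact_Suc field_simps)
qed

end

context qflags
begin

section \<open>The second operator, and both operators in the leading degree\<close>

definition Top :: "('a \<Rightarrow> 'a \<Rightarrow> real) \<Rightarrow> 'a \<Rightarrow> 'a \<Rightarrow> real" where
  "Top f L P = (if flag L P then \<Sum>M | M \<curlyvee> P = tp \<and> M \<curlywedge> P = L. f L M else 0)"

lemma dual_flag: "qflags.flag (\<lambda>x y. y \<preceq> x) (\<lambda>x. n - dm x) k P L \<longleftrightarrow> flag L P"
proof -
  interpret d: qflags q "\<lambda>x y. y \<preceq> x" jn mt tp bt "\<lambda>x. n - dm x" n k by (rule dual_flags)
  have "n - dm P = k \<longleftrightarrow> dm P = 2 * k" "n - dm L = 2 * k \<longleftrightarrow> dm L = k"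
    using dm_le_n[of L] dm_le_n[of P] n_eq by linarith+
  then show ?thesis unfolding d.flag_def flag_def by blast
qed

lemma dual_phi: "qflags.phi (\<lambda>x y. y \<preceq> x) (\<lambda>x. n - dm x) k (\<lambda>P L. f L P) B A = phi f A B"
proof -
  interpret d: qflags q "\<lambda>x y. y \<preceq> x" jn mt tp bt "\<lambda>x. n - dm x" n k by (rule dual_flags)
  show ?thesis unfolding d.phi_UNIV phi_UNIV dual_flag by (subst sum.swap) (simp add: conj_commute)
qed

lemma dual_vanish: "qflags.vanish (\<lambda>x y. y \<preceq> x) (\<lambda>x. n - dm x) n k r (\<lambda>P L. f L P) \<longleftrightarrow> vanish r f"
proof -
  interpret d: qflags q "\<lambda>x y. y \<preceq> x" jn mt tp bt "\<lambda>x. n - dm x" n k by (rule dual_flags)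
  have "n - dm B + (n - (n - dm A)) = dm A + (n - dm B)" for A B using dm_le_n[of A] by simp
  then show ?thesis unfolding d.vanish_def vanish_def dual_flag dual_phi by (simp only:) blast
qed

lemma dual_Sop: "qflags.Sop (\<lambda>x y. y \<preceq> x) jn mt tp (\<lambda>x. n - dm x) k (\<lambda>P L. f L P) = (\<lambda>P L. Top f L P)"
proof -
  interpret d: qflags q "\<lambda>x y. y \<preceq> x" jn mt tp bt "\<lambda>x. n - dm x" n k by (rule dual_flags)
  show ?thesis by (intro ext) (simp add: d.Sop_def Top_def dual_flag)
qed

definition phir :: "nat \<Rightarrow> ('a \<Rightarrow> 'a \<Rightarrow> real) \<Rightarrow> 'a \<Rightarrow> 'a \<Rightarrow> real" where
  "phir r f A B = (if A \<preceq> B \<and> dm A + (n - dm B) = r then phi f A B else 0)"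

lemma dual_phir: "qflags.phir (\<lambda>x y. y \<preceq> x) (\<lambda>x. n - dm x) n k r (\<lambda>P L. f L P) = (\<lambda>B A. phir r f A B)"
proof -
  interpret d: qflags q "\<lambda>x y. y \<preceq> x" jn mt tp bt "\<lambda>x. n - dm x" n k by (rule dual_flags)
  have "n - dm B + (n - (n - dm A)) = dm A + (n - dm B)" for A B using dm_le_n[of A] by simp
  then show ?thesis unfolding d.phir_def phir_def dual_phi by (simp only:)
qed

lemma grade_iff: "r \<le> n \<Longrightarrow> A \<preceq> B \<Longrightarrow> dm B = dm A + (n - r) \<longleftrightarrow> dm A + (n - dm B) = r"
  using dm_mono[of A B] dm_le_n[of B] by auto

text \<open>Every flag between \<open>A\<close> and \<open>B\<close> lies below
  \<open>qint (dm B - 2 * k)\<close> coatoms of \<open>B\<close>, so the sum is a multiple of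
  \<open>phi f A B\<close>, whose degree is one less than \<open>r\<close>.\<close>

lemma phir_upper:
  assumes Z: "vanish r f" and r: "r \<le> n" and AB: "A \<preceq> B" "dm B = Suc (dm A + (n - r))"
  shows "(\<Sum>X | A \<preceq> X \<and> X \<lessdot> B. phir r f A X) = 0"
proof -
  have AX: "A \<preceq> X \<Longrightarrow> X \<lessdot> B \<Longrightarrow> phir r f A X = phi f A X" for X
    using grade_iff[OF r, of A X] AB by (auto simp: phir_def cov_def)
  have "(\<Sum>X | A \<preceq> X \<and> X \<lessdot> B. phir r f A X) = (\<Sum>X\<in>UNIV. \<Sum>L\<in>UNIV. \<Sum>P\<in>UNIV.
     if A \<preceq> X \<and> X \<lessdot> B \<and> flag L P \<and> A \<preceq> L \<and> P \<preceq> X then f L P else 0)"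
    unfolding sum_Collect
  proof (rule sum.cong[OF refl])
    fix X
    show "(if A \<preceq> X \<and> X \<lessdot> B then phir r f A X else 0) = (\<Sum>L\<in>UNIV. \<Sum>P\<in>UNIV.
      if A \<preceq> X \<and> X \<lessdot> B \<and> flag L P \<and> A \<preceq> L \<and> P \<preceq> X then f L P else 0)"
    proof (cases "A \<preceq> X \<and> X \<lessdot> B")
      case True
      then show ?thesis by (simp add: AX phi_UNIV)
    next
      case False
      then have "\<not> (A \<preceq> X \<and> X \<lessdot> B \<and> flag L P \<and> A \<preceq> L \<and> P \<preceq> X)" for L P by blast
      then show ?thesis by (simp only: False if_False sum.neutral_const)
    qed
  qed
  also have "\<dots> = (\<Sum>L\<in>UNIV. \<Sum>P\<in>UNIV. \<Sum>X\<in>UNIV.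
     if A \<preceq> X \<and> X \<lessdot> B \<and> flag L P \<and> A \<preceq> L \<and> P \<preceq> X then f L P else 0)"
    by (rule sum_rotate3)
  also have "\<dots> = (\<Sum>L\<in>UNIV. \<Sum>P\<in>UNIV. qint (dm B - 2 * k) * (if flag L P \<and> A \<preceq> L \<and> P \<preceq> B then f L P else 0))"
  proof (intro sum.cong refl)
    fix L P
    show "(\<Sum>X\<in>UNIV. if A \<preceq> X \<and> X \<lessdot> B \<and> flag L P \<and> A \<preceq> L \<and> P \<preceq> X then f L P else 0) =
      qint (dm B - 2 * k) * (if flag L P \<and> A \<preceq> L \<and> P \<preceq> B then f L P else 0)"
    proof (cases "flag L P \<and> A \<preceq> L \<and> P \<preceq> B")
      case True
      then have "A \<preceq> P" using le_trans[of A L P] by (simp add: flag_def)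
      then have "{X. A \<preceq> X \<and> X \<lessdot> B \<and> flag L P \<and> A \<preceq> L \<and> P \<preceq> X} = {X. P \<preceq> X \<and> X \<lessdot> B}"
        using True le_trans[of A P] by blast
      then show ?thesis using card_coatoms[of P B] True
        by (simp add: sum_if_const flag_def)
    next
      case False
      have "\<not> (X \<lessdot> B \<and> P \<preceq> X)" if "\<not> P \<preceq> B" for X using that le_trans[of P X B] by (auto simp: cov_def)
      then have "\<not> (A \<preceq> X \<and> X \<lessdot> B \<and> flag L P \<and> A \<preceq> L \<and> P \<preceq> X)" for X using False by blast
      then show ?thesis using False by (simp only: if_False sum.neutral_const mult_zero_right)
    qed
  qed
  also have "\<dots> = qint (dm B - 2 * k) * phi f A B" unfolding phi_UNIV by (simp add: sum_distrib_left)
  also have "phi f A B = 0"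
  proof -
    have "dm A + (n - dm B) < r" using AB dm_le_n[of B] r by linarith
    then show ?thesis using Z AB by (simp add: vanish_def)
  qed
  finally show ?thesis by simp
qed

lemma annihilated_phir:
  assumes Z: "vanish r f" and r: "r \<le> n"
  shows "annihilated (n - r) (phir r f)"
  unfolding annihilated_def
proof (intro conjI allI impI)
  fix A B assume "phir r f A B \<noteq> 0"
  then show "A \<preceq> B" "dm B = dm A + (n - r)" using grade_iff[OF r, of A B] by (auto simp: phir_def split: if_splits)
next
  fix A B assume AB: "A \<preceq> B" "dm B = Suc (dm A + (n - r))"
  show "(\<Sum>X | A \<preceq> X \<and> X \<lessdot> B. phir r f A X) = 0" by (rule phir_upper[OF Z r AB])
  interpret d: qflags q "\<lambda>x y. y \<preceq> x" jn mt tp bt "\<lambda>x. n - dm x" n k by (rule dual_flags)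
  have 1: "d.vanish r (\<lambda>P L. f L P)" unfolding dual_vanish by (rule Z)
  have 2: "n - dm A = Suc (n - dm B + (n - r))" using AB dm_le_n[of B] by linarith
  have "(\<Sum>X | X \<preceq> B \<and> d.cov X A. d.phir r (\<lambda>P L. f L P) B X) = 0"
    by (rule d.phir_upper[OF 1 r AB(1) 2])
  then show "(\<Sum>X | A \<lessdot> X \<and> X \<preceq> B. phir r f X B) = 0"
    unfolding dual_phir dual_cov by (simp add: conj_commute)
qed

text \<open>By adjointness the powers of the raising operator in the leading term of S become powers
  of the lowering operator on the test function \<open>u\<close>.\<close>

lemma ip_phir_Sop:
  assumes Z: "vanish r f" and r: "r \<le> n" and u: "annihilated (n - r) u" and hom: "\<And>A B. u A B \<noteq> 0 \<Longrightarrow> dm A = i"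
  shows "ip u (phir r (Sop f)) =
    (\<Sum>l\<le>i. coefS i (i + (n - r)) l * ((-1) ^ l / qfact l) * ip ((lower_op ^^ l) u) (phir r f))"
proof -
  have ip_pow: "ip u ((raise_op ^^ l) h) = ip ((lower_op ^^ l) u) h" for l h
  proof (induction l arbitrary: h)
    case (Suc l)
    have "ip u ((raise_op ^^ Suc l) h) = ip u ((raise_op ^^ l) (raise_op h))" by (simp add: funpow_swap1)
    then show ?case unfolding Suc ip_raise_op by simp
  qed simp
  have pt: "u A B * phir r (Sop f) A B =
    (\<Sum>l\<le>i. coefS i (i + (n - r)) l * ((-1) ^ l / qfact l) * (u A B * (raise_op ^^ l) (phir r f) A B))" for A B
  proof (cases "u A B = 0")
    case False
    then have AB: "A \<preceq> B" "dm B = dm A + (n - r)" "dm A = i" using annihilated_supp[OF u] hom by blast+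
    then have g: "dm A + (n - dm B) = r" using grade_iff[OF r] by blast
    have Rl: "Rl l (phi f) A B = Rl l (phir r f) A B" for l
      unfolding Rl_def
    proof (rule sum.cong[OF refl])
      fix Y assume "Y \<in> {B'. B' \<curlyvee> A = B \<and> dm B' + l = dm B}"
      then have "dm (Y \<curlywedge> A) + (n - dm Y) = r" using dm_mod[of Y A] g dm_le_n[of B] AB(2) r by auto
      then show "phi f (Y \<curlywedge> A) Y = phir r f (Y \<curlywedge> A) Y" by (simp add: phir_def)
    qed
    have "phir r (Sop f) A B = phi (Sop f) A B" using AB g by (simp add: phir_def)
    also have "\<dots> = (\<Sum>l\<le>dm A. coefS (dm A) (dm B) l * Rl l (phi f) A B)"
      by (rule phi_Sop_top[OF Z AB(1)]) (simp add: g)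
    also have "\<dots> = (\<Sum>l\<le>i. coefS i (i + (n - r)) l * ((-1) ^ l / qfact l * (raise_op ^^ l) (phir r f) A B))"
      unfolding Rl Rl_annihilated[OF annihilated_phir[OF Z r]] using AB by simp
    finally show ?thesis by (simp add: sum_distrib_left mult_ac)
  qed simp
  have "ip u (phir r (Sop f)) = (\<Sum>A\<in>UNIV. \<Sum>B\<in>UNIV. \<Sum>l\<le>i.
     coefS i (i + (n - r)) l * ((-1) ^ l / qfact l) * (u A B * (raise_op ^^ l) (phir r f) A B))"
    unfolding ip_def pt ..
  also have "\<dots> = (\<Sum>l\<le>i. \<Sum>A\<in>UNIV. \<Sum>B\<in>UNIV.
     coefS i (i + (n - r)) l * ((-1) ^ l / qfact l) * (u A B * (raise_op ^^ l) (phir r f) A B))"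
    by (rule sum_rotate3[symmetric])
  also have "\<dots> = (\<Sum>l\<le>i. coefS i (i + (n - r)) l * ((-1) ^ l / qfact l) * ip u ((raise_op ^^ l) (phir r f)))"
    unfolding ip_def by (simp add: sum_distrib_left)
  finally show ?thesis unfolding ip_pow .
qed

text \<open>\<open>ip_phir_Sop\<close> in the opposite lattice: the degree \<open>i\<close> becomes
  \<open>r - i\<close>, the end \<open>A\<close> has dimension \<open>n - i\<close> there, and
  raising and lowering change places.\<close>

lemma ip_phir_Top:
  assumes Z: "vanish r f" and r: "r \<le> n" and u: "annihilated (n - r) u" and hom: "\<And>A B. u A B \<noteq> 0 \<Longrightarrow> dm A = i"
    and i: "i \<le> r"
  shows "ip u (phir r (Top f)) =
    (\<Sum>l\<le>r - i. coefS (r - i) (n - i) l * ((-1) ^ l / qfact l) * ip ((raise_op ^^ l) u) (phir r f))"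
proof -
  interpret d: qflags q "\<lambda>x y. y \<preceq> x" jn mt tp bt "\<lambda>x. n - dm x" n k by (rule dual_flags)
  have flip: "d.ip (\<lambda>B A. g A B) (\<lambda>B A. h A B) = ip g h" for g h
    unfolding d.ip_def ip_def by (rule sum.swap)
  have dRd: "d.lower_op (\<lambda>B A. g A B) = (\<lambda>B A. raise_op g A B)" for g
    unfolding d.lower_op_def raise_op_def dual_cov by (intro ext, subst sum.swap) (intro sum.cong refl if_cong, auto)
  have dpow: "(d.lower_op ^^ l) (\<lambda>B A. g A B) = (\<lambda>B A. (raise_op ^^ l) g A B)" for l g
    by (induction l) (simp_all add: dRd)
  have 1: "d.vanish r (\<lambda>P L. f L P)" unfolding dual_vanish by (rule Z)
  have 2: "d.annihilated (n - r) (\<lambda>B A. u A B)" unfolding dual_annihilated by (rule u)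
  have 3: "n - dm B = r - i" if "u A B \<noteq> 0" for A B
    using annihilated_supp[OF u, of A B] hom[OF that] that dm_le_n[of B] r i by force
  have 4: "r - i + (n - r) = n - i" using r i by simp
  have a: "d.ip (\<lambda>B A. u A B) (d.phir r (d.Sop (\<lambda>P L. f L P))) = ip u (phir r (Top f))"
    by (subst dual_Sop, subst dual_phir, rule flip)
  have b: "d.ip ((d.lower_op ^^ l) (\<lambda>B A. u A B)) (d.phir r (\<lambda>P L. f L P)) = ip ((raise_op ^^ l) u) (phir r f)" for l
    by (subst dpow, subst dual_phir, rule flip)
  have "d.ip (\<lambda>B A. u A B) (d.phir r (d.Sop (\<lambda>P L. f L P))) =
    (\<Sum>l\<le>r - i. d.coefS (r - i) (n - i) l * ((-1) ^ l / qfact l) * d.ip ((d.lower_op ^^ l) (\<lambda>B A. u A B)) (d.phir r (\<lambda>P L. f L P)))"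
    using d.ip_phir_Sop[OF 1 r 2, of "r - i"] 3 unfolding 4 by blast
  then show ?thesis unfolding a b .
qed

end

section \<open>Coordinates along strings\<close>

context qlattice
begin

lemma raise_op_scale: "raise_op (\<lambda>A B. c * g A B) = (\<lambda>A B. c * raise_op g A B)"
  unfolding raise_op_def by (intro ext) (auto simp: sum_distrib_left intro!: sum.cong)

lemma lower_op_scale: "lower_op (\<lambda>A B. c * g A B) = (\<lambda>A B. c * lower_op g A B)"
  unfolding lower_op_def by (intro ext) (auto simp: sum_distrib_left intro!: sum.cong)

lemma raise_op_nz: "raise_op g A B \<noteq> 0 \<Longrightarrow> \<exists>X Y. X \<lessdot> A \<and> A \<preceq> Y \<and> Y \<lessdot> B \<and> g X Y \<noteq> 0"
  unfolding raise_op_def by (rule ccontr) (auto intro!: sum.neutral)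

lemma lower_op_nz: "lower_op g A B \<noteq> 0 \<Longrightarrow> \<exists>X Y. A \<lessdot> X \<and> X \<preceq> B \<and> B \<lessdot> Y \<and> g X Y \<noteq> 0"
  unfolding lower_op_def by (rule ccontr) (auto intro!: sum.neutral)

definition homog :: "nat \<Rightarrow> ('l \<Rightarrow> 'l \<Rightarrow> real) \<Rightarrow> bool" where
  "homog j g \<longleftrightarrow> (\<forall>A B. g A B \<noteq> 0 \<longrightarrow> dm A = j)"

lemma raise_op_pow_dm:
  assumes "homog j w"
  shows "(raise_op ^^ t) w A B \<noteq> 0 \<Longrightarrow> dm A = j + t"
proof (induction t arbitrary: A B)
  case (Suc t)
  then obtain X Y where "X \<lessdot> A" "(raise_op ^^ t) w X Y \<noteq> 0" using raise_op_nz by fastforce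
  then show ?case using Suc.IH cov_dm by fastforce
qed (use assms in \<open>auto simp: homog_def\<close>)

lemma lower_op_pow_dm: "(lower_op ^^ t) w A B \<noteq> 0 \<Longrightarrow> dm A + t \<le> n"
proof (induction t arbitrary: A B)
  case 0
  then show ?case using dm_le_n by simp
next
  case (Suc t)
  then obtain X Y where "A \<lessdot> X" "(lower_op ^^ t) w X Y \<noteq> 0" using lower_op_nz by fastforce
  then show ?case using Suc.IH cov_dm by fastforce
qed

text \<open>The q-analogue of the sl2 coefficient (t + 1)(r - 2j - t), times a power of
  \<open>q\<close>. The second q-integer has an integer exponent because nothing yet says that r -
  2j - t is nonnegative.\<close>

definition qcoef :: "nat \<Rightarrow> nat \<Rightarrow> nat \<Rightarrow> nat \<Rightarrow> real" where
  "qcoef e r j t = q ^ (e + j) * qint (Suc t) * ((q powi (int r - 2 * int j - int t) - 1) / (q - 1))"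

lemma qcoef_Suc:
  assumes "j + Suc t \<le> r"
  shows "qcoef e r j t - q ^ e * (qint (j + Suc t) - qint (r - (j + Suc t))) = qcoef e r j (Suc t)"
proof -
  define x where "x = q powi (int r - 2 * int j - int (Suc t))"
  have 1: "q powi (int r - 2 * int j - int t) = q * x"
  proof -
    have "q powi (m + 1) = q * q powi m" for m by (simp add: power_int_add)
    from this[of "int r - 2 * int j - int (Suc t)"] show ?thesis unfolding x_def by (simp add: algebra_simps)
  qed
  have "int (r - (j + Suc t)) = (int r - 2 * int j - int (Suc t)) + int j" using assms by simp
  then have 2: "q ^ (r - (j + Suc t)) = x * q ^ j"
    unfolding x_def by (metis power_int_add power_int_of_nat q_nz(1))
  \<comment> \<open>With \<open>y\<close> for \<open>1 / (q - 1)\<close> the identity is a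
    polynomial one modulo \<open>y * (q - 1) = 1\<close>.\<close>
  define y where "y = 1 / (q - 1)"
  have y: "y * (q - 1) = 1" using q_gt_1 by (simp add: y_def)
  have "E * J * ((q * T - 1) * y) * ((q * x - 1) * y) - E * ((J * (q * T) - 1) * y - (x * J - 1) * y) =
     E * J * ((q * (q * T) - 1) * y) * ((x - 1) * y)" for E J T
  proof -
    have "E * J * ((q * T - 1) * y) * ((q * x - 1) * y) - E * ((J * (q * T) - 1) * y - (x * J - 1) * y) -
      E * J * ((q * (q * T) - 1) * y) * ((x - 1) * y) = E * J * y * (y * (q - 1) - 1) * (q * T - x)"
      by (simp add: algebra_simps)
    then show ?thesis using y by simp
  qed
  from this[of "q ^ e" "q ^ j" "q ^ t"] show ?thesis
    unfolding qcoef_def qint_def 1 2 x_def[symmetric] power_add power_Suc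
    by (simp only: y_def times_divide_eq_right mult_1_right)
qed

lemma qcoef_0:
  assumes "j \<le> r"
  shows "- (q ^ e * (qint j - qint (r - j))) = qcoef e r j 0"
proof -
  define x where "x = q powi (int r - 2 * int j)"
  have "int (r - j) = (int r - 2 * int j) + int j" using assms by simp
  then have 2: "q ^ (r - j) = x * q ^ j"
    unfolding x_def by (metis power_int_add power_int_of_nat q_nz(1))
  have 3: "qcoef e r j 0 = q ^ (e + j) * ((x - 1) / (q - 1))" by (simp add: qcoef_def x_def)
  show ?thesis unfolding 3 qint_def 2 by (simp add: power_add diff_divide_distrib algebra_simps)
qed

text \<open>The usual sl2 computation: moving the lowering operator past one raising operator costs
  a scalar in each degree, and \<open>qcoef_0\<close> and \<open>qcoef_Suc\<close> add these scalars
  up.\<close>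

lemma lower_op_raise_op_pow:
  assumes w: "annihilated (n - r) w" and e: "n - r = Suc e" and hom: "homog j w"
    and prim: "lower_op w = (\<lambda>A B. 0)"
  shows "lower_op ((raise_op ^^ Suc t) w) = (\<lambda>A B. qcoef e r j t * (raise_op ^^ t) w A B)"
proof (induction t)
  case 0
  show ?case
  proof (intro ext)
    fix A B
    have "raise_op (lower_op w) A B = 0" unfolding prim using raise_op_scale[where c=0 and g=w] by (simp add: fun_eq_iff)
    then have 1: "lower_op (raise_op w) A B = - (q ^ e * (qint (dm A) - qint (n - dm B))) * w A B"
      using commutator[OF w e, of A B] by simp
    show "lower_op ((raise_op ^^ Suc 0) w) A B = qcoef e r j 0 * (raise_op ^^ 0) w A B"
    proof (cases "w A B = 0")
      case False
      then have "dm A = j" "dm B = j + (n - r)" using hom annihilated_supp[OF w] unfolding homog_def by blast+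
      then have "dm A = j" "n - dm B = r - j" "j \<le> r" using dm_le_n[of B] e by auto
      then show ?thesis using 1 qcoef_0[of j r e] by simp
    qed (use 1 in simp)
  qed
next
  case (Suc t)
  show ?case
  proof (intro ext)
    fix A B
    let ?u = "(raise_op ^^ Suc t) w"
    have u: "annihilated (n - r) ?u" by (rule annihilated_raise_op_pow[OF w])
    have "raise_op (lower_op ?u) A B = qcoef e r j t * ?u A B" unfolding Suc raise_op_scale by simp
    then have 1: "lower_op (raise_op ?u) A B = (qcoef e r j t - q ^ e * (qint (dm A) - qint (n - dm B))) * ?u A B"
      using commutator[OF u e, of A B] by (simp add: algebra_simps)
    show "lower_op ((raise_op ^^ Suc (Suc t)) w) A B = qcoef e r j (Suc t) * ?u A B"
    proof (cases "?u A B = 0")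
      case False
      then have A: "dm A = j + Suc t" using raise_op_pow_dm[OF hom] by blast
      have "dm B = dm A + (n - r)" using False annihilated_supp[OF u] by blast
      then have "n - dm B = r - (j + Suc t)" "j + Suc t \<le> r" using dm_le_n[of B] A e by auto
      then show ?thesis using 1 qcoef_Suc[of j t r e] A by simp
    qed (use 1 in simp)
  qed
qed

lemma ip_commute: "ip g h = ip h g" by (simp add: ip_def mult.commute)

lemma ip_self: "ip g g \<ge> 0" "ip g g = 0 \<longleftrightarrow> g = (\<lambda>A B. 0)"
proof -
  show "ip g g \<ge> 0" unfolding ip_def by (intro sum_nonneg) simp
  have "ip g g = 0 \<longleftrightarrow> (\<forall>A B. g A B = 0)"
    unfolding ip_def by (simp add: sum_nonneg_eq_0_iff sum_nonneg)
  then show "ip g g = 0 \<longleftrightarrow> g = (\<lambda>A B. 0)" by (auto simp: fun_eq_iff)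
qed

lemma ip_scale: "ip (\<lambda>A B. c * g A B) h = c * ip g h"
  unfolding ip_def by (simp add: sum_distrib_left mult.assoc)

lemma string_norm:
  assumes w: "annihilated (n - r) w" and e: "n - r = Suc e" and hom: "homog j w"
    and prim: "lower_op w = (\<lambda>A B. 0)"
  shows "ip ((raise_op ^^ Suc t) w) ((raise_op ^^ Suc t) w) = qcoef e r j t * ip ((raise_op ^^ t) w) ((raise_op ^^ t) w)"
proof -
  have "ip ((raise_op ^^ Suc t) w) ((raise_op ^^ Suc t) w) = ip ((raise_op ^^ Suc t) w) (raise_op ((raise_op ^^ t) w))" by simp
  also have "\<dots> = ip (lower_op ((raise_op ^^ Suc t) w)) ((raise_op ^^ t) w)" by (rule ip_raise_op)
  also have "\<dots> = qcoef e r j t * ip ((raise_op ^^ t) w) ((raise_op ^^ t) w)"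
    unfolding lower_op_raise_op_pow[OF assms] ip_scale ..
  finally show ?thesis .
qed

text \<open>Squared norms along the string are multiplied by \<open>qcoef\<close>. Its nonnegativity
  at the first step forces \<open>2 * j \<le> r\<close>; at \<open>t = r - 2 * j\<close> it is 0, so
  the string ends there.\<close>

lemma string_length:
  assumes w: "annihilated (n - r) w" and e: "n - r = Suc e" and hom: "homog j w"
    and prim: "lower_op w = (\<lambda>A B. 0)" and nz: "w \<noteq> (\<lambda>A B. 0)"
  shows "2 * j \<le> r" "t > r - 2 * j \<Longrightarrow> (raise_op ^^ t) w = (\<lambda>A B. 0)"
proof -
  have pos: "ip w w > 0" using ip_self[of w] nz by linarith
  have "0 \<le> qcoef e r j 0 * ip w w" using string_norm[OF assms(1-4), of 0] ip_self(1)[of "(raise_op ^^ Suc 0) w"] by simp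
  then have "0 \<le> qcoef e r j 0" using pos by (simp add: zero_le_mult_iff)
  moreover have "q ^ (e + j) > 0" by simp
  ultimately have "q powi (int r - 2 * int j) \<ge> 1"
    using q_gt_1 by (simp add: qcoef_def zero_le_mult_iff zero_le_divide_iff)
  then have "\<not> int r - 2 * int j < 0"
    using power_int_strict_increasing[of "int r - 2 * int j" 0 q] q_gt_1 by auto
  then show j: "2 * j \<le> r" by simp
  have "qcoef e r j (r - 2 * j) = 0" using j by (simp add: qcoef_def of_nat_diff)
  then have 0: "(raise_op ^^ Suc (r - 2 * j)) w = (\<lambda>A B. 0)"
    using string_norm[OF assms(1-4), of "r - 2 * j"] ip_self(2)[of "(raise_op ^^ Suc (r - 2 * j)) w"] by simp
  have z: "(raise_op ^^ m) (\<lambda>A B. 0) = (\<lambda>A B. 0)" for m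
    by (induction m) (use raise_op_scale[where c=0] in simp_all)
  assume "t > r - 2 * j"
  then obtain m where t: "t = m + Suc (r - 2 * j)"
    by (intro that[of "t - Suc (r - 2 * j)"]) simp
  show "(raise_op ^^ t) w = (\<lambda>A B. 0)" unfolding t funpow_add comp_apply 0 z ..
qed

lemma lower_op_pow_raise_op_pow:
  assumes w: "annihilated (n - r) w" and e: "n - r = Suc e" and hom: "homog j w"
    and prim: "lower_op w = (\<lambda>A B. 0)" and r: "r = 2 * j + d" and td: "t \<le> d"
  shows "l \<le> t \<Longrightarrow> (lower_op ^^ l) ((raise_op ^^ t) w) = (\<lambda>A B. q ^ ((e + j) * l) * (qfact t / qfact (t - l)) *
     (qfact (d - t + l) / qfact (d - t)) * (raise_op ^^ (t - l)) w A B)"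
proof (induction l)
  case 0
  show ?case using qfact_pos[of t] qfact_pos[of "d - t"] by simp
next
  case (Suc l)
  define m where "m = t - Suc l"
  have m: "t - l = Suc m" using Suc.prems by (simp add: m_def)
  have "int r - 2 * int j - int m = int (Suc (d - t + l))" using r td Suc.prems by (simp add: m_def)
  then have "qcoef e r j m = q ^ (e + j) * qint (Suc m) * qint (Suc (d - t + l))"
    unfolding qcoef_def by (simp only: power_int_of_nat qint_def[of "Suc (d - t + l)"])
  moreover have "(lower_op ^^ Suc l) ((raise_op ^^ t) w) = (\<lambda>A B. q ^ ((e + j) * l) * (qfact t / qfact (Suc m)) *
     (qfact (d - t + l) / qfact (d - t)) * (qcoef e r j m * (raise_op ^^ m) w A B))"
  proof -
    have "(lower_op ^^ Suc l) ((raise_op ^^ t) w) = lower_op ((lower_op ^^ l) ((raise_op ^^ t) w))" by simp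
    also have "(lower_op ^^ l) ((raise_op ^^ t) w) = (\<lambda>A B. q ^ ((e + j) * l) * (qfact t / qfact (Suc m)) *
     (qfact (d - t + l) / qfact (d - t)) * (raise_op ^^ Suc m) w A B)"
      using Suc.IH Suc.prems unfolding m by (simp only: Suc_leD)
    also have "lower_op \<dots> = (\<lambda>A B. q ^ ((e + j) * l) * (qfact t / qfact (Suc m)) *
     (qfact (d - t + l) / qfact (d - t)) * lower_op ((raise_op ^^ Suc m) w) A B)" by (rule lower_op_scale)
    finally show ?thesis unfolding lower_op_raise_op_pow[OF assms(1-4)] .
  qed
  ultimately show ?case
    using qfact_pos[of m] qint_pos[of "Suc m"] unfolding m_def[symmetric]
    by (simp add: qfact_Suc power_add field_simps)
qed

lemma lower_op_pow_raise_op_pow_zero: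
  assumes w: "annihilated (n - r) w" and e: "n - r = Suc e" and hom: "homog j w"
    and prim: "lower_op w = (\<lambda>A B. 0)" and r: "r = 2 * j + d" and td: "t \<le> d" and l: "l > t"
  shows "(lower_op ^^ l) ((raise_op ^^ t) w) = (\<lambda>A B. 0)"
proof -
  have z: "(lower_op ^^ m) (\<lambda>A B. 0) = (\<lambda>A B. 0)" for m
    by (induction m) (use lower_op_scale[where c=0] in simp_all)
  have "(lower_op ^^ t) ((raise_op ^^ t) w) = (\<lambda>A B. (q ^ ((e + j) * t) * (qfact t / qfact 0) *
     (qfact (d - t + t) / qfact (d - t))) * w A B)"
    using lower_op_pow_raise_op_pow[OF assms(1-6) order_refl] by (simp only: diff_self_eq_0 funpow_0)
  then have "(lower_op ^^ Suc t) ((raise_op ^^ t) w) = lower_op (\<lambda>A B. (q ^ ((e + j) * t) * (qfact t / qfact 0) *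
     (qfact (d - t + t) / qfact (d - t))) * w A B)" by simp
  then have "(lower_op ^^ Suc t) ((raise_op ^^ t) w) = (\<lambda>A B. 0)"
    unfolding lower_op_scale prim by simp
  moreover obtain m where m: "l = m + Suc t" using l by (intro that[of "l - Suc t"]) simp
  ultimately show ?thesis unfolding m funpow_add comp_apply by (simp only: z)
qed

end

context qflags
begin

text \<open>Collects all powers of \<open>q\<close>, including those in the two values of
  \<open>mu\<close>, where the quadratic terms in \<open>l\<close> cancel.\<close>

lemma coefS_powi:
  assumes "l \<le> i"
  shows "coefS i b l = (-1) ^ i * q powi (ee k i - int i * int l + int l - int l * (int b - 2 * int k - int l))"
proof -
  have s: "(-1) ^ (i - l) = (-1) ^ i * (-1 :: real) ^ l"
  proof -
    have "(-1 :: real) ^ i = (-1) ^ l * (-1) ^ (i - l)" using assms by (simp flip: power_add)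
    then show ?thesis by (simp add: minus_one_power_sq mult.commute)
  qed
  have "mu (i - l) / mu l = (-1) ^ i * (q ^ ((i - l) choose 2) / q ^ (l choose 2))"
    unfolding mu_def s by (simp add: field_simps)
  also have "q ^ ((i - l) choose 2) / q ^ (l choose 2) = q powi (int ((i - l) choose 2) - int (l choose 2))"
    by (simp add: power_int_diff)
  finally have m: "mu (i - l) / mu l = (-1) ^ i * q powi (int ((i - l) choose 2) - int (l choose 2))" .
  have "coefS i b l = q powi (int k * (int k - int i)) * (mu (i - l) / mu l) * q powi (- (int l * (int b - 2 * int k - int l)))"
    by (simp add: coefS_def coefP_def)
  also have "\<dots> = (-1) ^ i * (q powi (int k * (int k - int i)) * q powi (int ((i - l) choose 2) - int (l choose 2)) *
      q powi (- (int l * (int b - 2 * int k - int l))))" unfolding m by simp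
  also have "\<dots> = (-1) ^ i * q powi (int k * (int k - int i) + (int ((i - l) choose 2) - int (l choose 2))
      + - (int l * (int b - 2 * int k - int l)))" by (simp only: power_int_add q_nz simp_thms)
  also have "int k * (int k - int i) + (int ((i - l) choose 2) - int (l choose 2))
      + - (int l * (int b - 2 * int k - int l)) =
      ee k i - int i * int l + int l - int l * (int b - 2 * int k - int l)"
  proof -
    have cancel: "a = b" if "2 * a = 2 * b" for a b :: int using that by simp
    have "2 * (int ((i - l) choose 2) - int (l choose 2)) = 2 * (int (i choose 2) - int i * int l + int l)"
      using two_choose_2[of "i - l"] two_choose_2[of l] two_choose_2[of i] assms
      by (simp add: of_nat_diff algebra_simps)
    then have D: "int ((i - l) choose 2) - int (l choose 2) = int (i choose 2) - int i * int l + int l"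
      by (rule cancel)
    have "A + D + - P = (A + c) - u + m - P" if "D = c - u + m" for A D c u m P :: int using that by simp
    from this[OF D] show ?thesis unfolding ee_def .
  qed
  finally show ?thesis .
qed

text \<open>Solved from the wish that S have the entries \<open>sig k j t * qbin t p\<close>: the
  sign absorbs the one in \<open>Rl_annihilated\<close>, the factorial absorbs the surplus quotient
  in \<open>lower_op_pow_raise_op_pow\<close>, and the quadratic exponent absorbs what still depends
  on \<open>l\<close>.\<close>

definition coord_scale :: "nat \<Rightarrow> nat \<Rightarrow> nat \<Rightarrow> real" where
  "coord_scale j d t = (-1) ^ t * q powi (- (int t * int t) + (2 * int k - int j) * int t) / qfact (d - t)"

lemma coord_scale_nz: "coord_scale j d t \<noteq> 0" using qfact_pos[of "d - t"] by (simp add: coord_scale_def)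

text \<open>The scaling makes the matrices of both operators depend on \<open>k\<close>, \<open>r\<close>, \<open>j\<close>, \<open>d\<close> only
  through the factors \<open>sig\<close> and a power of \<open>q\<close>.\<close>

definition string_coord :: "nat \<Rightarrow> nat \<Rightarrow> nat \<Rightarrow> ('a \<Rightarrow> 'a \<Rightarrow> real) \<Rightarrow> nat \<Rightarrow> ('a \<Rightarrow> 'a \<Rightarrow> real) \<Rightarrow> real" where
  "string_coord r j d w t f = ip ((raise_op ^^ t) w) (phir r f) / coord_scale j d t"

lemma coord_scale_ratio:
  assumes "l \<le> t" "t \<le> d"
  shows "coord_scale j d (t - l) = (-1) ^ l * q powi (int t * int t - int (t - l) * int (t - l) - (2 * int k - int j) * int l)
    * (qfact (d - t) / qfact (d - t + l)) * coord_scale j d t"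
proof -
  have s: "(-1 :: real) ^ t = (-1) ^ (t - l) * (-1) ^ l" using assms by (simp flip: power_add)
  have "- (int (t - l) * int (t - l)) + (2 * int k - int j) * int (t - l) =
    (int t * int t - int (t - l) * int (t - l) - (2 * int k - int j) * int l) +
    (- (int t * int t) + (2 * int k - int j) * int t)"
    using assms by (simp add: of_nat_diff algebra_simps)
  then have "q powi (- (int (t - l) * int (t - l)) + (2 * int k - int j) * int (t - l)) =
    q powi (int t * int t - int (t - l) * int (t - l) - (2 * int k - int j) * int l) *
    q powi (- (int t * int t) + (2 * int k - int j) * int t)"
    by (simp only: power_int_add q_nz simp_thms)
  moreover have "d - (t - l) = d - t + l" using assms by simp
  ultimately show ?thesis unfolding coord_scale_def s
    using qfact_pos[of "d - t"] by (simp add: minus_one_power_sq field_simps)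
qed

text \<open>\<open>ip_phir_Sop\<close> for the string vector of height \<open>t\<close>, which the
  lowering operator brings to height \<open>t - l\<close>. Terms with \<open>l > t\<close> vanish
  because \<open>w\<close> is primitive.\<close>

lemma string_coord_Sop:
  assumes Z: "vanish r f" and w: "annihilated (n - r) w" and e: "n - r = Suc e" and hom: "homog j w"
    and prim: "lower_op w = (\<lambda>A B. 0)" and r: "r = 2 * j + d" and td: "t \<le> d"
  shows "string_coord r j d w t (Sop f) = sig k j t * (\<Sum>p\<le>t. qbin t p * string_coord r j d w p f)"
proof -
  have rn: "r \<le> n" using e by simp
  have hom': "(raise_op ^^ t) w A B \<noteq> 0 \<Longrightarrow> dm A = j + t" for A B using raise_op_pow_dm[OF hom] .
  have "ip ((raise_op ^^ t) w) (phir r (Sop f)) = (\<Sum>l\<le>j + t. coefS (j + t) (j + t + (n - r)) l * ((-1) ^ l / qfact l) *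
      ip ((lower_op ^^ l) ((raise_op ^^ t) w)) (phir r f))"
    by (rule ip_phir_Sop[OF Z rn annihilated_raise_op_pow[OF w] hom'])
  also have "\<dots> = (\<Sum>l\<le>t. coefS (j + t) (j + t + (n - r)) l * ((-1) ^ l / qfact l) *
      ip ((lower_op ^^ l) ((raise_op ^^ t) w)) (phir r f))"
    using lower_op_pow_raise_op_pow_zero[OF assms(2-7)]
    by (intro sum.mono_neutral_right) (auto simp: ip_def)
  also have "\<dots> = (\<Sum>l\<le>t. sig k j t * qbin t (t - l) * string_coord r j d w (t - l) f * coord_scale j d t)"
  proof (rule sum.cong[OF refl])
    fix l assume "l \<in> {..t}"
    then have l: "l \<le> t" by simp
    define X where "X = ip ((raise_op ^^ (t - l)) w) (phir r f)"
    have "ee k (j + t) - int (j + t) * int l + int l - int l * (int (j + t + (n - r)) - 2 * int k - int l)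
       + int ((e + j) * l) + (int t * int t - int (t - l) * int (t - l) - (2 * int k - int j) * int l) = ee k (j + t)"
    proof -
      have 1: "int (n - r) = int e + 1" using e by simp
      have 2: "int (t - l) = int t - int l" using l by simp
      show ?thesis unfolding of_nat_add of_nat_mult 1 2 by (simp add: algebra_simps)
    qed
    moreover have "coefS (j + t) (j + t + (n - r)) l * q ^ ((e + j) * l) *
        q powi (int t * int t - int (t - l) * int (t - l) - (2 * int k - int j) * int l) =
      (-1) ^ (j + t) * q powi (ee k (j + t) - int (j + t) * int l + int l - int l * (int (j + t + (n - r)) - 2 * int k - int l)
       + int ((e + j) * l) + (int t * int t - int (t - l) * int (t - l) - (2 * int k - int j) * int l))"
      using l by (subst coefS_powi, simp) (simp only: power_int_add q_nz simp_thms power_int_of_nat mult.assoc)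
    ultimately have key: "coefS (j + t) (j + t + (n - r)) l * q ^ ((e + j) * l) *
        q powi (int t * int t - int (t - l) * int (t - l) - (2 * int k - int j) * int l) = sig k j t"
      by (simp only: sig_def)
    let ?P = "q powi (int t * int t - int (t - l) * int (t - l) - (2 * int k - int j) * int l)"
    have nz: "coord_scale j d t \<noteq> 0" "?P \<noteq> 0" "qfact (d - t) \<noteq> 0" "qfact (d - t + l) \<noteq> 0" "qfact l \<noteq> 0" "qfact (t - l) \<noteq> 0"
      using coord_scale_nz qfact_pos[of "d - t"] qfact_pos[of "d - t + l"] qfact_pos[of l] qfact_pos[of "t - l"] by auto
    have z: "string_coord r j d w (t - l) f * coord_scale j d t = (-1) ^ l * X * (qfact (d - t + l) / qfact (d - t)) / ?P"
      unfolding string_coord_def X_def[symmetric] coord_scale_ratio[OF l td] using nz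
      by (simp add: field_simps minus_one_power_sq)
    have "coefS (j + t) (j + t + (n - r)) l * ((-1) ^ l / qfact l) * ip ((lower_op ^^ l) ((raise_op ^^ t) w)) (phir r f) =
      (coefS (j + t) (j + t + (n - r)) l * q ^ ((e + j) * l) * ?P) * (qfact t / (qfact (t - l) * qfact l)) *
      ((-1) ^ l * X * (qfact (d - t + l) / qfact (d - t)) / ?P)"
      unfolding lower_op_pow_raise_op_pow[OF assms(2-7) l] ip_scale X_def[symmetric] using nz by (simp add: field_simps)
    also have "\<dots> = sig k j t * qbin t (t - l) * (string_coord r j d w (t - l) f * coord_scale j d t)"
      unfolding key z using l by (simp add: qbin_def)
    finally show "coefS (j + t) (j + t + (n - r)) l * ((-1) ^ l / qfact l) * ip ((lower_op ^^ l) ((raise_op ^^ t) w)) (phir r f) =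
      sig k j t * qbin t (t - l) * string_coord r j d w (t - l) f * coord_scale j d t" by (simp add: mult.assoc)
  qed
  also have "\<dots> = (\<Sum>p\<le>t. sig k j t * qbin t p * string_coord r j d w p f * coord_scale j d t)"
    by (rule sum.reindex_bij_witness[of _ "\<lambda>p. t - p" "\<lambda>p. t - p"]) auto
  finally have "ip ((raise_op ^^ t) w) (phir r (Sop f)) = sig k j t * (\<Sum>p\<le>t. qbin t p * string_coord r j d w p f) * coord_scale j d t"
    by (simp add: sum_distrib_left sum_distrib_right mult.assoc)
  then show ?thesis unfolding string_coord_def[of _ _ _ _ t] using coord_scale_nz[of j d t] by simp
qed

text \<open>The normalisation was fitted to S, so a power of \<open>q\<close> linear in
  \<open>l\<close> stays behind for T. The sum stops at position \<open>d\<close> because the string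
  does.\<close>

lemma string_coord_Top:
  assumes Z: "vanish r f" and w: "annihilated (n - r) w" and e: "n - r = Suc e" and hom: "homog j w"
    and prim: "lower_op w = (\<lambda>A B. 0)" and nz: "w \<noteq> (\<lambda>A B. 0)" and r: "r = 2 * j + d" and td: "t \<le> d"
  shows "string_coord r j d w t (Top f) = sig k j (d - t) *
    (\<Sum>l\<le>d - t. q powi ((int k + 1 - int r + int j) * int l) * qbin (d - t) (d - t - l) * string_coord r j d w (t + l) f)"
proof -
  have rn: "r \<le> n" using e by simp
  have hom': "(raise_op ^^ t) w A B \<noteq> 0 \<Longrightarrow> dm A = j + t" for A B using raise_op_pow_dm[OF hom] .
  have i: "r - (j + t) = j + (d - t)" "j + t \<le> r" using r td by auto
  have "ip ((raise_op ^^ t) w) (phir r (Top f)) = (\<Sum>l\<le>r - (j + t). coefS (r - (j + t)) (n - (j + t)) l * ((-1) ^ l / qfact l) *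
      ip ((raise_op ^^ l) ((raise_op ^^ t) w)) (phir r f))"
    by (rule ip_phir_Top[OF Z rn annihilated_raise_op_pow[OF w] hom' i(2)])
  also have "\<dots> = (\<Sum>l\<le>j + (d - t). coefS (j + (d - t)) (n - (j + t)) l * ((-1) ^ l / qfact l) *
      ip ((raise_op ^^ (t + l)) w) (phir r f))"
    unfolding i by (simp add: funpow_add add.commute[of t])
  also have "\<dots> = (\<Sum>l\<le>d - t. coefS (j + (d - t)) (n - (j + t)) l * ((-1) ^ l / qfact l) *
      ip ((raise_op ^^ (t + l)) w) (phir r f))"
    using string_length(2)[OF assms(2-6)] r td
    by (intro sum.mono_neutral_right) (auto simp: ip_def)
  also have "\<dots> = (\<Sum>l\<le>d - t. sig k j (d - t) * (q powi ((int k + 1 - int r + int j) * int l) * qbin (d - t) (d - t - l) * string_coord r j d w (t + l) f) * coord_scale j d t)"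
  proof (rule sum.cong[OF refl])
    fix l assume "l \<in> {..d - t}"
    then have l: "l \<le> d - t" by simp
    define X where "X = ip ((raise_op ^^ (t + l)) w) (phir r f)"
    let ?i = "j + (d - t)"
    let ?P = "q powi (int (t + l) * int (t + l) - int t * int t - (2 * int k - int j) * int l)"
    have td': "int (d - t) = int d - int t" using td by simp
    have b: "int (n - (j + t)) = 3 * int k - int j - int t" using n_eq r td rn by simp
    have "ee k ?i - int ?i * int l + int l - int l * (int (n - (j + t)) - 2 * int k - int l)
       = ee k ?i + (int k + 1 - int r + int j) * int l + (int (t + l) * int (t + l) - int t * int t - (2 * int k - int j) * int l)"
      unfolding b of_nat_add td' r by (simp add: algebra_simps)
    then have key: "coefS ?i (n - (j + t)) l = sig k j (d - t) * q powi ((int k + 1 - int r + int j) * int l) * ?P"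
      using l by (subst coefS_powi, simp) (simp only: sig_def power_int_add q_nz simp_thms mult.assoc)
    have nz: "coord_scale j d (t + l) \<noteq> 0" "?P \<noteq> 0" "qfact (d - t) \<noteq> 0" "qfact (d - t - l) \<noteq> 0" "qfact l \<noteq> 0"
      using coord_scale_nz qfact_pos[of "d - t"] qfact_pos[of "d - t - l"] qfact_pos[of l] by auto
    have e1: "d - (t + l) + l = d - t" "d - (t + l) = d - t - l" using l by auto
    have "coord_scale j d t = (-1) ^ l * ?P * (qfact (d - t - l) / qfact (d - t)) * coord_scale j d (t + l)"
      using coord_scale_ratio[of l "t + l" d j] l td unfolding e1 by simp
    then have z: "string_coord r j d w (t + l) f * coord_scale j d t = (-1) ^ l * X * ?P * (qfact (d - t - l) / qfact (d - t))"
      unfolding string_coord_def X_def[symmetric] using nz by (simp add: field_simps)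
    have q1: "qbin (d - t) (d - t - l) = qfact (d - t) / (qfact (d - t - l) * qfact l)"
    proof -
      have "d - t - (d - t - l) = l" using l by simp
      then show ?thesis by (simp only: qbin_def diff_le_self if_True)
    qed
    have "coefS ?i (n - (j + t)) l * ((-1) ^ l / qfact l) * X =
      sig k j (d - t) * (q powi ((int k + 1 - int r + int j) * int l) * qbin (d - t) (d - t - l)) *
      ((-1) ^ l * X * ?P * (qfact (d - t - l) / qfact (d - t)))"
      unfolding key q1 using nz by (simp add: field_simps)
    then show "coefS ?i (n - (j + t)) l * ((-1) ^ l / qfact l) * ip ((raise_op ^^ (t + l)) w) (phir r f) =
      sig k j (d - t) * (q powi ((int k + 1 - int r + int j) * int l) * qbin (d - t) (d - t - l) * string_coord r j d w (t + l) f) * coord_scale j d t"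
      unfolding X_def[symmetric] z[symmetric] by (simp add: mult.assoc)
  qed
  finally have "ip ((raise_op ^^ t) w) (phir r (Top f)) = sig k j (d - t) *
    (\<Sum>l\<le>d - t. q powi ((int k + 1 - int r + int j) * int l) * qbin (d - t) (d - t - l) * string_coord r j d w (t + l) f) * coord_scale j d t"
    by (simp add: sum_distrib_left sum_distrib_right mult.assoc)
  then show ?thesis unfolding string_coord_def[of _ _ _ _ t] using coord_scale_nz[of j d t] by simp
qed

text \<open>Lower the layer of \<open>f\<close> to its last nonzero stage \<open>w0\<close>, reached
  after \<open>t\<close> steps, and let \<open>w\<close> be a homogeneous component of
  \<open>w0\<close>. By adjointness the pairing in the last claim is \<open>ip w w0\<close>, which
  equals \<open>ip w w\<close>.\<close>

lemma primitive_exists: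
  assumes Z: "vanish r f" and nZ: "\<not> vanish (Suc r) f" and r: "r \<le> n"
  obtains j w t where "annihilated (n - r) w" "homog j w" "lower_op w = (\<lambda>A B. 0)"
    "w \<noteq> (\<lambda>A B. 0)" "ip ((raise_op ^^ t) w) (phir r f) \<noteq> 0"
proof -
  define g where "g = phir r f"
  have ag: "annihilated (n - r) g" unfolding g_def by (rule annihilated_phir[OF Z r])
  obtain A B where "A \<preceq> B" "dm A + (n - dm B) < Suc r" "phi f A B \<noteq> 0"
    using Z nZ by (auto simp: vanish_def)
  moreover then have "\<not> dm A + (n - dm B) < r" using Z by (auto simp: vanish_def)
  ultimately have "g A B \<noteq> 0" by (simp add: g_def phir_def)
  then have g0: "g \<noteq> (\<lambda>A B. 0)" by auto
  have "(lower_op ^^ Suc n) g = (\<lambda>A B. 0)"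
    using lower_op_pow_dm[of "Suc n" g] by (intro ext) force
  then have ex: "\<exists>t. (lower_op ^^ t) g = (\<lambda>A B. 0)" by blast
  define t1 where "t1 = (LEAST t. (lower_op ^^ t) g = (\<lambda>A B. 0))"
  have t1: "(lower_op ^^ t1) g = (\<lambda>A B. 0)" unfolding t1_def by (rule LeastI_ex[OF ex])
  then obtain t where t: "t1 = Suc t" using g0 by (cases t1) auto
  define w0 where "w0 = (lower_op ^^ t) g"
  have w0: "w0 \<noteq> (\<lambda>A B. 0)" using not_less_Least[of t "\<lambda>t. (lower_op ^^ t) g = (\<lambda>A B. 0)"] t
    by (auto simp: w0_def t1_def)
  have Rw0: "lower_op w0 = (\<lambda>A B. 0)" using t1 t by (simp add: w0_def)
  have aw0: "annihilated (n - r) w0" unfolding w0_def by (rule annihilated_lower_op_pow[OF ag])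
  obtain A0 B0 where A0: "w0 A0 B0 \<noteq> 0" using w0 by (auto simp: fun_eq_iff)
  define j where "j = dm A0"
  define w where "w = (\<lambda>A B. if dm A = j then w0 A B else 0)"
  \<comment> \<open>Each vanishing condition involves values with one and the same dimension of the
    first argument, so it passes to homogeneous components.\<close>
  have aw: "annihilated (n - r) w"
    unfolding annihilated_def
  proof (intro conjI allI impI)
    fix A B assume "w A B \<noteq> 0"
    then have "w0 A B \<noteq> 0" by (auto simp: w_def split: if_splits)
    then show "A \<preceq> B" "dm B = dm A + (n - r)" using annihilated_supp[OF aw0] by blast+
  next
    fix A B assume AB: "A \<preceq> B" "dm B = Suc (dm A + (n - r))"
    show "(\<Sum>X | A \<preceq> X \<and> X \<lessdot> B. w A X) = 0"
      using annihilated_upper[OF aw0 AB] by (cases "dm A = j") (simp_all add: w_def)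
    have "(\<Sum>X | A \<lessdot> X \<and> X \<preceq> B. w X B) = (\<Sum>X | A \<lessdot> X \<and> X \<preceq> B. if Suc (dm A) = j then w0 X B else 0)"
      by (intro sum.cong refl) (auto simp: w_def cov_def)
    then show "(\<Sum>X | A \<lessdot> X \<and> X \<preceq> B. w X B) = 0"
      using annihilated_lower[OF aw0 AB] by (cases "Suc (dm A) = j") simp_all
  qed
  have Rw: "lower_op w A B = 0" for A B
  proof -
    have "lower_op w A B = (\<Sum>X\<in>UNIV. \<Sum>Y\<in>UNIV. (if Suc (dm A) = j then 1 else 0) *
       (if A \<lessdot> X \<and> X \<preceq> B \<and> B \<lessdot> Y then w0 X Y else 0))"
      unfolding lower_op_def by (intro sum.cong refl) (auto simp: w_def cov_def)
    also have "\<dots> = (if Suc (dm A) = j then 1 else 0) * lower_op w0 A B"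
      unfolding lower_op_def by (simp only: sum_distrib_left)
    finally show ?thesis unfolding Rw0 by simp
  qed
  have ip_pow: "ip ((raise_op ^^ l) u) h = ip u ((lower_op ^^ l) h)" for l u h
  proof (induction l arbitrary: h)
    case (Suc l)
    have "ip ((raise_op ^^ Suc l) u) h = ip (lower_op h) ((raise_op ^^ l) u)" by (simp add: ip_commute[of _ h] ip_raise_op)
    also have "\<dots> = ip u ((lower_op ^^ l) (lower_op h))" unfolding ip_commute[of "lower_op h"] Suc ..
    finally show ?case by (simp add: funpow_swap1)
  qed simp
  have "ip ((raise_op ^^ t) w) g = ip w w0" unfolding ip_pow w0_def ..
  also have "\<dots> = ip w w" unfolding ip_def by (intro sum.cong refl) (auto simp: w_def)
  finally have *: "ip ((raise_op ^^ t) w) g = ip w w" .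
  have wnz: "w \<noteq> (\<lambda>A B. 0)" using A0 by (auto simp: w_def j_def fun_eq_iff)
  then have "ip ((raise_op ^^ t) w) g \<noteq> 0" unfolding * using ip_self(2) by blast
  then have "ip ((raise_op ^^ t) w) (phir r f) \<noteq> 0" unfolding g_def .
  moreover have "homog j w" by (auto simp: homog_def w_def split: if_splits)
  moreover have "lower_op w = (\<lambda>A B. 0)" by (intro ext Rw)
  ultimately show thesis using that[OF aw] wnz by blast
qed

text \<open>An interval whose lower end has dimension above \<open>k\<close>, or whose upper end has
  codimension above \<open>k\<close>, contains no flag.\<close>

lemma string_coord_trunc:
  assumes "homog j w" and "annihilated (n - r) w" and "r \<le> n"
    and "j + t > k \<or> r - (j + t) > k"
  shows "string_coord r j d w t f = 0"
proof -
  have "(raise_op ^^ t) w A B * phir r f A B = 0" for A B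
  proof (rule ccontr)
    assume nz: "(raise_op ^^ t) w A B * phir r f A B \<noteq> 0"
    then have A: "dm A = j + t" using raise_op_pow_dm[OF assms(1)] by auto
    from nz have AB: "A \<preceq> B" "dm A + (n - dm B) = r" "phi f A B \<noteq> 0" by (auto simp: phir_def split: if_splits)
    have "{(L,P). flag L P \<and> A \<preceq> L \<and> P \<preceq> B} = {}"
    proof -
      have False if "flag L P" "A \<preceq> L" "P \<preceq> B" for L P
        using dm_mono[OF that(2)] dm_mono[OF that(3)] that(1) A AB assms(4) n_eq by (auto simp: flag_def)
      then show ?thesis by blast
    qed
    then have "phi f A B = 0" unfolding phi_def by (simp only: sum.empty)
    then show False using AB by simp
  qed
  then have "ip ((raise_op ^^ t) w) (phir r f) = 0" unfolding ip_def by (simp only: sum.neutral_const)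
  then show ?thesis unfolding string_coord_def by simp
qed

end

section \<open>Identities for Gaussian binomial coefficients\<close>

context qnum
begin

lemma qbin_0 [simp]: "qbin t 0 = 1" using qfact_pos[of t] by (simp add: qbin_def)
lemma qbin_self [simp]: "qbin t t = 1" using qfact_pos[of t] by (simp add: qbin_def)
lemma qbin_gt: "t < p \<Longrightarrow> qbin t p = 0" by (simp add: qbin_def)
lemma qbin_sym: "p \<le> t \<Longrightarrow> qbin t (t - p) = qbin t p" by (simp add: qbin_def mult.commute)

lemma qint_add: "qint (a + b) = qint a + q ^ a * qint b"
  by (simp add: qint_def diff_divide_distrib right_diff_distrib power_add)

lemma qbin_Suc_Suc: "qbin (Suc t) (Suc p) = qbin t p + q ^ Suc p * qbin t (Suc p)"
proof (cases "p < t")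
  case True
  then obtain m where m: "t = p + Suc m" using less_imp_Suc_add by fastforce
  have e1: "qbin (Suc t) (Suc p) = qfact (p + Suc (Suc m)) / (qfact (Suc p) * qfact (Suc m))"
    and e2: "qbin t p = qfact (p + Suc m) / (qfact p * qfact (Suc m))"
    and e3: "qbin t (Suc p) = qfact (p + Suc m) / (qfact (Suc p) * qfact m)"
    unfolding m by (simp_all add: qbin_def)
  have f: "qfact (p + Suc (Suc m)) = qint (Suc p + Suc m) * qfact (p + Suc m)"
    by (simp add: qfact_Suc)
  have nz: "qfact p \<noteq> 0" "qfact m \<noteq> 0" "qint (Suc p) \<noteq> 0" "qint (Suc m) \<noteq> 0"
    using qfact_pos[of p] qfact_pos[of m] qint_pos[of "Suc p"] qint_pos[of "Suc m"] by auto
  show ?thesis unfolding e1 e2 e3 f qint_add[of "Suc p" "Suc m"] qfact_Suc[of p] qfact_Suc[of m]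
    using nz by (simp add: field_simps)
next
  case False
  then show ?thesis by (cases "p = t") (simp_all add: qbin_gt)
qed

lemma qbin_Suc_Suc': "qbin (Suc t) (Suc p) = qbin t (Suc p) + q ^ (t - p) * qbin t p"
proof (cases "p < t")
  case True
  then obtain m where m: "t = p + Suc m" using less_imp_Suc_add by fastforce
  have e1: "qbin (Suc t) (Suc p) = qfact (p + Suc (Suc m)) / (qfact (Suc p) * qfact (Suc m))"
    and e2: "qbin t p = qfact (p + Suc m) / (qfact p * qfact (Suc m))"
    and e3: "qbin t (Suc p) = qfact (p + Suc m) / (qfact (Suc p) * qfact m)"
    unfolding m by (simp_all add: qbin_def)
  have f: "qfact (p + Suc (Suc m)) = qint (Suc m + Suc p) * qfact (p + Suc m)"
    by (simp add: qfact_Suc add_ac)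
  have g: "t - p = Suc m" using m by simp
  have nz: "qfact p \<noteq> 0" "qfact m \<noteq> 0" "qint (Suc p) \<noteq> 0" "qint (Suc m) \<noteq> 0"
    using qfact_pos[of p] qfact_pos[of m] qint_pos[of "Suc p"] qint_pos[of "Suc m"] by auto
  show ?thesis unfolding e1 e2 e3 f g qint_add[of "Suc m" "Suc p"] qfact_Suc[of p] qfact_Suc[of m]
    using nz by (simp add: field_simps)
next
  case False
  then show ?thesis by (cases "p = t") (simp_all add: qbin_gt)
qed

lemma qbin_mult: "p \<le> u \<Longrightarrow> u \<le> t \<Longrightarrow> qbin t u * qbin u p = qbin t p * qbin (t - p) (u - p)"
  using qfact_pos[of u] qfact_pos[of "t - p"] qfact_pos[of p] qfact_pos[of "t - u"] qfact_pos[of "u - p"]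
  by (simp add: qbin_def field_simps)

text \<open>The left side is the \<open>M\<close>-th q-difference of \<open>qbin t p\<close> in
  \<open>t\<close>. The first Pascal rule gives the recursion
  \<open>W (Suc M) t = W M (Suc t) - q ^ M * W M t\<close>, and the second Pascal rule evaluates
  it.\<close>

lemma sum_qbin_shift:
  "(\<Sum>l\<le>M. (-1) ^ (M - l) * q ^ ((M - l) choose 2) * qbin M l * qbin (t + l) p) =
    (if M \<le> p then q powi (int M * (int t + int M - int p)) * qbin t (p - M) else 0)"
proof (induction M arbitrary: t)
  case 0
  show ?case by (simp add: numeral_2_eq_2)
next
  case (Suc M)
  define W where "W M t = (\<Sum>l\<le>M. (-1) ^ (M - l) * q ^ ((M - l) choose 2) * qbin M l * qbin (t + l) p)" for M t
  have rec: "W (Suc M) t = W M (Suc t) - q ^ M * W M t"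
  proof -
    let ?c = "\<lambda>l. (-1) ^ (M - l) * q ^ ((M - l) choose 2)"
    have Sc: "Suc m choose 2 = m + (m choose 2)" for m by (simp add: numeral_2_eq_2)
    have "W (Suc M) t = (-1) ^ Suc M * q ^ (Suc M choose 2) * qbin t p +
      (\<Sum>l\<le>M. ?c l * qbin (Suc M) (Suc l) * qbin (t + Suc l) p)"
      unfolding W_def by (subst sum.atMost_Suc_shift) simp
    also have "(\<Sum>l\<le>M. ?c l * qbin (Suc M) (Suc l) * qbin (t + Suc l) p) =
      W M (Suc t) + (\<Sum>l\<le>M. ?c l * q ^ Suc l * qbin M (Suc l) * qbin (t + Suc l) p)"
      unfolding W_def qbin_Suc_Suc by (simp add: sum.distrib algebra_simps)
    also have "(\<Sum>l\<le>M. ?c l * q ^ Suc l * qbin M (Suc l) * qbin (t + Suc l) p) =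
      (\<Sum>l<M. ?c l * q ^ Suc l * qbin M (Suc l) * qbin (t + Suc l) p)"
      by (rule sum.mono_neutral_right) (auto simp: qbin_gt)
    also have "\<dots> = (\<Sum>l<M. - (q ^ M * ((-1) ^ (M - Suc l) * q ^ ((M - Suc l) choose 2) * qbin M (Suc l) * qbin (t + Suc l) p)))"
    proof (rule sum.cong[OF refl])
      fix l assume "l \<in> {..<M}"
      then obtain m where m: "M = Suc (m + l)" using less_imp_Suc_add by (metis add.commute lessThan_iff)
      have 1: "M - l = Suc m" "M - Suc l = m" using m by auto
      have qM: "q ^ M = q * (q ^ m * q ^ l)" using m by (simp add: power_add)
      show "?c l * q ^ Suc l * qbin M (Suc l) * qbin (t + Suc l) p =
        - (q ^ M * ((-1) ^ (M - Suc l) * q ^ ((M - Suc l) choose 2) * qbin M (Suc l) * qbin (t + Suc l) p))"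
        unfolding 1 Sc qM power_add power_Suc by (simp add: mult_ac)
    qed
    also have "\<dots> = - (q ^ M * (W M t - (-1) ^ M * q ^ (M choose 2) * qbin t p))"
      unfolding W_def by (subst sum.atMost_shift) (simp add: sum_distrib_left sum_negf algebra_simps)
    finally show ?thesis unfolding Sc power_add by (simp add: algebra_simps)
  qed
  show ?case
  proof (cases "Suc M \<le> p")
    case True
    define u where "u = p - Suc M"
    have u: "p - M = Suc u" "p = Suc M + u" using True by (auto simp: u_def)
    have a: "W M t' = q powi (int M * (int t' + int M - int p)) * qbin t' (Suc u)" for t'
      using Suc[of t'] True unfolding W_def u by simp
    show ?thesis
    proof (cases "u \<le> t")
      case False
      then have "W (Suc M) t = 0" unfolding rec a by (simp add: qbin_gt)
      then show ?thesis using False u True unfolding W_def by (simp add: qbin_gt)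
    next
      case ut: True
      have s: "int M * (int (Suc t) + int M - int p) = int M * (int t + int M - int p) + int M"
        by (simp add: algebra_simps)
      define x where "x = q powi (int M * (int t + int M - int p))"
      have xM: "q powi (int M * (int t + int M - int p) + int M) = x * q ^ M"
        by (simp only: x_def power_int_add q_nz simp_thms power_int_of_nat)
      have "W (Suc M) t = q powi (int M * (int t + int M - int p)) * q ^ M * (qbin (Suc t) (Suc u) - qbin t (Suc u))"
        unfolding rec a s xM x_def[symmetric] by (simp add: algebra_simps)
      also have "\<dots> = q powi (int M * (int t + int M - int p)) * q ^ M * q ^ (t - u) * qbin t u"
        unfolding qbin_Suc_Suc' by simp
      also have "q powi (int M * (int t + int M - int p)) * q ^ M * q ^ (t - u) =
        q powi (int M * (int t + int M - int p) + int M + int (t - u))"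
        by (simp add: power_int_add)
      also have "int M * (int t + int M - int p) + int M + int (t - u) = int (Suc M) * (int t + int (Suc M) - int p)"
        using ut u(2) by (simp add: of_nat_diff algebra_simps)
      finally show ?thesis using True unfolding W_def u_def[symmetric] by simp
    qed
  next
    case False
    show ?thesis
    proof (cases "M = p")
      case True
      then have "W M t' = q powi (int M * int t')" for t'
        using Suc[of t'] unfolding W_def by simp
      then have "W (Suc M) t = 0" unfolding rec by (simp add: power_int_add distrib_left)
      then show ?thesis using False unfolding W_def by simp
    next
      case neq: False
      then have "W M t' = 0" for t' using Suc[of t'] False unfolding W_def by simp
      then have "W (Suc M) t = 0" unfolding rec by simp
      then show ?thesis using False unfolding W_def by simp
    qed
  qed
qed

lemma sum_qbin_alternating: "(\<Sum>l\<le>M. (-1) ^ l * q ^ (l choose 2) * qbin M l) = (if M = 0 then 1 else 0)"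
proof -
  have "(\<Sum>l\<le>M. (-1) ^ l * q ^ (l choose 2) * qbin M l) = (\<Sum>l\<le>M. (-1) ^ (M - l) * q ^ ((M - l) choose 2) * qbin M l * qbin (0 + l) 0)"
    by (rule sum.reindex_bij_witness[of _ "\<lambda>l. M - l" "\<lambda>l. M - l"]) (auto simp: qbin_sym)
  then show ?thesis unfolding sum_qbin_shift by auto
qed

text \<open>Gaussian inversion: after \<open>qbin_mult\<close> only the alternating row sum
  \<open>sum_qbin_alternating\<close> is left.\<close>

lemma qbin_inversion:
  "(\<Sum>u=p..t. (-1) ^ (u - p) * q ^ ((u - p) choose 2) * qbin t u * qbin u p) = (if t = p then 1 else 0)"
proof (cases "p \<le> t")
  case True
  have "(\<Sum>u=p..t. (-1) ^ (u - p) * q ^ ((u - p) choose 2) * qbin t u * qbin u p) =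
    (\<Sum>u=p..t. qbin t p * ((-1) ^ (u - p) * q ^ ((u - p) choose 2) * qbin (t - p) (u - p)))"
    by (intro sum.cong refl) (simp add: qbin_mult[symmetric] mult_ac)
  also have "\<dots> = (\<Sum>l\<le>t - p. qbin t p * ((-1) ^ l * q ^ (l choose 2) * qbin (t - p) l))"
    by (rule sum.reindex_bij_witness[of _ "\<lambda>l. l + p" "\<lambda>u. u - p"]) (use True in auto)
  finally show ?thesis unfolding sum_distrib_left[symmetric] sum_qbin_alternating using True by auto
qed simp

lemma choose_2_add: "(a + b) choose 2 = (a choose 2) + (b choose 2) + a * b"
proof (induction b)
  case (Suc b)
  have "Suc m choose 2 = m + (m choose 2)" for m by (simp add: numeral_2_eq_2)
  then show ?case using Suc by simp
qed (simp add: numeral_2_eq_2)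

lemma ee_add: "ee k (i + l) = ee k i - int k * int l + int i * int l + int (l choose 2)"
  unfolding ee_def choose_2_add by (simp add: algebra_simps)

lemma sig_add: "sig k j (t + l) = sig k j t * ((-1) ^ l * q powi (int (j + t) * int l - int k * int l + int (l choose 2)))"
proof -
  have "ee k (j + (t + l)) = ee k (j + t) + (int (j + t) * int l - int k * int l + int (l choose 2))"
    using ee_add[of k "j + t" l] by (simp add: add.assoc)
  then show ?thesis unfolding sig_def by (simp only: power_int_add q_nz simp_thms add.assoc[symmetric] power_add) simp
qed

lemma sig_nz: "sig k j t \<noteq> 0" by (simp add: sig_def)

text \<open>Equal absolute values with \<open>s \<noteq> t\<close> force
  \<open>2 * j + s + t = 2 * k + 1\<close>; then \<open>s + t\<close> is odd and the signs
  differ.\<close>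

lemma sig_inj:
  assumes "sig k j s = sig k j t" shows "s = t"
proof (rule ccontr)
  assume "s \<noteq> t"
  have abs: "\<bar>sig k j u\<bar> = q powi ee k (j + u)" for u
    by (simp add: sig_def abs_mult power_abs abs_of_pos[OF zero_less_power_int[OF q_nz(2)]])
  have "q powi ee k (j + s) = q powi ee k (j + t)" unfolding abs[symmetric] assms ..
  then have e: "ee k (j + s) = ee k (j + t)"
    using q_gt_1 power_int_strict_increasing[of "ee k (j + s)" "ee k (j + t)" q]
      power_int_strict_increasing[of "ee k (j + t)" "ee k (j + s)" q] by linarith
  have "2 * ee k (j + s) = 2 * ee k (j + t)" using e by simp
  then have "(int s - int t) * (2 * int j + int s + int t - 2 * int k - 1) = 0"
    unfolding ee_def distrib_left two_choose_2 by (simp add: algebra_simps)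
  then have "2 * int j + int s + int t = 2 * int k + 1" using \<open>s \<noteq> t\<close> by auto
  then have o: "odd ((j + s) + (j + t))" by presburger
  have "(-1 :: real) ^ (j + s) = (-1) ^ (j + t)" using assms e by (simp add: sig_def)
  then have "(-1 :: real) ^ ((j + s) + (j + t)) = (-1) ^ (j + t) * (-1) ^ (j + t)" by (simp add: power_add)
  also have "\<dots> = 1" by (simp flip: power_mult_distrib)
  finally show False using o by simp
qed

text \<open>Shows \<open>qbin t p\<close> as a polynomial of degree \<open>p\<close> in
  \<open>q ^ t\<close>, the form that \<open>zero_of_interpolation\<close> needs.\<close>

lemma qbin_poly: "qbin t p = (\<Prod>u<p. (q ^ t - q ^ u) / (q ^ p - q ^ u))"
proof (cases "p \<le> t")
  case False
  then have "t \<in> {..<p}" by simp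
  then have "(\<Prod>u<p. (q ^ t - q ^ u) / (q ^ p - q ^ u)) = 0" by (intro prod_zero) auto
  then show ?thesis using False by (simp add: qbin_gt)
next
  case True
  have P: "(\<Prod>u<p. (q ^ t - q ^ u)) * qfact (t - p) = (\<Prod>u<p. q ^ u * (q - 1)) * qfact t" if "p \<le> t" for p t
    using that
  proof (induction p)
    case (Suc p)
    have 1: "t - p = Suc (t - Suc p)" using Suc.prems by simp
    have "q ^ t = q ^ p * q ^ (t - p)" using Suc.prems by (simp flip: power_add)
    then have 2: "q ^ t - q ^ p = q ^ p * (q - 1) * qint (t - p)"
      using q_gt_1 by (simp add: qint_def field_simps)
    have "(\<Prod>u<Suc p. (q ^ t - q ^ u)) * qfact (t - Suc p) = (\<Prod>u<p. (q ^ t - q ^ u)) * qfact (t - p) * (q ^ p * (q - 1))"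
      unfolding 1 qfact_Suc prod.lessThan_Suc 2[unfolded 1] by (simp add: mult_ac)
    also have "\<dots> = (\<Prod>u<p. q ^ u * (q - 1)) * qfact t * (q ^ p * (q - 1))" using Suc by simp
    finally show ?case by (simp add: mult_ac)
  qed simp
  have nz: "(\<Prod>u<p. q ^ u * (q - 1)) \<noteq> 0" using q_gt_1 by simp
  show ?thesis unfolding prod_dividef qbin_def using True P[OF True] P[of p p] nz qfact_pos[of p] qfact_pos[of "t - p"]
    by (simp add: field_simps)
qed

end

section \<open>The braid relation\<close>

lemma sum_flip: "(\<Sum>l\<le>m. f (m - l)) = (\<Sum>l\<le>m. f l)" for f :: "nat \<Rightarrow> real"
  by (rule sum.reindex_bij_witness[of _ "\<lambda>l. m - l" "\<lambda>l. m - l"]) auto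

text \<open>The coordinates \<open>z 0, \<dots>, z d\<close> are those along a string of length \<open>d + 1\<close>; they embed \<open>E\<close>, but
  are in general not independent on \<open>E\<close>.\<close>

locale strmod = qnum q for q +
  fixes k r j d :: nat and E :: "'v::euclidean_space set" and S T :: "'v \<Rightarrow> 'v" and z :: "nat \<Rightarrow> 'v \<Rightarrow> real"
  assumes subE: "subspace E"
    and linS: "linear S" and linT: "linear T" and linz: "linear (z t)"
    and SE: "v \<in> E \<Longrightarrow> S v \<in> E" and TE: "v \<in> E \<Longrightarrow> T v \<in> E"
    and r_eq: "r = 2 * j + d" and r_le: "r \<le> 2 * k"
    and zS: "v \<in> E \<Longrightarrow> t \<le> d \<Longrightarrow> z t (S v) = sig k j t * (\<Sum>p\<le>t. qbin t p * z p v)"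
    and zT: "v \<in> E \<Longrightarrow> t \<le> d \<Longrightarrow> z t (T v) = sig k j (d - t) *
      (\<Sum>l\<le>d - t. q powi ((int k + 1 - int r + int j) * int l) * qbin (d - t) (d - t - l) * z (t + l) v)"
    and z_inj: "v \<in> E \<Longrightarrow> (\<And>t. t \<le> d \<Longrightarrow> z t v = 0) \<Longrightarrow> v = 0"
    and z_trunc: "v \<in> E \<Longrightarrow> t \<le> d \<Longrightarrow> j + t > k \<or> r - (j + t) > k \<Longrightarrow> z t v = 0"
begin

abbreviation gg :: int where "gg \<equiv> int k + 1 - int r + int j"

definition e0 :: int where "e0 = 3 * ee k j - int k * int d + int j * int d"

lemma powi_mult: "q powi a * q powi b = q powi (a + b)"
  by (simp add: power_int_add)

lemma z_lin: "z t (a + b) = z t a + z t b" "z t (c *\<^sub>R a) = c * z t a" "z t 0 = 0" "z t (a - b) = z t a - z t b"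
  "z t (\<Sum>i\<in>I. f i) = (\<Sum>i\<in>I. z t (f i))"
  using linz[of t] by (simp_all add: linear_add linear_scale linear_0 linear_diff linear_sum)

lemma z_eqI: "u \<in> E \<Longrightarrow> v \<in> E \<Longrightarrow> (\<And>t. t \<le> d \<Longrightarrow> z t u = z t v) \<Longrightarrow> u = v"
  using z_inj[of "u - v"] subE by (auto simp: subspace_diff z_lin)

text \<open>The signs and powers that T and S contribute at position \<open>t + l\<close> are those
  of a q-difference of order \<open>d - t\<close>, so \<open>sum_qbin_shift\<close> evaluates the
  sum over \<open>l\<close>.\<close>

lemma zTS:
  assumes v: "v \<in> E" and t: "t \<le> d"
  shows "z t (T (S v)) = sig k j (d - t) * sig k j t * (-1) ^ (d - t) * q powi (- int ((d - t) choose 2)) *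
    (\<Sum>u\<le>t. q powi (int (d - t) * int (t - u)) * qbin t u * z (d - t + u) v)"
proof -
  define M where "M = d - t"
  have M: "d = t + M" using t by (simp add: M_def)
  have coef: "q powi (gg * int l) * ((-1) ^ l * q powi (int (j + t) * int l - int k * int l + int (l choose 2))) =
     (-1) ^ M * q powi (- int (M choose 2)) * ((-1) ^ (M - l) * q ^ ((M - l) choose 2))" if l: "l \<le> M" for l
  proof -
    have c: "M choose 2 = ((M - l) choose 2) + (l choose 2) + (M - l) * l"
      using choose_2_add[of "M - l" l] l by simp
    have "int (M choose 2) = int ((M - l) choose 2) + int (l choose 2) + (int M - int l) * int l"
      by (simp only: c of_nat_add of_nat_mult of_nat_diff[OF l])
    then have e: "gg * int l + (int (j + t) * int l - int k * int l + int (l choose 2)) = - int (M choose 2) + int ((M - l) choose 2)"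
      using two_choose_2[of l] unfolding r_eq M by (simp add: algebra_simps)
    have s: "(-1 :: real) ^ l = (-1) ^ M * (-1) ^ (M - l)"
    proof -
      have "(-1 :: real) ^ M = (-1) ^ (M - l) * (-1) ^ l" using l by (simp flip: power_add)
      then show ?thesis by (simp add: minus_one_power_sq mult.commute mult.left_commute)
    qed
    have "q powi (gg * int l) * ((-1) ^ l * q powi (int (j + t) * int l - int k * int l + int (l choose 2))) =
      (-1) ^ l * (q powi (gg * int l) * q powi (int (j + t) * int l - int k * int l + int (l choose 2)))" by simp
    also have "\<dots> = (-1) ^ l * (q powi (- int (M choose 2)) * q powi int ((M - l) choose 2))"
      unfolding powi_mult e ..
    finally show ?thesis unfolding s power_int_of_nat by (simp add: mult_ac)
  qed
  have "z t (T (S v)) = sig k j M * (\<Sum>l\<le>M. q powi (gg * int l) * qbin M l * z (t + l) (S v))"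
    unfolding zT[OF SE[OF v] t] M_def[symmetric] by (simp add: qbin_sym)
  also have "(\<Sum>l\<le>M. q powi (gg * int l) * qbin M l * z (t + l) (S v)) =
    (\<Sum>l\<le>M. \<Sum>p\<le>d. sig k j t * (-1) ^ M * q powi (- int (M choose 2)) * z p v *
      ((-1) ^ (M - l) * q ^ ((M - l) choose 2) * qbin M l * qbin (t + l) p))"
  proof (rule sum.cong[OF refl])
    fix l assume "l \<in> {..M}"
    then have l: "l \<le> M" by simp
    have "(\<Sum>p\<le>t + l. qbin (t + l) p * z p v) = (\<Sum>p\<le>d. qbin (t + l) p * z p v)"
      by (rule sum.mono_neutral_left) (use l M in \<open>auto simp: qbin_gt\<close>)
    then have zs: "z (t + l) (S v) = sig k j (t + l) * (\<Sum>p\<le>d. qbin (t + l) p * z p v)"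
      using zS[OF v, of "t + l"] l M by simp
    have "q powi (gg * int l) * qbin M l * z (t + l) (S v) = sig k j t * (q powi (gg * int l) *
      ((-1) ^ l * q powi (int (j + t) * int l - int k * int l + int (l choose 2)))) * qbin M l * (\<Sum>p\<le>d. qbin (t + l) p * z p v)"
      unfolding zs sig_add by (simp only: mult_ac)
    also have "\<dots> = (\<Sum>p\<le>d. sig k j t * (-1) ^ M * q powi (- int (M choose 2)) * z p v *
      ((-1) ^ (M - l) * q ^ ((M - l) choose 2) * qbin M l * qbin (t + l) p))"
      unfolding coef[OF l] sum_distrib_left by (intro sum.cong refl) (simp only: mult_ac)
    finally show "q powi (gg * int l) * qbin M l * z (t + l) (S v) = (\<Sum>p\<le>d. sig k j t * (-1) ^ M * q powi (- int (M choose 2)) * z p v *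
      ((-1) ^ (M - l) * q ^ ((M - l) choose 2) * qbin M l * qbin (t + l) p))" .
  qed
  also have "\<dots> = (\<Sum>p\<le>d. sig k j t * (-1) ^ M * q powi (- int (M choose 2)) * z p v *
     (\<Sum>l\<le>M. (-1) ^ (M - l) * q ^ ((M - l) choose 2) * qbin M l * qbin (t + l) p))"
    by (subst sum.swap) (simp only: sum_distrib_left)
  also have "\<dots> = (\<Sum>p\<in>{M..d}. sig k j t * (-1) ^ M * q powi (- int (M choose 2)) * z p v *
     (q powi (int M * (int t + int M - int p)) * qbin t (p - M)))"
    unfolding sum_qbin_shift by (rule sum.mono_neutral_cong_right) auto
  also have "\<dots> = (\<Sum>u\<le>t. sig k j t * (-1) ^ M * q powi (- int (M choose 2)) * (q powi (int M * int (t - u)) * qbin t u * z (M + u) v))"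
    by (rule sum.reindex_bij_witness[of _ "\<lambda>u. M + u" "\<lambda>p. p - M"]) (auto simp: M mult_ac of_nat_diff)
  finally show ?thesis unfolding M_def[symmetric] by (simp only: sum_distrib_left mult_ac)
qed

text \<open>Simplifies the factor in \<open>zTS\<close>: the exponents at \<open>u\<close> and at
  \<open>d - u\<close> combine so that only \<open>u choose 2\<close> depends on
  \<open>u\<close>.\<close>

lemma kappa: assumes "u \<le> d"
  shows "sig k j (d - u) * sig k j u * (-1) ^ (d - u) * q powi (- int ((d - u) choose 2)) =
    (-1) ^ u * q powi (2 * ee k j - int k * int d + int j * int d + int (u choose 2))"
proof -
  have s: "(-1 :: real) ^ (j + (d - u)) * (-1) ^ (j + u) * (-1) ^ (d - u) = (-1) ^ u"
  proof -
    have "j + (d - u) + (j + u) + (d - u) = 2 * (j + (d - u)) + u" by simp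
    then have "(-1 :: real) ^ (j + (d - u)) * (-1) ^ (j + u) * (-1) ^ (d - u) = (-1) ^ (2 * (j + (d - u)) + u)"
      by (simp only: power_add[symmetric])
    then show ?thesis by (simp add: power_add power_mult)
  qed
  have e: "ee k (j + (d - u)) + ee k (j + u) + - int ((d - u) choose 2) =
     2 * ee k j - int k * int d + int j * int d + int (u choose 2)"
    unfolding ee_add using assms by (simp add: of_nat_diff algebra_simps)
  have "sig k j (d - u) * sig k j u * (-1) ^ (d - u) * q powi (- int ((d - u) choose 2)) =
    ((-1) ^ (j + (d - u)) * (-1) ^ (j + u) * (-1) ^ (d - u)) *
    (q powi ee k (j + (d - u)) * q powi ee k (j + u) * q powi (- int ((d - u) choose 2)))"
    unfolding sig_def by (simp only: mult_ac)
  then show ?thesis unfolding s powi_mult e .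
qed

definition D :: "'v \<Rightarrow> 'v" where "D v = S (T (S v))"

lemma DE: "v \<in> E \<Longrightarrow> D v \<in> E" by (simp add: D_def SE TE)

text \<open>Inserting \<open>zTS\<close> into the formula for S produces the Gaussian binomial
  matrix times its signed inverse, so a single term survives: \<open>D\<close> reverses the string
  up to scalars.\<close>

lemma zD:
  assumes v: "v \<in> E" and t: "t \<le> d"
  shows "z t (D v) = (-1) ^ j * q powi (e0 - gg * int t) * z (d - t) v"
proof -
  define Q where "Q = 2 * ee k j - int k * int d + int j * int d"
  have pick: "(\<Sum>p\<le>t. F p * (if t = p then 1 else 0)) = F t" for F :: "nat \<Rightarrow> real"
  proof -
    have "(\<Sum>p\<le>t. F p * (if t = p then 1 else 0)) = (\<Sum>p\<le>t. if t = p then F p else 0)"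
      by (intro sum.cong) auto
    then show ?thesis by simp
  qed
  have zts: "z u (T (S v)) = (\<Sum>p\<le>t. (-1) ^ p * q powi (Q + int (p choose 2) + int d * int p - int p * int p) * z (d - p) v *
     ((-1) ^ (u - p) * q ^ ((u - p) choose 2) * (if p \<le> u then qbin u p else 0)))" if u: "u \<le> t" for u
  proof -
    have ud: "u \<le> d" using u t by simp
    have "z u (T (S v)) = (-1) ^ u * q powi (Q + int (u choose 2)) *
      (\<Sum>s\<le>u. q powi (int (d - u) * int (u - s)) * qbin u s * z (d - u + s) v)"
      unfolding zTS[OF v ud] kappa[OF ud] Q_def ..
    also have "(\<Sum>s\<le>u. q powi (int (d - u) * int (u - s)) * qbin u s * z (d - u + s) v) =
      (\<Sum>p\<le>u. q powi (int (d - u) * int p) * qbin u p * z (d - p) v)"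
      by (rule sum.reindex_bij_witness[of _ "\<lambda>p. u - p" "\<lambda>s. u - s"]) (use ud in \<open>auto simp: qbin_sym\<close>)
    also have "(-1) ^ u * q powi (Q + int (u choose 2)) * \<dots> =
      (\<Sum>p\<le>u. (-1) ^ p * q powi (Q + int (p choose 2) + int d * int p - int p * int p) * z (d - p) v *
       ((-1) ^ (u - p) * q ^ ((u - p) choose 2) * (if p \<le> u then qbin u p else 0)))"
      unfolding sum_distrib_left
    proof (rule sum.cong[OF refl])
      fix p assume "p \<in> {..u}"
      then have p: "p \<le> u" by simp
      have c: "u choose 2 = ((u - p) choose 2) + (p choose 2) + (u - p) * p"
        using choose_2_add[of "u - p" p] p by simp
      have "int (u choose 2) = int ((u - p) choose 2) + int (p choose 2) + (int u - int p) * int p"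
        by (simp only: c of_nat_add of_nat_mult of_nat_diff[OF p])
      then have e: "Q + int (u choose 2) + int (d - u) * int p = Q + int (p choose 2) + int d * int p - int p * int p + int ((u - p) choose 2)"
        using p ud by (simp add: of_nat_diff algebra_simps)
      have s: "(-1 :: real) ^ u = (-1) ^ p * (-1) ^ (u - p)" using p by (simp flip: power_add)
      have "(-1) ^ u * q powi (Q + int (u choose 2)) * (q powi (int (d - u) * int p) * qbin u p * z (d - p) v) =
        (-1) ^ u * (q powi (Q + int (u choose 2)) * q powi (int (d - u) * int p)) * qbin u p * z (d - p) v"
        by (simp only: mult_ac)
      also have "\<dots> = (-1) ^ u * (q powi (Q + int (p choose 2) + int d * int p - int p * int p) * q powi int ((u - p) choose 2)) * qbin u p * z (d - p) v"
        unfolding powi_mult e ..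
      finally show "(-1) ^ u * q powi (Q + int (u choose 2)) * (q powi (int (d - u) * int p) * qbin u p * z (d - p) v) =
        (-1) ^ p * q powi (Q + int (p choose 2) + int d * int p - int p * int p) * z (d - p) v *
        ((-1) ^ (u - p) * q ^ ((u - p) choose 2) * (if p \<le> u then qbin u p else 0))"
        unfolding s power_int_of_nat using p by (simp add: mult_ac)
    qed
    also have "\<dots> = (\<Sum>p\<le>t. (-1) ^ p * q powi (Q + int (p choose 2) + int d * int p - int p * int p) * z (d - p) v *
       ((-1) ^ (u - p) * q ^ ((u - p) choose 2) * (if p \<le> u then qbin u p else 0)))"
      by (rule sum.mono_neutral_left) (use u in auto)
    finally show ?thesis .
  qed
  have "z t (D v) = sig k j t * (\<Sum>u\<le>t. qbin t u * z u (T (S v)))"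
    unfolding D_def by (rule zS[OF TE[OF SE[OF v]] t])
  also have "(\<Sum>u\<le>t. qbin t u * z u (T (S v))) = (\<Sum>u\<le>t. \<Sum>p\<le>t.
     (-1) ^ p * q powi (Q + int (p choose 2) + int d * int p - int p * int p) * z (d - p) v *
     ((-1) ^ (u - p) * q ^ ((u - p) choose 2) * qbin t u * (if p \<le> u then qbin u p else 0)))"
    by (intro sum.cong refl) (simp add: zts sum_distrib_left mult_ac)
  also have "\<dots> = (\<Sum>p\<le>t. (-1) ^ p * q powi (Q + int (p choose 2) + int d * int p - int p * int p) * z (d - p) v *
     (\<Sum>u\<le>t. (-1) ^ (u - p) * q ^ ((u - p) choose 2) * qbin t u * (if p \<le> u then qbin u p else 0)))"
    by (subst sum.swap) (simp only: sum_distrib_left)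
  also have "\<dots> = (\<Sum>p\<le>t. (-1) ^ p * q powi (Q + int (p choose 2) + int d * int p - int p * int p) * z (d - p) v *
     (if t = p then 1 else 0))"
  proof (intro sum.cong refl arg_cong2[of _ _ _ _ times])
    fix p assume "p \<in> {..t}"
    have "(\<Sum>u\<le>t. (-1) ^ (u - p) * q ^ ((u - p) choose 2) * qbin t u * (if p \<le> u then qbin u p else 0)) =
      (\<Sum>u=p..t. (-1) ^ (u - p) * q ^ ((u - p) choose 2) * qbin t u * qbin u p)"
      by (rule sum.mono_neutral_cong_right) auto
    then show "(\<Sum>u\<le>t. (-1) ^ (u - p) * q ^ ((u - p) choose 2) * qbin t u * (if p \<le> u then qbin u p else 0)) = (if t = p then 1 else 0)"
      unfolding qbin_inversion .
  qed
  also have "\<dots> = (-1) ^ t * q powi (Q + int (t choose 2) + int d * int t - int t * int t) * z (d - t) v"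
    unfolding pick ..
  also have "sig k j t * \<dots> = ((-1) ^ (j + t) * (-1) ^ t) * (q powi ee k (j + t) *
     q powi (Q + int (t choose 2) + int d * int t - int t * int t)) * z (d - t) v"
    unfolding sig_def by (simp only: mult_ac)
  also have "(-1 :: real) ^ (j + t) * (-1) ^ t = (-1) ^ j"
    by (simp add: power_add mult.assoc minus_one_power_sq[of t 1, simplified])
  also have "q powi ee k (j + t) * q powi (Q + int (t choose 2) + int d * int t - int t * int t) = q powi (e0 - gg * int t)"
  proof -
    have "ee k (j + t) + (Q + int (t choose 2) + int d * int t - int t * int t) = e0 - gg * int t"
      unfolding ee_add Q_def e0_def r_eq using two_choose_2[of t] by (simp add: algebra_simps)
    then show ?thesis unfolding powi_mult by (simp only:)
  qed
  finally show ?thesis .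
qed

text \<open>Reversal turns the lower triangle of S into the upper triangle of T, and the weights of
  \<open>D\<close> produce exactly the powers \<open>q powi (gg * int l)\<close> by which T differs
  from a mirrored S.\<close>

lemma DS_TD: assumes v: "v \<in> E" shows "D (S v) = T (D v)"
proof (rule z_eqI)
  show "D (S v) \<in> E" "T (D v) \<in> E" using v by (simp_all add: DE SE TE)
  fix t assume t: "t \<le> d"
  have "z t (D (S v)) = (-1) ^ j * q powi (e0 - gg * int t) * (sig k j (d - t) * (\<Sum>p\<le>d - t. qbin (d - t) p * z p v))"
    unfolding zD[OF SE[OF v] t] by (subst zS[OF v]) auto
  also have "(\<Sum>p\<le>d - t. qbin (d - t) p * z p v) = (\<Sum>l\<le>d - t. qbin (d - t) (d - t - l) * z (d - t - l) v)"
    by (rule sum_flip[symmetric, of "\<lambda>p. qbin (d - t) p * z p v"])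
  finally have 1: "z t (D (S v)) = (-1) ^ j * q powi (e0 - gg * int t) * (sig k j (d - t) * (\<Sum>l\<le>d - t. qbin (d - t) (d - t - l) * z (d - t - l) v))" .
  have "z t (T (D v)) = sig k j (d - t) * (\<Sum>l\<le>d - t. (-1) ^ j * q powi (e0 - gg * int t) * (qbin (d - t) (d - t - l) * z (d - t - l) v))"
    unfolding zT[OF DE[OF v] t]
  proof (rule arg_cong[where f="\<lambda>x. sig k j (d - t) * x"], rule sum.cong[OF refl])
    fix l assume "l \<in> {..d - t}"
    then have l: "t + l \<le> d" using t by simp
    have "gg * int l + (e0 - gg * int (t + l)) = e0 - gg * int t" by (simp add: algebra_simps)
    then have p: "q powi (gg * int l) * q powi (e0 - gg * int (t + l)) = q powi (e0 - gg * int t)" by (simp only: powi_mult)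
    have "d - (t + l) = d - t - l" by simp
    then show "q powi (gg * int l) * qbin (d - t) (d - t - l) * z (t + l) (D v) =
       (-1) ^ j * q powi (e0 - gg * int t) * (qbin (d - t) (d - t - l) * z (d - t - l) v)"
      unfolding zD[OF DE[OF v] l] zD[OF v l] p[symmetric] by (simp add: mult_ac)
  qed
  then show "z t (D (S v)) = z t (T (D v))" unfolding 1 by (simp add: sum_distrib_left mult_ac)
qed

lemma S_inj: assumes v: "v \<in> E" and "S v = 0" shows "v = 0"
proof (rule z_inj[OF v])
  fix t show "t \<le> d \<Longrightarrow> z t v = 0"
  proof (induction t rule: less_induct)
    case (less t)
    have "(\<Sum>p\<le>t. qbin t p * z p v) = (\<Sum>p\<in>{t}. qbin t p * z p v)"
      by (rule sum.mono_neutral_right) (use less in auto)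
    then have "z t (S v) = sig k j t * z t v" using zS[OF v less.prems] by simp
    then show ?case using assms(2) sig_nz[of k j t] by (simp add: z_lin)
  qed
qed

lemma S_image: "S ` E = E"
proof -
  have "inj_on S E"
  proof (rule inj_onI)
    fix x y assume "x \<in> E" "y \<in> E" "S x = S y"
    then have "x - y \<in> E" "S (x - y) = 0" using subE linS by (simp_all add: subspace_diff linear_diff)
    then show "x = y" using S_inj by fastforce
  qed
  then have "inj_on S (span E)" unfolding span_eq_iff[THEN iffD2, OF subE] .
  then have "dim (S ` E) = dim E" using linS by (intro dim_image_eq)
  moreover have "S ` E \<subseteq> E" using SE by auto
  moreover have "subspace (S ` E)" using linS subE by (rule linear_subspace_image)
  ultimately show ?thesis using subE by (intro subspace_dim_equal) auto
qed

text \<open>\<open>DS_TD\<close> reads STSS = TSTS, and S can be cancelled on the right because it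
  maps \<open>E\<close> onto \<open>E\<close>.\<close>

lemma braid: assumes v: "v \<in> E" shows "T (S (T v)) = D v"
proof -
  obtain w where w: "w \<in> E" "v = S w" using v S_image by blast
  show ?thesis using DS_TD[OF w(1)] unfolding w(2) by (simp add: D_def)
qed

definition s_exp :: int where "s_exp = 2 * e0 - gg * int d"

text \<open>Reversing twice: the exponents at \<open>t\<close> and at \<open>d - t\<close> add up to
  a constant.\<close>

lemma D_D: assumes v: "v \<in> E" shows "D (D v) = (q powi s_exp) *\<^sub>R v"
proof (rule z_eqI)
  show "D (D v) \<in> E" "(q powi s_exp) *\<^sub>R v \<in> E" using v subE by (simp_all add: DE subspace_scale)
  fix t assume t: "t \<le> d"
  have "e0 - gg * int t + (e0 - gg * int (d - t)) = s_exp"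
    using t by (simp add: s_exp_def of_nat_diff algebra_simps)
  then have p: "q powi (e0 - gg * int t) * q powi (e0 - gg * int (d - t)) = q powi s_exp" by (simp only: powi_mult)
  have "z t (D (D v)) = ((-1) ^ j * ((-1) ^ j * (q powi (e0 - gg * int t) * q powi (e0 - gg * int (d - t))))) * z t v"
    using zD[OF DE[OF v] t] zD[OF v, of "d - t"] t by (simp add: mult_ac)
  then show "z t (D (D v)) = z t ((q powi s_exp) *\<^sub>R v)" unfolding p by (simp add: z_lin minus_one_power_sq)
qed

lemma y_cube: assumes v: "v \<in> E" shows "S (T (S (T (S (T v))))) = (q powi s_exp) *\<^sub>R v"
proof -
  have "S (T (S (T (S (T v))))) = D (T (S (T v)))" by (simp add: D_def)
  then show ?thesis unfolding braid[OF v] D_D[OF v] .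
qed

text \<open>The factor 4 clears the halves from the binomials and from \<open>j\<close> being half
  of \<open>r - d\<close>.\<close>

lemma four_s_exp: "4 * s_exp = 24 * int k * int k - 12 * int k * int r + 3 * int r * int r - 6 * int r + int d * int d + 2 * int d"
proof -
  have "2 * ee k j = 2 * (int k * (int k - int j)) + int j * (int j - 1)"
    unfolding ee_def distrib_left two_choose_2 ..
  have "4 * s_exp = 12 * (2 * ee k j) + 8 * (int j * int d - int k * int d) - 4 * gg * int d"
    unfolding s_exp_def e0_def by (simp add: algebra_simps)
  also have "\<dots> = 12 * (2 * (int k * (int k - int j)) + int j * (int j - 1)) +
      8 * (int j * int d - int k * int d) - 4 * gg * int d"
    unfolding \<open>2 * ee k j = _\<close> ..
  finally show ?thesis unfolding r_eq by (simp add: algebra_simps)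
qed

text \<open>Four times the exponent is 3(2k - r)^2 + 12k^2 - 6r + d^2 + 2d, and 6r is at most 12k,
  hence at most 12k^2.\<close>

lemma s_exp_nonneg: "s_exp \<ge> 0"
proof -
  define X where "X = (2 * int k - int r) * (2 * int k - int r)"
  define A where "A = int k * int k"
  define B where "B = int d * int d"
  have "4 * s_exp = 3 * X + 12 * A - 6 * int r + B + 2 * int d"
    unfolding four_s_exp X_def A_def B_def by (simp add: algebra_simps)
  moreover have "X \<ge> 0" "B \<ge> 0" by (simp_all add: X_def B_def)
  moreover have "A \<ge> int k" unfolding A_def by (cases "k = 0") simp_all
  ultimately show ?thesis using r_le by linarith
qed

text \<open>Modulo 3 four times the exponent is d(d + 2), which is 0 unless d is 2 modulo 3.\<close>

lemma s_exp_mod_3: assumes "\<not> 3 dvd Suc d" shows "3 dvd s_exp"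
proof -
  have "3 dvd int d * (int d + 2)"
  proof -
    have "d mod 3 = 0 \<or> d mod 3 = 1" using assms by presburger
    then have "3 dvd int d \<or> 3 dvd int d + 2" by presburger
    then show ?thesis by auto
  qed
  moreover have "4 * s_exp = 3 * (8 * int k * int k - 4 * int k * int r + int r * int r - 2 * int r) + int d * (int d + 2)"
    unfolding four_s_exp by (simp add: algebra_simps)
  ultimately have "3 dvd 4 * s_exp" by (simp only: dvd_add dvd_triv_left)
  then show ?thesis by presburger
qed

end

section \<open>A bidiagonal operator\<close>

context qnum
begin

lemma qbin_absorb1: "(q ^ Suc p - 1) * qbin t (Suc p) = (q ^ (t - p) - 1) * qbin t p"
proof (cases "p < t")
  case True
  then have e: "t - p = Suc (t - Suc p)" by simp
  have "qint (Suc p) * qbin t (Suc p) = qint (t - p) * qbin t p"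
    using True qfact_pos[of p] qfact_pos[of "t - Suc p"] qint_pos[of "Suc p"] qint_pos[of "Suc (t - Suc p)"]
    unfolding qbin_def e qfact_Suc by (simp add: e qfact_Suc field_simps)
  then show ?thesis using q_gt_1 by (simp add: qint_def field_simps)
next
  case False
  then show ?thesis by (cases "p = t") (simp_all add: qbin_gt)
qed

lemma qbin_absorb2: "t \<ge> 1 \<Longrightarrow> p \<le> t \<Longrightarrow> (q ^ t - 1) * qbin (t - 1) p = (q ^ (t - p) - 1) * qbin t p"
proof (cases "p < t")
  case True
  then obtain s where t: "t = Suc s" "p \<le> s" by (cases t) auto
  then have e: "Suc s - p = Suc (s - p)" by simp
  have "qint (Suc s) * qbin s p = qint (Suc s - p) * qbin (Suc s) p"
    using t qfact_pos[of p] qfact_pos[of "s - p"] qint_pos[of "Suc s"] qint_pos[of "Suc (s - p)"]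
    unfolding qbin_def e qfact_Suc by (simp add: e qfact_Suc field_simps)
  then show ?thesis using q_gt_1 unfolding t by (simp add: qint_def field_simps)
qed (auto simp: qbin_gt)

end

context strmod
begin

text \<open>The operator that multiplies the \<open>t\<close>-th eigenspace of \<open>S\<close> by \<open>K1_diag t\<close> has, in the string
  coordinates, the diagonal entries \<open>K1_diag t\<close>, the subdiagonal entries \<open>K1_sub t\<close> and no others.
  It shows that the degrees occurring in \<open>E\<close> form an interval.\<close>

definition KK :: nat where "KK = k - j + 1"
definition K1_diag :: "nat \<Rightarrow> real" where "K1_diag t = q ^ (t + 1) + q powi (2 * int KK - int t)"
definition K1_sub :: "nat \<Rightarrow> real" where "K1_sub t = (q ^ t - 1) * (q ^ t - q ^ KK)"

lemma j_le_k: "j \<le> k" using r_eq r_le by simp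

lemma sig_pred: "t \<ge> 1 \<Longrightarrow> sig k j (t - 1) = - sig k j t * q powi (int KK - int t)"
proof -
  assume "t \<ge> 1"
  then have "sig k j t = sig k j (t - 1) * (- (q powi (int t - int KK)))"
    using sig_add[of k j "t - 1" 1] j_le_k by (simp add: KK_def of_nat_diff numeral_2_eq_2 algebra_simps)
  then have "- sig k j t * q powi (int KK - int t) = sig k j (t - 1) * (q powi (int t - int KK) * q powi (int KK - int t))"
    by simp
  then show ?thesis unfolding powi_mult by simp
qed

text \<open>Entry by entry, the bidiagonal matrix commutes with the matrix of S. The absorption
  rules let \<open>qbin t p\<close> factor out, and a polynomial identity in \<open>x\<close>,
  \<open>P\<close>, \<open>y\<close> remains.\<close>

lemma K1_entry:
  assumes "t \<ge> 1" "p \<le> t"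
  shows "sig k j t * (qbin t p * K1_diag p + qbin t (Suc p) * K1_sub (Suc p)) =
    K1_diag t * (sig k j t * qbin t p) + K1_sub t * (sig k j (t - 1) * qbin (t - 1) p)"
proof -
  define x where "x = q ^ (t - p)"
  define P where "P = q ^ p"
  define Q where "Q = q ^ KK"
  define y where "y = q powi (int KK - int t)"
  have t: "q ^ t = x * P" unfolding x_def P_def using assms by (simp flip: power_add)
  have Q: "Q = y * (x * P)" unfolding t[symmetric] y_def Q_def
    by (simp flip: power_int_of_nat power_int_add)
  have p1: "q powi (2 * int KK - int p) = Q * y * x"
  proof -
    have "2 * int KK - int p = int KK + (int KK - int t) + int (t - p)" using assms by (simp add: of_nat_diff)
    then show ?thesis unfolding Q_def y_def x_def by (simp only: power_int_add q_nz simp_thms power_int_of_nat)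
  qed
  have p2: "q powi (2 * int KK - int t) = Q * y"
  proof -
    have "2 * int KK - int t = int KK + (int KK - int t)" by simp
    then show ?thesis unfolding Q_def y_def by (simp only: power_int_add q_nz simp_thms power_int_of_nat)
  qed
  have a1: "qbin t (Suc p) * K1_sub (Suc p) = (x - 1) * qbin t p * (q * P - Q)"
    unfolding K1_sub_def using qbin_absorb1[of p t] by (simp add: x_def P_def Q_def mult_ac)
  have a2: "K1_sub t * qbin (t - 1) p = (x - 1) * qbin t p * (x * P - Q)"
    unfolding K1_sub_def using qbin_absorb2[OF assms] by (simp add: x_def t[unfolded x_def] Q_def mult_ac)
  have s: "K1_sub t * (sig k j (t - 1) * qbin (t - 1) p) = - sig k j t * y * ((x - 1) * qbin t p * (x * P - Q))"
    unfolding a2[symmetric] sig_pred[OF assms(1)] y_def by (simp add: mult_ac)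
  have "K1_diag p + (x - 1) * (q * P - Q) = K1_diag t - y * (x - 1) * (x * P - Q)"
    unfolding K1_diag_def p1 p2 power_add t power_one_right P_def[symmetric] Q by (simp add: algebra_simps)
  then have "sig k j t * qbin t p * (K1_diag p + (x - 1) * (q * P - Q)) = sig k j t * qbin t p * (K1_diag t - y * (x - 1) * (x * P - Q))"
    by simp
  then show ?thesis unfolding a1 s by (simp add: algebra_simps)
qed

lemma eig_low:
  assumes u: "u \<in> E" "S u = sig k j s *\<^sub>R u" "s \<le> d"
  shows "t < s \<Longrightarrow> z t u = 0"
proof (induction t rule: less_induct)
  case (less t)
  have td: "t \<le> d" using less.prems u by simp
  have "(\<Sum>p\<le>t. qbin t p * z p u) = (\<Sum>p\<in>{t}. qbin t p * z p u)"
    by (rule sum.mono_neutral_right) (use less in auto)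
  then have "sig k j s * z t u = sig k j t * z t u" using zS[OF u(1) td] u(2) by (simp add: z_lin)
  then show ?case using sig_inj[of k j s t] less.prems by auto
qed

text \<open>The defect \<open>y\<close> of the claimed equation is again an eigenvector of the
  matrix of S for \<open>sig k j s\<close>, since the two matrices commute, and it vanishes up to
  position \<open>s\<close>. As the diagonal entries of S are distinct, it vanishes
  everywhere.\<close>

lemma K1_eig:
  assumes u: "u \<in> E" "S u = sig k j s *\<^sub>R u" "s \<le> d"
  shows "t \<le> d \<Longrightarrow> K1_diag t * z t u + K1_sub t * z (t - 1) u = K1_diag s * z t u"
proof (induction t rule: less_induct)
  case (less t)
  define y where "y p = K1_diag p * z p u + K1_sub p * z (p - 1) u - K1_diag s * z p u" for p
  have eig: "sig k j s * z p u = sig k j p * (\<Sum>i\<le>p. qbin p i * z i u)" if "p \<le> d" for p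
    using zS[OF u(1) that] u(2) by (simp add: z_lin)
  have ta0: "K1_sub 0 = 0" by (simp add: K1_sub_def)
  consider "t < s" | "t = s" | "t > s" by linarith
  then show ?case
  proof cases
    case 1
    then show ?thesis using eig_low[OF u, of t] eig_low[OF u, of "t - 1"] by simp
  next
    case 2
    then show ?thesis using eig_low[OF u, of "t - 1"] ta0 by (cases t) simp_all
  next
    case 3
    then have t1: "t \<ge> 1" by simp
    have "(\<Sum>p\<le>t. qbin t p * y p) = (\<Sum>p\<in>{t}. qbin t p * y p)"
      by (rule sum.mono_neutral_right) (use less in \<open>auto simp: y_def\<close>)
    then have 1: "sig k j t * (\<Sum>p\<le>t. qbin t p * y p) = sig k j t * y t" by simp
    have sh: "(\<Sum>p\<le>t. qbin t p * (K1_sub p * z (p - 1) u)) = (\<Sum>p\<le>t. qbin t (Suc p) * K1_sub (Suc p) * z p u)"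
    proof -
      have "(\<Sum>p\<le>t. qbin t p * (K1_sub p * z (p - 1) u)) = (\<Sum>p\<le>Suc t. qbin t p * (K1_sub p * z (p - 1) u))"
        by (simp add: qbin_gt)
      also have "\<dots> = (\<Sum>p\<le>t. qbin t (Suc p) * K1_sub (Suc p) * z p u)"
        by (subst sum.atMost_Suc_shift) (simp add: ta0 mult_ac)
      finally show ?thesis .
    qed
    have "sig k j t * (\<Sum>p\<le>t. qbin t p * y p) =
      sig k j t * ((\<Sum>p\<le>t. qbin t p * K1_diag p * z p u) + (\<Sum>p\<le>t. qbin t p * (K1_sub p * z (p - 1) u))) - K1_diag s * (sig k j t * (\<Sum>p\<le>t. qbin t p * z p u))"
      unfolding y_def by (simp add: algebra_simps sum.distrib sum_subtractf sum_distrib_left)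
    also have "sig k j t * ((\<Sum>p\<le>t. qbin t p * K1_diag p * z p u) + (\<Sum>p\<le>t. qbin t p * (K1_sub p * z (p - 1) u))) =
      (\<Sum>p\<le>t. sig k j t * (qbin t p * K1_diag p + qbin t (Suc p) * K1_sub (Suc p)) * z p u)"
      unfolding sh by (simp add: sum_distrib_left sum.distrib[symmetric] algebra_simps)
    also have "\<dots> = (\<Sum>p\<le>t. (K1_diag t * (sig k j t * qbin t p) + K1_sub t * (sig k j (t - 1) * qbin (t - 1) p)) * z p u)"
      by (intro sum.cong refl) (simp add: K1_entry[OF t1])
    also have "\<dots> = K1_diag t * (sig k j t * (\<Sum>p\<le>t. qbin t p * z p u)) + K1_sub t * (sig k j (t - 1) * (\<Sum>p\<le>t. qbin (t - 1) p * z p u))"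
      by (simp add: sum_distrib_left sum.distrib[symmetric] algebra_simps)
    also have "(\<Sum>p\<le>t. qbin (t - 1) p * z p u) = (\<Sum>p\<le>t - 1. qbin (t - 1) p * z p u)"
      by (rule sum.mono_neutral_right) (auto simp: qbin_gt)
    finally have e: "sig k j t * (\<Sum>p\<le>t. qbin t p * y p) =
      K1_diag t * (sig k j t * (\<Sum>p\<le>t. qbin t p * z p u)) + K1_sub t * (sig k j (t - 1) * (\<Sum>p\<le>t - 1. qbin (t - 1) p * z p u))
      - K1_diag s * (sig k j t * (\<Sum>p\<le>t. qbin t p * z p u))" .
    have "t - 1 \<le> d" using less.prems by simp
    then have 2: "sig k j t * (\<Sum>p\<le>t. qbin t p * y p) = sig k j s * y t"
      unfolding e eig[OF less.prems, symmetric] by (subst eig[symmetric]) (simp_all add: y_def[of t] algebra_simps)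
    have "(sig k j t - sig k j s) * y t = 0"
      by (simp only: 1[symmetric] 2[symmetric] left_diff_distrib diff_self)
    then have "y t = 0" using sig_inj[of k j t s] 3 by auto
    then show ?thesis by (simp add: y_def)
  qed
qed

text \<open>A triangular operator with distinct diagonal entries is diagonalisable on any invariant
  subspace. Applying \<open>S - sig k j m\<close> clears coordinate \<open>m\<close>; the components
  of the result are then divided by differences of eigenvalues.\<close>

lemma eig_decomp:
  assumes "v \<in> E" "\<And>t. t < m \<Longrightarrow> t \<le> d \<Longrightarrow> z t v = 0" "m \<le> Suc d"
  shows "\<exists>f. (\<forall>t\<in>{m..d}. f t \<in> E \<and> S (f t) = sig k j t *\<^sub>R f t) \<and> v = (\<Sum>t=m..d. f t)"
  using assms
proof (induction "Suc d - m" arbitrary: m v)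
  case 0
  then have "v = 0" by (intro z_inj) auto
  then show ?case using 0 by auto
next
  case (Suc x)
  then have md: "m \<le> d" by simp
  define u where "u = S v - sig k j m *\<^sub>R v"
  have uE: "u \<in> E" using Suc.prems subE by (simp add: u_def subspace_diff subspace_scale SE)
  have uz: "z t u = 0" if "t < Suc m" "t \<le> d" for t
  proof -
    have "(\<Sum>p\<le>t. qbin t p * z p v) = (\<Sum>p\<in>{t}. qbin t p * z p v)"
      by (rule sum.mono_neutral_right) (use Suc.prems that in auto)
    then have "z t (S v) = sig k j t * z t v" using zS[OF Suc.prems(1) that(2)] by simp
    then show ?thesis using Suc.prems(2)[of t] that by (cases "t = m") (auto simp: u_def z_lin)
  qed
  obtain f where f: "\<forall>t\<in>{Suc m..d}. f t \<in> E \<and> S (f t) = sig k j t *\<^sub>R f t" "u = (\<Sum>t=Suc m..d. f t)"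
  proof -
    have "\<exists>f. (\<forall>t\<in>{Suc m..d}. f t \<in> E \<and> S (f t) = sig k j t *\<^sub>R f t) \<and> u = (\<Sum>t=Suc m..d. f t)"
      by (rule Suc.hyps(1)) (use Suc.hyps(2) uE uz md in auto)
    then show ?thesis using that by blast
  qed
  define h where "h t = (1 / (sig k j t - sig k j m)) *\<^sub>R f t" for t
  have hE: "h t \<in> E" "S (h t) = sig k j t *\<^sub>R h t" if "t \<in> {Suc m..d}" for t
    using f(1) that subE linS by (auto simp: h_def subspace_scale linear_scale)
  define w where "w = v - (\<Sum>t=Suc m..d. h t)"
  have wE: "w \<in> E" unfolding w_def using Suc.prems hE subE by (intro subspace_diff subspace_sum) auto
  have "S w - sig k j m *\<^sub>R w = u - (\<Sum>t=Suc m..d. S (h t) - sig k j m *\<^sub>R h t)"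
    unfolding w_def u_def using linS by (simp add: linear_diff linear_sum scaleR_diff_right scaleR_sum_right sum_subtractf)
  also have "(\<Sum>t=Suc m..d. S (h t) - sig k j m *\<^sub>R h t) = (\<Sum>t=Suc m..d. f t)"
  proof (rule sum.cong[OF refl])
    fix t assume t: "t \<in> {Suc m..d}"
    then have "sig k j t \<noteq> sig k j m" using sig_inj[of k j t m] by auto
    then show "S (h t) - sig k j m *\<^sub>R h t = f t"
      unfolding hE(2)[OF t] scaleR_diff_left[symmetric] by (simp add: h_def)
  qed
  finally have "S w = sig k j m *\<^sub>R w" using f(2) by simp
  moreover have "v = (\<Sum>t=m..d. (if t = m then w else h t))"
  proof -
    have "(\<Sum>t=m..d. (if t = m then w else h t)) = w + (\<Sum>t=Suc m..d. (if t = m then w else h t))"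
      using md by (simp add: sum.atLeast_Suc_atMost)
    also have "(\<Sum>t=Suc m..d. (if t = m then w else h t)) = (\<Sum>t=Suc m..d. h t)" by (rule sum.cong) auto
    finally show ?thesis by (simp add: w_def)
  qed
  ultimately show ?case using wE hE by (intro exI[of _ "\<lambda>t. if t = m then w else h t"]) auto
qed

text \<open>In string coordinates the bidiagonal operator is a function of S, so it preserves
  \<open>E\<close> although it is not known which coordinate vectors \<open>E\<close>
  contains.\<close>

lemma K1_ex:
  assumes "v \<in> E"
  obtains v' where "v' \<in> E" "\<And>t. t \<le> d \<Longrightarrow> z t v' = K1_diag t * z t v + K1_sub t * z (t - 1) v"
proof -
  obtain f where f: "\<forall>t\<in>{0..d}. f t \<in> E \<and> S (f t) = sig k j t *\<^sub>R f t" "v = (\<Sum>t=0..d. f t)"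
    using eig_decomp[OF assms, of 0] by auto
  let ?v = "\<Sum>s=0..d. K1_diag s *\<^sub>R f s"
  have "z t ?v = K1_diag t * z t v + K1_sub t * z (t - 1) v" if "t \<le> d" for t
  proof -
    have "z t ?v = (\<Sum>s=0..d. K1_diag s * z t (f s))" by (simp add: z_lin)
    also have "\<dots> = (\<Sum>s=0..d. K1_diag t * z t (f s) + K1_sub t * z (t - 1) (f s))"
    proof (rule sum.cong[OF refl])
      fix s assume "s \<in> {0..d}"
      then show "K1_diag s * z t (f s) = K1_diag t * z t (f s) + K1_sub t * z (t - 1) (f s)"
        using f(1) K1_eig[of "f s" s t] that by simp
    qed
    finally show ?thesis unfolding f(2) by (simp add: z_lin sum.distrib sum_distrib_left)
  qed
  moreover have "?v \<in> E" using f(1) subE by (intro subspace_sum subspace_scale) auto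
  ultimately show thesis using that by blast
qed

section \<open>Highest nonzero coordinates\<close>

definition has_deg :: "'v \<Rightarrow> nat \<Rightarrow> bool" where
  "has_deg v y \<longleftrightarrow> v \<in> E \<and> y \<le> d \<and> z y v \<noteq> 0 \<and> (\<forall>t. y < t \<longrightarrow> t \<le> d \<longrightarrow> z t v = 0)"

text \<open>By \<open>z_trunc\<close> the coordinates below \<open>t0\<close> and those above
  \<open>d - t0\<close> vanish on \<open>E\<close>. The truncated subtraction gives 0 when nothing
  is forced to vanish at the lower end.\<close>

definition t0 :: nat where "t0 = r - (k + j)"

lemma has_deg_bounds:
  assumes "has_deg v y" shows "t0 \<le> y" "y \<le> d - t0" "j + y \<le> k"
proof -
  have a: "\<not> (j + y > k \<or> r - (j + y) > k)" "y \<le> d"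
    using assms z_trunc[of v y] unfolding has_deg_def by blast+
  then show "t0 \<le> y" "j + y \<le> k" unfolding t0_def by linarith+
  show "y \<le> d - t0" using a r_eq unfolding t0_def by (cases "r \<ge> k + j") auto
qed

text \<open>The entry \<open>K1_sub (Suc y)\<close> vanishes only for \<open>Suc y = KK\<close>, and
  \<open>y < d - t0\<close> keeps \<open>Suc y\<close> below \<open>KK\<close>. So the bidiagonal
  operator raises the degree by one.\<close>

lemma has_deg_Suc:
  assumes v: "has_deg v y" and y: "y < d - t0"
  shows "\<exists>v'. has_deg v' (Suc y)"
proof -
  have vE: "v \<in> E" using v by (simp add: has_deg_def)
  obtain v' where v': "v' \<in> E" "\<And>t. t \<le> d \<Longrightarrow> z t v' = K1_diag t * z t v + K1_sub t * z (t - 1) v"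
    using K1_ex[OF vE] by blast
  have "j + y < k" using y r_eq r_le unfolding t0_def by (cases "r \<ge> k + j") auto
  then have "q ^ Suc y \<noteq> q ^ KK" unfolding KK_def using q_gt_1 power_inject_exp[of q "Suc y" "k - j + 1"] by simp
  moreover have "q ^ Suc y \<noteq> 1" using one_less_power[of q "Suc y"] q_gt_1 by simp
  ultimately have "K1_sub (Suc y) \<noteq> 0" by (simp add: K1_sub_def)
  then have "has_deg v' (Suc y)"
    using v y v' unfolding has_deg_def by auto
  then show ?thesis by blast
qed

lemma has_deg_ex: assumes "v \<in> E" "v \<noteq> 0" shows "\<exists>y. has_deg v y"
proof -
  let ?A = "{t. t \<le> d \<and> z t v \<noteq> 0}"
  have fin: "finite ?A" by (rule finite_subset[of _ "{..d}"]) auto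
  have ne: "?A \<noteq> {}" using z_inj assms by blast
  have "has_deg v (Max ?A)"
    unfolding has_deg_def using Max_in[OF fin ne] Max_ge[OF fin] assms by (auto simp: not_less[symmetric])
  then show ?thesis by blast
qed

end

section \<open>Balanced modules\<close>

context qnum
begin

lemma sum_ee:
  "12 * (\<Sum>x<m. ee k (a + x)) = int m * (12 * int k * int k - 12 * int k * int a - 6 * int k * (int m - 1)
    + 6 * int a * int a + 6 * int a * (int m - 1) + (int m - 1) * (2 * int m - 1) - 6 * int a - 3 * (int m - 1))"
proof (induction m)
  case (Suc m)
  have "12 * ee k (a + m) = 12 * (int k * (int k - int (a + m))) + 6 * (int (a + m) * (int (a + m) - 1))"
    unfolding ee_def two_choose_2[symmetric] by simp
  then show ?case using Suc by (simp add: algebra_simps)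
qed simp

text \<open>The sum is a polynomial of degree at most \<open>e\<close> in \<open>q ^ s\<close> with
  more than \<open>e\<close> zeros, hence 0 for every \<open>s\<close>. Evaluating at s = 0, 1, ...
  then yields the coefficients one after the other.\<close>

lemma zero_of_interpolation:
  fixes c :: "nat \<Rightarrow> real"
  assumes X: "finite X" "card X > e" and zero: "\<And>s. s \<in> X \<Longrightarrow> (\<Sum>p\<le>e. qbin s p * c p) = 0"
  shows "p \<le> e \<Longrightarrow> c p = 0"
proof -
  define G where "G p = (\<Prod>u<p. Polynomial.smult (1 / (q ^ p - q ^ u)) [:- (q ^ u), 1:])" for p
  have G: "poly (G p) (q ^ s) = qbin s p" for p s
    unfolding G_def qbin_poly poly_prod by (intro prod.cong refl) (simp add: diff_divide_distrib)
  have dG: "degree (G p) \<le> p" for p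
  proof -
    have "degree (G p) \<le> sum (degree \<circ> (\<lambda>u. Polynomial.smult (1 / (q ^ p - q ^ u)) [:- (q ^ u), 1:])) {..<p}"
      unfolding G_def by (rule degree_prod_sum_le) simp
    also have "\<dots> \<le> (\<Sum>u<p. 1)" by (intro sum_mono) (simp add: degree_smult_le[THEN order_trans])
    finally show ?thesis by simp
  qed
  define h where "h = (\<Sum>p\<le>e. Polynomial.smult (c p) (G p))"
  have ph: "poly h (q ^ s) = (\<Sum>p\<le>e. qbin s p * c p)" for s
    unfolding h_def by (simp add: poly_sum G mult.commute)
  have dh: "degree h \<le> e"
    unfolding h_def by (rule degree_sum_le) (auto intro: order_trans[OF degree_smult_le] order_trans[OF dG])
  have "h = 0"
  proof (rule ccontr)
    assume "h \<noteq> 0"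
    have "inj_on (\<lambda>s. q ^ s) X" using q_gt_1 power_inject_exp by (intro inj_onI) blast
    then have "card X = card ((\<lambda>s. q ^ s) ` X)" by (simp add: card_image)
    also have "\<dots> \<le> card {x. poly h x = 0}"
      using poly_roots_finite[OF \<open>h \<noteq> 0\<close>] zero ph by (intro card_mono) auto
    also have "\<dots> \<le> degree h" by (rule card_poly_roots_bound[OF \<open>h \<noteq> 0\<close>])
    finally show False using dh X by simp
  qed
  then have all: "(\<Sum>p\<le>e. qbin s p * c p) = 0" for s using ph[of s] by simp
  show "p \<le> e \<Longrightarrow> c p = 0"
  proof (induction p rule: less_induct)
    case (less s)
    have "(\<Sum>p\<le>e. qbin s p * c p) = (\<Sum>p\<in>{s}. qbin s p * c p)"
    proof (rule sum.mono_neutral_right)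
      show "\<forall>p\<in>{..e} - {s}. qbin s p * c p = 0"
      proof
        fix p assume "p \<in> {..e} - {s}"
        then show "qbin s p * c p = 0" using less.IH[of p] by (cases "p < s") (auto simp: qbin_gt)
      qed
    qed (use less in auto)
    then show ?case using all[of s] by simp
  qed
qed

end

context strmod
begin

text \<open>\<open>has_deg_Suc\<close> excludes gaps, so the least degree \<open>y0\<close> is the
  only unknown, and with it the dimension of \<open>E\<close>.\<close>

lemma deg_range:
  assumes "E \<noteq> {0}"
  obtains y0 where "t0 \<le> y0" "y0 \<le> d - t0" "\<And>y. y0 \<le> y \<Longrightarrow> y \<le> d - t0 \<Longrightarrow> \<exists>v. has_deg v y"
    "\<And>v y. has_deg v y \<Longrightarrow> y0 \<le> y"
proof -
  have "0 \<in> E" using subE by (simp add: subspace_0)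
  then obtain v where "v \<in> E" "v \<noteq> 0" using assms by blast
  then have ex: "\<exists>y v. has_deg v y" using has_deg_ex by blast
  define y0 where "y0 = (LEAST y. \<exists>v. has_deg v y)"
  have y0: "\<exists>v. has_deg v y0" unfolding y0_def by (rule LeastI_ex[OF ex])
  have le: "y0 \<le> y" if "has_deg v y" for v y unfolding y0_def using that by (intro Least_le) blast
  have up: "\<exists>v. has_deg v y" if "y0 \<le> y" "y \<le> d - t0" for y
    using that
  proof (induction y rule: dec_induct)
    case base
    show ?case by (rule y0)
  next
    case (step y)
    then obtain v where "has_deg v y" by auto
    then show ?case using has_deg_Suc[of v y] step.prems by auto
  qed
  show thesis using that[of y0] y0 le up has_deg_bounds by blast
qed

text \<open>One vector for each degree from \<open>y0\<close> to \<open>d - t0\<close>, cleared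
  successively in echelon form. A vector on which all these coordinates vanish has no possible
  degree and is therefore 0.\<close>

lemma dual_basis:
  assumes "E \<noteq> {0}"
  obtains y0 m e where "t0 \<le> y0" "y0 + m = Suc (d - t0)" "m > 0"
    "\<And>i. i < m \<Longrightarrow> e i \<in> E"
    "\<And>i l. i < m \<Longrightarrow> l < m \<Longrightarrow> z (y0 + l) (e i) = (if l = i then 1 else 0)"
    "\<And>v. v \<in> E \<Longrightarrow> v = (\<Sum>l<m. z (y0 + l) v *\<^sub>R e l)"
proof -
  obtain y0 where y0: "t0 \<le> y0" "y0 \<le> d - t0" "\<And>y. y0 \<le> y \<Longrightarrow> y \<le> d - t0 \<Longrightarrow> \<exists>v. has_deg v y"
    "\<And>v y. has_deg v y \<Longrightarrow> y0 \<le> y" using deg_range[OF assms] by blast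
  define m where "m = Suc (d - t0) - y0"
  have m: "y0 + m = Suc (d - t0)" "m > 0" using y0(2) by (auto simp: m_def)
  have "\<exists>e. \<forall>i<M. e i \<in> E \<and> (\<forall>l<m. z (y0 + l) (e i) = (if l = i then 1 else 0))" if "M \<le> m" for M
    using that
  proof (induction M)
    case (Suc M)
    then obtain e where e: "\<And>i. i < M \<Longrightarrow> e i \<in> E" "\<And>i l. i < M \<Longrightarrow> l < m \<Longrightarrow> z (y0 + l) (e i) = (if l = i then 1 else 0)"
      by auto
    obtain v where v: "has_deg v (y0 + M)" using y0(3)[of "y0 + M"] Suc.prems m by auto
    define u where "u = v - (\<Sum>i<M. z (y0 + i) v *\<^sub>R e i)"
    have uE: "u \<in> E" using v e(1) subE unfolding u_def has_deg_def by (intro subspace_diff subspace_sum subspace_scale) auto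
    have zu: "z (y0 + l) u = (if l < M then 0 else z (y0 + l) v)" if "l < m" for l
    proof -
      have "z (y0 + l) u = z (y0 + l) v - (\<Sum>i<M. z (y0 + i) v * (if l = i then 1 else 0))"
        unfolding u_def z_lin using e(2) that by (intro arg_cong2[of _ _ _ _ minus] refl sum.cong) auto
      also have "(\<Sum>i<M. z (y0 + i) v * (if l = i then 1 else 0)) = (\<Sum>i<M. if l = i then z (y0 + i) v else 0)"
        by (intro sum.cong) auto
      finally show ?thesis by simp
    qed
    have hi: "z (y0 + l) v = 0" if "M < l" "l < m" for l
      using v that m unfolding has_deg_def by auto
    have nz: "z (y0 + M) v \<noteq> 0" using v by (simp add: has_deg_def)
    let ?e = "e(M := (1 / z (y0 + M) v) *\<^sub>R u)"
    show ?case
    proof (intro exI[of _ ?e] allI impI conjI)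
      fix i assume i: "i < Suc M"
      show "?e i \<in> E" using e(1) i uE subE by (auto simp: subspace_scale)
      fix l assume l: "l < m"
      show "z (y0 + l) (?e i) = (if l = i then 1 else 0)"
        using e(2)[of i l] i l zu[OF l] hi[of l] nz by (auto simp: z_lin)
    qed
  qed simp
  from this[of m] obtain e where e: "\<And>i. i < m \<Longrightarrow> e i \<in> E"
    "\<And>i l. i < m \<Longrightarrow> l < m \<Longrightarrow> z (y0 + l) (e i) = (if l = i then 1 else 0)" by auto
  have exp: "v = (\<Sum>l<m. z (y0 + l) v *\<^sub>R e l)" if v: "v \<in> E" for v
  proof (rule ccontr)
    define w where "w = v - (\<Sum>l<m. z (y0 + l) v *\<^sub>R e l)"
    assume "v \<noteq> (\<Sum>l<m. z (y0 + l) v *\<^sub>R e l)"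
    then have "w \<noteq> 0" by (simp add: w_def)
    moreover have wE: "w \<in> E" using v e(1) subE unfolding w_def by (intro subspace_diff subspace_sum subspace_scale) auto
    ultimately obtain y where y: "has_deg w y" using has_deg_ex by blast
    then have yb: "y0 \<le> y" "y \<le> d - t0" using y0(4) has_deg_bounds by blast+
    then have lm: "y - y0 < m" using m by simp
    have "z (y0 + (y - y0)) w = z (y0 + (y - y0)) v - (\<Sum>l<m. z (y0 + l) v * (if y - y0 = l then 1 else 0))"
      unfolding w_def z_lin using e(2) lm by (intro arg_cong2[of _ _ _ _ minus] refl sum.cong) auto
    also have "(\<Sum>l<m. z (y0 + l) v * (if y - y0 = l then 1 else 0)) = (\<Sum>l<m. if y - y0 = l then z (y0 + l) v else 0)"
      by (intro sum.cong) auto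
    finally have "z y w = 0" using lm yb by simp
    then show False using y by (simp add: has_deg_def)
  qed
  show thesis using that[OF y0(1) m] e exp by blast
qed

lemma T_low:
  assumes v: "v \<in> E" and low: "\<And>s. y < s \<Longrightarrow> s \<le> d \<Longrightarrow> z s v = 0" and t: "y \<le> t" "t \<le> d"
  shows "z t (T v) = sig k j (d - t) * z t v"
proof -
  have "(\<Sum>l\<le>d - t. q powi (gg * int l) * qbin (d - t) (d - t - l) * z (t + l) v) =
    (\<Sum>l\<in>{0}. q powi (gg * int l) * qbin (d - t) (d - t - l) * z (t + l) v)"
    by (rule sum.mono_neutral_right) (use low t in auto)
  then show ?thesis using zT[OF v t(2)] by simp
qed

text \<open>\<open>STS = TST\<close> forces \<open>det S = det T\<close>, so \<open>(det T)\<^sup>6\<close> is the determinant of \<open>(STS)\<^sup>2 = q\<^sup>s\<close>, while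
  \<open>det T\<close> is also the product of the diagonal entries of a triangular matrix. This determines \<open>dim E\<close>.\<close>

lemma det_relation:
  assumes e: "\<And>i. i < m \<Longrightarrow> e i \<in> E"
    "\<And>i l. i < m \<Longrightarrow> l < m \<Longrightarrow> z (y0 + l) (e i) = (if l = i then 1 else 0)"
    "\<And>v. v \<in> E \<Longrightarrow> v = (\<Sum>l<m. z (y0 + l) v *\<^sub>R e l)"
    and m: "y0 + m = Suc (d - t0)" and y0: "t0 \<le> y0"
  shows "6 * (\<Sum>i<m. ee k (j + (d - (y0 + i)))) = s_exp * int m"
proof -
  define M where "M F = Matrix.mat m m (\<lambda>(l,i). z (y0 + l) (F (e i)))" for F :: "'v \<Rightarrow> 'v"
  have carrier: "M F \<in> carrier_mat m m" for F by (simp add: M_def)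
  have comp: "M (\<lambda>v. F (G v)) = M F * M G" if F: "linear F" and G: "\<And>v. v \<in> E \<Longrightarrow> G v \<in> E" for F G
  proof (rule eq_matI)
    fix l i assume "l < dim_row (M F * M G)" "i < dim_col (M F * M G)"
    then have li: "l < m" "i < m" by (auto simp: M_def)
    have "z (y0 + l) (F (G (e i))) = z (y0 + l) (F (\<Sum>h<m. z (y0 + h) (G (e i)) *\<^sub>R e h))"
      using e(3)[OF G[OF e(1)[OF li(2)]]] by simp
    also have "\<dots> = (\<Sum>h<m. z (y0 + l) (F (e h)) * z (y0 + h) (G (e i)))"
      using F by (simp add: linear_sum linear_scale z_lin mult.commute)
    finally show "M (\<lambda>v. F (G v)) $$ (l,i) = (M F * M G) $$ (l,i)"
      using li by (simp add: M_def scalar_prod_def lessThan_atLeast0)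
  qed (simp_all add: M_def)
  have linD: "linear D" unfolding D_def using linS linT linear_compose[of T S] linear_compose[of S "\<lambda>v. S (T v)"]
    by (simp add: comp_def)
  have linTS: "linear (\<lambda>v. S v)" "linear (\<lambda>v. T v)" using linS linT by auto
  define a b where "a = Determinant.det (M S)" and "b = Determinant.det (M T)"
  have det_comp: "Determinant.det (M (\<lambda>v. F (G v))) = Determinant.det (M F) * Determinant.det (M G)"
    if "linear F" "\<And>v. v \<in> E \<Longrightarrow> G v \<in> E" for F G
  proof -
    have "M (\<lambda>v. F (G v)) = M F * M G" by (rule comp) (use that in auto)
    then show ?thesis by (simp only: det_mult[OF carrier carrier])
  qed
  have Deq: "D = (\<lambda>v. S (T (S v)))" by (simp add: D_def fun_eq_iff)
  have D1: "Determinant.det (M D) = a * (b * a)"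
    unfolding Deq a_def b_def using det_comp[of S "\<lambda>v. T (S v)"] det_comp[of T S] linS linT SE TE by simp
  have "M D = M (\<lambda>v. T (S (T v)))" unfolding M_def using e(1) by (intro eq_matI) (auto simp: braid)
  then have D2: "Determinant.det (M D) = b * (a * b)"
    unfolding a_def b_def using det_comp[of T "\<lambda>v. S (T v)"] det_comp[of S T] linS linT SE TE by simp
  have "M (\<lambda>v. D (D v)) = (q powi s_exp) \<cdot>\<^sub>m 1\<^sub>m m"
    unfolding M_def using e(1,2) by (intro eq_matI) (auto simp: D_D z_lin)
  then have D3: "Determinant.det (M D) * Determinant.det (M D) = (q powi s_exp) ^ m"
    using det_comp[of D D, OF linD DE] by simp
  have bv: "b = (\<Prod>i<m. sig k j (d - (y0 + i)))"
  proof -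
    have ent: "z (y0 + l) (T (e i)) = (if l = i then sig k j (d - (y0 + i)) else 0)" if "i \<le> l" "l < m" for i l
    proof -
      have i: "i < m" using that by simp
      have low: "z s (e i) = 0" if "y0 + i < s" "s \<le> d" for s
      proof (cases "s \<le> d - t0")
        case True
        then have "s - y0 < m" "s - y0 \<noteq> i" "y0 + (s - y0) = s" using that m by auto
        then show ?thesis using e(2)[OF i, of "s - y0"] by simp
      next
        case False
        then have "j + s > k" using r_eq r_le that unfolding t0_def by (cases "r \<ge> k + j") auto
        then show ?thesis using z_trunc[OF e(1)[OF i] that(2)] by simp
      qed
      have "y0 + l \<le> d" using that m by simp
      then show ?thesis using T_low[OF e(1)[OF i] low, of "y0 + l"] that e(2)[OF i that(2)] by simp
    qed
    have ut: "upper_triangular (M T)" unfolding upper_triangular_def using ent by (auto simp: M_def)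
    have "b = (\<Prod>i = 0..<m. M T $$ (i,i))"
      unfolding b_def det_upper_triangular[OF ut carrier] prod_list_diag_prod by (simp add: M_def)
    also have "\<dots> = (\<Prod>i<m. sig k j (d - (y0 + i)))"
      unfolding lessThan_atLeast0 by (intro prod.cong refl) (simp add: M_def ent)
    finally show ?thesis .
  qed
  have nz: "a \<noteq> 0" "b \<noteq> 0"
    using D1 D3 by auto
  have "a = b" using D1 D2 nz by simp
  then have "b ^ 6 = (q powi s_exp) ^ m" using D1 D3 by (simp add: power_def numeral_eq_Suc mult_ac)
  moreover have "\<bar>b\<bar> = q powi (\<Sum>i<m. ee k (j + (d - (y0 + i))))"
  proof -
    have pos: "\<bar>q powi x\<bar> = q powi x" for x by (rule abs_of_pos[OF zero_less_power_int[OF q_nz(2)]])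
    have "\<bar>b\<bar> = (\<Prod>i<m. q powi ee k (j + (d - (y0 + i))))"
      unfolding bv abs_prod by (simp add: sig_def abs_mult power_abs pos)
    also have "\<dots> = q powi (\<Sum>i<m. ee k (j + (d - (y0 + i))))"
      by (induction m) (simp_all add: power_int_add)
    finally show ?thesis .
  qed
  ultimately have "(q powi (\<Sum>i<m. ee k (j + (d - (y0 + i))))) ^ 6 = (q powi s_exp) ^ m"
    by (metis power_even_abs even_numeral)
  then have "q powi ((\<Sum>i<m. ee k (j + (d - (y0 + i)))) * int 6) = q powi (s_exp * int m)"
    by (simp only: power_int_mult power_int_of_nat)
  then have "(\<Sum>i<m. ee k (j + (d - (y0 + i)))) * int 6 = s_exp * int m"
    using q_gt_1 power_int_strict_increasing[of "(\<Sum>i<m. ee k (j + (d - (y0 + i)))) * int 6" "s_exp * int m" q]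
     power_int_strict_increasing[of "s_exp * int m" "(\<Sum>i<m. ee k (j + (d - (y0 + i)))) * int 6" q] by linarith
  then show ?thesis by simp
qed

text \<open>Divided by \<open>m\<close>, the determinant relation is quadratic in \<open>m\<close>.
  One root is \<open>d + 1 - 3 * t0\<close>; the other is excluded by the bounds on
  \<open>m\<close>. The two cases distinguish whether the subtraction in \<open>t0\<close> is
  truncated.\<close>

lemma dimension_formula:
  assumes m: "y0 + m = Suc (d - t0)" "m > 0" and y0: "t0 \<le> y0"
    and det: "6 * (\<Sum>i<m. ee k (j + (d - (y0 + i)))) = s_exp * int m"
  shows "m + 3 * t0 = Suc d"
proof -
  have td: "t0 \<le> d" using m y0 by simp
  have "(\<Sum>i<m. ee k (j + (d - (y0 + i)))) = (\<Sum>x<m. ee k (j + t0 + x))"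
  proof -
    have "(\<Sum>i<m. ee k (j + (d - (y0 + i)))) = (\<Sum>x<m. ee k (j + (d - (y0 + (m - Suc x)))))"
      by (rule sum.nat_diff_reindex[symmetric])
    also have "\<dots> = (\<Sum>x<m. ee k (j + t0 + x))"
      by (intro sum.cong refl arg_cong[of _ _ "ee k"]) (use m td y0 in auto)
    finally show ?thesis .
  qed
  then have "12 * (\<Sum>x<m. ee k (j + t0 + x)) = int m * (2 * s_exp)" using det by simp
  define F where "F = 12 * int k * int k - 12 * int k * int (j + t0) - 6 * int k * (int m - 1)
    + 6 * int (j + t0) * int (j + t0) + 6 * int (j + t0) * (int m - 1) + (int m - 1) * (2 * int m - 1) - 6 * int (j + t0) - 3 * (int m - 1)"
  have "int m * F = int m * (2 * s_exp)"
    using \<open>12 * _ = int m * (2 * s_exp)\<close> sum_ee[of k "j + t0" m] unfolding F_def by simp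
  then have "F = 2 * s_exp" using m by simp
  then have F: "2 * F = 24 * int k * int k - 12 * int k * int r + 3 * int r * int r - 6 * int r + int d * int d + 2 * int d"
    using four_s_exp by simp
  have jk: "j \<le> k" by (rule j_le_k)
  show ?thesis
  proof (cases "r \<ge> k + j")
    case False
    then have t0: "t0 = 0" by (simp add: t0_def)
    have "4 * ((int m - int d - 1) * (int m + int d - 2 - 3 * int k + 3 * int j)) =
      2 * F - (24 * int k * int k - 12 * int k * int r + 3 * int r * int r - 6 * int r + int d * int d + 2 * int d)"
      unfolding F_def t0 unfolding r_eq by (simp add: algebra_simps)
    then have "(int m - int d - 1) * (int m + int d - 2 - 3 * int k + 3 * int j) = 0" using F by simp
    moreover have "int m + int d - 2 - 3 * int k + 3 * int j \<noteq> 0"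
      using m False t0 r_eq jk by linarith
    ultimately show ?thesis using t0 by simp
  next
    case True
    then have "int t0 = int r - (int k + int j)" unfolding t0_def by linarith
    then have t0: "int t0 = int d + int j - int k" using r_eq by linarith
    have jt: "int (j + t0) = 2 * int j + int d - int k" using t0 by simp
    have "4 * ((int m - (int d + 1 - 3 * (int d + int j - int k))) * (int m + int d + 1 - 3 * (int d + int j - int k) + 3 * (2 * int j + int d - int k) - 3 * int k - 3)) =
      2 * F - (24 * int k * int k - 12 * int k * int r + 3 * int r * int r - 6 * int r + int d * int d + 2 * int d)"
      unfolding F_def jt unfolding r_eq by (simp add: algebra_simps)
    then have "(int m - (int d + 1 - 3 * (int d + int j - int k))) * (int m + int d + 1 - 3 * (int d + int j - int k) + 3 * (2 * int j + int d - int k) - 3 * int k - 3) = 0"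
      using F by simp
    moreover have "int m + int d + 1 - 3 * (int d + int j - int k) + 3 * (2 * int j + int d - int k) - 3 * int k - 3 \<noteq> 0"
    proof -
      have "int y0 + int m = int d - int t0 + 1" using m(1) td by linarith
      then have "int m \<le> int d - 2 * int t0 + 1" using y0 by linarith
      then have "int m + int d + 2 * int j \<le> 2 * int k + 1" unfolding t0 by simp
      moreover have "int j \<le> int k" using jk by simp
      ultimately show ?thesis by simp
    qed
    ultimately have "int m = int d + 1 - 3 * int t0" using t0 by simp
    then show ?thesis by linarith
  qed
qed

section \<open>Three vanishing conditions permuted by ST\<close>

definition low :: "nat \<Rightarrow> 'v \<Rightarrow> bool" where
  "low c v \<longleftrightarrow> v \<in> E \<and> (\<forall>s. d - c < s \<longrightarrow> s \<le> d \<longrightarrow> z s v = 0)"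

lemma low_add: "low c u \<Longrightarrow> low c v \<Longrightarrow> low c (u + v)"
  and low_scale: "low c u \<Longrightarrow> low c (x *\<^sub>R u)"
  using subE by (auto simp: low_def z_lin subspace_add subspace_scale)

lemma low_scale_iff: assumes "x \<noteq> 0" "v \<in> E" shows "low c (x *\<^sub>R v) \<longleftrightarrow> low c v"
proof
  assume "low c (x *\<^sub>R v)"
  then have "low c ((1 / x) *\<^sub>R (x *\<^sub>R v))" by (rule low_scale)
  then show "low c v" using assms by simp
qed (rule low_scale)

text \<open>T is upper triangular with nonzero diagonal, so vanishing of the top coordinates passes
  in both directions.\<close>

lemma low_T: assumes "v \<in> E" shows "low c (T v) \<longleftrightarrow> low c v"
proof
  assume l: "low c v"
  show "low c (T v)"
    unfolding low_def
  proof (intro conjI allI impI)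
    show "T v \<in> E" by (rule TE[OF assms])
    fix s assume s: "d - c < s" "s \<le> d"
    show "z s (T v) = 0" using T_low[OF assms, of "d - c" s] l s by (auto simp: low_def)
  qed
next
  assume l: "low c (T v)"
  have "z s v = 0" if "d - c < s" "s \<le> d" for s
    using that
  proof (induction "d - s" arbitrary: s rule: less_induct)
    case less
    have "z s (T v) = sig k j (d - s) * z s v"
    proof (rule T_low[OF assms])
      fix s' assume s': "s < s'" "s' \<le> d"
      show "z s' v = 0" by (rule less.hyps) (use s' less.prems in auto)
    qed (use less.prems in auto)
    moreover have "z s (T v) = 0" using l less.prems by (simp add: low_def)
    ultimately show ?case using sig_nz[of k j "d - s"] by simp
  qed
  then show "low c v" using assms by (simp add: low_def)
qed

abbreviation Y :: "'v \<Rightarrow> 'v" where "Y v \<equiv> S (T v)"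
text \<open>On \<open>E\<close> this is \<open>q powi s_exp\<close> times the inverse of S, by
  \<open>y_cube\<close>.\<close>

definition G1 :: "'v \<Rightarrow> 'v" where "G1 v = T (S (T (S (T v))))"

lemma G1_E: "v \<in> E \<Longrightarrow> G1 v \<in> E" by (simp add: G1_def SE TE)
lemma Y_E: "v \<in> E \<Longrightarrow> Y v \<in> E" by (simp add: SE TE)
lemma pos_s: "q powi s_exp \<noteq> 0" by simp

lemma linSs: "S (a + b) = S a + S b" "S (x *\<^sub>R a) = x *\<^sub>R S a" "S 0 = 0" "T (a + b) = T a + T b" "T (x *\<^sub>R a) = x *\<^sub>R T a" "T 0 = 0"
  using linS linT by (simp_all add: linear_add linear_scale linear_0)

text \<open>Number the conditions \<open>low c\<close> on \<open>v\<close>, \<open>G1 v\<close> and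
  \<open>D v\<close> by 0, 1, 2 modulo 3. This lemma and the next two say that condition
  \<open>i + 1\<close> for \<open>Y v\<close> is condition \<open>i\<close> for
  \<open>v\<close>.\<close>

lemma cyc1: assumes v: "v \<in> E" shows "low c (G1 (Y v)) \<longleftrightarrow> low c v"
proof -
  have "G1 (Y v) = T (S (T (S (T (S (T v))))))" by (simp add: G1_def)
  then have "G1 (Y v) = (q powi s_exp) *\<^sub>R T v" unfolding y_cube[OF v] by (simp add: linSs)
  then show ?thesis using low_scale_iff[OF pos_s TE[OF v]] low_T[OF v] by simp
qed

lemma cyc2: assumes v: "v \<in> E" shows "low c (D (Y v)) \<longleftrightarrow> low c (G1 v)"
proof -
  have "D (Y v) = T (D (T v))" by (rule DS_TD[OF TE[OF v]])
  moreover have "G1 v = T (D (T v))" by (simp add: G1_def D_def)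
  ultimately show ?thesis by simp
qed

lemma cyc0: assumes v: "v \<in> E" shows "low c (Y v) \<longleftrightarrow> low c (D v)"
proof -
  have "low c (Y v) \<longleftrightarrow> low c (G1 (Y (Y v)))" by (rule cyc1[OF Y_E[OF v], symmetric])
  also have "\<dots> \<longleftrightarrow> low c (D (Y (Y (Y v))))" by (rule cyc2[OF Y_E[OF Y_E[OF v]], symmetric])
  also have "D (Y (Y (Y v))) = (q powi s_exp) *\<^sub>R D v" unfolding y_cube[OF v] by (simp add: D_def linSs)
  finally show ?thesis using low_scale_iff[OF pos_s DE[OF v]] by simp
qed

text \<open>Lowness of \<open>v\<close> and of \<open>D v\<close> gives zeros of the polynomial in \<open>q\<^sup>x\<close> with the coordinates of
  \<open>G1 v\<close> as coefficients, lowness of \<open>G1 v\<close> bounds its degree.\<close>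

lemma triple_zero:
  assumes c: "Suc d \<le> 3 * c" "c \<le> d" and v: "v \<in> E" "low c v" "low c (G1 v)" "low c (D v)"
  shows "v = 0"
proof -
  define w where "w = G1 v"
  have w: "w \<in> E" "S w = (q powi s_exp) *\<^sub>R v" using v(1) y_cube[OF v(1)] by (simp_all add: w_def G1_E) (simp add: G1_def)
  define X where "X = {..<c} \<union> {d - c<..d}"
  have disj: "{..<c} \<inter> {d - c<..d} = {} \<or> Suc d \<le> 2 * c" by auto
  have zw: "(\<Sum>p\<le>d - c. qbin s p * z p w) = 0" if s: "s \<in> X" for s
  proof -
    have sd: "s \<le> d" using s c by (auto simp: X_def)
    have "z s v = 0"
    proof (cases "d - c < s")
      case True
      then show ?thesis using v(2) sd by (simp add: low_def)
    next
      case False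
      then have "s < c" using s by (auto simp: X_def)
      then have "z (d - s) (D v) = 0" using v(4) sd c unfolding low_def by auto
      then show ?thesis using zD[OF v(1), of "d - s"] sd by simp
    qed
    then have "z s (S w) = 0" unfolding w(2) by (simp add: z_lin)
    then have "(\<Sum>p\<le>s. qbin s p * z p w) = 0" using zS[OF w(1) sd] sig_nz[of k j s] by simp
    moreover have "(\<Sum>p\<le>s. qbin s p * z p w) = (\<Sum>p\<le>d. qbin s p * z p w)"
      by (rule sum.mono_neutral_left) (use sd in \<open>auto simp: qbin_gt\<close>)
    moreover have "(\<Sum>p\<le>d. qbin s p * z p w) = (\<Sum>p\<le>d - c. qbin s p * z p w)"
      by (rule sum.mono_neutral_right) (use v(3) in \<open>auto simp: low_def w_def\<close>)
    ultimately show ?thesis by simp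
  qed
  \<comment> \<open>If the two ranges overlap they cover all of \<open>0..d\<close>; otherwise
    \<open>2 * c > d - c\<close> because \<open>Suc d \<le> 3 * c\<close>.\<close>
  have "card X > d - c"
  proof (cases "Suc d \<le> 2 * c")
    case True
    then have "{..<c} \<union> {d - c<..d} \<supseteq> {..<Suc d}" by auto
    then have "Suc d \<le> card X" unfolding X_def by (metis card_lessThan card_mono finite_UnI finite_greaterThanAtMost finite_lessThan)
    then show ?thesis by simp
  next
    case False
    then have "{..<c} \<inter> {d - c<..d} = {}" by auto
    then have "card X = c + c" using c unfolding X_def by (simp add: card_Un_disjoint)
    then show ?thesis using c by simp
  qed
  then have "z p w = 0" if "p \<le> d - c" for p
    using zero_of_interpolation[of X "d - c" "\<lambda>p. z p w" p] zw that by (simp add: X_def)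
  then have "z p w = 0" if "p \<le> d" for p
    using v(3) that unfolding low_def w_def[symmetric] by (cases "p \<le> d - c") auto
  then have "w = 0" by (rule z_inj[OF w(1)])
  then have "(q powi s_exp) *\<^sub>R v = 0" using w(2) by (simp add: linSs)
  then show ?thesis by simp
qed

text \<open>With \<open>3 * c = Suc d\<close> the dimension is \<open>3 * h\<close> for
  \<open>h = c - t0\<close>, and each of the three conditions amounts to \<open>h\<close> linear
  equations, since the top \<open>t0\<close> coordinates vanish on \<open>E\<close>. By
  \<open>triple_zero\<close> the \<open>3 * h\<close> equations are independent, so their values can
  be prescribed. \<open>A\<close> satisfies conditions 0 and 1, hence \<open>Y\<close> maps it into
  conditions 1 and 2, and \<open>Y\<close> twice into 2 and 0. A vector is split by giving each
  summand one block of its values.\<close>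

theorem balanced:
  assumes three: "3 dvd Suc d"
  shows "\<exists>A. subspace A \<and> A \<subseteq> E \<and>
    (\<forall>a\<in>A. \<forall>b\<in>A. \<forall>c\<in>A. a + Y b + Y (Y c) = 0 \<longrightarrow> a = 0 \<and> b = 0 \<and> c = 0) \<and>
    (\<forall>v\<in>E. \<exists>a\<in>A. \<exists>b\<in>A. \<exists>c\<in>A. v = a + Y b + Y (Y c))"
proof (cases "E = {0}")
  case True
  then show ?thesis by (intro exI[of _ "{0}"]) (auto simp: linSs subspace_def)
next
  case False
  obtain c where c: "Suc d = 3 * c" using dvdE[OF three] by metis
  obtain y0 m e where e: "t0 \<le> y0" "y0 + m = Suc (d - t0)" "m > 0" "\<And>i. i < m \<Longrightarrow> e i \<in> E"
    "\<And>i l. i < m \<Longrightarrow> l < m \<Longrightarrow> z (y0 + l) (e i) = (if l = i then 1 else 0)"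
    "\<And>v. v \<in> E \<Longrightarrow> v = (\<Sum>l<m. z (y0 + l) v *\<^sub>R e l)"
    by (rule dual_basis[OF False]) blast
  have md: "m + 3 * t0 = Suc d"
    by (rule dimension_formula[OF e(2,3,1) det_relation[OF e(4,5,6,2,1)]])
  define h where "h = c - t0"
  have h: "m = 3 * h" "c = t0 + h" "h > 0" using md c e(3) by (auto simp: h_def)
  have cd: "c \<le> d" "Suc d \<le> 3 * c" using c h by auto
  define P where "P x = Suc (d - c) + x" for x
  have Pd: "P x \<le> d" if "x < h" for x using that c h cd by (simp add: P_def)
  have lowP: "low c v \<longleftrightarrow> (\<forall>x<h. z (P x) v = 0)" if v: "v \<in> E" for v
  proof
    assume "low c v"
    then show "\<forall>x<h. z (P x) v = 0" using Pd by (auto simp: low_def P_def)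
  next
    assume a: "\<forall>x<h. z (P x) v = 0"
    have "z s v = 0" if s: "d - c < s" "s \<le> d" for s
    proof (cases "s \<le> d - t0")
      case True
      then have "s - Suc (d - c) < h" "P (s - Suc (d - c)) = s" using s h cd by (auto simp: P_def)
      then show ?thesis using a by metis
    next
      case False
      then have "j + s > k" using r_eq r_le s unfolding t0_def by (cases "r \<ge> k + j") auto
      then show ?thesis using z_trunc[OF v s(2)] by simp
    qed
    then show "low c v" using v by (simp add: low_def)
  qed
  \<comment> \<open>All \<open>3 * h = m\<close> values in one list. \<open>R\<close> writes them
    back into \<open>E\<close> as coordinates, so that injectivity yields surjectivity by
    dimension.\<close>
  define F where "F v i = (if i < h then z (P i) v else if i < 2 * h then z (P (i - h)) (G1 v) else z (P (i - 2 * h)) (D v))" for v i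
  define R where "R v = (\<Sum>i<m. F v i *\<^sub>R e i)" for v
  have RE: "R v \<in> E" for v unfolding R_def using e(4) subE by (intro subspace_sum subspace_scale) auto
  have Flin: "F (a + b) i = F a i + F b i" "F (x *\<^sub>R a) i = x * F a i" for a b x i
    by (simp_all add: F_def G1_def D_def linSs z_lin)
  have linR: "linear R" unfolding R_def
    by (rule linearI) (simp_all add: Flin scaleR_left_distrib sum.distrib scaleR_sum_right)
  have zR: "z (y0 + i) (R v) = F v i" if i: "i < m" for i v
  proof -
    have "z (y0 + i) (R v) = (\<Sum>l<m. if i = l then F v l else 0)"
      unfolding R_def z_lin using e(5) i by (intro sum.cong refl) auto
    then show ?thesis using i by simp
  qed
  have Rinj: "v = 0" if v: "v \<in> E" and "R v = 0" for v
  proof -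
    have F0: "F v i = 0" if "i < m" for i using zR[OF that, of v] \<open>R v = 0\<close> by (simp add: z_lin)
    have "low c v" unfolding lowP[OF v]
    proof (intro allI impI)
      fix x assume "x < h" then show "z (P x) v = 0" using F0[of x] h by (simp add: F_def)
    qed
    moreover have "low c (G1 v)" unfolding lowP[OF G1_E[OF v]]
    proof (intro allI impI)
      fix x assume "x < h" then show "z (P x) (G1 v) = 0" using F0[of "h + x"] h by (simp add: F_def)
    qed
    moreover have "low c (D v)" unfolding lowP[OF DE[OF v]]
    proof (intro allI impI)
      fix x assume "x < h" then show "z (P x) (D v) = 0" using F0[of "2 * h + x"] h by (simp add: F_def)
    qed
    ultimately show ?thesis using triple_zero[OF cd(2,1) v] by blast
  qed
  have Rsurj: "\<exists>v\<in>E. \<forall>i<m. F v i = f i" for f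
  proof -
    have "inj_on R E"
    proof (rule inj_onI)
      fix x y assume "x \<in> E" "y \<in> E" "R x = R y"
      then have "x - y \<in> E" "R (x - y) = 0" using subE linR by (simp_all add: subspace_diff linear_diff)
      then show "x = y" using Rinj[of "x - y"] by simp
    qed
    then have "inj_on R (span E)" unfolding span_eq_iff[THEN iffD2, OF subE] .
    then have "dim (R ` E) = dim E" using linR by (intro dim_image_eq)
    moreover have "R ` E \<subseteq> E" using RE by auto
    moreover have "subspace (R ` E)" using linR subE by (rule linear_subspace_image)
    ultimately have RI: "R ` E = E" using subE by (intro subspace_dim_equal) auto
    have "(\<Sum>i<m. f i *\<^sub>R e i) \<in> E" using e(4) subE by (intro subspace_sum subspace_scale) auto
    then have "(\<Sum>i<m. f i *\<^sub>R e i) \<in> R ` E" by (simp only: RI)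
    then obtain v where v: "v \<in> E" "R v = (\<Sum>i<m. f i *\<^sub>R e i)" by (metis imageE)
    have "F v i = f i" if i: "i < m" for i
    proof -
      have "F v i = (\<Sum>l<m. if i = l then f l else 0)"
        unfolding zR[OF i, symmetric] v(2) z_lin using e(5) i by (intro sum.cong refl) auto
      then show ?thesis using i by simp
    qed
    then show ?thesis using v(1) by blast
  qed
  have low0: "low c v" if "v \<in> E" "\<And>i. i < h \<Longrightarrow> F v i = 0" for v
    unfolding lowP[OF that(1)]
  proof (intro allI impI)
    fix x assume "x < h" then show "z (P x) v = 0" using that(2)[of x] by (simp add: F_def)
  qed
  have low1: "low c (G1 v)" if "v \<in> E" "\<And>i. h \<le> i \<Longrightarrow> i < 2 * h \<Longrightarrow> F v i = 0" for v
    unfolding lowP[OF G1_E[OF that(1)]]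
  proof (intro allI impI)
    fix x assume "x < h" then show "z (P x) (G1 v) = 0" using that(2)[of "h + x"] by (simp add: F_def)
  qed
  have low2: "low c (D v)" if "v \<in> E" "\<And>i. 2 * h \<le> i \<Longrightarrow> i < 3 * h \<Longrightarrow> F v i = 0" for v
    unfolding lowP[OF DE[OF that(1)]]
  proof (intro allI impI)
    fix x assume "x < h" then show "z (P x) (D v) = 0" using that(2)[of "2 * h + x"] by (simp add: F_def)
  qed
  define A where "A = {v \<in> E. low c v \<and> low c (G1 v)}"
  have subA: "subspace A" unfolding A_def using subE
    by (auto simp: subspace_def G1_def linSs low_add low_scale) (auto simp: low_def z_lin subE subspace_0)
  have AE: "A \<subseteq> E" by (auto simp: A_def)
  have Ysurj: "\<exists>u\<in>E. Y u = v" if "v \<in> E" for v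
  proof -
    have "Y (Y (Y ((1 / q powi s_exp) *\<^sub>R v))) = v" using y_cube[OF that] by (simp add: linSs)
    then show ?thesis using that subE by (intro bexI[of _ "Y (Y ((1 / q powi s_exp) *\<^sub>R v))"]) (auto simp: Y_E subspace_scale)
  qed
  have indep: "a = 0 \<and> b = 0 \<and> x = 0" if a: "a \<in> A" "b \<in> A" "x \<in> A" and 0: "a + Y b + Y (Y x) = 0" for a b x
  proof -
    have aE: "a \<in> E" "b \<in> E" "x \<in> E" using a by (auto simp: A_def)
    have la: "low c a" "low c (G1 a)" "low c b" "low c (G1 b)" "low c x" "low c (G1 x)" using a by (auto simp: A_def)
    have b1: "low c (G1 (Y b))" "low c (D (Y b))" using cyc1[OF aE(2)] cyc2[OF aE(2)] la by auto
    have x1: "low c (G1 (Y x))" "low c (D (Y x))" using cyc1[OF aE(3)] cyc2[OF aE(3)] la by auto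
    have x2: "low c (D (Y (Y x)))" "low c (Y (Y x))"
      using cyc2[OF Y_E[OF aE(3)]] cyc0[OF Y_E[OF aE(3)]] x1 by auto
    have Dadd: "D (u + v) = D u + D v" "D (y *\<^sub>R u) = y *\<^sub>R D u" for u v y by (simp_all add: D_def linSs)
    \<comment> \<open>The other two summands satisfy condition 2, hence so does \<open>a\<close>,
      which then satisfies all three.\<close>
    have a': "a = (-1) *\<^sub>R (Y b + Y (Y x))" using 0 by (simp only: add.assoc eq_neg_iff_add_eq_0 scaleR_minus1_left)
    have "low c (D a)" unfolding a' Dadd using b1(2) x2(1) by (intro low_scale low_add)
    then have a0: "a = 0" using triple_zero[OF cd(2,1) aE(1)] la by blast
    then have b': "Y b = (-1) *\<^sub>R Y (Y x)" using 0 by (simp add: eq_neg_iff_add_eq_0)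
    have "low c (Y b)" unfolding b' using x2(2) by (rule low_scale)
    then have "Y b = 0" using triple_zero[OF cd(2,1) Y_E[OF aE(2)]] b1 by blast
    then have yx: "Y (Y x) = 0" using b' by simp
    have Yz: "u = 0" if "u \<in> E" "Y u = 0" for u
      using y_cube[OF that(1)] that(2) by (simp add: linSs)
    show ?thesis using a0 Yz[OF aE(2) \<open>Y b = 0\<close>] Yz[OF aE(3) Yz[OF Y_E[OF aE(3)] yx]] by blast
  qed
  have spans: "\<exists>a\<in>A. \<exists>b\<in>A. \<exists>x\<in>A. v = a + Y b + Y (Y x)" if v: "v \<in> E" for v
  proof -
    obtain a where a: "a \<in> E" "\<And>i. i < m \<Longrightarrow> F a i = (if 2 * h \<le> i then F v i else 0)"
      using Rsurj[of "\<lambda>i. if 2 * h \<le> i then F v i else 0"] by blast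
    obtain b where b: "b \<in> E" "\<And>i. i < m \<Longrightarrow> F b i = (if i < h then F v i else 0)"
      using Rsurj[of "\<lambda>i. if i < h then F v i else 0"] by blast
    obtain x where x: "x \<in> E" "\<And>i. i < m \<Longrightarrow> F x i = (if h \<le> i \<and> i < 2 * h then F v i else 0)"
      using Rsurj[of "\<lambda>i. if h \<le> i \<and> i < 2 * h then F v i else 0"] by blast
    have "v = a + b + x"
    proof -
      define w where "w = v + (-1) *\<^sub>R (a + b + x)"
      have "w \<in> E" unfolding w_def using v a(1) b(1) x(1) subE by (intro subspace_add subspace_scale) auto
      moreover have "R w = 0"
        unfolding R_def w_def Flin using a(2) b(2) x(2) by (intro sum.neutral) auto
      ultimately have "w = 0" by (rule Rinj)
      then have "v - (a + b + x) = 0" by (simp only: w_def scaleR_minus1_left diff_conv_add_uminus)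
      then show ?thesis by (simp only: right_minus_eq)
    qed
    moreover have "a \<in> A"
    proof -
      have "low c a" by (rule low0[OF a(1)]) (use a(2) h(1) in simp)
      moreover have "low c (G1 a)" by (rule low1[OF a(1)]) (use a(2) h(1) in simp)
      ultimately show ?thesis using a(1) by (simp add: A_def)
    qed
    moreover obtain b' where b': "b' \<in> E" "Y b' = b" using Ysurj[OF b(1)] by blast
    moreover have "b' \<in> A"
    proof -
      have "low c (G1 b)" by (rule low1[OF b(1)]) (use b(2) h(1) in simp)
      moreover have "low c (D b)" by (rule low2[OF b(1)]) (use b(2) h(1) in simp)
      ultimately show ?thesis using cyc1[OF b'(1)] cyc2[OF b'(1)] b' by (simp add: A_def)
    qed
    moreover obtain x' where x': "x' \<in> E" "Y x' = x" using Ysurj[OF x(1)] by blast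
    moreover obtain x'' where x'': "x'' \<in> E" "Y x'' = x'" using Ysurj[OF x'(1)] by blast
    moreover have "x'' \<in> A"
    proof -
      have "low c x" by (rule low0[OF x(1)]) (use x(2) h(1) in simp)
      moreover have "low c (D x)" by (rule low2[OF x(1)]) (use x(2) h(1) in simp)
      ultimately have "low c (G1 x')" "low c (D x')" using cyc2[OF x'(1)] cyc0[OF x'(1)] x' by auto
      then show ?thesis using cyc1[OF x''(1)] cyc2[OF x''(1)] x'' by (simp add: A_def)
    qed
    ultimately show ?thesis by blast
  qed
  show ?thesis using subA AE indep spans by (intro exI[of _ A]) blast
qed

end

section \<open>Traces of powers\<close>

definition tr :: "('v::euclidean_space \<Rightarrow> 'v) \<Rightarrow> real" where
  "tr F = (\<Sum>b\<in>Basis. F b \<bullet> b)"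

lemma tr_commute:
  fixes F G :: "'v::euclidean_space \<Rightarrow> 'v"
  assumes F: "linear F" and G: "linear G"
  shows "tr (\<lambda>v. F (G v)) = tr (\<lambda>v. G (F v))"
proof -
  have key: "tr (\<lambda>v. F (G v)) = (\<Sum>b\<in>Basis. \<Sum>c\<in>Basis. (G b \<bullet> c) * (F c \<bullet> b))" if "linear F" for F G :: "'v \<Rightarrow> 'v"
  proof -
    have "F (G b) \<bullet> b = (\<Sum>c\<in>Basis. (G b \<bullet> c) * (F c \<bullet> b))" for b
    proof -
      have "F (G b) = F (\<Sum>c\<in>Basis. (G b \<bullet> c) *\<^sub>R c)" by (simp add: euclidean_representation)
      also have "\<dots> = (\<Sum>c\<in>Basis. (G b \<bullet> c) *\<^sub>R F c)" using that by (simp add: linear_sum linear_scale)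
      finally show ?thesis by (simp add: inner_sum_left)
    qed
    then show ?thesis by (simp add: tr_def)
  qed
  show ?thesis unfolding key[OF F] key[OF G] by (subst sum.swap) (simp add: mult.commute)
qed

text \<open>Extend \<open>B\<close> to a basis of the whole space: the added vectors contribute
  nothing, because \<open>F\<close> maps into \<open>span B\<close>.\<close>

lemma tr_range_basis:
  fixes F :: "'v::euclidean_space \<Rightarrow> 'v"
  assumes B: "independent B" and F: "linear F" and range: "\<And>v. F v \<in> span B"
  shows "tr F = (\<Sum>b\<in>B. representation B (F b) b)"
proof -
  define C where "C = extend_basis B"
  have C: "independent C" "span C = UNIV" "B \<subseteq> C"
    unfolding C_def using B by (simp_all add: independent_extend_basis span_extend_basis extend_basis_superset)
  have fin: "finite C" "finite B" using C(1) B independent_imp_finite by blast+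
  let ?r = "representation C"
  have lin: "linear (\<lambda>v. ?r v b)" for b
    using linear_representation[OF C(1,2)] by (auto simp: linear_iff representation_add[OF C(1)] representation_scale[OF C(1)] C(2))
  have "tr F = (\<Sum>c\<in>Basis. \<Sum>b\<in>C. ?r c b * (F b \<bullet> c))"
    unfolding tr_def
  proof (rule sum.cong[OF refl])
    fix c :: 'v
    have "F c = F (\<Sum>b\<in>C. ?r c b *\<^sub>R b)" using sum_representation_eq[OF C(1) _ fin(1), of c] C(2) by simp
    also have "\<dots> = (\<Sum>b\<in>C. ?r c b *\<^sub>R F b)" using F by (simp add: linear_sum linear_scale)
    finally show "F c \<bullet> c = (\<Sum>b\<in>C. ?r c b * (F b \<bullet> c))" by (simp add: inner_sum_left)
  qed
  also have "\<dots> = (\<Sum>b\<in>C. \<Sum>c\<in>Basis. ?r c b * (F b \<bullet> c))" by (rule sum.swap)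
  also have "\<dots> = (\<Sum>b\<in>C. ?r (F b) b)"
  proof (rule sum.cong[OF refl])
    fix b
    have "?r (F b) b = ?r (\<Sum>c\<in>Basis. (F b \<bullet> c) *\<^sub>R c) b" by (simp add: euclidean_representation)
    also have "\<dots> = (\<Sum>c\<in>Basis. (F b \<bullet> c) * ?r c b)" by (simp add: linear_sum[OF lin] linear_scale[OF lin])
    finally show "(\<Sum>c\<in>Basis. ?r c b * (F b \<bullet> c)) = ?r (F b) b" by (simp add: mult.commute)
  qed
  also have "\<dots> = (\<Sum>b\<in>C. representation B (F b) b)"
    using representation_extend[OF C(1) range C(3)] by simp
  also have "\<dots> = (\<Sum>b\<in>B. representation B (F b) b)"
    using fin C(3) representation_ne_zero[of B] by (intro sum.mono_neutral_right) auto
  finally show ?thesis .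
qed

lemma independent_Un_trivial_Int:
  fixes B C :: "'v::euclidean_space set"
  assumes B: "independent B" and C: "independent C" and BC: "span B \<inter> span C = {0}"
  shows "independent (B \<union> C)" "B \<inter> C = {}"
proof -
  have fin: "finite B" "finite C" using B C independent_imp_finite by blast+
  show disj: "B \<inter> C = {}"
  proof (rule ccontr)
    assume "B \<inter> C \<noteq> {}"
    then obtain x where x: "x \<in> B" "x \<in> C" by blast
    then have "x = 0" using BC span_base by blast
    then show False using x B dependent_zero by blast
  qed
  show "independent (B \<union> C)"
    unfolding independent_explicit
  proof (intro conjI allI impI ballI)
    show "finite (B \<union> C)" using fin by simp
    fix u v assume 0: "(\<Sum>v\<in>B \<union> C. u v *\<^sub>R v) = 0" and v: "v \<in> B \<union> C"
    define x y where "x = (\<Sum>v\<in>B. u v *\<^sub>R v)" and "y = (\<Sum>v\<in>C. u v *\<^sub>R v)"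
    have "x + y = 0" using 0 fin disj by (simp add: x_def y_def sum.union_disjoint)
    moreover have xB: "x \<in> span B" unfolding x_def by (intro span_sum span_scale span_base)
    moreover have yC: "y \<in> span C" unfolding y_def by (intro span_sum span_scale span_base)
    ultimately have "x \<in> span B \<inter> span C"
      using span_neg[OF yC] by (simp flip: eq_neg_iff_add_eq_0)
    then have "x = 0" using BC by blast
    with \<open>x + y = 0\<close> have "y = 0" by simp
    show "u v = 0"
      using v \<open>x = 0\<close> \<open>y = 0\<close> B C unfolding independent_explicit x_def y_def by blast
  qed
qed

text \<open>\<open>Z1 s\<close>, \<open>Z2 s\<close> and \<open>Z3 s\<close> stand for the three kinds of factors of the theorem.\<close>

lemma span_pairE:
  assumes "w \<in> span {a, b}"
  obtains x y where "w = x *\<^sub>R a + y *\<^sub>R (b :: 'v::real_vector)"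
proof -
  obtain x y where "w - x *\<^sub>R a - y *\<^sub>R b \<in> span {}" using assms unfolding span_breakdown_eq by blast
  then have "w = x *\<^sub>R a + y *\<^sub>R b" by (simp add: algebra_simps)
  then show thesis by (rule that)
qed

lemma span_tripleE:
  assumes "w \<in> span {a, b, c}"
  obtains x y z where "w = x *\<^sub>R a + y *\<^sub>R b + z *\<^sub>R (c :: 'v::real_vector)"
proof -
  obtain x y z where "w - x *\<^sub>R a - y *\<^sub>R b - z *\<^sub>R c \<in> span {}" using assms unfolding span_breakdown_eq by blast
  then have "w = x *\<^sub>R a + y *\<^sub>R b + z *\<^sub>R c" by (simp add: algebra_simps)
  then show thesis by (rule that)
qed

datatype ztype = Z1 nat | Z2 nat | Z3 nat

text \<open>Power sums of the eigenvalues of ST behind each factor: \<open>q ^ s\<close> itself;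
  \<open>q ^ s\<close> times the two nonreal cube roots of unity; the three cube roots of
  \<open>q ^ s\<close>. So the cube of the operator is \<open>q ^ (3 * s)\<close> in the first two
  cases but \<open>q ^ s\<close> in the third.\<close>

fun zpow :: "real \<Rightarrow> nat \<Rightarrow> ztype \<Rightarrow> real" where
  "zpow q l (Z1 s) = q ^ (s * l)"
| "zpow q l (Z2 s) = (if 3 dvd l then 2 else -1) * q ^ (s * l)"
| "zpow q l (Z3 s) = (if 3 dvd l then 3 * q ^ (s * (l div 3)) else 0)"

locale operator =
  fixes Y :: "'v::euclidean_space \<Rightarrow> 'v" and q :: real
  assumes linY: "linear Y" and q_pos: "q > 0"
begin

definition stable :: "'v set \<Rightarrow> bool" where
  "stable W \<longleftrightarrow> subspace W \<and> (\<forall>v\<in>W. Y v \<in> W)"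

text \<open>The traces of the powers of \<open>Y\<close> on \<open>W\<close>, computed in a basis, are the power sums of the factors in \<open>M\<close>.\<close>

definition dec :: "'v set \<Rightarrow> ztype multiset \<Rightarrow> bool" where
  "dec W M \<longleftrightarrow> stable W \<and> (\<exists>B. independent B \<and> span B = W \<and>
     (\<forall>l. (\<Sum>b\<in>B. representation B ((Y ^^ l) b) b) = (\<Sum>t\<in>#M. zpow q l t)))"

lemma stable_pow: "stable W \<Longrightarrow> v \<in> W \<Longrightarrow> (Y ^^ l) v \<in> W"
  by (induction l) (auto simp: stable_def)

lemma dec_stable: "dec W M \<Longrightarrow> stable W" by (simp add: dec_def)

lemma stable_subspace: "stable W \<Longrightarrow> subspace W" by (simp add: stable_def)

lemma linY_simps: "Y (a + b) = Y a + Y b" "Y (x *\<^sub>R a) = x *\<^sub>R Y a" "Y 0 = 0" "Y (a - b) = Y a - Y b" "Y (- a) = - Y a"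
  using linY by (simp_all add: linear_add linear_scale linear_0 linear_diff linear_neg)

lemma stable_sums: "stable A \<Longrightarrow> stable B \<Longrightarrow> stable {a + b | a b. a \<in> A \<and> b \<in> B}"
  unfolding stable_def by (auto simp: linY_simps subspace_sums) blast

lemma dec_zero: "dec {0} {#}"
  unfolding dec_def stable_def by (auto simp: linY_simps independent_empty intro!: exI[of _ "{}"])

lemma dec_sums:
  assumes A: "dec A M" and C: "dec C N" and AC: "A \<inter> C = {0}"
  shows "dec {a + c | a c. a \<in> A \<and> c \<in> C} (M + N)"
proof -
  obtain B where B: "independent B" "span B = A"
    "\<And>l. (\<Sum>b\<in>B. representation B ((Y ^^ l) b) b) = (\<Sum>t\<in>#M. zpow q l t)" using A unfolding dec_def by blast
  obtain D where D: "independent D" "span D = C"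
    "\<And>l. (\<Sum>b\<in>D. representation D ((Y ^^ l) b) b) = (\<Sum>t\<in>#N. zpow q l t)" using C unfolding dec_def by blast
  note BD = independent_Un_trivial_Int[OF B(1) D(1), unfolded B(2) D(2), OF AC]
  have fin: "finite B" "finite D" using B D independent_imp_finite by blast+
  have "(\<Sum>b\<in>B \<union> D. representation (B \<union> D) ((Y ^^ l) b) b) = (\<Sum>t\<in>#M + N. zpow q l t)" for l
  proof -
    have "representation (B \<union> D) ((Y ^^ l) b) = representation B ((Y ^^ l) b)" if "b \<in> B" for b
      using stable_pow[OF dec_stable[OF A], of b l] that span_base[OF that] B(2) by (intro representation_extend[OF BD(1)]) auto
    moreover have "representation (B \<union> D) ((Y ^^ l) b) = representation D ((Y ^^ l) b)" if "b \<in> D" for b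
      using stable_pow[OF dec_stable[OF C], of b l] that span_base[OF that] D(2) by (intro representation_extend[OF BD(1)]) auto
    ultimately show ?thesis using fin BD(2) by (simp add: sum.union_disjoint B(3) D(3))
  qed
  moreover have "span (B \<union> D) = {a + c | a c. a \<in> A \<and> c \<in> C}" unfolding span_Un B(2) D(2) by simp
  ultimately show ?thesis
    unfolding dec_def using BD(1) stable_sums[OF dec_stable[OF A] dec_stable[OF C]] by blast
qed

text \<open>Splits off pieces until \<open>W\<close> is exhausted. \<open>Q\<close> is what the part
  \<open>U\<close> reached so far must satisfy for the next piece to be found: nothing, stability or
  invariance in the three uses.\<close>

lemma greedy:
  assumes W: "subspace W" and Q0: "Q {0}"
    and step: "\<And>U. subspace U \<Longrightarrow> U \<subset> W \<Longrightarrow> Q U \<Longrightarrow>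
      \<exists>C M. dec C M \<and> C \<subseteq> W \<and> C \<noteq> {0} \<and> U \<inter> C = {0} \<and> Q {a + c | a c. a \<in> U \<and> c \<in> C}"
  shows "\<exists>M. dec W M"
proof -
  have "\<exists>M. dec W M" if "dec U N" "U \<subseteq> W" "Q U" for U N
    using that
  proof (induction "dim W - dim U" arbitrary: U N rule: less_induct)
    case less
    show ?case
    proof (cases "U = W")
      case False
      have U: "subspace U" using less.prems(1) by (simp add: dec_stable stable_subspace)
      obtain C M where C: "dec C M" "C \<subseteq> W" "C \<noteq> {0}" "U \<inter> C = {0}" "Q {a + c | a c. a \<in> U \<and> c \<in> C}"
        using step[OF U] False less.prems by blast
      have sC: "subspace C" using C(1) by (simp add: dec_stable stable_subspace)
      let ?V = "{a + c | a c. a \<in> U \<and> c \<in> C}"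
      have VW: "?V \<subseteq> W"
      proof
        fix x assume "x \<in> ?V"
        then obtain a c where "x = a + c" "a \<in> U" "c \<in> C" by blast
        then show "x \<in> W" using less.prems(2) C(2) subspace_add[OF W, of a c] by auto
      qed
      have "dim C \<noteq> 0" using C(3) subspace_0[OF sC] dim_eq_0[of C] by auto
      then have "dim C > 0" by (rule neq0_conv[THEN iffD1])
      then have "dim ?V > dim U" using dim_sums_Int[OF U sC] C(4) by simp
      moreover have "dim ?V \<le> dim W" by (rule dim_subset[OF VW])
      ultimately have "dim W - dim ?V < dim W - dim U" by simp
      then show ?thesis using less.hyps[OF _ dec_sums[OF less.prems(1) C(1,4)] VW C(5)] by blast
    qed (use less.prems in blast)
  qed
  from this[OF dec_zero] show ?thesis using Q0 subspace_0[OF W] by simp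
qed

lemma dec_eigenvector:
  assumes v: "Y v = (q ^ s) *\<^sub>R v" "v \<noteq> 0"
  shows "dec (span {v}) {#Z1 s#}"
proof -
  have pow: "(Y ^^ l) v = (q ^ (s * l)) *\<^sub>R v" for l
    by (induction l) (simp_all add: linY_simps v(1) power_add mult.commute)
  have ind: "independent {v}" using v by simp
  have "stable (span {v})" unfolding stable_def using v(1)
    by (auto simp: span_singleton linY_simps subspace_span) (metis subspace_span span_singleton)
  moreover have "representation {v} ((Y ^^ l) v) v = q ^ (s * l)" for l
    unfolding pow using representation_scale[OF ind span_base, of v "q ^ (s * l)"] representation_basis[OF ind, of v] by simp
  ultimately show ?thesis unfolding dec_def using ind by (intro conjI exI[of _ "{v}"]) auto
qed

lemma Y_cube_pow:
  assumes "Y (Y (Y v)) = c *\<^sub>R v"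
  shows "(Y ^^ (3 * m)) v = (c ^ m) *\<^sub>R v"
  by (induction m) (simp_all add: numeral_3_eq_3 linY_simps assms)

lemma independent_two:
  assumes "\<And>x y. x *\<^sub>R a + y *\<^sub>R b = 0 \<Longrightarrow> x = 0 \<and> y = 0"
  shows "independent {a, b :: 'v}" "a \<noteq> b"
proof -
  have a: "a \<noteq> b" using assms[of 1 "-1"] by auto
  show "a \<noteq> b" by (rule a)
  show "independent {a,b}" unfolding independent_explicit using a assms by auto
qed

lemma independent_three:
  assumes "\<And>x y z. x *\<^sub>R a + y *\<^sub>R b + z *\<^sub>R c = 0 \<Longrightarrow> x = 0 \<and> y = 0 \<and> z = 0"
  shows "independent {a, b, c :: 'v}" "a \<noteq> b" "a \<noteq> c" "b \<noteq> c"
proof -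
  have a: "a \<noteq> b" "a \<noteq> c" "b \<noteq> c" using assms[of 1 "-1" 0] assms[of 1 0 "-1"] assms[of 0 1 "-1"] by auto
  show "a \<noteq> b" "a \<noteq> c" "b \<noteq> c" by (fact a)+
  show "independent {a,b,c}" unfolding independent_explicit using a assms
    by (auto simp: add.assoc)
qed

text \<open>In the basis \<open>v\<close>, \<open>Y v\<close> the operator is the companion matrix
  of x^2 + c x + c^2 with \<open>c = q ^ s\<close>, whose roots are \<open>c\<close> times the
  nonreal cube roots of unity.\<close>

lemma dec_pair:
  assumes v: "Y (Y v) = - (q ^ s) *\<^sub>R Y v - (q ^ s * q ^ s) *\<^sub>R v"
    and ind: "\<And>x y. x *\<^sub>R v + y *\<^sub>R Y v = 0 \<Longrightarrow> x = 0 \<and> y = 0"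
  shows "dec (span {v, Y v}) {#Z2 s#}"
proof -
  let ?c = "q ^ s"
  let ?B = "{v, Y v}"
  have B: "independent ?B" "v \<noteq> Y v" using independent_two[of v "Y v"] ind by blast+
  have cube: "Y (Y (Y u)) = (?c ^ 3) *\<^sub>R u" if "u = v \<or> u = Y v" for u
    using that by (auto simp: linY_simps v power3_eq_cube algebra_simps)
  have cube3: "(Y ^^ (3 * m)) v = (?c ^ (3 * m)) *\<^sub>R v" "(Y ^^ (3 * m)) (Y v) = (?c ^ (3 * m)) *\<^sub>R Y v" for m
    using Y_cube_pow[OF cube, of v m] Y_cube_pow[OF cube, of "Y v" m] by (simp_all add: power_mult)
  have rB: "representation ?B (x *\<^sub>R v + y *\<^sub>R Y v) = (\<lambda>b. if b = v then x else if b = Y v then y else 0)" for x y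
    using B by (subst representation_add[OF B(1)])
      (auto simp: representation_scale[OF B(1)] representation_basis[OF B(1)] span_base span_scale fun_eq_iff)
  have st: "stable (span ?B)" unfolding stable_def
  proof (intro conjI ballI subspace_span)
    fix u assume "u \<in> span ?B"
    obtain x y where u: "u = x *\<^sub>R v + y *\<^sub>R Y v" by (rule span_pairE[OF \<open>u \<in> span ?B\<close>])
    have m: "v \<in> span ?B" "Y v \<in> span ?B" by (auto intro: span_base)
    show "Y u \<in> span ?B" unfolding u linY_simps v by (intro span_add span_scale span_diff m)
  qed
  have "(\<Sum>b\<in>?B. representation ?B ((Y ^^ l) b) b) = zpow q l (Z2 s)" for l
  proof -
    have sum: "(\<Sum>b\<in>?B. g b) = g v + g (Y v)" for g :: "'v \<Rightarrow> real" using B by simp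
    have cl: "?c ^ l = q ^ (s * l)" for l by (simp add: power_mult)
    consider m where "l = 3 * m" | m where "l = Suc (3 * m)" | m where "l = Suc (Suc (3 * m))"
    proof -
      have "l = 3 * (l div 3) + l mod 3" by simp
      moreover have "l mod 3 = 0 \<or> l mod 3 = 1 \<or> l mod 3 = 2" by linarith
      ultimately show thesis using that by (metis One_nat_def Suc_1 add.right_neutral add_Suc_right)
    qed
    then show ?thesis
    proof cases
      case 1
      have p: "(Y ^^ l) v = (?c ^ l) *\<^sub>R v + 0 *\<^sub>R Y v" "(Y ^^ l) (Y v) = 0 *\<^sub>R v + (?c ^ l) *\<^sub>R Y v"
        unfolding 1 by (simp_all only: cube3 scaleR_zero_left add_0 add_0_right)
      show ?thesis unfolding sum p rB using B(2) by (simp add: cl) (simp add: 1)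
    next
      case 2
      have p: "(Y ^^ l) v = 0 *\<^sub>R v + (?c ^ (3 * m)) *\<^sub>R Y v"
         "(Y ^^ l) (Y v) = (- (?c ^ (3 * m)) * (?c * ?c)) *\<^sub>R v + (- (?c ^ (3 * m)) * ?c) *\<^sub>R Y v"
        unfolding 2 funpow.simps comp_apply cube3 linY_simps v by (simp_all add: algebra_simps)
      have "\<not> 3 dvd l" unfolding 2 by presburger
      then show ?thesis unfolding sum p rB using B(2) by (simp flip: cl) (simp add: 2)
    next
      case 3
      have p: "(Y ^^ l) v = (- (?c ^ (3 * m)) * (?c * ?c)) *\<^sub>R v + (- (?c ^ (3 * m)) * ?c) *\<^sub>R Y v"
        "(Y ^^ l) (Y v) = (?c ^ (3 * m) * ?c ^ 3) *\<^sub>R v + 0 *\<^sub>R Y v"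
        unfolding 3 funpow.simps comp_apply cube3 linY_simps v by (simp_all add: algebra_simps power3_eq_cube)
      have "\<not> 3 dvd l" unfolding 3 by presburger
      then show ?thesis unfolding sum p rB using B(2) by (simp flip: cl) (simp add: 3)
    qed
  qed
  then show ?thesis unfolding dec_def using B(1) st by (intro conjI exI[of _ ?B]) auto
qed

text \<open>The operator permutes the three basis vectors cyclically up to scalars, so only powers
  divisible by 3 have diagonal entries.\<close>

lemma dec_triple:
  assumes v: "Y (Y (Y v)) = (q ^ s) *\<^sub>R v"
    and ind: "\<And>x y z. x *\<^sub>R v + y *\<^sub>R Y v + z *\<^sub>R Y (Y v) = 0 \<Longrightarrow> x = 0 \<and> y = 0 \<and> z = 0"
  shows "dec (span {v, Y v, Y (Y v)}) {#Z3 s#}"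
proof -
  let ?c = "q ^ s"
  let ?B = "{v, Y v, Y (Y v)}"
  have B: "independent ?B" "v \<noteq> Y v" "v \<noteq> Y (Y v)" "Y v \<noteq> Y (Y v)"
    using independent_three[of v "Y v" "Y (Y v)"] ind by blast+
  have cube: "Y (Y (Y u)) = ?c *\<^sub>R u" if "u \<in> ?B" for u
    using that by (auto simp: linY_simps v)
  have rB: "representation ?B (x *\<^sub>R v + y *\<^sub>R Y v + z *\<^sub>R Y (Y v)) =
     (\<lambda>b. if b = v then x else if b = Y v then y else if b = Y (Y v) then z else 0)" for x y z
  proof -
    have m: "v \<in> span ?B" "Y v \<in> span ?B" "Y (Y v) \<in> span ?B" by (auto intro: span_base)
    show ?thesis
      using B m by (simp add: representation_add[OF B(1)] representation_scale[OF B(1)] representation_basis[OF B(1)]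
        span_add span_scale fun_eq_iff)
  qed
  have st: "stable (span ?B)" unfolding stable_def
  proof (intro conjI ballI subspace_span)
    fix u assume "u \<in> span ?B"
    obtain x y z where u: "u = x *\<^sub>R v + y *\<^sub>R Y v + z *\<^sub>R Y (Y v)"
      by (rule span_tripleE[OF \<open>u \<in> span ?B\<close>])
    have m: "v \<in> span ?B" "Y v \<in> span ?B" "Y (Y v) \<in> span ?B" by (auto intro: span_base)
    show "Y u \<in> span ?B" unfolding u linY_simps v by (intro span_add span_scale m)
  qed
  have "(\<Sum>b\<in>?B. representation ?B ((Y ^^ l) b) b) = zpow q l (Z3 s)" for l
  proof -
    have sum: "(\<Sum>b\<in>?B. g b) = g v + g (Y v) + g (Y (Y v))" for g :: "'v \<Rightarrow> real" using B by simp
    have cm: "?c ^ m = q ^ (s * m)" for m by (simp add: power_mult)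
    consider m where "l = 3 * m" | m where "l = Suc (3 * m)" | m where "l = Suc (Suc (3 * m))"
    proof -
      have "l = 3 * (l div 3) + l mod 3" by simp
      moreover have "l mod 3 = 0 \<or> l mod 3 = 1 \<or> l mod 3 = 2" by linarith
      ultimately show thesis using that by (metis One_nat_def Suc_1 add.right_neutral add_Suc_right)
    qed
    then show ?thesis
    proof cases
      case 1
      have p: "(Y ^^ l) v = (?c ^ m) *\<^sub>R v + 0 *\<^sub>R Y v + 0 *\<^sub>R Y (Y v)" "(Y ^^ l) (Y v) = 0 *\<^sub>R v + (?c ^ m) *\<^sub>R Y v + 0 *\<^sub>R Y (Y v)"
        "(Y ^^ l) (Y (Y v)) = 0 *\<^sub>R v + 0 *\<^sub>R Y v + (?c ^ m) *\<^sub>R Y (Y v)"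
        unfolding 1 using Y_cube_pow[OF cube] by simp_all
      show ?thesis unfolding sum p rB using B(2-4) by (simp add: 1 cm)
    next
      case 2
      have p: "(Y ^^ l) v = 0 *\<^sub>R v + (?c ^ m) *\<^sub>R Y v + 0 *\<^sub>R Y (Y v)" "(Y ^^ l) (Y v) = 0 *\<^sub>R v + 0 *\<^sub>R Y v + (?c ^ m) *\<^sub>R Y (Y v)"
        "(Y ^^ l) (Y (Y v)) = (?c ^ m * ?c) *\<^sub>R v + 0 *\<^sub>R Y v + 0 *\<^sub>R Y (Y v)"
        unfolding 2 using Y_cube_pow[OF cube] by (simp_all add: linY_simps v)
      have "\<not> 3 dvd l" unfolding 2 by presburger
      then show ?thesis unfolding sum p rB using B(2-4) by auto
    next
      case 3
      have p: "(Y ^^ l) v = 0 *\<^sub>R v + 0 *\<^sub>R Y v + (?c ^ m) *\<^sub>R Y (Y v)" "(Y ^^ l) (Y v) = (?c ^ m * ?c) *\<^sub>R v + 0 *\<^sub>R Y v + 0 *\<^sub>R Y (Y v)"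
        "(Y ^^ l) (Y (Y v)) = 0 *\<^sub>R v + (?c ^ m * ?c) *\<^sub>R Y v + 0 *\<^sub>R Y (Y v)"
        unfolding 3 using Y_cube_pow[OF cube] by (simp_all add: linY_simps v)
      have "\<not> 3 dvd l" unfolding 3 by presburger
      then show ?thesis unfolding sum p rB using B(2-4) by auto
    qed
  qed
  then show ?thesis unfolding dec_def using B(1) st by (intro conjI exI[of _ ?B]) auto
qed

text \<open>With \<open>c = q ^ s\<close>, the real factorisation x^3 - c^3 = (x - c)(x^2 + c x +
  c^2) splits \<open>E\<close> into \<open>E1\<close> and \<open>E2\<close>. In \<open>E2\<close>
  every nonzero vector spans a stable plane with its image, so the conjugate eigenvalues are handled
  without complex scalars.\<close>

lemma dec_cube_scalar:
  assumes E: "stable E" and cube: "\<And>v. v \<in> E \<Longrightarrow> Y (Y (Y v)) = ((q ^ s) ^ 3) *\<^sub>R v"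
  shows "\<exists>M. dec E M"
proof -
  define c where "c = q ^ s"
  have c: "c > 0" using q_pos by (simp add: c_def)
  have sE: "subspace E" using E by (rule stable_subspace)
  define E1 E2 where "E1 = {v \<in> E. Y v = c *\<^sub>R v}" and "E2 = {v \<in> E. Y (Y v) + c *\<^sub>R Y v + (c * c) *\<^sub>R v = 0}"
  have s1: "subspace E1" unfolding E1_def using sE by (auto simp: subspace_def linY_simps algebra_simps)
  have s2: "subspace E2" unfolding subspace_def
  proof (intro conjI allI ballI)
    show "0 \<in> E2" using sE by (simp add: E2_def subspace_0 linY_simps)
    fix x y assume x: "x \<in> E2"
    { assume "y \<in> E2"
      then have "(Y (Y x) + c *\<^sub>R Y x + (c * c) *\<^sub>R x) + (Y (Y y) + c *\<^sub>R Y y + (c * c) *\<^sub>R y) = 0" using x by (simp add: E2_def)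
      then show "x + y \<in> E2" using x \<open>y \<in> E2\<close> sE by (simp add: E2_def subspace_add linY_simps algebra_simps) }
    fix a :: real
    have "a *\<^sub>R (Y (Y x) + c *\<^sub>R Y x + (c * c) *\<^sub>R x) = 0" using x by (simp add: E2_def)
    then show "a *\<^sub>R x \<in> E2" using x sE by (simp add: E2_def subspace_scale linY_simps algebra_simps)
  qed
  have "\<exists>M. dec E1 M"
  proof (rule greedy[OF s1, of "\<lambda>U. True"])
    fix U assume U: "subspace U" "U \<subset> E1"
    then obtain v where v: "v \<in> E1" "v \<notin> U" by blast
    have v0: "v \<noteq> 0" using v(2) subspace_0[OF U(1)] by blast
    have "dec (span {v}) {#Z1 s#}" by (rule dec_eigenvector) (use v(1) v0 in \<open>simp_all add: E1_def c_def\<close>)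
    moreover have "span {v} \<subseteq> E1" using v(1) s1 by (intro span_minimal) auto
    moreover have "span {v} \<noteq> {0}" using v0 span_base[of v "{v}"] by auto
    moreover have "U \<inter> span {v} = {0}"
    proof -
      have "x *\<^sub>R v \<in> U \<Longrightarrow> x = 0" for x
        using subspace_scale[OF U(1), of "x *\<^sub>R v" "1 / x"] v(2) by (cases "x = 0") auto
      then show ?thesis using subspace_0[OF U(1)] by (auto simp: span_singleton)
    qed
    ultimately show "\<exists>C M. dec C M \<and> C \<subseteq> E1 \<and> C \<noteq> {0} \<and> U \<inter> C = {0} \<and> True" by blast
  qed simp
  then obtain M1 where M1: "dec E1 M1" by blast
  have st: "\<And>v. v \<in> E \<Longrightarrow> Y v \<in> E" using E by (simp add: stable_def)
  have "\<exists>M. dec E2 M"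
  proof (rule greedy[OF s2, of stable])
    show "stable {0}" by (simp add: stable_def linY_simps)
    fix U assume U: "subspace U" "U \<subset> E2" "stable U"
    then obtain v where v: "v \<in> E2" "v \<notin> U" by blast
    have vE: "v \<in> E" using v by (simp add: E2_def)
    have Yv: "Y (Y v) = - c *\<^sub>R Y v - (c * c) *\<^sub>R v"
    proof -
      have "Y (Y v) + (c *\<^sub>R Y v + (c * c) *\<^sub>R v) = 0" using v(1) by (simp add: E2_def add.assoc)
      then have "Y (Y v) = - (c *\<^sub>R Y v + (c * c) *\<^sub>R v)" by (rule eq_neg_iff_add_eq_0[THEN iffD2])
      then show ?thesis by simp
    qed
    have indep: "x = 0 \<and> y = 0" if "x *\<^sub>R v + y *\<^sub>R Y v \<in> U" for x y
    proof -
      let ?w = "x *\<^sub>R v + y *\<^sub>R Y v"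
      have "Y ?w \<in> U" using U(3) that by (simp add: stable_def)
      \<comment> \<open>Multiplying \<open>x + y * Y\<close> by its conjugate
        \<open>x - c * y - y * Y\<close> modulo the quadratic relation gives the norm form, which is
        positive definite.\<close>
      then have "(x - c * y) *\<^sub>R ?w - y *\<^sub>R Y ?w \<in> U" using that U(1) by (intro subspace_diff subspace_scale)
      also have "(x - c * y) *\<^sub>R ?w - y *\<^sub>R Y ?w = (x * x - x * (c * y) + (c * y) * (c * y)) *\<^sub>R v"
        unfolding linY_simps Yv by (simp add: algebra_simps)
      finally have "x * x - x * (c * y) + (c * y) * (c * y) = 0"
        using subspace_scale[OF U(1), of "(x * x - x * (c * y) + (c * y) * (c * y)) *\<^sub>R v" "1 / (x * x - x * (c * y) + (c * y) * (c * y))"] v(2)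
        by (cases "x * x - x * (c * y) + (c * y) * (c * y) = 0") auto
      moreover have "4 * (x * x - x * (c * y) + (c * y) * (c * y)) = (2 * x - c * y) * (2 * x - c * y) + 3 * ((c * y) * (c * y))"
        by (simp add: algebra_simps)
      ultimately have "(2 * x - c * y) * (2 * x - c * y) + 3 * ((c * y) * (c * y)) = 0" by simp
      then have "(c * y) * (c * y) = 0" "(2 * x - c * y) * (2 * x - c * y) = 0"
        using zero_le_square[of "c * y"] zero_le_square[of "2 * x - c * y"] by linarith+
      then show ?thesis using c by auto
    qed
    have st2: "stable (span {v, Y v})" "dec (span {v, Y v}) {#Z2 s#}"
    proof -
      show "dec (span {v, Y v}) {#Z2 s#}"
      proof (rule dec_pair)
        show "Y (Y v) = - (q ^ s) *\<^sub>R Y v - (q ^ s * q ^ s) *\<^sub>R v" using Yv by (simp add: c_def)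
        fix x y assume "x *\<^sub>R v + y *\<^sub>R Y v = 0"
        then have "x *\<^sub>R v + y *\<^sub>R Y v \<in> U" using subspace_0[OF U(1)] by simp
        then show "x = 0 \<and> y = 0" by (rule indep)
      qed
      then show "stable (span {v, Y v})" by (rule dec_stable)
    qed
    have YvE2: "Y v \<in> E2"
    proof -
      have "Y (Y (Y v) + c *\<^sub>R Y v + (c * c) *\<^sub>R v) = Y 0" using v(1) by (simp add: E2_def)
      then show ?thesis using st[OF vE] by (simp add: E2_def linY_simps)
    qed
    have "span {v, Y v} \<subseteq> E2" using v(1) YvE2 s2 by (intro span_minimal) auto
    moreover have "span {v, Y v} \<noteq> {0}"
    proof -
      have "v \<in> span {v, Y v}" by (intro span_base) simp
      moreover have "v \<noteq> 0" using v(2) subspace_0[OF U(1)] by metis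
      ultimately show ?thesis by blast
    qed
    moreover have "U \<inter> span {v, Y v} = {0}"
    proof -
      have "w = 0" if "w \<in> U" "w \<in> span {v, Y v}" for w
      proof -
        obtain x y where "w = x *\<^sub>R v + y *\<^sub>R Y v" by (rule span_pairE[OF \<open>w \<in> span {v, Y v}\<close>])
        then show ?thesis using indep[of x y] that(1) by simp
      qed
      then show ?thesis using subspace_0[OF U(1)] span_zero by blast
    qed
    ultimately show "\<exists>C M. dec C M \<and> C \<subseteq> E2 \<and> C \<noteq> {0} \<and> U \<inter> C = {0} \<and> stable {a + c | a c. a \<in> U \<and> c \<in> C}"
      using st2 stable_sums[OF U(3) st2(1)] by blast
  qed
  then obtain M2 where M2: "dec E2 M2" by blast
  have "E1 \<inter> E2 = {0}"
  proof -
    have "v = 0" if "v \<in> E1" "v \<in> E2" for v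
    proof -
      have "Y v = c *\<^sub>R v" using that by (simp add: E1_def)
      then have "(c * c) *\<^sub>R v + (c * c) *\<^sub>R v + (c * c) *\<^sub>R v = 0" using that(2) by (simp add: E2_def linY_simps)
      then have "(3 * (c * c)) *\<^sub>R v = 0" by (simp add: algebra_simps flip: scaleR_add_left)
      then show ?thesis using c by simp
    qed
    then show ?thesis using subspace_0[OF s1] subspace_0[OF s2] by blast
  qed
  then have "dec {a + b | a b. a \<in> E1 \<and> b \<in> E2} (M1 + M2)" by (rule dec_sums[OF M1 M2])
  moreover have "{a + b | a b. a \<in> E1 \<and> b \<in> E2} = E"
  proof (intro equalityI subsetI)
    fix v assume "v \<in> {a + b | a b. a \<in> E1 \<and> b \<in> E2}"
    then show "v \<in> E" using sE by (auto simp: E1_def E2_def subspace_add)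
  next
    fix v assume v: "v \<in> E"
    \<comment> \<open>The projection onto \<open>E1\<close> along \<open>E2\<close>; the denominator
      is the value of x^2 + c x + c^2 at \<open>c\<close>.\<close>
    define a where "a = (1 / (3 * (c * c))) *\<^sub>R (Y (Y v) + c *\<^sub>R Y v + (c * c) *\<^sub>R v)"
    have cv: "Y (Y (Y v)) = (c * c * c) *\<^sub>R v" using cube[OF v] by (simp add: c_def power3_eq_cube)
    have aE: "a \<in> E" unfolding a_def using v sE st by (intro subspace_scale subspace_add) auto
    have "Y a = c *\<^sub>R a" unfolding a_def linY_simps cv by (simp add: algebra_simps)
    then have a1: "a \<in> E1" using aE by (simp add: E1_def)
    have "Y (Y v) + c *\<^sub>R Y v + (c * c) *\<^sub>R v = (3 * (c * c)) *\<^sub>R a" unfolding a_def using c by simp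
    moreover have "Y (Y a) + c *\<^sub>R Y a + (c * c) *\<^sub>R a = (3 * (c * c)) *\<^sub>R a"
      using \<open>Y a = c *\<^sub>R a\<close> by (simp add: linY_simps) (simp add: algebra_simps flip: scaleR_add_left)
    ultimately have va: "v - a \<in> E2" using aE v sE unfolding E2_def by (simp add: subspace_diff linY_simps algebra_simps)
    have "v = a + (v - a)" by simp
    then show "v \<in> {a + b | a b. a \<in> E1 \<and> b \<in> E2}" using a1 va by blast
  qed
  ultimately show ?thesis by auto
qed

text \<open>Each vector of a basis of \<open>A\<close> generates a triple as in
  \<open>dec_triple\<close>, and \<open>indep\<close> makes these triples independent.\<close>

lemma dec_balanced:
  assumes A: "subspace A"
    and indep: "\<And>a b c. a \<in> A \<Longrightarrow> b \<in> A \<Longrightarrow> c \<in> A \<Longrightarrow> a + Y b + Y (Y c) = 0 \<Longrightarrow> a = 0 \<and> b = 0 \<and> c = 0"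
    and cube: "\<And>v. v \<in> A \<Longrightarrow> Y (Y (Y v)) = (q ^ s) *\<^sub>R v"
  shows "\<exists>M. dec {a + Y b + Y (Y c) | a b c. a \<in> A \<and> b \<in> A \<and> c \<in> A} M"
proof -
  define H where "H U = {a + Y b + Y (Y c) | a b c. a \<in> U \<and> b \<in> U \<and> c \<in> U}" for U
  have HI: "a + Y b + Y (Y c) \<in> H U" if "a \<in> U" "b \<in> U" "c \<in> U" for a b c U using that by (auto simp: H_def)
  have sH: "subspace (H U)" if U: "subspace U" for U
    unfolding subspace_def
  proof (intro conjI ballI allI)
    show "0 \<in> H U" using HI[of 0 U 0 0] subspace_0[OF U] by (simp add: linY_simps)
    fix x y assume "x \<in> H U"
    then obtain a b c where x: "x = a + Y b + Y (Y c)" "a \<in> U" "b \<in> U" "c \<in> U" by (auto simp: H_def)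
    { assume "y \<in> H U"
      then obtain a' b' c' where y: "y = a' + Y b' + Y (Y c')" "a' \<in> U" "b' \<in> U" "c' \<in> U" by (auto simp: H_def)
      have "x + y = (a + a') + Y (b + b') + Y (Y (c + c'))" unfolding x y by (simp add: linY_simps algebra_simps)
      show "x + y \<in> H U" unfolding \<open>x + y = _\<close> using x y U by (intro HI subspace_add) }
    fix k :: real
    have "k *\<^sub>R x = (k *\<^sub>R a) + Y (k *\<^sub>R b) + Y (Y (k *\<^sub>R c))" unfolding x by (simp add: linY_simps algebra_simps)
    show "k *\<^sub>R x \<in> H U" unfolding \<open>k *\<^sub>R x = _\<close> using x U by (intro HI subspace_scale)
  qed
  have "\<exists>M. dec (H (span C)) M" if C: "independent C" "C \<subseteq> A" for C
  proof -
    have "finite C" using C(1) by (rule independent_imp_finite)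
    then show ?thesis using C
    proof (induction C rule: finite_induct)
      case empty
      have "H {0} = {0}" by (auto simp: H_def linY_simps)
      then show ?case using dec_zero by auto
    next
      case (insert v C)
      have ind: "independent C" "v \<notin> span C" using insert by (auto simp: independent_insert)
      obtain M where M: "dec (H (span C)) M" using insert.IH ind(1) insert.prems by blast
      have vA: "v \<in> A" and CA: "span C \<subseteq> A" using insert.prems span_minimal[OF _ A, of C] by auto
      have vs: "x = 0" if "x *\<^sub>R v \<in> span C" for x
        using span_scale[OF that, of "1 / x"] ind(2) by (cases "x = 0") auto
      have N: "dec (span {v, Y v, Y (Y v)}) {#Z3 s#}"
      proof (rule dec_triple[OF cube[OF vA]])
        fix x y z assume 0: "x *\<^sub>R v + y *\<^sub>R Y v + z *\<^sub>R Y (Y v) = 0"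
        have "x *\<^sub>R v = 0 \<and> y *\<^sub>R v = 0 \<and> z *\<^sub>R v = 0"
          by (rule indep) (use vA A 0 in \<open>simp_all add: subspace_scale linY_simps\<close>)
        moreover have "v \<noteq> 0" using ind(2) span_zero by blast
        ultimately show "x = 0 \<and> y = 0 \<and> z = 0" by simp
      qed
      have "H (span C) \<inter> span {v, Y v, Y (Y v)} = {0}"
      proof -
        have "w = 0" if w: "w \<in> H (span C)" "w \<in> span {v, Y v, Y (Y v)}" for w
        proof -
          obtain a b c where abc: "w = a + Y b + Y (Y c)" "a \<in> span C" "b \<in> span C" "c \<in> span C" using w(1) by (auto simp: H_def)
          obtain x y z where xyz: "w = x *\<^sub>R v + y *\<^sub>R Y v + z *\<^sub>R Y (Y v)"
            by (rule span_tripleE[OF w(2)])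
          have "(x *\<^sub>R v - a) + Y (y *\<^sub>R v - b) + Y (Y (z *\<^sub>R v - c)) = w - w"
            by (subst (2) abc(1), subst xyz) (simp add: linY_simps algebra_simps)
          then have "x *\<^sub>R v - a = 0 \<and> y *\<^sub>R v - b = 0 \<and> z *\<^sub>R v - c = 0"
            by (intro indep subspace_diff subspace_scale A vA subsetD[OF CA] abc) simp
          then have "x *\<^sub>R v \<in> span C" "y *\<^sub>R v \<in> span C" "z *\<^sub>R v \<in> span C" using abc by auto
          then show "w = 0" using xyz vs[of x] vs[of y] vs[of z] by simp
        qed
        then show ?thesis using subspace_0[OF sH[OF subspace_span]] span_zero by blast
      qed
      then have "dec {a + b |a b. a \<in> H (span C) \<and> b \<in> span {v, Y v, Y (Y v)}} (M + {#Z3 s#})"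
        by (rule dec_sums[OF M N])
      moreover have "{a + b |a b. a \<in> H (span C) \<and> b \<in> span {v, Y v, Y (Y v)}} = H (span (insert v C))"
      proof (intro equalityI subsetI)
        fix w assume "w \<in> {a + b |a b. a \<in> H (span C) \<and> b \<in> span {v, Y v, Y (Y v)}}"
        then obtain u u' where u: "w = u + u'" "u \<in> H (span C)" "u' \<in> span {v, Y v, Y (Y v)}" by blast
        obtain a b c where abc: "u = a + Y b + Y (Y c)" "a \<in> span C" "b \<in> span C" "c \<in> span C" using u(2) by (auto simp: H_def)
        obtain x y z where xyz: "u' = x *\<^sub>R v + y *\<^sub>R Y v + z *\<^sub>R Y (Y v)"
          by (rule span_tripleE[OF u(3)])
        have "w = (a + x *\<^sub>R v) + Y (b + y *\<^sub>R v) + Y (Y (c + z *\<^sub>R v))"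
          unfolding u(1) abc(1) xyz by (simp add: linY_simps algebra_simps)
        moreover have "a + x *\<^sub>R v \<in> span (insert v C)" if "a \<in> span C" for a x
          by (intro span_add span_scale span_base subsetD[OF span_mono[OF subset_insertI] that]) simp
        ultimately show "w \<in> H (span (insert v C))" using abc(2-4) HI by metis
      next
        fix w assume "w \<in> H (span (insert v C))"
        then obtain a b c where abc: "w = a + Y b + Y (Y c)" "a \<in> span (insert v C)" "b \<in> span (insert v C)" "c \<in> span (insert v C)"
          by (auto simp: H_def)
        obtain x y z where xyz: "a - x *\<^sub>R v \<in> span C" "b - y *\<^sub>R v \<in> span C" "c - z *\<^sub>R v \<in> span C"
          using abc(2-4) unfolding span_breakdown_eq by auto
        have "w = ((a - x *\<^sub>R v) + Y (b - y *\<^sub>R v) + Y (Y (c - z *\<^sub>R v))) + (x *\<^sub>R v + y *\<^sub>R Y v + z *\<^sub>R Y (Y v))"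
          unfolding abc(1) by (simp add: linY_simps algebra_simps)
        moreover have "x *\<^sub>R v + y *\<^sub>R Y v + z *\<^sub>R Y (Y v) \<in> span {v, Y v, Y (Y v)}"
          by (intro span_add span_scale span_base) auto
        ultimately show "w \<in> {a + b |a b. a \<in> H (span C) \<and> b \<in> span {v, Y v, Y (Y v)}}"
          using HI[OF xyz] by blast
      qed
      ultimately show ?case by auto
    qed
  qed
  note * = this
  obtain C where C: "C \<subseteq> A" "independent C" "A \<subseteq> span C" by (rule basis_exists[of A])
  then have "span C = A" using span_minimal[OF C(1) A] by (intro equalityI)
  then show ?thesis using *[OF C(2,1)] by (simp add: H_def)
qed

text \<open>For \<open>l > 0\<close> the power maps into \<open>W\<close>, so its trace on the whole
  space is the one on \<open>W\<close>.\<close>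

lemma tr_dec:
  assumes W: "dec W M" and range: "\<And>v. Y v \<in> W" and l: "l > 0"
  shows "tr (Y ^^ l) = (\<Sum>t\<in>#M. zpow q l t)"
proof -
  obtain B where B: "independent B" "span B = W"
    "\<And>l. (\<Sum>b\<in>B. representation B ((Y ^^ l) b) b) = (\<Sum>t\<in>#M. zpow q l t)" using W unfolding dec_def by blast
  obtain l' where l': "l = Suc l'" using l by (cases l) auto
  have "linear (Y ^^ l)"
  proof (induction l)
    case (Suc l)
    then show ?case using linear_compose[OF Suc linY] by (simp add: comp_def)
  qed (simp add: linear_id[unfolded id_def] id_def)
  moreover have "(Y ^^ l) v \<in> span B" for v using range[of "(Y ^^ l') v"] B(2) by (simp add: l')
  ultimately show ?thesis using tr_range_basis[OF B(1)] B(3) by simp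
qed

end

section \<open>Decomposition into irreducible modules\<close>

context qflags
begin

definition flag_fn :: "real ^ ('a \<times> 'a) \<Rightarrow> 'a \<Rightarrow> 'a \<Rightarrow> real" where "flag_fn v L P = v $ (L, P)"

definition S_op :: "real ^ ('a \<times> 'a) \<Rightarrow> real ^ ('a \<times> 'a)" where
  "S_op v = (\<chi> x. Sop (flag_fn v) (fst x) (snd x))"

definition T_op :: "real ^ ('a \<times> 'a) \<Rightarrow> real ^ ('a \<times> 'a)" where
  "T_op v = (\<chi> x. Top (flag_fn v) (fst x) (snd x))"

definition flag_space :: "(real ^ ('a \<times> 'a)) set" where
  "flag_space = {v. \<forall>L P. \<not> flag L P \<longrightarrow> v $ (L, P) = 0}"

lemma flag_fn_S_op: "flag_fn (S_op v) = Sop (flag_fn v)" by (simp add: flag_fn_def S_op_def fun_eq_iff)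
lemma flag_fn_T_op: "flag_fn (T_op v) = Top (flag_fn v)" by (simp add: flag_fn_def T_op_def fun_eq_iff)

lemma flag_fn_add: "flag_fn (u + v) L P = flag_fn u L P + flag_fn v L P" and flag_fn_scale: "flag_fn (c *\<^sub>R v) L P = c * flag_fn v L P"
  by (simp_all add: flag_fn_def)

lemma linear_S_op: "linear S_op"
  by (rule linearI) (auto simp: S_op_def Sop_def Finite_Cartesian_Product.vec_eq_iff flag_fn_add flag_fn_scale sum.distrib sum_distrib_left)

lemma linear_T_op: "linear T_op"
  by (rule linearI) (auto simp: T_op_def Top_def Finite_Cartesian_Product.vec_eq_iff flag_fn_add flag_fn_scale sum.distrib sum_distrib_left)

lemma S_op_flag_space: "S_op v \<in> flag_space" by (simp add: flag_space_def S_op_def Sop_def)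
lemma T_op_flag_space: "T_op v \<in> flag_space" by (simp add: flag_space_def T_op_def Top_def)
lemma subspace_flag_space: "subspace flag_space" by (auto simp: flag_space_def subspace_def)

lemma flag_cocomplement:
  assumes "flag L P" "M \<curlyvee> P = tp" "M \<curlywedge> P = L"
  shows "flag L M"
proof -
  have "L \<preceq> M" using assms(3) mt_le1 by metis
  moreover have "dm M = 2 * k" using assms dm_mod[of M P] dm_tp n_eq by (simp add: flag_def)
  ultimately show ?thesis using assms by (simp add: flag_def)
qed

lemma inner_pairs: "(u :: real ^ ('a \<times> 'a)) \<bullet> v = (\<Sum>L\<in>UNIV. \<Sum>P\<in>UNIV. u $ (L,P) * v $ (L,P))"
  unfolding inner_vec_def UNIV_Times_UNIV[symmetric] by (simp add: sum.cartesian_product)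

text \<open>S keeps \<open>P\<close>, and being complementary in \<open>P\<close> is a symmetric
  relation between \<open>L\<close> and \<open>M\<close>.\<close>

lemma S_op_symmetric: "S_op u \<bullet> v = u \<bullet> S_op v"
proof -
  define s where "s L M P = (if flag L P \<and> M \<curlywedge> L = bt \<and> M \<curlyvee> L = P then 1 else 0 :: real)" for L M P
  have sym: "s L M P = s M L P" for L M P
    unfolding s_def using flag_complement[of L P M] flag_complement[of M P L]
    by (auto simp: mt_commute[of L] jn_commute[of L])
  have S_op: "S_op u $ (L,P) = (\<Sum>M\<in>UNIV. s L M P * u $ (M,P))" for u L P
    unfolding S_op_def Sop_def sum_Collect by (auto simp: s_def flag_fn_def intro!: sum.cong)
  have "S_op u \<bullet> v = (\<Sum>L\<in>UNIV. \<Sum>P\<in>UNIV. \<Sum>M\<in>UNIV. s L M P * u $ (M,P) * v $ (L,P))"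
    unfolding inner_pairs S_op by (simp add: sum_distrib_right)
  also have "\<dots> = (\<Sum>M\<in>UNIV. \<Sum>P\<in>UNIV. \<Sum>L\<in>UNIV. s L M P * u $ (M,P) * v $ (L,P))"
    by (subst sum_rotate3, subst sum.swap) simp
  also have "\<dots> = u \<bullet> S_op v"
    unfolding inner_pairs S_op by (simp add: sum_distrib_left sym mult_ac)
  finally show ?thesis .
qed

lemma T_op_symmetric: "T_op u \<bullet> v = u \<bullet> T_op v"
proof -
  define s where "s L P M = (if flag L P \<and> M \<curlyvee> P = tp \<and> M \<curlywedge> P = L then 1 else 0 :: real)" for L P M
  have sym: "s L P M = s L M P" for L M P
    unfolding s_def using flag_cocomplement[of L P M] flag_cocomplement[of L M P]
    by (auto simp: mt_commute[of P] jn_commute[of P])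
  have T_op: "T_op u $ (L,P) = (\<Sum>M\<in>UNIV. s L P M * u $ (L,M))" for u L P
    unfolding T_op_def Top_def sum_Collect by (auto simp: s_def flag_fn_def intro!: sum.cong)
  have "T_op u \<bullet> v = (\<Sum>L\<in>UNIV. \<Sum>P\<in>UNIV. \<Sum>M\<in>UNIV. s L P M * u $ (L,M) * v $ (L,P))"
    unfolding inner_pairs T_op by (simp add: sum_distrib_right)
  also have "\<dots> = (\<Sum>L\<in>UNIV. \<Sum>M\<in>UNIV. \<Sum>P\<in>UNIV. s L P M * u $ (L,M) * v $ (L,P))"
    by (intro sum.cong refl sum.swap)
  also have "\<dots> = u \<bullet> T_op v"
    unfolding inner_pairs T_op by (simp add: sum_distrib_left sym mult_ac)
  finally show ?thesis .
qed

lemma phi_add: "phi (\<lambda>L P. f L P + g L P) A B = phi f A B + phi g A B"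
  and phi_scale: "phi (\<lambda>L P. c * f L P) A B = c * phi f A B"
  unfolding phi_def by (simp_all add: sum.distrib sum_distrib_left split_def)

lemma linear_string_coord: "linear (\<lambda>v. string_coord r j d w t (flag_fn v))"
proof (rule linearI)
  have e: "flag_fn (u + v) = (\<lambda>L P. flag_fn u L P + flag_fn v L P)" "flag_fn (c *\<^sub>R v) = (\<lambda>L P. c * flag_fn v L P)" for u v c
    by (simp_all add: fun_eq_iff flag_fn_add flag_fn_scale)
  have a: "phir r (flag_fn (u + v)) A B = phir r (flag_fn u) A B + phir r (flag_fn v) A B"
    "phir r (flag_fn (c *\<^sub>R v)) A B = c * phir r (flag_fn v) A B" for u v c A B
    unfolding e phir_def phi_add phi_scale by simp_all
  fix u v c
  show "string_coord r j d w t (flag_fn (u + v)) = string_coord r j d w t (flag_fn u) + string_coord r j d w t (flag_fn v)"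
    unfolding string_coord_def ip_def a by (simp add: sum.distrib distrib_left add_divide_distrib)
  show "string_coord r j d w t (flag_fn (c *\<^sub>R v)) = c *\<^sub>R string_coord r j d w t (flag_fn v)"
    unfolding string_coord_def ip_def a by (simp add: sum_distrib_left mult_ac)
qed

definition invariant :: "(real ^ ('a \<times> 'a)) set \<Rightarrow> bool" where
  "invariant U \<longleftrightarrow> subspace U \<and> (\<forall>v\<in>U. S_op v \<in> U \<and> T_op v \<in> U)"

lemma exists_irreducible:
  assumes W: "invariant W" "W \<noteq> {0}"
  obtains E where "invariant E" "E \<subseteq> W" "E \<noteq> {0}" "\<And>K. invariant K \<Longrightarrow> K \<subseteq> E \<Longrightarrow> K = {0} \<or> K = E"
proof -
  define Q where "Q E \<longleftrightarrow> invariant E \<and> E \<subseteq> W \<and> E \<noteq> {0}" for E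
  have "Q W" using W by (simp add: Q_def)
  then obtain E where E: "Q E" "\<forall>K. Q K \<longrightarrow> dim E \<le> dim K"
    using ex_has_least_nat[of Q W dim] by blast
  have "K = {0} \<or> K = E" if K: "invariant K" "K \<subseteq> E" for K
  proof (cases "K = {0}")
    case False
    then have "Q K" using K E(1) by (auto simp: Q_def)
    then have "dim E \<le> dim K" using E(2) by blast
    then have "K = E" using K E(1) by (intro subspace_dim_equal) (auto simp: Q_def invariant_def)
    then show ?thesis by simp
  qed simp
  then show thesis using that E(1) by (auto simp: Q_def)
qed

text \<open>For a flag the interval from \<open>L\<close> to \<open>P\<close> has degree
  \<open>2 * k\<close> and contains no other flag, so the filtration ends here.\<close>

lemma vanish_bound:
  assumes Z: "vanish (Suc (2 * k)) f" shows "f = (\<lambda>L P. 0)"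
proof (intro ext)
  fix L P
  show "f L P = 0"
  proof (cases "flag L P")
    case True
    have "dm L + (n - dm P) < Suc (2 * k)" "L \<preceq> P" using True n_eq by (auto simp: flag_def)
    then have "phi f L P = 0" using Z by (auto simp: vanish_def)
    moreover have "{(M,Q). flag M Q \<and> L \<preceq> M \<and> Q \<preceq> P} = {(L,P)}"
    proof -
      have "M = L \<and> Q = P" if "flag M Q" "L \<preceq> M" "Q \<preceq> P" for M Q
        using that True le_dm_eq[of L M] le_dm_eq[of Q P] by (auto simp: flag_def)
      then show ?thesis using True by auto
    qed
    ultimately show ?thesis by (simp add: phi_def)
  next
    case False
    then show ?thesis using Z by (simp add: vanish_def)
  qed
qed

lemma operator_ST: "operator (\<lambda>v. S_op (T_op v)) q"
proof (rule operator.intro)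
  show "linear (\<lambda>v. S_op (T_op v))" using linear_compose[OF linear_T_op linear_S_op] by (simp add: comp_def)
qed (use q_gt_1 in simp)

text \<open>The common kernel of the string coordinates is invariant, because their values on
  \<open>S_op v\<close> and \<open>T_op v\<close> are combinations of those on \<open>v\<close>. It
  does not contain \<open>f\<close>, so irreducibility makes it 0 and the coordinates embed
  \<open>E\<close>.\<close>

lemma irreducible_dec:
  assumes k: "k \<ge> 1" and E: "invariant E" "E \<subseteq> flag_space" "E \<noteq> {0}"
    and irr: "\<And>K. invariant K \<Longrightarrow> K \<subseteq> E \<Longrightarrow> K = {0} \<or> K = E"
  shows "\<exists>M. operator.dec (\<lambda>v. S_op (T_op v)) q E M"
proof -
  interpret op: operator "\<lambda>v. S_op (T_op v)" q by (rule operator_ST)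
  have sE: "subspace E" and inv: "\<And>v. v \<in> E \<Longrightarrow> S_op v \<in> E" "\<And>v. v \<in> E \<Longrightarrow> T_op v \<in> E" using E(1) by (auto simp: invariant_def)
  define Q where "Q r \<longleftrightarrow> (\<forall>v\<in>E. vanish r (flag_fn v))" for r
  have Q0: "Q 0" using E(2) by (auto simp: Q_def vanish_def flag_space_def flag_fn_def)
  have notQ: "\<not> Q (Suc (2 * k))"
  proof
    assume *: "Q (Suc (2 * k))"
    have "v = 0" if "v \<in> E" for v
    proof -
      have "flag_fn v = (\<lambda>L P. 0)" using * that vanish_bound by (simp add: Q_def)
      then show ?thesis by (auto simp: Finite_Cartesian_Product.vec_eq_iff flag_fn_def fun_eq_iff)
    qed
    then show False using E(3) subspace_0[OF sE] by blast
  qed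
  obtain r where r: "Q r" "\<not> Q (Suc r)" "r \<le> 2 * k"
  proof -
    have "\<exists>r\<le>2 * k. Q r \<and> \<not> Q (Suc r)"
    proof (rule ccontr)
      assume a: "\<not> ?thesis"
      have "Q r" if "r \<le> Suc (2 * k)" for r using that by (induction r) (use Q0 a in auto)
      then show False using notQ by simp
    qed
    then show thesis using that by blast
  qed
  have rn: "r \<le> n" using r(3) n_eq by simp
  have rZ: "vanish r (flag_fn v)" if "v \<in> E" for v using r(1) that by (simp add: Q_def)
  obtain f where f: "f \<in> E" "\<not> vanish (Suc r) (flag_fn f)" using r(2) by (auto simp: Q_def)
  obtain j w t where w: "annihilated (n - r) w" "homog j w" "lower_op w = (\<lambda>A B. 0)" "w \<noteq> (\<lambda>A B. 0)"
    and t: "ip ((raise_op ^^ t) w) (phir r (flag_fn f)) \<noteq> 0"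
    by (rule primitive_exists[OF rZ[OF f(1)] f(2) rn])
  \<comment> \<open>\<open>r\<close> is at most \<open>2 * k\<close>, hence less than
    \<open>n\<close>; the commutator formula needs this positive width.\<close>
  obtain e where e: "n - r = Suc e" using r(3) n_eq k by (cases "n - r") auto
  have jr: "2 * j \<le> r" by (rule string_length(1)[OF w(1) e w(2,3,4)])
  define d where "d = r - 2 * j"
  have rd: "r = 2 * j + d" using jr by (simp add: d_def)
  define z where "z t v = string_coord r j d w t (flag_fn v)" for t v
  have linz: "linear (z t)" for t unfolding z_def by (rule linear_string_coord)
  have zS: "z t (S_op v) = sig k j t * (\<Sum>p\<le>t. qbin t p * z p v)" if "v \<in> E" "t \<le> d" for t v
    unfolding z_def flag_fn_S_op by (rule string_coord_Sop[OF rZ[OF that(1)] w(1) e w(2,3) rd that(2)])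
  have zT: "z t (T_op v) = sig k j (d - t) *
      (\<Sum>l\<le>d - t. q powi ((int k + 1 - int r + int j) * int l) * qbin (d - t) (d - t - l) * z (t + l) v)"
    if "v \<in> E" "t \<le> d" for t v
    unfolding z_def flag_fn_T_op by (rule string_coord_Top[OF rZ[OF that(1)] w(1) e w(2,3,4) rd that(2)])
  define K where "K = {v \<in> E. \<forall>t\<le>d. z t v = 0}"
  have "invariant K"
    unfolding invariant_def
  proof (intro conjI ballI)
    show "subspace K" unfolding K_def subspace_def using sE linz
      by (auto simp: subspace_0 subspace_add subspace_scale linear_0 linear_add linear_scale)
    fix v assume "v \<in> K"
    then show "S_op v \<in> K" "T_op v \<in> K" using inv by (simp_all add: K_def zS zT)
  qed
  moreover have "K \<subseteq> E" by (auto simp: K_def)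
  moreover have "K \<noteq> E"
  proof -
    have "t \<le> d"
    proof (rule ccontr)
      assume "\<not> t \<le> d"
      then have "(raise_op ^^ t) w = (\<lambda>A B. 0)" by (intro string_length(2)[OF w(1) e w(2,3,4)]) (simp add: d_def)
      then show False using t by (simp add: ip_def)
    qed
    moreover have "z t f \<noteq> 0" using t coord_scale_nz[of j d t] by (simp add: z_def string_coord_def)
    ultimately show ?thesis using f(1) by (auto simp: K_def)
  qed
  ultimately have K0: "K = {0}" using irr by blast
  interpret m: strmod q k r j d E S_op T_op z
  proof (intro strmod.intro strmod_axioms.intro)
    show "qnum q" by (rule qnum_axioms)
    show "v = 0" if "v \<in> E" "\<And>t. t \<le> d \<Longrightarrow> z t v = 0" for v using that K0 by (auto simp: K_def)
    show "z t v = 0" if "v \<in> E" "t \<le> d" "j + t > k \<or> r - (j + t) > k" for v t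
      unfolding z_def by (rule string_coord_trunc[OF w(2,1) rn that(3)])
  qed (use sE linear_S_op linear_T_op linz inv rd r(3) zS zT in blast)+
  define s where "s = nat m.s_exp"
  have qs: "q powi m.s_exp = q ^ s" using m.s_exp_nonneg by (simp add: s_def power_int_def)
  have cube: "S_op (T_op (S_op (T_op (S_op (T_op v))))) = (q ^ s) *\<^sub>R v" if "v \<in> E" for v
    using m.y_cube[OF that] qs by simp
  show ?thesis
  proof (cases "3 dvd Suc d")
    case True
    obtain A where A: "subspace A" "A \<subseteq> E"
      "\<forall>a\<in>A. \<forall>b\<in>A. \<forall>c\<in>A. a + S_op (T_op b) + S_op (T_op (S_op (T_op c))) = 0 \<longrightarrow> a = 0 \<and> b = 0 \<and> c = 0"
      "\<forall>v\<in>E. \<exists>a\<in>A. \<exists>b\<in>A. \<exists>c\<in>A. v = a + S_op (T_op b) + S_op (T_op (S_op (T_op c)))"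
      using m.balanced[OF True] by blast
    have "{a + S_op (T_op b) + S_op (T_op (S_op (T_op c))) | a b c. a \<in> A \<and> b \<in> A \<and> c \<in> A} = E"
    proof (intro equalityI subsetI)
      fix v assume "v \<in> {a + S_op (T_op b) + S_op (T_op (S_op (T_op c))) | a b c. a \<in> A \<and> b \<in> A \<and> c \<in> A}"
      then obtain a b c where v: "v = a + S_op (T_op b) + S_op (T_op (S_op (T_op c)))" and abc: "a \<in> A" "b \<in> A" "c \<in> A" by blast
      show "v \<in> E" unfolding v by (intro subspace_add[OF sE] inv subsetD[OF A(2)] abc)
    next
      fix v assume "v \<in> E"
      then show "v \<in> {a + S_op (T_op b) + S_op (T_op (S_op (T_op c))) | a b c. a \<in> A \<and> b \<in> A \<and> c \<in> A}" using A(4) by blast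
    qed
    moreover have "\<exists>M. op.dec {a + S_op (T_op b) + S_op (T_op (S_op (T_op c))) | a b c. a \<in> A \<and> b \<in> A \<and> c \<in> A} M"
    proof (rule op.dec_balanced[OF A(1)])
      show "S_op (T_op (S_op (T_op (S_op (T_op v))))) = (q ^ s) *\<^sub>R v" if "v \<in> A" for v using cube that A(2) by blast
    qed (use A(3) in blast)
    ultimately show ?thesis by simp
  next
    case False
    then have "3 dvd m.s_exp" by (rule m.s_exp_mod_3)
    then have "int 3 dvd int s" using m.s_exp_nonneg by (simp add: s_def)
    then have "3 dvd s" by (simp only: int_dvd_int_iff)
    then obtain u where u: "s = u * 3" by (auto simp: mult.commute)
    show ?thesis
    proof (rule op.dec_cube_scalar)
      show "op.stable E" using sE inv by (simp add: op.stable_def)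
      show "S_op (T_op (S_op (T_op (S_op (T_op v))))) = ((q ^ u) ^ 3) *\<^sub>R v" if "v \<in> E" for v
        using cube[OF that] by (simp add: u power_mult)
    qed
  qed
qed

text \<open>As S and T are symmetric, the orthogonal complement of an invariant subspace is
  invariant and supplies the next irreducible piece.\<close>

theorem trace_decomposition:
  assumes k: "k \<ge> 1"
  shows "\<exists>M. \<forall>l>0. tr ((\<lambda>v. S_op (T_op v)) ^^ l) = (\<Sum>t\<in>#M. zpow q l t)"
proof -
  interpret op: operator "\<lambda>v. S_op (T_op v)" q by (rule operator_ST)
  have "\<exists>M. op.dec flag_space M"
  proof (rule op.greedy[OF subspace_flag_space, of invariant])
    show "invariant {0}" using linear_S_op linear_T_op by (simp add: invariant_def linear_0)
    fix U assume U: "subspace U" "U \<subset> flag_space" "invariant U"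
    define W where "W = {w \<in> flag_space. \<forall>u\<in>U. u \<bullet> w = 0}"
    have W: "invariant W" unfolding invariant_def
    proof (intro conjI ballI)
      show "subspace W" unfolding W_def subspace_def using subspace_flag_space
        by (auto simp: subspace_0 subspace_add subspace_scale inner_add_right)
      fix w assume w: "w \<in> W"
      show "S_op w \<in> W" using w U(3) S_op_flag_space by (auto simp: W_def invariant_def S_op_symmetric[symmetric])
      show "T_op w \<in> W" using w U(3) T_op_flag_space by (auto simp: W_def invariant_def T_op_symmetric[symmetric])
    qed
    have "span U \<subset> span flag_space" using U(2) unfolding span_eq_iff[THEN iffD2, OF U(1)] span_eq_iff[THEN iffD2, OF subspace_flag_space] .
    then obtain x where x: "x \<noteq> 0" "x \<in> span flag_space" "\<And>y. y \<in> span U \<Longrightarrow> Linear_Algebra.orthogonal x y"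
      using orthogonal_to_subspace_exists_gen[of U flag_space] by metis
    then have "u \<bullet> x = 0" if "u \<in> U" for u
      using x(3)[OF span_base[OF that]] by (simp add: Linear_Algebra.orthogonal_def inner_commute)
    then have "x \<in> W" "x \<noteq> 0" using x(1,2)
      unfolding W_def span_eq_iff[THEN iffD2, OF subspace_flag_space] by auto
    then have "W \<noteq> {0}" by blast
    obtain E where E: "invariant E" "E \<subseteq> W" "E \<noteq> {0}" "\<And>K. invariant K \<Longrightarrow> K \<subseteq> E \<Longrightarrow> K = {0} \<or> K = E"
      by (rule exists_irreducible[OF W \<open>W \<noteq> {0}\<close>]) blast
    have EF: "E \<subseteq> flag_space" using E(2) by (auto simp: W_def)
    obtain M where M: "op.dec E M" using irreducible_dec[OF k E(1) EF E(3,4)] by blast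
    have "u = 0" if "u \<in> U" "u \<in> E" for u
    proof -
      have "u \<in> W" using that E(2) by blast
      then have "u \<bullet> u = 0" using that(1) unfolding W_def by blast
      then show ?thesis by simp
    qed
    moreover have "0 \<in> U" "0 \<in> E" using U(1) E(1) by (simp_all add: invariant_def subspace_0)
    ultimately have "U \<inter> E = {0}" by blast
    moreover have "invariant {a + c | a c. a \<in> U \<and> c \<in> E}" unfolding invariant_def
    proof (intro conjI ballI)
      show "subspace {a + c | a c. a \<in> U \<and> c \<in> E}" using U(1) E(1) by (simp add: invariant_def subspace_sums)
      fix v assume "v \<in> {a + c | a c. a \<in> U \<and> c \<in> E}"
      then obtain a c where v: "v = a + c" "a \<in> U" "c \<in> E" by blast
      have "S_op v = S_op a + S_op c" "T_op v = T_op a + T_op c" using v(1) linear_S_op linear_T_op by (simp_all add: linear_add)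
      moreover have "S_op a \<in> U" "T_op a \<in> U" "S_op c \<in> E" "T_op c \<in> E" using v U(3) E(1) by (simp_all add: invariant_def)
      ultimately show "S_op v \<in> {a + c | a c. a \<in> U \<and> c \<in> E}" "T_op v \<in> {a + c | a c. a \<in> U \<and> c \<in> E}" by blast+
    qed
    ultimately show "\<exists>C M. op.dec C M \<and> C \<subseteq> flag_space \<and> C \<noteq> {0} \<and> U \<inter> C = {0} \<and> invariant {a + c | a c. a \<in> U \<and> c \<in> C}"
      using M EF E(3) by blast
  qed
  then obtain M where "op.dec flag_space M" by blast
  then show ?thesis using op.tr_dec S_op_flag_space by blast
qed

end

section \<open>Closed walks\<close>

lemma tr_axis: "tr F = (\<Sum>i\<in>UNIV. F (axis i 1) $ i)" for F :: "real ^ 'i \<Rightarrow> real ^ 'i"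
proof -
  have B: "(Basis :: (real ^ 'i) set) = range (\<lambda>i. axis i 1)" by (auto simp: Basis_vec_def)
  have "inj (\<lambda>i. axis i (1 :: real) :: real ^ 'i)" by (rule injI) (simp add: axis_eq_axis)
  then show ?thesis unfolding tr_def B by (simp add: sum.reindex inner_axis)
qed

context qflags
begin

text \<open>\<open>N l u t\<close> stands for the number of walks of length \<open>l\<close> from
  \<open>u\<close> to \<open>t\<close>. As functions of the start, these numbers arise by applying S
  and T alternately, so a return takes an even number of steps. The two kinds of vertices contribute
  the traces of the powers of ST and of TS, which agree.\<close>

lemma closed_walk_count:
  fixes N :: "nat \<Rightarrow> 'v \<Rightarrow> 'v \<Rightarrow> real" and up dn :: "'a \<Rightarrow> 'a \<Rightarrow> 'v"
  assumes inj: "\<And>L P L' P'. up L P = up L' P' \<longleftrightarrow> L = L' \<and> P = P'"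
      "\<And>L P L' P'. dn L P = dn L' P' \<longleftrightarrow> L = L' \<and> P = P'"
    and disj: "\<And>L P L' P'. flag L P \<Longrightarrow> flag L' P' \<Longrightarrow> up L P \<noteq> dn L' P'"
    and N0up: "\<And>L P t. flag L P \<Longrightarrow> N 0 (up L P) t = (if up L P = t then 1 else 0)"
    and N0dn: "\<And>L P t. flag L P \<Longrightarrow> N 0 (dn L P) t = (if dn L P = t then 1 else 0)"
    and Nup: "\<And>L P t l. flag L P \<Longrightarrow> N (Suc l) (up L P) t = (\<Sum>M | M \<curlywedge> L = bt \<and> M \<curlyvee> L = P. N l (dn M P) t)"
    and Ndn: "\<And>L P t l. flag L P \<Longrightarrow> N (Suc l) (dn L P) t = (\<Sum>M | M \<curlyvee> P = tp \<and> M \<curlywedge> P = L. N l (up L M) t)"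
    and l: "l > 0"
  shows "(\<Sum>(L,P) | flag L P. N l (up L P) (up L P)) + (\<Sum>(L,P) | flag L P. N l (dn L P) (dn L P)) =
    (if even l then 2 * tr ((\<lambda>v. S_op (T_op v)) ^^ (l div 2)) else 0)"
proof -
  let ?y = "\<lambda>v. S_op (T_op v)" and ?y' = "\<lambda>v. T_op (S_op v)"
  define g where "g t l = (\<chi> x. if flag (fst x) (snd x) then N l (up (fst x) (snd x)) t else 0)" for t l
  define h where "h t l = (\<chi> x. if flag (fst x) (snd x) then N l (dn (fst x) (snd x)) t else 0)" for t l
  have gS: "g t (Suc l) = S_op (h t l)" for t l
  proof -
    have "flag_fn (h t l) M P = N l (dn M P) t" if "flag L P" "M \<curlywedge> L = bt" "M \<curlyvee> L = P" for L P M
      using flag_complement[OF that] by (simp add: flag_fn_def h_def)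
    then show ?thesis
      by (auto simp: g_def S_op_def Sop_def Finite_Cartesian_Product.vec_eq_iff Nup intro!: sum.cong)
  qed
  have hS: "h t (Suc l) = T_op (g t l)" for t l
  proof -
    have "flag_fn (g t l) L M = N l (up L M) t" if "flag L P" "M \<curlyvee> P = tp" "M \<curlywedge> P = L" for L P M
      using flag_cocomplement[OF that] by (simp add: flag_fn_def g_def)
    then show ?thesis
      by (auto simp: h_def T_op_def Top_def Finite_Cartesian_Product.vec_eq_iff Ndn intro!: sum.cong)
  qed
  have g2: "g t (2 * m) = (?y ^^ m) (g t 0)" "g t (Suc (2 * m)) = (?y ^^ m) (S_op (h t 0))" for t m
    by (induction m) (simp_all add: gS hS)
  have h2: "h t (2 * m) = (?y' ^^ m) (h t 0)" "h t (Suc (2 * m)) = (?y' ^^ m) (T_op (g t 0))" for t m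
    by (induction m) (simp_all add: gS hS)
  have g0: "g (up L P) 0 = axis (L,P) 1" "h (up L P) 0 = 0" if "flag L P" for L P
    using that disj by (auto simp: g_def h_def Finite_Cartesian_Product.vec_eq_iff N0up N0dn inj axis_def) metis
  have h0: "h (dn L P) 0 = axis (L,P) 1" "g (dn L P) 0 = 0" if "flag L P" for L P
    using that disj by (auto simp: g_def h_def Finite_Cartesian_Product.vec_eq_iff N0up N0dn inj axis_def)
  have zero: "(?y ^^ m) 0 = 0" "(?y' ^^ m) 0 = 0" "S_op 0 = 0" "T_op 0 = 0" for m
    by (induction m) (simp_all add: linear_0[OF linear_S_op] linear_0[OF linear_T_op])
  have gN: "N l (up L P) (up L P) = g (up L P) l $ (L,P)" "N l (dn L P) (dn L P) = h (dn L P) l $ (L,P)" if "flag L P" for L P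
    using that by (simp_all add: g_def h_def)
  show ?thesis
  proof (cases "even l")
    case False
    then obtain m where m: "l = Suc (2 * m)" by (auto elim: oddE)
    have "N l (up L P) (up L P) = 0" "N l (dn L P) (dn L P) = 0" if "flag L P" for L P
      unfolding gN[OF that] unfolding m g2 h2 g0[OF that] h0[OF that] zero by simp_all
    then have "(\<Sum>(L,P) | flag L P. N l (up L P) (up L P)) = 0" "(\<Sum>(L,P) | flag L P. N l (dn L P) (dn L P)) = 0"
      by (auto intro!: sum.neutral)
    then show ?thesis using False by simp
  next
    case True
    then obtain m where m: "l = 2 * m" by blast
    then obtain m' where m': "m = Suc m'" using l by (cases m) auto
    have tr: "tr (F ^^ m) = (\<Sum>(L,P) | flag L P. (F ^^ m) (axis (L,P) 1) $ (L,P))"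
      if "\<And>v. F v \<in> flag_space" for F :: "real ^ ('a \<times> 'a) \<Rightarrow> real ^ ('a \<times> 'a)"
    proof -
      have "(\<Sum>x\<in>UNIV. (F ^^ m) (axis x 1) $ x) = (\<Sum>x\<in>{x. flag (fst x) (snd x)}. (F ^^ m) (axis x 1) $ x)"
      proof (rule sum.mono_neutral_right)
        show "\<forall>x\<in>UNIV - {x. flag (fst x) (snd x)}. (F ^^ m) (axis x 1) $ x = 0"
        proof
          fix x assume x: "x \<in> UNIV - {x. flag (fst x) (snd x)}"
          have "(F ^^ m) (axis x 1) \<in> flag_space" using that by (simp add: m')
          then show "(F ^^ m) (axis x 1) $ x = 0" using x by (cases x) (simp add: flag_space_def)
        qed
      qed auto
      then show ?thesis unfolding tr_axis by (simp add: split_def)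
    qed
    have lin: "linear (?y ^^ m)" for m
    proof (induction m)
      case (Suc m)
      have "linear ?y" by (rule operator.linY[OF operator_ST])
      then show ?case using linear_compose[OF Suc] by (simp add: comp_def)
    qed (simp add: linear_id[unfolded id_def] id_def)
    have comm: "?y' ((?y' ^^ m') v) = T_op ((?y ^^ m') (S_op v))" for v
      by (induction m') simp_all
    have "tr (?y' ^^ m) = tr (\<lambda>v. T_op ((?y ^^ m') (S_op v)))"
      unfolding m' by (intro arg_cong[of _ _ tr] ext) (simp add: comm)
    also have "\<dots> = tr (\<lambda>v. (?y ^^ m') (S_op (T_op v)))"
      using linear_compose[OF linear_S_op lin] by (intro tr_commute[OF linear_T_op]) (simp add: comp_def)
    also have "\<dots> = tr (?y ^^ m)" unfolding m' funpow_Suc_right by (simp add: comp_def)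
    finally have tr': "tr (?y' ^^ m) = tr (?y ^^ m)" .
    have "(\<Sum>(L,P) | flag L P. N l (up L P) (up L P)) = tr (?y ^^ m)"
      unfolding tr[OF S_op_flag_space] by (rule sum.cong) (auto simp: m gN[unfolded m] g2 g0)
    moreover have "(\<Sum>(L,P) | flag L P. N l (dn L P) (dn L P)) = tr (?y' ^^ m)"
      unfolding tr[OF T_op_flag_space] by (rule sum.cong) (auto simp: m gN[unfolded m] h2 h0)
    ultimately show ?thesis using tr' m by simp
  qed
qed

end

section \<open>The lattice of subspaces\<close>

lemma card_span_vec:
  fixes B :: "('a::{field,finite} ^ 'n::finite) set"
  assumes "vec.independent B"
  shows "card (vec.span B) = CARD('a) ^ card B"
proof -
  have "finite B" by simp
  then show ?thesis using assms
  proof (induction B rule: finite_induct)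
    case (insert v B)
    have ind: "vec.independent B" "v \<notin> vec.span B" using insert by (auto simp: vec.independent_insert)
    define g where "g = (\<lambda>(c,w). c *s v + w)"
    have "vec.span (insert v B) = g ` (UNIV \<times> vec.span B)"
    proof (intro equalityI subsetI)
      fix x assume "x \<in> vec.span (insert v B)"
      then obtain c where "x - c *s v \<in> vec.span B" by (auto simp: vec.span_breakdown_eq)
      then have "x = g (c, x - c *s v)" "x - c *s v \<in> vec.span B" by (auto simp: g_def)
      then show "x \<in> g ` (UNIV \<times> vec.span B)" by blast
    next
      fix x assume "x \<in> g ` (UNIV \<times> vec.span B)"
      then obtain c w where "x = c *s v + w" "w \<in> vec.span B" by (auto simp: g_def)
      then show "x \<in> vec.span (insert v B)" unfolding vec.span_breakdown_eq by (intro exI[of _ c]) simp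
    qed
    moreover have "inj_on g (UNIV \<times> vec.span B)"
    proof (rule inj_onI, clarify)
      fix c d x y assume a: "x \<in> vec.span B" "y \<in> vec.span B" "g (c,x) = g (d,y)"
      have e: "(c - d) *s v = y - x" using a(3) by (simp add: g_def vec.scale_left_diff_distrib algebra_simps)
      have "c = d"
      proof (rule ccontr)
        assume "c \<noteq> d"
        have "(c - d) *s v \<in> vec.span B" unfolding e using a by (intro vec.span_diff)
        then have "(1 / (c - d)) *s ((c - d) *s v) \<in> vec.span B" by (rule vec.span_scale)
        moreover have "(1 / (c - d)) * (c - d) = 1" using \<open>c \<noteq> d\<close> by simp
        ultimately show False using ind(2) by (simp only: vec.scale_scale vec.scale_one)
      qed
      then show "c = d \<and> x = y" using e by simp
    qed
    ultimately have "card (vec.span (insert v B)) = card (UNIV :: 'a set) * card (vec.span B)"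
      by (simp add: card_image card_cartesian_product)
    then show ?case using insert ind by simp
  qed simp
qed

lemma vec_sum_eq: "(A :: ('a::field ^ 'n) set) + B = {x + y | x y. x \<in> A \<and> y \<in> B}"
  by (auto simp: set_plus_def)

lemma vec_subspace_plus: "vec.subspace A \<Longrightarrow> vec.subspace B \<Longrightarrow> vec.subspace (A + B)"
  unfolding vec_sum_eq by (rule vec.subspace_sums)

lemma vec_span_Un: "vec.span (A \<union> B) = vec.span A + vec.span B"
  unfolding vec_sum_eq by (rule vec.span_Un)

lemma vec_dim_plus:
  assumes "vec.subspace A" "vec.subspace B"
  shows "vec.dim (A + B) + vec.dim (A \<inter> B) = vec.dim A + vec.dim B"
  unfolding vec_sum_eq by (rule vec.dim_sums_Int[OF assms])

lemma vec_plus_least: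
  assumes "vec.subspace C" "A \<subseteq> C" "B \<subseteq> C" shows "A + B \<subseteq> C"
  using assms by (auto simp: set_plus_def intro!: vec.subspace_add)

lemma vec_plus_upper: "vec.subspace B \<Longrightarrow> A \<subseteq> A + B" "vec.subspace A \<Longrightarrow> B \<subseteq> A + B"
  using vec.subspace_0[of A] vec.subspace_0[of B] by (force simp: set_plus_def)+

lemma vec_eq_of_dim: "vec.subspace A \<Longrightarrow> vec.subspace B \<Longrightarrow> A \<subseteq> B \<Longrightarrow> vec.dim B \<le> vec.dim A \<Longrightarrow> A = B"
  by (rule vec.subspace_dim_equal)

text \<open>Choose a complement \<open>U\<close> of \<open>c\<close> in \<open>a\<close> and a basis
  \<open>D\<close> of \<open>b\<close> modulo \<open>a\<close>. A relative complement meets each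
  coset \<open>d + U\<close> in exactly one vector, so relative complements correspond to functions
  from \<open>D\<close> to \<open>U\<close> through \<open>X\<close>.\<close>

lemma card_relative_complements_vec:
  fixes a b c :: "('a::{field,finite} ^ 'n::finite) set"
  assumes a: "vec.subspace a" and b: "vec.subspace b" and c: "vec.subspace c" and ca: "c \<subseteq> a" and ab: "a \<subseteq> b"
  shows "card {x. vec.subspace x \<and> x \<inter> a = c \<and> x + a = b} =
    CARD('a) ^ ((vec.dim a - vec.dim c) * (vec.dim b - vec.dim a))"
proof -
  obtain C where C: "C \<subseteq> c" "vec.independent C" "c \<subseteq> vec.span C" "card C = vec.dim c"
    by (rule vec.basis_exists[of c])
  have sC: "vec.span C = c" using C vec.span_minimal[OF C(1) c] by blast
  have "C \<subseteq> a" using C(1) ca by blast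
  then obtain CA where CA: "C \<subseteq> CA" "CA \<subseteq> a" "vec.independent CA" "a \<subseteq> vec.span CA"
    using vec.maximal_independent_subset_extend[OF _ C(2)] by blast
  have sCA: "vec.span CA = a" using CA vec.span_minimal[OF CA(2) a] by blast
  have "CA \<subseteq> b" using CA(2) ab by blast
  then obtain CAD where CAD: "CA \<subseteq> CAD" "CAD \<subseteq> b" "vec.independent CAD" "b \<subseteq> vec.span CAD"
    using vec.maximal_independent_subset_extend[OF _ CA(3)] by blast
  have sCAD: "vec.span CAD = b" using CAD vec.span_minimal[OF CAD(2) b] by blast
  define A D where "A = CA - C" and "D = CAD - CA"
  define U where "U = vec.span A"
  have iA: "vec.independent A" using vec.independent_mono[OF CA(3)] by (auto simp: A_def)
  have dims: "vec.dim a = card CA" "vec.dim b = card CAD"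
    using vec.dim_span_eq_card_independent[OF CA(3)] vec.dim_span_eq_card_independent[OF CAD(3)] sCA sCAD by simp_all
  have cardA: "card A = vec.dim a - vec.dim c" and cardD: "card D = vec.dim b - vec.dim a"
    unfolding A_def D_def dims C(4)[symmetric] by (rule card_Diff_subset; use CA(1) CAD(1) in simp)+
  have le: "vec.dim c \<le> vec.dim a" "vec.dim a \<le> vec.dim b" using vec.dim_subset[OF ca] vec.dim_subset[OF ab] by auto
  have sU: "vec.subspace U" by (simp add: U_def)
  have cardU: "card U = CARD('a) ^ card A" unfolding U_def by (rule card_span_vec[OF iA])
  have acU: "a = c + U"
    unfolding U_def sC[symmetric] vec_span_Un[symmetric] sCA[symmetric] A_def using CA(1) by (simp add: Un_absorb1)
  have Ua: "U \<subseteq> a" unfolding acU by (rule vec_plus_upper[OF c])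
  have "vec.dim U = card A" unfolding U_def by (rule vec.dim_span_eq_card_independent[OF iA])
  then have "vec.dim (c \<inter> U) = 0" using vec_dim_plus[OF c sU] cardA le unfolding acU[symmetric] by simp
  then have cU: "c \<inter> U \<subseteq> {0}" by simp
  define X where "X h = vec.span (C \<union> (\<lambda>d. d + h d) ` D)" for h
  let ?H = "PiE D (\<lambda>_. U)"
  let ?R = "{x. vec.subspace x \<and> x \<inter> a = c \<and> x + a = b}"
  have dX: "d + h d \<in> X h" if "d \<in> D" for d h unfolding X_def using that by (intro vec.span_base) auto
  have X_R: "X h \<in> ?R" if h: "h \<in> ?H" for h
  proof -
    have sX: "vec.subspace (X h)" by (simp add: X_def)
    have cX: "c \<subseteq> X h" unfolding X_def sC[symmetric] by (intro vec.span_mono) auto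
    have Xa: "X h + a = b"
    proof (rule equalityI)
      have "X h \<subseteq> b" unfolding X_def
      proof (rule vec.span_minimal[OF _ b])
        have "d + h d \<in> b" if "d \<in> D" for d
          using that h Ua ab CAD(2) by (intro vec.subspace_add[OF b]) (auto simp: D_def)
        then show "C \<union> (\<lambda>d. d + h d) ` D \<subseteq> b" using C(1) ca ab by auto
      qed
      then show "X h + a \<subseteq> b" using ab by (intro vec_plus_least[OF b])
      have sXa: "vec.subspace (X h + a)" by (rule vec_subspace_plus[OF sX a])
      have "d \<in> X h + a" if "d \<in> D" for d
      proof -
        have "d + h d \<in> X h + a" using dX[OF that, of h] vec_plus_upper(1)[OF a, of "X h"] by blast
        moreover have "h d \<in> X h + a" using h that Ua vec_plus_upper(2)[OF sX, of a] by blast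
        ultimately have "(d + h d) - h d \<in> X h + a" by (rule vec.subspace_diff[OF sXa])
        then show ?thesis by simp
      qed
      then have "CAD \<subseteq> X h + a" using CA(2) vec_plus_upper(2)[OF sX, of a] by (auto simp: D_def)
      then show "b \<subseteq> X h + a" unfolding sCAD[symmetric] by (rule vec.span_minimal[OF _ sXa])
    qed
    have "vec.dim (X h) \<le> card (C \<union> (\<lambda>d. d + h d) ` D)" unfolding X_def by (simp add: vec.dim_le_card')
    also have "\<dots> \<le> card C + card D" by (rule order_trans[OF card_Un_le]) (simp add: card_image_le)
    finally have "vec.dim (X h \<inter> a) \<le> vec.dim c" using vec_dim_plus[OF sX a] Xa cardD le C(4) by simp
    then have "c = X h \<inter> a" using cX ca by (intro vec_eq_of_dim[OF c vec.subspace_inter[OF sX a]]) auto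
    then show ?thesis using sX Xa by simp
  qed
  have "inj_on X ?H"
  proof (rule inj_onI)
    fix h h' assume hh: "h \<in> ?H" "h' \<in> ?H" "X h = X h'"
    show "h = h'"
    proof (rule PiE_ext[OF hh(1,2)])
      fix d assume d: "d \<in> D"
      have "h d - h' d \<in> X h"
        using vec.subspace_diff[of "X h", OF _ dX[OF d, of h] dX[OF d, of h', folded hh(3)]] by (simp add: X_def)
      moreover have u: "h d - h' d \<in> U" using hh d by (intro vec.subspace_diff[OF sU]) auto
      ultimately have "h d - h' d \<in> X h \<inter> a" using Ua by blast
      then have "h d - h' d \<in> c" using X_R[OF hh(1)] by blast
      then show "h d = h' d" using u cU by auto
    qed
  qed
  moreover have "X ` ?H = ?R"
  proof (intro equalityI subsetI)
    fix x assume "x \<in> ?R"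
    then have x: "vec.subspace x" "x \<inter> a = c" "x + a = b" by auto
    have cx: "c \<subseteq> x" using x(2) by blast
    have "\<exists>u\<in>U. d + u \<in> x" if "d \<in> D" for d
    proof -
      have "d \<in> x + a" using that CAD(2) x(3) by (auto simp: D_def)
      then obtain y w where y: "d = y + w" "y \<in> x" "w \<in> a" by (auto simp: set_plus_def)
      obtain v u where u: "w = v + u" "v \<in> c" "u \<in> U" using y(3) unfolding acU by (auto simp: set_plus_def)
      have "d + (- u) = y + v" using y(1) u(1) by simp
      also have "\<dots> \<in> x" using y(2) u(2) cx by (intro vec.subspace_add[OF x(1)]) auto
      finally have "d + (- u) \<in> x" .
      moreover have "- u \<in> U" using u(3) by (rule vec.subspace_neg[OF sU])
      ultimately show ?thesis by blast
    qed
    then obtain h0 where h0: "\<And>d. d \<in> D \<Longrightarrow> h0 d \<in> U \<and> d + h0 d \<in> x" by metis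
    define h where "h = restrict h0 D"
    have h: "h \<in> ?H" using h0 by (auto simp: h_def)
    have "X h \<subseteq> x" unfolding X_def
      using h0 C(1) cx by (intro vec.span_minimal[OF _ x(1)]) (auto simp: h_def)
    moreover have "vec.dim x \<le> vec.dim (X h)"
      using vec_dim_plus[OF x(1) a] vec_dim_plus[of "X h" a] X_R[OF h] x a by simp
    moreover have "vec.subspace (X h)" by (simp add: X_def)
    ultimately have "X h = x" using x(1) by (intro vec_eq_of_dim) auto
    then show "x \<in> X ` ?H" using h by blast
  qed (use X_R in blast)
  ultimately have "card ?R = card ?H" using card_image by metis
  also have "\<dots> = card U ^ card D" by (simp add: card_PiE)
  finally show ?thesis unfolding cardU cardA cardD by (simp add: power_mult)
qed

section \<open>Subspaces as a finite type\<close>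

typedef (overloaded) ('a, 'n) subsp = "{W :: ('a::field ^ 'n::finite) set. vec.subspace W}"
  morphisms space_of Subsp
  using vec.subspace_UNIV by blast

setup_lifting type_definition_subsp

instance subsp :: ("{field,finite}", finite) finite
proof
  have "inj (space_of :: ('a, 'b) subsp \<Rightarrow> _)" by (rule injI) (simp add: space_of_inject)
  then show "finite (UNIV :: ('a, 'b) subsp set)" by (rule finite_imageD[rotated]) simp
qed

lift_definition subsp_le :: "('a::field, 'n::finite) subsp \<Rightarrow> ('a, 'n) subsp \<Rightarrow> bool" is "(\<subseteq>)" .
lift_definition subsp_inf :: "('a::field, 'n::finite) subsp \<Rightarrow> ('a, 'n) subsp \<Rightarrow> ('a, 'n) subsp" is "(\<inter>)"
  by (rule vec.subspace_inter)
lift_definition subsp_sum :: "('a::field, 'n::finite) subsp \<Rightarrow> ('a, 'n) subsp \<Rightarrow> ('a, 'n) subsp" is "(+)"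
  by (rule vec_subspace_plus)
lift_definition subsp_bot :: "('a::field, 'n::finite) subsp" is "{0}" by simp
lift_definition subsp_top :: "('a::field, 'n::finite) subsp" is UNIV by simp
lift_definition subsp_dim :: "('a::field, 'n::finite) subsp \<Rightarrow> nat" is vec.dim .

lemma subspace_space_of [simp]: "vec.subspace (space_of x)"
  using space_of[of x] by simp

lemma vec_atom:
  assumes x: "vec.subspace x" and y: "vec.subspace y" and xy: "x \<subseteq> y" "x \<noteq> y"
  shows "\<exists>a. vec.subspace a \<and> x \<subseteq> a \<and> a \<subseteq> y \<and> vec.dim a = Suc (vec.dim x)"
proof -
  obtain v where v: "v \<in> y" "v \<notin> x" using xy by blast
  have xs: "vec.span x = x" using x by simp
  have "vec.dim (insert v x) = Suc (vec.dim x)" using v(2) by (simp add: vec.dim_insert xs)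
  then have "vec.dim (vec.span (insert v x)) = Suc (vec.dim x)" by simp
  moreover have "vec.span (insert v x) \<subseteq> y" using v xy y by (intro vec.span_minimal) auto
  moreover have "x \<subseteq> vec.span (insert v x)" by (auto intro: vec.span_base)
  ultimately show ?thesis by (intro exI[of _ "vec.span (insert v x)"]) simp
qed

lemma vec_coatom:
  assumes x: "vec.subspace x" and y: "vec.subspace y" and xy: "x \<subseteq> y" "x \<noteq> y"
  shows "\<exists>a. vec.subspace a \<and> x \<subseteq> a \<and> a \<subseteq> y \<and> Suc (vec.dim a) = vec.dim y"
proof -
  have "\<exists>a. vec.subspace a \<and> x \<subseteq> a \<and> a \<subseteq> y \<and> vec.dim a = m" if "vec.dim x \<le> m" "m \<le> vec.dim y" for m
    using that
  proof (induction m rule: dec_induct)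
    case base
    show ?case using x xy by blast
  next
    case (step m)
    then obtain a where a: "vec.subspace a" "x \<subseteq> a" "a \<subseteq> y" "vec.dim a = m" by auto
    have "a \<noteq> y" using a(4) step.prems by auto
    then show ?case using vec_atom[OF a(1) y a(3)] a by (metis order_trans)
  qed
  moreover have "vec.dim x < vec.dim y" using vec_eq_of_dim[OF x y xy(1)] xy(2) by force
  moreover then have "vec.dim x \<le> vec.dim y - 1" "Suc (vec.dim y - 1) = vec.dim y" by auto
  ultimately show ?thesis by (metis diff_le_self)
qed

section \<open>The digraph\<close>

lemma qflags_subsp:
  assumes "CARD('n) = 3 * k"
  shows "qflags (real CARD('a)) (subsp_le :: ('a::{field,finite}, 'n::finite) subsp \<Rightarrow> _) subsp_inf subsp_sum subsp_bot subsp_top subsp_dim CARD('n) k"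
proof (intro qflags.intro qlattice.intro qnum.intro qlattice_axioms.intro qflags_axioms.intro)
  have "card {0, 1 :: 'a} \<le> CARD('a)" by (rule card_mono) auto
  then show "1 < real CARD('a)" by simp
  fix x y z :: "('a, 'n) subsp"
  show "subsp_le x x" by transfer simp
  show "subsp_le x y \<Longrightarrow> subsp_le y x \<Longrightarrow> x = y" by transfer simp
  show "subsp_le x y \<Longrightarrow> subsp_le y z \<Longrightarrow> subsp_le x z" by transfer simp
  show "subsp_le (subsp_inf x y) x" "subsp_le (subsp_inf x y) y" by (transfer, simp)+
  show "subsp_le z x \<Longrightarrow> subsp_le z y \<Longrightarrow> subsp_le z (subsp_inf x y)" by transfer simp
  show "subsp_le x (subsp_sum x y)" by transfer (rule vec_plus_upper)
  show "subsp_le y (subsp_sum x y)" by transfer (rule vec_plus_upper)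
  show "subsp_le x z \<Longrightarrow> subsp_le y z \<Longrightarrow> subsp_le (subsp_sum x y) z" by transfer (rule vec_plus_least)
  show "subsp_le subsp_bot x" by transfer (simp add: vec.subspace_0)
  show "subsp_le x subsp_top" by transfer simp
  show "subsp_dim (subsp_bot :: ('a, 'n) subsp) = 0" by transfer simp
  show "subsp_dim (subsp_top :: ('a, 'n) subsp) = CARD('n)" by transfer (rule vec_dim_card)
  show "subsp_dim x < subsp_dim y" if "subsp_le x y" "x \<noteq> y" using that
  proof transfer
    fix x y :: "('a ^ 'n) set" assume "vec.subspace x" "vec.subspace y" "x \<subseteq> y" "x \<noteq> y"
    then show "vec.dim x < vec.dim y" using vec_eq_of_dim[of x y] by (meson not_le_imp_less)
  qed
  show "subsp_dim (subsp_inf x y) + subsp_dim (subsp_sum x y) = subsp_dim x + subsp_dim y"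
    by transfer (simp add: vec_dim_plus add.commute)
  have ex: "\<exists>a. subsp_le x a \<and> subsp_le a y \<and> R (subsp_dim a)"
    if W: "\<exists>W. vec.subspace W \<and> space_of x \<subseteq> W \<and> W \<subseteq> space_of y \<and> R (vec.dim W)" for R
  proof -
    obtain W where "vec.subspace W" "space_of x \<subseteq> W" "W \<subseteq> space_of y" "R (vec.dim W)" using W by metis
    moreover then have "space_of (Subsp W) = W" by (simp add: Subsp_inverse)
    ultimately show ?thesis by (intro exI[of _ "Subsp W"]) (simp add: subsp_le.rep_eq subsp_dim.rep_eq)
  qed
  have xy: "space_of x \<subseteq> space_of y" "space_of x \<noteq> space_of y" if "subsp_le x y" "x \<noteq> y"
    using that by (simp_all add: subsp_le.rep_eq space_of_inject)
  show "\<exists>a. subsp_le x a \<and> subsp_le a y \<and> subsp_dim a = Suc (subsp_dim x)" if "subsp_le x y" "x \<noteq> y"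
    unfolding subsp_dim.rep_eq[of x] by (rule ex) (rule vec_atom[OF subspace_space_of subspace_space_of xy[OF that]])
  show "\<exists>a. subsp_le x a \<and> subsp_le a y \<and> Suc (subsp_dim a) = subsp_dim y" if "subsp_le x y" "x \<noteq> y"
    unfolding subsp_dim.rep_eq[of y] by (rule ex[of "\<lambda>m. Suc m = vec.dim (space_of y)"])
      (rule vec_coatom[OF subspace_space_of subspace_space_of xy[OF that]])
  fix a b c :: "('a, 'n) subsp"
  assume ca: "subsp_le c a" and ab: "subsp_le a b"
  have "space_of ` {x. subsp_inf x a = c \<and> subsp_sum x a = b} =
    {x. vec.subspace x \<and> x \<inter> space_of a = space_of c \<and> x + space_of a = space_of b}"
  proof (intro equalityI subsetI)
    fix x assume "x \<in> space_of ` {x. subsp_inf x a = c \<and> subsp_sum x a = b}"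
    then show "x \<in> {x. vec.subspace x \<and> x \<inter> space_of a = space_of c \<and> x + space_of a = space_of b}"
      by (auto simp: subsp_inf.rep_eq subsp_sum.rep_eq)
  next
    fix x assume x: "x \<in> {x. vec.subspace x \<and> x \<inter> space_of a = space_of c \<and> x + space_of a = space_of b}"
    then have s: "space_of (Subsp x) = x" by (simp add: Subsp_inverse)
    have "subsp_inf (Subsp x) a = c" "subsp_sum (Subsp x) a = b"
      using x by (simp_all add: space_of_inject[symmetric] subsp_inf.rep_eq subsp_sum.rep_eq s)
    then show "x \<in> space_of ` {x. subsp_inf x a = c \<and> subsp_sum x a = b}" using s by (metis (mono_tags, lifting) imageI mem_Collect_eq)
  qed
  note im = this
  have "card {x. subsp_inf x a = c \<and> subsp_sum x a = b} = card (space_of ` {x. subsp_inf x a = c \<and> subsp_sum x a = b})"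
    by (rule card_image[symmetric]) (rule inj_onI, simp add: space_of_inject)
  also have "\<dots> = card {x. vec.subspace x \<and> x \<inter> space_of a = space_of c \<and> x + space_of a = space_of b}"
    by (simp only: im)
  also have "\<dots> = CARD('a) ^ ((subsp_dim a - subsp_dim c) * (subsp_dim b - subsp_dim a))"
    unfolding subsp_dim.rep_eq using ca ab by (intro card_relative_complements_vec) (simp_all add: subsp_le.rep_eq)
  finally show "real (card {x. subsp_inf x a = c \<and> subsp_sum x a = b}) = real CARD('a) ^ ((subsp_dim a - subsp_dim c) * (subsp_dim b - subsp_dim a))" by simp
qed (rule assms)

definition nwalks :: "('v, 'v \<times> 'v) pre_digraph \<Rightarrow> nat \<Rightarrow> 'v \<Rightarrow> 'v \<Rightarrow> nat" where
  "nwalks G l u v = card {p. pre_digraph.awalk G u p v \<and> length p = l}"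

locale simple_walks =
  fixes G :: "('v, 'v \<times> 'v) pre_digraph"
  assumes tail: "tail G = fst" and head: "head G = snd"
    and arcs: "arcs G \<subseteq> verts G \<times> verts G" and fin: "finite (verts G)"
begin

lemma finite_walks: "finite {p. pre_digraph.awalk G u p v \<and> length p = l}"
proof (rule finite_subset)
  show "finite {p. set p \<subseteq> arcs G \<and> length p = l}"
    using finite_subset[OF arcs] fin by (intro finite_lists_length_eq) simp
qed (auto simp: pre_digraph.awalk_def)

lemma nwalks_0: "u \<in> verts G \<Longrightarrow> nwalks G 0 u v = (if u = v then 1 else 0)"
proof -
  assume "u \<in> verts G"
  then have "{p. pre_digraph.awalk G u p v \<and> length p = 0} = (if u = v then {[]} else {})"
    by (auto simp: pre_digraph.awalk_def pre_digraph.cas.simps)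
  then show ?thesis by (simp add: nwalks_def)
qed

lemma nwalks_Suc:
  assumes u: "u \<in> verts G"
  shows "nwalks G (Suc l) u v = (\<Sum>w | (u, w) \<in> arcs G. nwalks G l w v)"
proof -
  let ?W = "\<lambda>w. {p. pre_digraph.awalk G w p v \<and> length p = l}"
  let ?A = "{w. (u, w) \<in> arcs G}"
  have finA: "finite ?A"
  proof (rule finite_subset)
    show "?A \<subseteq> verts G" using arcs by auto
  qed (rule fin)
  have "{p. pre_digraph.awalk G u p v \<and> length p = Suc l} = (\<Union>w\<in>?A. (#) (u, w) ` ?W w)"
  proof (intro equalityI subsetI)
    fix p assume "p \<in> {p. pre_digraph.awalk G u p v \<and> length p = Suc l}"
    then obtain e p' where p: "p = e # p'" "length p' = l" "pre_digraph.awalk G u (e # p') v"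
      by (cases p) auto
    then have "e \<in> arcs G" "fst e = u" "pre_digraph.awalk G (snd e) p' v"
      using arcs by (auto simp: pre_digraph.awalk_def pre_digraph.cas.simps tail head)
    then have "snd e \<in> ?A" "p \<in> (#) (u, snd e) ` ?W (snd e)" using p by (cases e; auto)+
    then show "p \<in> (\<Union>w\<in>?A. (#) (u, w) ` ?W w)" by blast
  next
    fix p assume "p \<in> (\<Union>w\<in>?A. (#) (u, w) ` ?W w)"
    then obtain w p' where p: "(u, w) \<in> arcs G" "p = (u, w) # p'" "p' \<in> ?W w" by blast
    then show "p \<in> {p. pre_digraph.awalk G u p v \<and> length p = Suc l}"
      using u by (auto simp: pre_digraph.awalk_def pre_digraph.cas.simps tail head)
  qed
  then have "nwalks G (Suc l) u v = card (\<Union>w\<in>?A. (#) (u, w) ` ?W w)" by (simp add: nwalks_def)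
  also have "\<dots> = (\<Sum>w\<in>?A. card ((#) (u, w) ` ?W w))"
    using finA finite_walks by (intro card_UN_disjoint) auto
  also have "\<dots> = (\<Sum>w\<in>?A. nwalks G l w v)"
    unfolding nwalks_def by (intro sum.cong refl card_image) (simp add: inj_on_def)
  finally show ?thesis .
qed

lemma num_closed_walks_sum: "num_closed_walks G l = (\<Sum>v\<in>verts G. nwalks G l v v)"
proof -
  have "{(v, p). pre_digraph.awalk G v p v \<and> length p = l} =
    Sigma (verts G) (\<lambda>v. {p. pre_digraph.awalk G v p v \<and> length p = l})"
    by (auto simp: pre_digraph.awalk_def)
  then show ?thesis unfolding num_closed_walks_def nwalks_def using fin finite_walks by (simp add: card_SigmaI)
qed

end

text \<open>From \<open>up L P\<close> only the direct sum alternative is possible, as the other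
  would put \<open>P\<close> inside \<open>L\<close>; from \<open>dn L P\<close> only the other one
  is. So the two kinds of steps are those summed by S and by T.\<close>

theorem num_closed_walks_X2:
  assumes n: "CARD('n::finite) = 3 * k" and k: "k \<ge> 1"
  shows "\<exists>M. \<forall>l>0. real (num_closed_walks (X2_multidim (k, 2 * k) ::
      (('a::{field,finite} ^ 'n) set \<times> ('a ^ 'n) set,
       (('a ^ 'n) set \<times> ('a ^ 'n) set) \<times> (('a ^ 'n) set \<times> ('a ^ 'n) set)) pre_digraph) l) =
    (if even l then 2 * (\<Sum>t\<in>#M. zpow (real CARD('a)) (l div 2) t) else 0)"
proof -
  interpret qflags "real CARD('a)" "subsp_le :: ('a, 'n) subsp \<Rightarrow> _" subsp_inf subsp_sum subsp_bot subsp_top subsp_dim "CARD('n)" k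
    by (rule qflags_subsp[OF n])
  let ?G = "X2_multidim (k, 2 * k) :: (('a ^ 'n) set \<times> ('a ^ 'n) set,
       (('a ^ 'n) set \<times> ('a ^ 'n) set) \<times> (('a ^ 'n) set \<times> ('a ^ 'n) set)) pre_digraph"
  define up :: "('a, 'n) subsp \<Rightarrow> ('a, 'n) subsp \<Rightarrow> ('a ^ 'n) set \<times> ('a ^ 'n) set"
    where "up L P = (space_of L, space_of P)" for L P
  define dn :: "('a, 'n) subsp \<Rightarrow> ('a, 'n) subsp \<Rightarrow> ('a ^ 'n) set \<times> ('a ^ 'n) set"
    where "dn L P = (space_of P, space_of L)" for L P
  have flag_iff: "flag L P \<longleftrightarrow> space_of L \<subseteq> space_of P \<and> vec.dim (space_of L) = k \<and> vec.dim (space_of P) = 2 * k" for L P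
    by (simp add: flag_def subsp_le.rep_eq subsp_dim.rep_eq)
  have fd: "space_of L \<subseteq> space_of P" "vec.dim (space_of L) = k" "vec.dim (space_of P) = 2 * k" if "flag L P" for L P
    using that by (simp_all add: flag_iff)
  have nle: "\<not> space_of P \<subseteq> space_of L" if f: "flag L P" for L P
  proof
    assume "space_of P \<subseteq> space_of L"
    then have "vec.dim (space_of P) \<le> vec.dim (space_of L)" by (rule vec.dim_subset)
    then show False using fd(2,3)[OF f] k by linarith
  qed
  have nzp: "nonzero_proper_subspace (space_of L)" if "vec.dim (space_of L) = k \<or> vec.dim (space_of L) = 2 * k" for L :: "('a, 'n) subsp"
  proof -
    have "vec.dim (UNIV :: ('a ^ 'n) set) = 3 * k" unfolding vec_dim_card by (rule n)
    then have "space_of L \<noteq> UNIV" using that k by auto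
    moreover have "space_of L \<noteq> {0}"
    proof -
      have "vec.dim (space_of L) \<noteq> 0" using that k by linarith
      then have "\<not> space_of L \<subseteq> {0}" by (simp only: vec.dim_eq_0 not_False_eq_True)
      then show ?thesis by blast
    qed
    ultimately show ?thesis by (simp add: nonzero_proper_subspace_def)
  qed
  define V where "V = {F \<in> (directed_flags :: (('a ^ 'n) set \<times> ('a ^ 'n) set) set).
     multi_dimension F = (k, 2 * k) \<or> multi_dimension F = prod.swap (k, 2 * k)}"
  have upV: "up L P \<in> V" and dnV: "dn L P \<in> V" if "flag L P" for L P
  proof -
    have "space_of L \<subset> space_of P" using fd(1)[OF that] nle[OF that] by blast
    moreover have "nonzero_proper_subspace (space_of L)" "nonzero_proper_subspace (space_of P)"
      using fd(2,3)[OF that] by (intro nzp; simp)+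
    ultimately show "up L P \<in> V" "dn L P \<in> V"
      using fd(2,3)[OF that] by (simp_all add: V_def up_def dn_def directed_flags_def multi_dimension_def)
  qed
  have Vcases: "(\<exists>L P. flag L P \<and> W1 = space_of L \<and> W2 = space_of P) \<or>
     (\<exists>L P. flag L P \<and> W1 = space_of P \<and> W2 = space_of L)" if W: "(W1, W2) \<in> V" for W1 W2
  proof -
    have s: "vec.subspace W1" "vec.subspace W2" using W by (auto simp: V_def directed_flags_def nonzero_proper_subspace_def)
    then have r: "space_of (Subsp W1) = W1" "space_of (Subsp W2) = W2" by (simp_all add: Subsp_inverse)
    have d: "vec.dim W1 = k \<and> vec.dim W2 = 2 * k \<or> vec.dim W1 = 2 * k \<and> vec.dim W2 = k" "W1 \<subseteq> W2 \<or> W2 \<subseteq> W1"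
      using W by (auto simp: V_def directed_flags_def multi_dimension_def)
    moreover have "W1 \<subseteq> W2 \<Longrightarrow> vec.dim W1 \<le> vec.dim W2" "W2 \<subseteq> W1 \<Longrightarrow> vec.dim W2 \<le> vec.dim W1"
      by (rule vec.dim_subset; assumption)+
    ultimately have "flag (Subsp W1) (Subsp W2) \<or> flag (Subsp W2) (Subsp W1)" using k unfolding flag_iff r by linarith
    then show ?thesis using r by metis
  qed
  have vG: "verts ?G = V" and tG: "tail ?G = fst" and hG: "head ?G = snd"
    by (simp_all add: X2_multidim_def V_def)
  have aG: "((W1, W2), (W3, W4)) \<in> arcs ?G \<longleftrightarrow> (W1, W2) \<in> V \<and> (W3, W4) \<in> V \<and> W2 = W3 \<and>
     (internal_direct_sum W1 W4 W2 \<or> (W1 \<inter> W4 = W2 \<and> W1 + W4 = UNIV))" for W1 W2 W3 W4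
    by (auto simp: X2_multidim_def V_def X2_def)
  interpret simple_walks ?G
  proof
    show "arcs ?G \<subseteq> verts ?G \<times> verts ?G" using aG vG by auto
  qed (simp_all add: tG hG)
  have out_up: "{w. (up L P, w) \<in> arcs ?G} = (\<lambda>M. dn M P) ` {M. subsp_inf M L = subsp_bot \<and> subsp_sum M L = P}" if f: "flag L P" for L P
  proof (intro equalityI subsetI)
    fix w assume "w \<in> {w. (up L P, w) \<in> arcs ?G}"
    then obtain W4 where w: "w = (space_of P, W4)" and wV: "(space_of P, W4) \<in> V"
      and or: "internal_direct_sum (space_of L) W4 (space_of P) \<or> (space_of L \<inter> W4 = space_of P \<and> space_of L + W4 = UNIV)"
      by (cases w) (auto simp: up_def aG)
    have "internal_direct_sum (space_of L) W4 (space_of P)" using or nle[OF f] by blast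
    then have i: "space_of L \<inter> W4 = {0}" "space_of L + W4 = space_of P" by (auto simp: internal_direct_sum_def)
    obtain M where M: "W4 = space_of M" using Vcases[OF wV] by blast
    have "subsp_inf M L = subsp_bot" "subsp_sum M L = P" using i unfolding M
      by (simp_all add: space_of_inject[symmetric] subsp_inf.rep_eq subsp_sum.rep_eq subsp_bot.rep_eq Int_commute add.commute)
    then show "w \<in> (\<lambda>M. dn M P) ` {M. subsp_inf M L = subsp_bot \<and> subsp_sum M L = P}" using w M by (auto simp: dn_def)
  next
    fix w assume "w \<in> (\<lambda>M. dn M P) ` {M. subsp_inf M L = subsp_bot \<and> subsp_sum M L = P}"
    then obtain M where M: "w = dn M P" "subsp_inf M L = subsp_bot" "subsp_sum M L = P" by blast
    have fM: "flag M P" by (rule flag_complement[OF f M(2,3)])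
    have "space_of M \<inter> space_of L = {0}" "space_of M + space_of L = space_of P"
      using M(2,3) by (metis subsp_inf.rep_eq subsp_bot.rep_eq, metis subsp_sum.rep_eq)
    then have "internal_direct_sum (space_of L) (space_of M) (space_of P)"
      by (simp add: internal_direct_sum_def Int_commute add.commute)
    then show "w \<in> {w. (up L P, w) \<in> arcs ?G}"
      using upV[OF f] dnV[OF fM] unfolding M(1) by (simp add: up_def dn_def aG)
  qed
  have out_dn: "{w. (dn L P, w) \<in> arcs ?G} = (\<lambda>M. up L M) ` {M. subsp_sum M P = subsp_top \<and> subsp_inf M P = L}" if f: "flag L P" for L P
  proof (intro equalityI subsetI)
    fix w assume "w \<in> {w. (dn L P, w) \<in> arcs ?G}"
    then obtain W4 where w: "w = (space_of L, W4)" and wV: "(space_of L, W4) \<in> V"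
      and or: "internal_direct_sum (space_of P) W4 (space_of L) \<or> (space_of P \<inter> W4 = space_of L \<and> space_of P + W4 = UNIV)"
      by (cases w) (auto simp: dn_def aG)
    obtain M where M: "W4 = space_of M" using Vcases[OF wV] by blast
    have "\<not> internal_direct_sum (space_of P) W4 (space_of L)"
      using nle[OF f] vec_plus_upper(1)[of W4 "space_of P"] by (auto simp: internal_direct_sum_def M)
    then have i: "space_of P \<inter> W4 = space_of L" "space_of P + W4 = UNIV" using or by auto
    have "subsp_sum M P = subsp_top" "subsp_inf M P = L" using i unfolding M
      by (simp_all add: space_of_inject[symmetric] subsp_inf.rep_eq subsp_sum.rep_eq subsp_top.rep_eq Int_commute add.commute)
    then show "w \<in> (\<lambda>M. up L M) ` {M. subsp_sum M P = subsp_top \<and> subsp_inf M P = L}" using w M by (auto simp: up_def)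
  next
    fix w assume "w \<in> (\<lambda>M. up L M) ` {M. subsp_sum M P = subsp_top \<and> subsp_inf M P = L}"
    then obtain M where M: "w = up L M" "subsp_sum M P = subsp_top" "subsp_inf M P = L" by blast
    have fM: "flag L M" by (rule flag_cocomplement[OF f M(2,3)])
    have "space_of M + space_of P = UNIV" "space_of M \<inter> space_of P = space_of L"
      using M(2,3) by (metis subsp_sum.rep_eq subsp_top.rep_eq, metis subsp_inf.rep_eq)
    then have "space_of P \<inter> space_of M = space_of L \<and> space_of P + space_of M = UNIV"
      by (simp add: Int_commute add.commute)
    then show "w \<in> {w. (dn L P, w) \<in> arcs ?G}"
      using dnV[OF f] upV[OF fM] unfolding M(1) by (simp add: up_def dn_def aG)
  qed
  have inj: "up L P = up L' P' \<longleftrightarrow> L = L' \<and> P = P'" "dn L P = dn L' P' \<longleftrightarrow> L = L' \<and> P = P'" for L P L' P'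
    by (auto simp: up_def dn_def space_of_inject)
  have disj: "up L P \<noteq> dn L' P'" if "flag L P" "flag L' P'" for L P L' P'
  proof
    assume "up L P = dn L' P'"
    then have "vec.dim (space_of L) = vec.dim (space_of P')" by (simp add: up_def dn_def)
    then show False using fd(2)[OF that(1)] fd(3)[OF that(2)] k by linarith
  qed
  have Nup: "real (nwalks ?G (Suc l) (up L P) t) = (\<Sum>M | subsp_inf M L = subsp_bot \<and> subsp_sum M L = P. real (nwalks ?G l (dn M P) t))"
    if f: "flag L P" for L P t l
  proof -
    have "nwalks ?G (Suc l) (up L P) t = (\<Sum>M | subsp_inf M L = subsp_bot \<and> subsp_sum M L = P. nwalks ?G l (dn M P) t)"
      unfolding nwalks_Suc[of "up L P", unfolded vG, OF upV[OF f]] out_up[OF f]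
      by (subst sum.reindex) (auto simp: inj_on_def inj)
    then show ?thesis by simp
  qed
  have Ndn: "real (nwalks ?G (Suc l) (dn L P) t) = (\<Sum>M | subsp_sum M P = subsp_top \<and> subsp_inf M P = L. real (nwalks ?G l (up L M) t))"
    if f: "flag L P" for L P t l
  proof -
    have "nwalks ?G (Suc l) (dn L P) t = (\<Sum>M | subsp_sum M P = subsp_top \<and> subsp_inf M P = L. nwalks ?G l (up L M) t)"
      unfolding nwalks_Suc[of "dn L P", unfolded vG, OF dnV[OF f]] out_dn[OF f]
      by (subst sum.reindex) (auto simp: inj_on_def inj)
    then show ?thesis by simp
  qed
  let ?F = "{(L,P). flag L P}"
  have Veq: "V = (\<lambda>(L,P). up L P) ` ?F \<union> (\<lambda>(L,P). dn L P) ` ?F"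
  proof (intro equalityI subsetI)
    fix w assume "w \<in> V"
    then show "w \<in> (\<lambda>(L,P). up L P) ` ?F \<union> (\<lambda>(L,P). dn L P) ` ?F"
      using Vcases[of "fst w" "snd w"] by (auto simp: up_def dn_def image_iff prod_eq_iff)
  qed (use upV dnV in auto)
  have dj: "(\<lambda>(L,P). up L P) ` ?F \<inter> (\<lambda>(L,P). dn L P) ` ?F = {}"
  proof (rule equals0I)
    fix w assume w: "w \<in> (\<lambda>(L,P). up L P) ` ?F \<inter> (\<lambda>(L,P). dn L P) ` ?F"
    from w have "w \<in> (\<lambda>(L,P). up L P) ` ?F" by (rule IntD1)
    then obtain L P where 1: "w = up L P" "flag L P" by auto
    from w have "w \<in> (\<lambda>(L,P). dn L P) ` ?F" by (rule IntD2)
    then obtain L' P' where 2: "w = dn L' P'" "flag L' P'" by auto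
    show False using disj[OF 1(2) 2(2)] 1(1) 2(1) by simp
  qed
  have total: "real (num_closed_walks ?G l) = (\<Sum>(L,P) | flag L P. real (nwalks ?G l (up L P) (up L P))) +
      (\<Sum>(L,P) | flag L P. real (nwalks ?G l (dn L P) (dn L P)))" for l
  proof -
    have "real (num_closed_walks ?G l) = (\<Sum>v\<in>V. real (nwalks ?G l v v))"
      unfolding num_closed_walks_sum vG by simp
    also have "\<dots> = (\<Sum>v\<in>(\<lambda>(L,P). up L P) ` ?F. real (nwalks ?G l v v)) + (\<Sum>v\<in>(\<lambda>(L,P). dn L P) ` ?F. real (nwalks ?G l v v))"
      unfolding Veq by (intro sum.union_disjoint dj) auto
    also have "(\<Sum>v\<in>(\<lambda>(L,P). up L P) ` ?F. real (nwalks ?G l v v)) = (\<Sum>(L,P) | flag L P. real (nwalks ?G l (up L P) (up L P)))"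
      by (subst sum.reindex) (auto simp: inj_on_def inj split_def)
    also have "(\<Sum>v\<in>(\<lambda>(L,P). dn L P) ` ?F. real (nwalks ?G l v v)) = (\<Sum>(L,P) | flag L P. real (nwalks ?G l (dn L P) (dn L P)))"
      by (subst sum.reindex) (auto simp: inj_on_def inj split_def)
    finally show ?thesis .
  qed
  obtain M where M: "\<And>l. l > 0 \<Longrightarrow> tr ((\<lambda>v. S_op (T_op v)) ^^ l) = (\<Sum>t\<in>#M. zpow (real CARD('a)) l t)"
    using trace_decomposition[OF k] by blast
  have "real (num_closed_walks ?G l) = (if even l then 2 * (\<Sum>t\<in>#M. zpow (real CARD('a)) (l div 2) t) else 0)"
    if l: "l > 0" for l
  proof -
    have "real (num_closed_walks ?G l) = (if even l then 2 * tr ((\<lambda>v. S_op (T_op v)) ^^ (l div 2)) else 0)"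
      unfolding total
    proof (rule closed_walk_count[where N = "\<lambda>l u v. real (nwalks ?G l u v)", OF inj disj _ _ Nup Ndn l])
      show "real (nwalks ?G 0 (up L P) t) = (if up L P = t then 1 else 0)" if "flag L P" for L P t
        using nwalks_0[of "up L P"] upV[OF that] by (simp add: vG)
      show "real (nwalks ?G 0 (dn L P) t) = (if dn L P = t then 1 else 0)" if "flag L P" for L P t
        using nwalks_0[of "dn L P"] dnV[OF that] by (simp add: vG)
    qed
    moreover have "l div 2 > 0" if "even l" using l that by (auto elim: evenE)
    ultimately show ?thesis using M[of "l div 2"] by auto
  qed
  then show ?thesis by blast
qed

section \<open>The zeta function\<close>

text \<open>States that \<open>f\<close> is the exponential of minus the sum of the terms
  \<open>c l / l\<close> times the \<open>l\<close>-th power of the variable, in differential form.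
  Products of series then correspond to sums of \<open>c\<close>.\<close>

definition log_deriv :: "complex fps \<Rightarrow> (nat \<Rightarrow> complex) \<Rightarrow> bool" where
  "log_deriv f c \<longleftrightarrow> fps_nth f 0 = 1 \<and> fps_deriv f = - f * Abs_fps (\<lambda>l. c (Suc l))"

lemma log_deriv_1: "log_deriv 1 (\<lambda>l. 0)"
  by (simp add: log_deriv_def fps_eq_iff fps_mult_nth)

lemma log_deriv_mult:
  assumes "log_deriv f c" "log_deriv g d"
  shows "log_deriv (f * g) (\<lambda>l. c l + d l)"
proof -
  have "Abs_fps (\<lambda>l. c (Suc l) + d (Suc l)) = Abs_fps (\<lambda>l. c (Suc l)) + Abs_fps (\<lambda>l. d (Suc l))"
    by (simp add: fps_eq_iff)
  then show ?thesis using assms by (simp add: log_deriv_def algebra_simps)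
qed

text \<open>The reciprocal roots are the \<open>m\<close>-th roots of \<open>e\<close>, and these
  are their power sums.\<close>

lemma log_deriv_binomial:
  assumes m: "m > 0"
  shows "log_deriv (fps_of_poly (1 - monom e m)) (\<lambda>l. if m dvd l then of_nat m * e ^ (l div m) else 0)"
proof -
  define c where "c l = (if m dvd l then of_nat m * e ^ (l div m) else 0)" for l
  define C where "C = Abs_fps (\<lambda>l. c (Suc l))"
  have f: "fps_of_poly (1 - monom e m) = 1 - fps_const e * fps_X ^ m"
    by (simp add: fps_of_poly_diff fps_of_poly_monom)
  have "fps_deriv (1 - fps_const e * fps_X ^ m) = - (1 - fps_const e * fps_X ^ m) * C"
  proof (rule fps_ext)
    fix l
    have L: "fps_nth (fps_deriv (1 - fps_const e * fps_X ^ m)) l = - (if Suc l = m then of_nat m * e else 0)"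
      by (auto simp: fps_X_power_nth)
    have "fps_nth ((1 - fps_const e * fps_X ^ m) * C) l = fps_nth C l - e * fps_nth (fps_X ^ m * C) l"
      by (simp add: left_diff_distrib mult.assoc)
    also have "\<dots> = c (Suc l) - e * (if l < m then 0 else c (Suc (l - m)))"
      by (simp add: fps_X_power_mult_nth C_def)
    also have "\<dots> = (if Suc l = m then of_nat m * e else 0)"
    proof (cases "l < m")
      case True
      then have "m dvd Suc l \<longleftrightarrow> Suc l = m" using dvd_imp_le[of m "Suc l"] by auto
      then show ?thesis using True m by (auto simp: c_def)
    next
      case False
      then have l: "Suc l = Suc (l - m) + m" by simp
      have "c (Suc l) = e * c (Suc (l - m))" unfolding c_def l using m by (simp del: add_Suc)
      then show ?thesis using False by simp
    qed
    finally show "fps_nth (fps_deriv (1 - fps_const e * fps_X ^ m)) l = fps_nth (- (1 - fps_const e * fps_X ^ m) * C) l"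
      unfolding L by (simp only: mult_minus_left fps_neg_nth)
  qed
  then show ?thesis using m unfolding log_deriv_def f C_def c_def by simp
qed

text \<open>The product of \<open>F\<close> and the zeta function has derivative 0 and constant term
  1.\<close>

lemma zeta_eq_of_log_deriv:
  assumes F: "log_deriv F c" and c: "\<And>l. l > 0 \<Longrightarrow> c l = of_nat (num_closed_walks G l)"
  shows "1 / zeta_closed G = F"
proof -
  define A where "A = Abs_fps (\<lambda>l. if l = 0 then 0 else of_nat (num_closed_walks G l) / of_nat l :: complex)"
  define Z where "Z = fps_exp 1 oo A"
  have Z: "zeta_closed G = Z" by (simp add: zeta_closed_def Z_def A_def)
  have A0: "fps_nth A 0 = 0" by (simp add: A_def)
  have dA: "fps_deriv A = Abs_fps (\<lambda>l. c (Suc l))"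
    by (rule fps_ext) (simp add: A_def c del: of_nat_Suc)
  have dZ: "fps_deriv Z = Z * fps_deriv A"
    unfolding Z_def using fps_compose_deriv[OF A0, of "fps_exp 1"] by simp
  have "fps_deriv (F * Z) = 0"
    using F dZ by (simp add: log_deriv_def dA)
  then have "F * Z = fps_const (fps_nth (F * Z) 0)" by (rule fps_deriv_eq_0_iff[THEN iffD1])
  moreover have Z0: "fps_nth Z 0 = 1" by (simp add: Z_def)
  ultimately have "F * Z = 1" using F by (simp add: log_deriv_def)
  then have "inverse Z = F" by (intro fps_inverse_unique) (simp add: mult.commute)
  then show ?thesis unfolding Z using Z0 by (simp add: fps_divide_unit)
qed

fun zfactor :: "complex \<Rightarrow> nat \<Rightarrow> ztype \<Rightarrow> complex poly" where
  "zfactor w q (Z1 s) = 1 - monom (of_nat q ^ s) 2"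
| "zfactor w q (Z2 s) = (1 - monom (w * of_nat q ^ s) 2) * (1 - monom (w\<^sup>2 * of_nat q ^ s) 2)"
| "zfactor w q (Z3 s) = 1 - monom (of_nat q ^ s) 6"

lemma cube_root_power_sum:
  fixes w :: complex
  assumes w: "w ^ 3 = 1" "w \<noteq> 1"
  shows "w ^ j + (w\<^sup>2) ^ j = (if 3 dvd j then 2 else -1)"
proof -
  have "(w - 1) * (1 + w + w\<^sup>2) = 0" using w(1) by (simp add: algebra_simps power2_eq_square power3_eq_cube)
  then have s: "w + w\<^sup>2 = -1" using w(2) by (simp add: eq_neg_iff_add_eq_0 add_ac)
  have w4: "(w\<^sup>2) ^ j = (w ^ j)\<^sup>2" by (simp add: power_mult[symmetric] mult.commute)
  have j: "w ^ j = w ^ (j mod 3)"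
  proof -
    have "w ^ j = w ^ (3 * (j div 3) + j mod 3)" by simp
    also have "\<dots> = w ^ (j mod 3)" by (simp only: power_add power_mult w(1) power_one mult_1_left)
    finally show ?thesis .
  qed
  have "(w\<^sup>2)\<^sup>2 = w ^ 3 * w" by (simp add: power2_eq_square power3_eq_cube)
  then have w22: "(w\<^sup>2)\<^sup>2 = w" using w(1) by simp
  consider "j mod 3 = 0" | "j mod 3 = 1" | "j mod 3 = 2" by linarith
  then show ?thesis
  proof cases
    case 1
    then show ?thesis unfolding w4 j by (simp add: dvd_eq_mod_eq_0)
  next
    case 2
    then show ?thesis unfolding w4 j using s by (simp add: dvd_eq_mod_eq_0)
  next
    case 3
    then have "\<not> 3 dvd j" by presburger
    then show ?thesis unfolding w4 j unfolding 3 w22 using s by (simp add: add.commute)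
  qed
qed

text \<open>Each eigenvalue of ST enters with its two square roots, so odd powers cancel and even
  ones give twice the power sum of order \<open>l div 2\<close>.\<close>

lemma log_deriv_zfactor:
  assumes w: "w ^ 3 = 1" "w \<noteq> 1"
  shows "log_deriv (fps_of_poly (zfactor w q t)) (\<lambda>l. if even l then 2 * complex_of_real (zpow (real q) (l div 2) t) else 0)"
proof (cases t)
  case (Z1 s)
  have e: "(\<lambda>l. if 2 dvd l then of_nat 2 * (of_nat q ^ s) ^ (l div 2) else 0) =
    (\<lambda>l. if even l then 2 * complex_of_real (zpow (real q) (l div 2) (Z1 s)) else 0)"
    by (rule ext) (simp add: power_mult)
  show ?thesis unfolding Z1 zfactor.simps e[symmetric] by (rule log_deriv_binomial) simp
next
  case (Z2 s)
  have e: "(\<lambda>l. (if 2 dvd l then of_nat 2 * (w * of_nat q ^ s) ^ (l div 2) else 0) + (if 2 dvd l then of_nat 2 * (w\<^sup>2 * of_nat q ^ s) ^ (l div 2) else 0)) =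
    (\<lambda>l. if even l then 2 * complex_of_real (zpow (real q) (l div 2) (Z2 s)) else 0)"
  proof
    fix l
    have "(w * of_nat q ^ s) ^ (l div 2) + (w\<^sup>2 * of_nat q ^ s) ^ (l div 2) =
      (w ^ (l div 2) + (w\<^sup>2) ^ (l div 2)) * of_nat q ^ (s * (l div 2))"
      by (simp add: power_mult_distrib power_mult distrib_right)
    also have "\<dots> = complex_of_real (zpow (real q) (l div 2) (Z2 s))"
      unfolding cube_root_power_sum[OF w] by simp
    finally show "(if 2 dvd l then of_nat 2 * (w * of_nat q ^ s) ^ (l div 2) else 0) + (if 2 dvd l then of_nat 2 * (w\<^sup>2 * of_nat q ^ s) ^ (l div 2) else 0) =
      (if even l then 2 * complex_of_real (zpow (real q) (l div 2) (Z2 s)) else 0)"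
      by (simp add: distrib_left[symmetric] del: zpow.simps)
  qed
  show ?thesis unfolding Z2 zfactor.simps fps_of_poly_mult e[symmetric]
    by (intro log_deriv_mult log_deriv_binomial) simp_all
next
  case (Z3 s)
  have e: "(\<lambda>l. if 6 dvd l then of_nat 6 * (of_nat q ^ s) ^ (l div 6) else 0) =
    (\<lambda>l. if even l then 2 * complex_of_real (zpow (real q) (l div 2) (Z3 s)) else 0)"
  proof
    fix l :: nat
    have "6 dvd l \<longleftrightarrow> even l \<and> 3 dvd l div 2" by presburger
    moreover have "l div 6 = l div 2 div 3" by (simp add: div_mult2_eq[symmetric])
    ultimately show "(if 6 dvd l then of_nat 6 * (of_nat q ^ s) ^ (l div 6) else 0) =
       (if even l then 2 * complex_of_real (zpow (real q) (l div 2) (Z3 s)) else 0)"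
      by (simp add: power_mult)
  qed
  show ?thesis unfolding Z3 zfactor.simps e[symmetric] by (rule log_deriv_binomial) simp
qed

lemma log_deriv_prod_zfactor:
  assumes w: "w ^ 3 = 1" "w \<noteq> 1"
  shows "log_deriv (fps_of_poly (prod_mset (image_mset (zfactor w q) M)))
    (\<lambda>l. if even l then 2 * complex_of_real (\<Sum>t\<in>#M. zpow (real q) (l div 2) t) else 0)"
proof (induction M)
  case empty
  have "(\<lambda>l. if even l then 2 * complex_of_real (\<Sum>t\<in>#{#}. zpow (real q) (l div 2) t) else 0) = (\<lambda>l. 0)" by (auto simp: fun_eq_iff)
  then show ?case using log_deriv_1 by (simp only: image_mset_empty prod_mset_empty fps_of_poly_1)
next
  case (add t M)
  have e: "(\<lambda>l. (if even l then 2 * complex_of_real (zpow (real q) (l div 2) t) else 0) +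
      (if even l then 2 * complex_of_real (\<Sum>t\<in>#M. zpow (real q) (l div 2) t) else 0)) =
    (\<lambda>l. if even l then 2 * complex_of_real (\<Sum>t\<in>#add_mset t M. zpow (real q) (l div 2) t) else 0)"
    by (auto simp: fun_eq_iff algebra_simps)
  show ?case unfolding e[symmetric] unfolding image_mset_add_mset prod_mset.add_mset fps_of_poly_mult
    by (intro log_deriv_mult log_deriv_zfactor[OF w] add.IH)
qed

lemma cube_root_of_unity:
  assumes "w = exp (2 * complex_of_real pi * \<i> / 3)"
  shows "w ^ 3 = 1" "w \<noteq> 1"
proof -
  have "w ^ 3 = exp (of_nat 3 * (2 * complex_of_real pi * \<i> / 3))" unfolding assms by (rule exp_of_nat_mult[symmetric])
  also have "of_nat 3 * (2 * complex_of_real pi * \<i> / 3) = 2 * complex_of_real pi * \<i>" by simp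
  finally show "w ^ 3 = 1" by (simp only: exp_two_pi_i)
  show "w \<noteq> 1"
  proof
    assume "w = 1"
    then obtain n :: int where n: "2 * pi / 3 = of_int (2 * n) * pi" unfolding assms exp_eq_1 by auto
    then have "1 = 3 * real_of_int n" by (simp add: field_simps)
    then have "1 = 3 * n" by linarith
    then show False by presburger
  qed
qed

theorem theorem8p4p3:
  fixes q k :: nat and \<omega> :: complex
  assumes "primepow q"
    and "CARD('a::{field,finite}) = q"
    and "k \<ge> 1"
    and "CARD('n::finite) = 3 * k"
    and "\<omega> = exp (2 * complex_of_real pi * \<i> / 3)"
  shows "\<exists>Fs :: complex poly multiset.
    (\<forall>f \<in># Fs. \<exists>s::nat.
        f = 1 - monom (of_nat q ^ s) 2 \<or>
        f = (1 - monom (\<omega> * of_nat q ^ s) 2) * (1 - monom (\<omega>\<^sup>2 * of_nat q ^ s) 2) \<or>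
        f = 1 - monom (of_nat q ^ s) 6) \<and>
    1 / zeta_closed
          (X2_multidim (k, 2 * k) ::
            (('a ^ 'n) set \<times> ('a ^ 'n) set,
             (('a ^ 'n) set \<times> ('a ^ 'n) set) \<times> (('a ^ 'n) set \<times> ('a ^ 'n) set)) pre_digraph)
      = fps_of_poly (prod_mset Fs)"
proof -
  obtain M where M: "\<And>l. l > 0 \<Longrightarrow> real (num_closed_walks (X2_multidim (k, 2 * k) ::
      (('a ^ 'n) set \<times> ('a ^ 'n) set,
       (('a ^ 'n) set \<times> ('a ^ 'n) set) \<times> (('a ^ 'n) set \<times> ('a ^ 'n) set)) pre_digraph) l) =
    (if even l then 2 * (\<Sum>t\<in>#M. zpow (real q) (l div 2) t) else 0)"
    using num_closed_walks_X2[OF assms(4,3)] assms(2) by metis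
  let ?Fs = "image_mset (zfactor \<omega> q) M"
  have "\<exists>s. f = 1 - monom (of_nat q ^ s) 2 \<or>
        f = (1 - monom (\<omega> * of_nat q ^ s) 2) * (1 - monom (\<omega>\<^sup>2 * of_nat q ^ s) 2) \<or>
        f = 1 - monom (of_nat q ^ s) 6" if "f \<in># ?Fs" for f
  proof -
    from that have "f \<in> zfactor \<omega> q ` set_mset M" by simp
    then obtain t where "f = zfactor \<omega> q t" by (rule imageE)
    then show ?thesis by (cases t) auto
  qed
  moreover have "1 / zeta_closed
          (X2_multidim (k, 2 * k) ::
            (('a ^ 'n) set \<times> ('a ^ 'n) set,
             (('a ^ 'n) set \<times> ('a ^ 'n) set) \<times> (('a ^ 'n) set \<times> ('a ^ 'n) set)) pre_digraph)
      = fps_of_poly (prod_mset ?Fs)" (is "1 / zeta_closed ?G = _")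
  proof (rule zeta_eq_of_log_deriv[OF log_deriv_prod_zfactor[OF cube_root_of_unity[OF assms(5)]]])
    fix l :: nat assume l: "l > 0"
    have "complex_of_nat (num_closed_walks ?G l) = complex_of_real (real (num_closed_walks ?G l))" by simp
    also have "\<dots> = (if even l then 2 * complex_of_real (\<Sum>t\<in>#M. zpow (real q) (l div 2) t) else 0)"
      unfolding M[OF l] by (simp only: of_real_mult of_real_numeral of_real_0 if_distrib[of complex_of_real])
    finally show "(if even l then 2 * complex_of_real (\<Sum>t\<in>#M. zpow (real q) (l div 2) t) else 0) =
      complex_of_nat (num_closed_walks ?G l)" by simp
  qed
  ultimately show ?thesis by blast
qed

end
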